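(* Let $d\in\mathbb N$, $a\in\{-1,1\}$, and let $\gamma,\alpha\in\mathbb R$ satisfy $\gamma>-\min(2,d)$ and $\alpha>1+\frac{2+\gamma}{d}$. Let $l\in\mathbb R$ and $q,r\in[1,\infty]$ satisfy $\frac ld+\frac1q=\frac1{q_c(\gamma)}$, $\frac{\gamma}{\alpha-1}\le l$, $r=1$ if $q=1$, $r=\infty$ if $q=\infty$. Let $k\in\mathbb R$, $p\in[1,\infty]$ satisfy $$\alpha<p\le\infty,\quad \frac{l+\gamma}{\alpha}\le k\le l,\quad 0\le\frac kd+\frac1p,\quad \frac{2+\gamma\alpha}{d\alpha(\alpha-1)}<\frac kd+\frac1p<\min\Big\{\frac1{q_c(\gamma)},\frac{d+\gamma}{d\alpha}\Big\}.$$ Let $u,v\in C([0,\infty);L^{q,r}_l(\mathbb R^d))\cap\mathcal K^p_k$ be global $L^{q,r}_l(\mathbb R^d)$-mild solutions of (I) with initial data $\varphi$ and $\psi$ respectively, such that $\max\{\|u\|_{\mathcal K^p_k},\|v\|_{\mathcal K^p_k}\}\le M$. Consider $$\text{(A)}\ \lim_{t\to\infty}\|e^{t\Delta}(\varphi-\psi)\|_{L^{q,r}_l}=0,\qquad \text{(B)}\ \lim_{t\to\infty}\|u(t)-v(t)\|_{L^{q,r}_l}=0 .$$ If (A) holds and $M$ is sufficiently small (depending only on the parameters), then (B) holds and moreover $$\lim_{t\to\infty}t^{\frac d2(\frac1{q_c(\gamma)}-\frac kd-\frac1p)}\|u(t)-v(t)\|_{L^{p,\infty}_k}=0 .$$ Conversely,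 for any $M>0$, (B) implies (A), provided that $q>1$. In particular, if $\|e^{t\Delta}\varphi\|_{\mathcal K^p_k}$ and $\|e^{t\Delta}\psi\|_{\mathcal K^p_k}$ are sufficiently small and $u,v$ are the corresponding global $L^{q,r}_l$-mild solutions, then (A) and (B) are equivalent, provided that $M$ is sufficiently small and $q>1$.
   Context: (I) is $u(t)=e^{t\Delta}\varphi+a\int_0^te^{(t-\tau)\Delta}\{|\cdot|^\gamma|u(\tau)|^{\alpha-1}u(\tau)\}\,d\tau$ (with $\psi$ in place of $\varphi$ for $v$), $e^{t\Delta}$ the heat semigroup; it is the integral form of $\partial_tu-\Delta u=a|x|^\gamma|u|^{\alpha-1}u$. $\frac1{q_c(\gamma)}=\frac{2+\gamma}{d(\alpha-1)}$. Functions are real- or complex-valued. Weighted Lorentz spaces: $\|f\|_{L^{q,r}_l}=\||\cdot|^lf\|_{L^{q,r}}$, where $\|g\|_{L^{q,r}}=(\int_0^\infty(t^{1/q}g^*(t))^r\frac{dt}t)^{1/r}$ for $r<\infty$, $\|g\|_{L^{q,\infty}}=\sup_{t>0}t^{1/q}g^*(t)$, with $g^*$ the decreasing rearrangement. $\|u\|_{\mathcal K^p_k}=\sup_{t>0}t^{\frac d2(\frac1{q_c(\gamma)}-\frac kd-\frac1p)}\|u(t)\|_{L^{p,\infty}_k}$; $\mathcal K^p_k$ is the set of $u\in\mathscr D'((0,\infty)\times\mathbb R^d)$ for which the corresponding supremum over $0<t<T'$ is finite for every $T'<\infty$. A global $L^{q,r}_l$-mild solution with data $\varphi\in L^{q,r}_l(\mathbb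 R^d)$ is $u\in C([0,\infty);L^{q,r}_l(\mathbb R^d))$ with $u(0)=\varphi$ satisfying (I) for all $t$ and a.e. $x$. When $\|e^{t\Delta}\varphi\|_{\mathcal K^p_k}$ is sufficiently small, "the corresponding global solution" is the one obtained by the contraction principle, i.e. the unique solution of (I) in a ball of $\mathcal K^p_k$ centred at $0$ of sufficiently small radius. *)

theory Defs
  imports "HOL-Analysis.Analysis"
begin

(* A scalar type of sort {real_normed_field, euclidean_space} is isometrically isomorphic to the
   reals or the complex numbers.  Functions on R^d (type real ^ 'n, d = CARD('n)) are Lebesgue
   measurable representatives of a.e.-classes.  Exponents in [1,\<infinity>] have type ennreal. *)

section \<open>Weighted Lorentz spaces\<close>

(* 1/p, with value 0 at p = \<infinity> *)
definition recip :: "ennreal \<Rightarrow> real" where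
  "recip p = enn2real (inverse p)"

(* x^s on [0,\<infinity>], used only for s > 0 *)
definition ennreal_powr :: "ennreal \<Rightarrow> real \<Rightarrow> ennreal" where
  "ennreal_powr x s = (if x = \<infinity> then \<infinity> else ennreal (enn2real x powr s))"

(* Inf {} = \<infinity> in ennreal *)
definition rearrangement :: "(real ^ 'n \<Rightarrow> 'c::euclidean_space) \<Rightarrow> real \<Rightarrow> ennreal" where
  "rearrangement g t =
     Inf {ennreal s | s. 0 \<le> s \<and> emeasure lebesgue {x. s < norm (g x)} \<le> ennreal t}"

definition lorentz_norm ::
  "ennreal \<Rightarrow> ennreal \<Rightarrow> (real ^ 'n \<Rightarrow> 'c::euclidean_space) \<Rightarrow> ennreal" where
  "lorentz_norm q r g =
     (if r = \<infinity> then (SUP t\<in>{0<..}. ennreal (t powr recip q) * rearrangement g t)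
      else ennreal_powr
        (\<integral>\<^sup>+ t\<in>{0<..}. ennreal_powr (ennreal (t powr recip q) * rearrangement g t) (enn2real r)
            * ennreal (1 / t) \<partial>lborel)
        (recip r))"

definition wlorentz_norm ::
  "ennreal \<Rightarrow> ennreal \<Rightarrow> real \<Rightarrow> (real ^ 'n \<Rightarrow> 'c::euclidean_space) \<Rightarrow> ennreal" where
  "wlorentz_norm q r l f = lorentz_norm q r (\<lambda>x. (norm x powr l) *\<^sub>R f x)"

definition wlorentz ::
  "ennreal \<Rightarrow> ennreal \<Rightarrow> real \<Rightarrow> (real ^ 'n \<Rightarrow> 'c::euclidean_space) set" where
  "wlorentz q r l = {f. f \<in> borel_measurable lebesgue \<and> wlorentz_norm q r l f < \<infinity>}"

(* C([0,\<infinity>); L^{q,r}_l) *)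
definition cont_wlorentz ::
  "ennreal \<Rightarrow> ennreal \<Rightarrow> real \<Rightarrow> (real \<Rightarrow> real ^ 'n \<Rightarrow> 'c::euclidean_space) set" where
  "cont_wlorentz q r l =
     {u. (\<forall>t\<ge>0. u t \<in> wlorentz q r l) \<and>
         (\<forall>t\<ge>0. ((\<lambda>s. wlorentz_norm q r l (\<lambda>x. u s x - u t x)) \<longlongrightarrow> 0) (at t within {0..}))}"

section \<open>The spaces K\<close>

(* 1 / q_c(\<gamma>) in dimension d *)
definition inv_qc :: "nat \<Rightarrow> real \<Rightarrow> real \<Rightarrow> real" where
  "inv_qc d \<gamma> \<alpha> = (2 + \<gamma>) / (real d * (\<alpha> - 1))"

definition decay_exponent :: "nat \<Rightarrow> real \<Rightarrow> real \<Rightarrow> ennreal \<Rightarrow> real \<Rightarrow> real" where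
  "decay_exponent d \<gamma> \<alpha> p k = real d / 2 * (inv_qc d \<gamma> \<alpha> - k / real d - recip p)"

definition K_norm ::
  "real \<Rightarrow> real \<Rightarrow> ennreal \<Rightarrow> real \<Rightarrow> (real \<Rightarrow> real ^ 'n \<Rightarrow> 'c::euclidean_space) \<Rightarrow> ennreal" where
  "K_norm \<gamma> \<alpha> p k u =
     (SUP t\<in>{0<..}. ennreal (t powr decay_exponent CARD('n) \<gamma> \<alpha> p k) * wlorentz_norm p \<infinity> k (u t))"

(* Membership in D'((0,\<infinity>) \<times> R^d) is that of a regular distribution, i.e. local integrability:
   k/d + 1/p < 1 makes L^{p,\<infinity>}_k embed in L^1_loc. *)
definition K_space ::
  "real \<Rightarrow> real \<Rightarrow> ennreal \<Rightarrow> real \<Rightarrow> (real \<Rightarrow> real ^ 'n \<Rightarrow> 'c::euclidean_space) set" where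
  "K_space \<gamma> \<alpha> p k =
     {u. (\<forall>C. compact C \<and> C \<subseteq> {0<..} \<times> UNIV \<longrightarrow> set_integrable lebesgue C (\<lambda>(t, x). u t x)) \<and>
         (\<forall>t>0. u t \<in> borel_measurable lebesgue) \<and>
         (\<forall>T>0. (SUP t\<in>{0<..<T}. ennreal (t powr decay_exponent CARD('n) \<gamma> \<alpha> p k)
                                   * wlorentz_norm p \<infinity> k (u t)) < \<infinity>)}"

section \<open>The integral equation\<close>

definition heat_kernel :: "real \<Rightarrow> real ^ 'n \<Rightarrow> real" where
  "heat_kernel t x = (4 * pi * t) powr (- (real CARD('n) / 2)) * exp (- (norm x)\<^sup>2 / (4 * t))"

definition heat ::
  "real \<Rightarrow> (real ^ 'n \<Rightarrow> 'c::euclidean_space) \<Rightarrow> real ^ 'n \<Rightarrow> 'c" where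
  "heat t f x = (if t > 0 then (LINT y|lebesgue. heat_kernel t (x - y) *\<^sub>R f y) else f x)"

(* absolute convergence of the integral in heat t f x, which is 0 by convention otherwise *)
definition heat_converges ::
  "real \<Rightarrow> (real ^ 'n \<Rightarrow> 'c::euclidean_space) \<Rightarrow> real ^ 'n \<Rightarrow> bool" where
  "heat_converges t f x \<longleftrightarrow> integrable lebesgue (\<lambda>y. heat_kernel t (x - y) *\<^sub>R f y)"

definition nonlinearity ::
  "real \<Rightarrow> real \<Rightarrow> (real ^ 'n \<Rightarrow> 'c::euclidean_space) \<Rightarrow> real ^ 'n \<Rightarrow> 'c" where
  "nonlinearity \<gamma> \<alpha> f x = (norm x powr \<gamma> * norm (f x) powr (\<alpha> - 1)) *\<^sub>R f x"

(* The integral equation for all t > 0 and a.e. x, including convergence of its integrals. *)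
definition solves_integral_eq ::
  "real \<Rightarrow> real \<Rightarrow> real \<Rightarrow> (real ^ 'n \<Rightarrow> 'c::euclidean_space) \<Rightarrow> (real \<Rightarrow> real ^ 'n \<Rightarrow> 'c) \<Rightarrow> bool"
  where
  "solves_integral_eq a \<gamma> \<alpha> \<phi> u \<longleftrightarrow>
     (\<forall>t>0. AE x in lebesgue.
        heat_converges t \<phi> x \<and>
        (AE \<tau>\<in>{0<..<t} in lebesgue. heat_converges (t - \<tau>) (nonlinearity \<gamma> \<alpha> (u \<tau>)) x) \<and>
        set_integrable lebesgue {0<..<t} (\<lambda>\<tau>. heat (t - \<tau>) (nonlinearity \<gamma> \<alpha> (u \<tau>)) x) \<and>
        u t x = heat t \<phi> x
          + a *\<^sub>R (LINT \<tau>:{0<..<t}|lebesgue. heat (t - \<tau>) (nonlinearity \<gamma> \<alpha> (u \<tau>)) x))"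

(* At t = 0 the integral equation reads u 0 = \<phi>. *)
definition global_mild_solution ::
  "real \<Rightarrow> real \<Rightarrow> real \<Rightarrow> ennreal \<Rightarrow> ennreal \<Rightarrow> real \<Rightarrow>
   (real ^ 'n \<Rightarrow> 'c::euclidean_space) \<Rightarrow> (real \<Rightarrow> real ^ 'n \<Rightarrow> 'c) \<Rightarrow> bool" where
  "global_mild_solution a \<gamma> \<alpha> q r l \<phi> u \<longleftrightarrow>
     \<phi> \<in> wlorentz q r l \<and> u \<in> cont_wlorentz q r l \<and>
     (AE x in lebesgue. u 0 x = \<phi> x) \<and> solves_integral_eq a \<gamma> \<alpha> \<phi> u"

(* u is the unique solution in the closed ball of radius \<rho> of the space K *)
definition unique_solution_in_ball ::
  "real \<Rightarrow> real \<Rightarrow> real \<Rightarrow> ennreal \<Rightarrow> real \<Rightarrow> real \<Rightarrow>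
   (real ^ 'n \<Rightarrow> 'c::euclidean_space) \<Rightarrow> (real \<Rightarrow> real ^ 'n \<Rightarrow> 'c) \<Rightarrow> bool" where
  "unique_solution_in_ball a \<gamma> \<alpha> p k \<rho> \<phi> u \<longleftrightarrow>
     u \<in> K_space \<gamma> \<alpha> p k \<and> K_norm \<gamma> \<alpha> p k u \<le> ennreal \<rho> \<and> solves_integral_eq a \<gamma> \<alpha> \<phi> u \<and>
     (\<forall>w. w \<in> K_space \<gamma> \<alpha> p k \<and> K_norm \<gamma> \<alpha> p k w \<le> ennreal \<rho> \<and> solves_integral_eq a \<gamma> \<alpha> \<phi> w
        \<longrightarrow> (\<forall>t>0. AE x in lebesgue. w t x = u t x))"

end

theory Submission
  imports Defs "HOL-Probability.Probability"
begin

text \<open>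
Write \<open>w = u - v\<close>. The heat semigroup maps a weighted weak Lebesgue space into another one with a polynomial
loss in time; by parabolic scaling this only has to be shown at time 1, where it amounts to bounding the
integral of a weighted kernel over a product of two sets in terms of their measures. Together with the pointwise
estimate of the difference of the nonlinearities, this bounds the Duhamel term of \<open>w\<close> at time \<open>t\<close> by
\<open>C * M powr (\<alpha> - 1)\<close> times the size of \<open>w\<close> in the scale invariant norm over large times, plus a contribution of
the times before a fixed \<open>T\<close>, which vanishes as \<open>t \<rightarrow> \<infinity>\<close>.

If \<open>M\<close> is small and the linear part decays, an eventual bound \<open>\<eta>\<close> for \<open>w\<close> hence improves to \<open>\<eta> / 2\<close>, so that \<open>w\<close> vanishes
asymptotically in the scale invariant norm. If instead \<open>w\<close> decays in the Lorentz norm, then restarting the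
equation at time \<open>(1 - \<epsilon>) * t\<close> leaves a Duhamel integral over a short interval, which is small with \<open>\<epsilon>\<close> uniformly
in \<open>t\<close>; this gives the same conclusion for every \<open>M\<close>. In both cases the full Duhamel term vanishes in the Lorentz norm, so
that \<open>w\<close> and the heat flow of \<open>\<phi> - \<psi>\<close> are asymptotically equal there.
\<close>

section \<open>Weak bounds and duality\<close>

text \<open>The time integrals are critical. With a source of size
  \<open>\<tau> powr (- theta)\<close> and a smoothing loss \<open>(t - \<tau>) powr (- e)\<close>,
  scale invariance fixes \<open>1 - e - theta\<close>, so a power of \<open>t\<close> yields no
  gain. Smallness can only come from \<open>M powr (\<alpha> - 1)\<close>, from the vanishing share
  \<open>(T / t) powr (1 - theta)\<close> of early times, or from a short final interval through
  \<open>\<epsilon> powr (1 - e)\<close>. The bounds on k/d + 1/p make the singularities at both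
  ends of the time interval integrable.

  The heat estimates live in weak spaces, while L^{q,r} with finite r is smaller. It is reached by
  real interpolation between the exponents 1/q - \<epsilon> and 1/q + \<epsilon>; there is room for
  this because the conditions on the target exponent hold strictly at 1/q.

  Measurability is a second obstacle. Solutions are Lebesgue measurable representatives, and Tonelli
  in time and space needs joint measurability of the source and of its heat flow. Borel
  representatives of the data and of the source are therefore fixed once, and every estimate is made
  for a nonnegative majorant, where no convergence question arises.\<close>

lemma sigma_finite_lebesgue: "sigma_finite_measure (lebesgue :: 'a::euclidean_space measure)"
proof
  let ?A = "range (\<lambda>n::nat. ball 0 (real n) :: 'a set)"
  show "\<exists>A. countable A \<and> A \<subseteq> sets (lebesgue :: 'a measure) \<and> \<Union>A = space lebesgue
          \<and> (\<forall>a\<in>A. emeasure lebesgue a \<noteq> \<infinity>)"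
  proof (intro exI[of _ ?A] conjI ballI)
    show "\<Union>?A = space lebesgue" by (auto simp: reals_Archimedean2)
    show "emeasure lebesgue a \<noteq> \<infinity>" if "a \<in> ?A" for a :: "'a set"
    proof -
      have "a \<in> lmeasurable" using that by auto
      thus ?thesis by (auto simp: fmeasurable_def)
    qed
  qed auto
qed

section \<open>Integrals of powers and the layer cake formula\<close>

lemma nn_integral_powr_near_0:
  fixes a S :: real
  assumes "a < 1" "S \<ge> 0"
  shows "(\<integral>\<^sup>+s\<in>{0..S}. ennreal (s powr (-a)) \<partial>lborel) = ennreal (S powr (1 - a) / (1 - a))"
proof -
  have "((\<lambda>x. x powr (-a)) has_integral (S powr (-a + 1) / (-a + 1))) {0..S}"
    by (rule has_integral_powr_from_0) (use assms in auto)
  from nn_integral_has_integral_lebesgue[OF _ this]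
  have "(\<integral>\<^sup>+x. ennreal (indicator {0..S} x * x powr (-a)) \<partial>lborel) = ennreal (S powr (-a + 1) / (-a + 1))"
    by simp
  moreover have "ennreal (indicator {0..S} x * x powr (-a)) = ennreal (x powr (-a)) * indicator {0..S} x" for x
    by (auto simp: indicator_def)
  ultimately show ?thesis by (simp add: add.commute)
qed

lemma nn_integral_powr_near_infinity:
  fixes a S :: real
  assumes "a > 1" "S > 0"
  shows "(\<integral>\<^sup>+s\<in>{S..}. ennreal (s powr (-a)) \<partial>lborel) = ennreal (S powr (1 - a) / (a - 1))"
proof -
  have "((\<lambda>x. x powr (-a)) has_integral (-(S powr (-a + 1)) / (-a + 1))) {S..}"
    by (rule has_integral_powr_to_inf) (use assms in auto)
  from nn_integral_has_integral_lebesgue[OF _ this]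
  have "(\<integral>\<^sup>+x. ennreal (indicator {S..} x * x powr (-a)) \<partial>lborel) = ennreal (-(S powr (-a + 1)) / (-a + 1))"
    by simp
  moreover have "ennreal (indicator {S..} x * x powr (-a)) = ennreal (x powr (-a)) * indicator {S..} x" for x
    by (auto simp: indicator_def)
  moreover have "-(S powr (-a + 1)) / (-a + 1) = S powr (1 - a) / (a - 1)"
    using assms by (simp add: field_simps)
  ultimately show ?thesis by simp
qed

text \<open>The elementary core of every interpolation step below. Both bounds equal
  \<open>K\<close> at \<open>s = S\<close>; the power with exponent below 1 is integrable up to
  \<open>S\<close>, the one with exponent above 1 beyond it. Each application produces two competing
  power bounds for one distribution function, with exponents on both sides of 1.\<close>

lemma nn_integral_two_powers_le:
  fixes D :: "real \<Rightarrow> ennreal" and x y S K :: real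
  assumes xy: "x < 1" "1 < y" and S: "S > 0" and K: "K \<ge> 0"
    and D1: "\<And>s. s > 0 \<Longrightarrow> D s \<le> ennreal (K * (s / S) powr (-x))"
    and D2: "\<And>s. s > 0 \<Longrightarrow> D s \<le> ennreal (K * (s / S) powr (-y))"
  shows "(\<integral>\<^sup>+s\<in>{0..}. D s \<partial>lborel) \<le> ennreal (K * S * (1 / (1 - x) + 1 / (y - 1)))"
proof -
  have "(\<integral>\<^sup>+s\<in>{0..}. D s \<partial>lborel)
      \<le> (\<integral>\<^sup>+s. ennreal (K * S powr x) * (ennreal (s powr (-x)) * indicator {0..S} s)
             + ennreal (K * S powr y) * (ennreal (s powr (-y)) * indicator {S..} s) \<partial>lborel)"
  proof (rule nn_integral_mono_AE)
    have "AE s in lborel. s \<noteq> (0::real)" by (rule AE_lborel_singleton)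
    then show "AE s in lborel. D s * indicator {0..} s \<le>
        ennreal (K * S powr x) * (ennreal (s powr (-x)) * indicator {0..S} s)
             + ennreal (K * S powr y) * (ennreal (s powr (-y)) * indicator {S..} s)"
    proof eventually_elim
      case (elim s)
      have *: "K * (s / S) powr (-z) = K * S powr z * s powr (-z)" if "s > 0" for z
        using that S by (simp add: powr_divide powr_minus field_simps)
      consider "s < 0" | "0 < s" "s \<le> S" | "S < s" using elim by linarith
      then show ?case
      proof cases
        case 2
        then have "D s \<le> ennreal (K * S powr x) * ennreal (s powr (-x))"
          using D1[of s] * K by (simp add: ennreal_mult'[symmetric])
        then show ?thesis using 2 by (auto simp: indicator_def intro: order_trans)
      next
        case 3
        then have "D s \<le> ennreal (K * S powr y) * ennreal (s powr (-y))"
          using D2[of s] * K S by (simp add: ennreal_mult'[symmetric])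
        then show ?thesis using 3 S by (auto simp: indicator_def intro: order_trans)
      qed auto
    qed
  qed
  also have "\<dots> = ennreal (K * S powr x) * ennreal (S powr (1 - x) / (1 - x))
      + ennreal (K * S powr y) * ennreal (S powr (1 - y) / (y - 1))"
    using xy S
    by (subst nn_integral_add)
       (auto simp: nn_integral_cmult nn_integral_powr_near_0 nn_integral_powr_near_infinity)
  also have "\<dots> = ennreal (K * S powr x * (S powr (1 - x) / (1 - x)) + K * S powr y * (S powr (1 - y) / (y - 1)))"
    using xy S K by (simp add: ennreal_mult'[symmetric] ennreal_plus[symmetric] del: ennreal_plus)
  also have "K * S powr x * (S powr (1 - x) / (1 - x)) = K * S * (1 / (1 - x))"
    using S by (simp add: powr_diff)
  also have "K * S powr y * (S powr (1 - y) / (y - 1)) = K * S * (1 / (y - 1))"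
    using S by (simp add: powr_diff)
  finally show ?thesis by (simp add: algebra_simps)
qed

lemma nn_integral_indicator_less:
  "(\<integral>\<^sup>+s. indicator {0..} s * indicator {s. ennreal s < w} s \<partial>lborel) = w"
proof (cases w)
  case (real r)
  have "(\<integral>\<^sup>+s. indicator {0..} s * indicator {s. ennreal s < w} s \<partial>lborel)
      = (\<integral>\<^sup>+s. indicator {0..<r} s \<partial>lborel)"
    by (intro nn_integral_cong) (use real in \<open>auto simp: indicator_def ennreal_less_iff\<close>)
  then show ?thesis using real by simp
next
  case top
  have "(\<integral>\<^sup>+s. indicator {0..} s * indicator {s. ennreal s < w} s \<partial>lborel)
      = (\<integral>\<^sup>+s. indicator {0::real..} s \<partial>lborel)"
    by (intro nn_integral_cong) (use top in \<open>auto simp: indicator_def\<close>)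
  moreover have "(\<integral>\<^sup>+s. indicator {0::real..} s \<partial>lborel) = top"
  proof -
    have "ennreal (real n) \<le> emeasure lborel {0::real..}" for n :: nat
      using emeasure_mono[of "{0..real n}" "{0..}" lborel] by simp
    then have "emeasure lborel {0::real..} = top"
      by (metis ennreal_of_nat_eq_real_of_nat ennreal_Ex_less_of_nat infinity_ennreal_def linorder_not_less top.not_eq_extremum)
    then show ?thesis by simp
  qed
  ultimately show ?thesis using top by simp
qed

text \<open>Tonelli for the region under the graph of \<open>W\<close>, with \<open>g\<close> as an
  additional density. The density is an indicator or 1 when a distribution function is integrated,
  and the dual function in the duality estimate.\<close>

lemma layer_cake:
  fixes W g :: "'a \<Rightarrow> ennreal"
  assumes "sigma_finite_measure M" and [measurable]: "W \<in> borel_measurable M" "g \<in> borel_measurable M"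
  shows "(\<integral>\<^sup>+x. W x * g x \<partial>M)
       = (\<integral>\<^sup>+s\<in>{0..}. (\<integral>\<^sup>+x. g x * indicator {x. ennreal s < W x} x \<partial>M) \<partial>lborel)"
proof -
  interpret sigma_finite_measure M by fact
  interpret pair_sigma_finite "lborel :: real measure" M ..
  note len = nn_integral_indicator_less
  have "(\<integral>\<^sup>+x. W x * g x \<partial>M)
      = (\<integral>\<^sup>+x. (\<integral>\<^sup>+s. g x * (indicator {0..} s * indicator {s. ennreal s < W x} s) \<partial>lborel) \<partial>M)"
    by (intro nn_integral_cong) (simp add: nn_integral_cmult len mult.commute)
  also have "\<dots> = (\<integral>\<^sup>+s. (\<integral>\<^sup>+x. g x * (indicator {0..} s * indicator {s. ennreal s < W x} s) \<partial>M) \<partial>lborel)"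
    by (rule Fubini') measurable
  also have "\<dots> = (\<integral>\<^sup>+s\<in>{0..}. (\<integral>\<^sup>+x. g x * indicator {x. ennreal s < W x} x \<partial>M) \<partial>lborel)"
    by (intro nn_integral_cong) (auto simp: indicator_def)
  finally show ?thesis .
qed

text \<open>With \<open>\<mu> = 1/p\<close>, \<open>weak_bound\<close> is the quasinorm of weak \<open>L\<^sup>p\<close>, and \<open>marc_bound\<close> is the equivalent norm (for \<open>\<mu> < 1\<close>)
\<open>sup |E| powr (\<mu> - 1) * \<integral>\<^sub>E f\<close>. The latter passes under time integrals by Tonelli alone, and it also makes sense
for \<open>\<mu> = 1\<close>, where it is the norm of \<open>L\<^sup>1\<close>.\<close>

definition weak_bound :: "real \<Rightarrow> real \<Rightarrow> ('a::euclidean_space \<Rightarrow> real) \<Rightarrow> bool" where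
  "weak_bound \<mu> A g \<longleftrightarrow>
     (\<forall>s>0. \<forall>E\<in>lmeasurable. (\<forall>x\<in>E. s < g x) \<longrightarrow> s * measure lebesgue E powr \<mu> \<le> A)"

definition marc_bound :: "real \<Rightarrow> real \<Rightarrow> ('a::euclidean_space \<Rightarrow> ennreal) \<Rightarrow> bool" where
  "marc_bound \<mu> B f \<longleftrightarrow>
     (\<forall>E\<in>lmeasurable. (\<integral>\<^sup>+x\<in>E. f x \<partial>lebesgue) \<le> ennreal (B * measure lebesgue E powr (1 - \<mu>)))"

lemma marc_boundD:
  "marc_bound \<mu> B f \<Longrightarrow> E \<in> lmeasurable \<Longrightarrow>
   (\<integral>\<^sup>+x\<in>E. f x \<partial>lebesgue) \<le> ennreal (B * measure lebesgue E powr (1 - \<mu>))"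
  unfolding marc_bound_def by blast

lemma weak_boundD:
  "weak_bound \<mu> A g \<Longrightarrow> 0 < s \<Longrightarrow> E \<in> lmeasurable \<Longrightarrow> (\<And>x. x \<in> E \<Longrightarrow> s < g x) \<Longrightarrow>
   s * measure lebesgue E powr \<mu> \<le> A"
  unfolding weak_bound_def by simp

lemma weak_bound_mono: "weak_bound \<mu> A g \<Longrightarrow> A \<le> A' \<Longrightarrow> weak_bound \<mu> A' g"
  unfolding weak_bound_def by (meson order_trans)

lemma weak_bound_nonneg: "weak_bound \<mu> A g \<Longrightarrow> 0 \<le> A"
  unfolding weak_bound_def by (metis emptyE fmeasurable.empty_sets measure_empty mult_zero_right powr_0 zero_less_one)

lemma marc_bound_mono:
  assumes "marc_bound \<mu> B f" "B \<le> B'" "AE x in lebesgue. f' x \<le> f x"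
  shows "marc_bound \<mu> B' f'"
  unfolding marc_bound_def
proof
  fix E :: "'a set" assume E: "E \<in> lmeasurable"
  have "(\<integral>\<^sup>+x\<in>E. f' x \<partial>lebesgue) \<le> (\<integral>\<^sup>+x\<in>E. f x \<partial>lebesgue)"
    using assms(3) by (intro nn_integral_mono_AE) (auto intro: mult_right_mono elim!: eventually_mono)
  also have "\<dots> \<le> ennreal (B * measure lebesgue E powr (1 - \<mu>))" using assms E by (auto simp: marc_bound_def)
  also have "\<dots> \<le> ennreal (B' * measure lebesgue E powr (1 - \<mu>))"
    using assms by (intro ennreal_leI mult_right_mono) auto
  finally show "(\<integral>\<^sup>+x\<in>E. f' x \<partial>lebesgue) \<le> ennreal (B' * measure lebesgue E powr (1 - \<mu>))" .
qed

lemma marc_bound_add: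
  assumes "marc_bound \<mu> A f" "marc_bound \<mu> B g" "A \<ge> 0" "B \<ge> 0"
    and [measurable]: "f \<in> borel_measurable lebesgue" "g \<in> borel_measurable lebesgue"
  shows "marc_bound \<mu> (A + B) (\<lambda>x. f x + g x)"
  unfolding marc_bound_def
proof
  fix E :: "'a set" assume E[measurable]: "E \<in> lmeasurable"
  have [measurable]: "E \<in> sets lebesgue" using E by (simp add: fmeasurableD)
  have "(\<integral>\<^sup>+x\<in>E. f x + g x \<partial>lebesgue) = (\<integral>\<^sup>+x\<in>E. f x \<partial>lebesgue) + (\<integral>\<^sup>+x\<in>E. g x \<partial>lebesgue)"
    by (subst nn_integral_add[symmetric]) (auto simp: algebra_simps)
  also have "\<dots> \<le> ennreal (A * measure lebesgue E powr (1 - \<mu>)) + ennreal (B * measure lebesgue E powr (1 - \<mu>))"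
    using assms E by (intro add_mono marc_boundD)
  also have "\<dots> = ennreal ((A + B) * measure lebesgue E powr (1 - \<mu>))"
    using assms by (simp add: ennreal_plus[symmetric] algebra_simps del: ennreal_plus)
  finally show "(\<integral>\<^sup>+x\<in>E. f x + g x \<partial>lebesgue) \<le> ennreal ((A + B) * measure lebesgue E powr (1 - \<mu>))" .
qed

text \<open>A set of finite Lebesgue measure differs from its Borel main part by a null set. Testing
  on Borel sets alone keeps all later uses of Tonelli inside products of Borel
  sigma-algebras.\<close>

lemma marc_bound_borelI:
  assumes [measurable]: "f \<in> borel_measurable borel"
    and *: "\<And>E. E \<in> sets borel \<Longrightarrow> emeasure lborel E < \<infinity> \<Longrightarrow>
       (\<integral>\<^sup>+x\<in>E. f x \<partial>lborel) \<le> ennreal (B * measure lborel E powr (1 - \<mu>))"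
  shows "marc_bound \<mu> B f"
  unfolding marc_bound_def
proof
  fix E :: "'a set" assume E: "E \<in> lmeasurable"
  then have Es: "E \<in> sets (completion lborel)" by (simp add: fmeasurableD)
  define E' where "E' = main_part lborel E"
  have E'[measurable]: "E' \<in> sets borel" using Es E'_def by (metis main_part_sets sets_lborel)
  have em: "emeasure lborel E' = emeasure lebesgue E" unfolding E'_def using Es by (simp add: emeasure_completion)
  have ae: "AE x in lborel. x \<in> E \<longleftrightarrow> x \<in> E'"
  proof -
    obtain N where N: "N \<in> null_sets lborel" "null_part lborel E \<subseteq> N"
      using null_part[OF Es] by auto
    have "AE x in lborel. x \<notin> N" using N(1) by (rule AE_not_in)
    then show ?thesis
    proof eventually_elim
      case (elim x)
      have "E = E' \<union> null_part lborel E" unfolding E'_def using main_part_null_part_Un[OF Es] by simp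
      then show ?case using elim N(2) by blast
    qed
  qed
  have "(\<integral>\<^sup>+x\<in>E. f x \<partial>lebesgue) = (\<integral>\<^sup>+x\<in>E. f x \<partial>lborel)" by (simp add: nn_integral_completion)
  also have "\<dots> = (\<integral>\<^sup>+x\<in>E'. f x \<partial>lborel)"
    using ae by (intro nn_integral_cong_AE) (auto elim!: eventually_mono simp: indicator_def)
  also have "\<dots> \<le> ennreal (B * measure lborel E' powr (1 - \<mu>))"
    using * E' em E by (auto simp: fmeasurable_def)
  also have "measure lborel E' = measure lebesgue E" using em by (simp add: measure_def)
  finally show "(\<integral>\<^sup>+x\<in>E. f x \<partial>lebesgue) \<le> ennreal (B * measure lebesgue E powr (1 - \<mu>))" .
qed

text \<open>Chebyshev's inequality on the test set: \<open>s\<close> times the measure of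
  \<open>E\<close> is at most the integral of \<open>f\<close> over \<open>E\<close>. The majorant
  \<open>f\<close> may take the value infinity, as Duhamel majorants do before they are known to be
  finite.\<close>

lemma weak_bound_of_marc_bound:
  assumes "marc_bound \<mu> B f" "AE x in lebesgue. ennreal (g x) \<le> f x" "0 \<le> \<mu>" "\<mu> \<le> 1" "0 \<le> B"
  shows "weak_bound \<mu> B g"
  unfolding weak_bound_def
proof (intro allI impI ballI)
  fix s :: real and E :: "'a set"
  assume s: "s > 0" and E: "E \<in> lmeasurable" and gs: "\<forall>x\<in>E. s < g x"
  let ?m = "measure lebesgue E"
  have m: "emeasure lebesgue E = ennreal ?m" using E by (simp add: emeasure_eq_measure2)
  have "ennreal s * emeasure lebesgue E = (\<integral>\<^sup>+x\<in>E. ennreal s \<partial>lebesgue)"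
    using E by (subst nn_integral_cmult_indicator) (auto simp: fmeasurableD)
  also have "\<dots> \<le> (\<integral>\<^sup>+x\<in>E. f x \<partial>lebesgue)"
    using assms(2) gs
    by (intro nn_integral_mono_AE)
       (auto elim!: eventually_mono simp: indicator_def intro: order_trans[OF ennreal_leI[OF less_imp_le]])
  also have "\<dots> \<le> ennreal (B * ?m powr (1 - \<mu>))" using assms E by (auto simp: marc_bound_def)
  finally have *: "s * ?m \<le> B * ?m powr (1 - \<mu>)"
    using s assms(5) by (simp add: m ennreal_mult'[symmetric])
  show "s * ?m powr \<mu> \<le> B"
  proof (cases "?m = 0")
    case False
    then have mp: "?m > 0" by (simp add: less_le)
    then have "s * ?m powr \<mu> = s * ?m * ?m powr (\<mu> - 1)" by (simp add: powr_diff)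
    also have "\<dots> \<le> B * ?m powr (1 - \<mu>) * ?m powr (\<mu> - 1)" using * by (intro mult_right_mono) auto
    also have "\<dots> = B" using mp by (simp add: mult.assoc powr_add[symmetric])
    finally show ?thesis .
  qed (use assms in auto)
qed

text \<open>The distribution function of \<open>g\<close> inside \<open>E\<close> is at most
  min(|E|, (A/s)^{1/\<mu>}), and the two bounds cross at \<open>S = A * |E| powr (-\<mu>)\<close>.
  Integrating over the levels gives \<open>A * |E| powr (1 - \<mu>)\<close> up to a constant that is
  finite because \<mu> < 1.\<close>

lemma marc_bound_of_weak_bound:
  fixes \<mu> :: real
  assumes \<mu>: "0 \<le> \<mu>" "\<mu> < 1"
  obtains C where "C > 0"
    "\<And>A (g :: 'a::euclidean_space \<Rightarrow> real). g \<in> borel_measurable lebesgue \<Longrightarrow> weak_bound \<mu> A g \<Longrightarrow>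
        marc_bound \<mu> (C * A) (\<lambda>x. ennreal (g x))"
proof -
  \<comment> \<open>For \<mu> = 0 the weak bound says that \<open>g\<close> exceeds no level above
    \<open>A\<close> on a set of positive measure, so any decay exponent above 1 is valid; 2 is one
    choice.\<close>
  define y where "y = (if \<mu> = 0 then 2 else 1 / \<mu>)"
  have y: "y > 1" using \<mu> by (auto simp: y_def field_simps)
  define C where "C = 1 + 1 / (y - 1)"
  have C: "C > 0" using y by (auto simp: C_def add_pos_pos)
  show ?thesis
  proof (rule that[OF C])
    fix A and g :: "'a \<Rightarrow> real"
    assume g[measurable]: "g \<in> borel_measurable lebesgue" and wb: "weak_bound \<mu> A g"
    show "marc_bound \<mu> (C * A) (\<lambda>x. ennreal (g x))"
      unfolding marc_bound_def
    proof
      fix E :: "'a set" assume E: "E \<in> lmeasurable"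
      then have Es[measurable]: "E \<in> sets lebesgue" by (simp add: fmeasurableD)
      let ?e = "measure lebesgue E"
      define D where "D s = measure lebesgue (E \<inter> {x. s < g x})" for s
      have Dm: "E \<inter> {x. s < g x} \<in> lmeasurable" for s
        by (intro fmeasurable_Int_fmeasurable E) (use borel_measurable_less[of "\<lambda>_. s" lebesgue g] in simp)
      have De: "D s \<le> ?e" for s unfolding D_def by (rule measure_mono_fmeasurable[OF Int_lower1 fmeasurableD[OF Dm] E])
      have Dw: "s * D s powr \<mu> \<le> A" if "s > 0" for s
        unfolding D_def by (rule weak_boundD[OF wb that Dm]) auto
      have Apos: "0 \<le> A" using weak_bound_nonneg[OF wb] .
      show "(\<integral>\<^sup>+x\<in>E. ennreal (g x) \<partial>lebesgue) \<le> ennreal (C * A * ?e powr (1 - \<mu>))"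
      \<comment> \<open>In these cases the crossover level \<open>S\<close> would be 0. Instead
        \<open>g\<close> is at most 0 almost everywhere on \<open>E\<close>; since
        \<open>0 powr 0 = 0\<close>, the argument through
        \<open>D (1 / real (Suc n)) powr \<mu>\<close> covers \<mu> = 0 as well.\<close>
      proof (cases "?e = 0 \<or> A = 0")
        case True
        have "AE x in lebesgue. x \<in> E \<longrightarrow> g x \<le> 0"
        proof -
          have "D (1 / real (Suc n)) = 0" for n
          proof -
            have "D (1 / real (Suc n)) powr \<mu> \<le> 0 \<or> ?e = 0"
              using Dw[of "1 / real (Suc n)"] True by (auto simp: field_simps mult_le_0_iff)
            then show ?thesis using De[of "1 / real (Suc n)"]
              by (auto simp: D_def measure_le_0_iff order_antisym)
          qed
          then have "E \<inter> {x. 1 / real (Suc n) < g x} \<in> null_sets lebesgue" for n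
            using Dm[of "1 / real (Suc n)"] unfolding D_def
            by (simp add: null_sets_def fmeasurableD emeasure_eq_measure2)
          then have "AE x in lebesgue. \<forall>n. x \<notin> E \<inter> {x. 1 / real (Suc n) < g x}"
            unfolding AE_all_countable by (intro allI AE_not_in)
          then show ?thesis
          proof eventually_elim
            case (elim x)
            show ?case
            proof (rule ccontr)
              assume "\<not> (x \<in> E \<longrightarrow> g x \<le> 0)"
              then have "x \<in> E" "g x > 0" by auto
              then obtain n where "inverse (real (Suc n)) < g x" using reals_Archimedean by blast
              then show False using elim \<open>x \<in> E\<close> by (auto simp: inverse_eq_divide)
            qed
          qed
        qed
        then have "AE x in lebesgue. ennreal (g x) * indicator E x \<le> 0"
          by eventually_elim (auto simp: indicator_def ennreal_neg)
        then have "(\<integral>\<^sup>+x\<in>E. ennreal (g x) \<partial>lebesgue) \<le> (\<integral>\<^sup>+x. 0 \<partial>(lebesgue::'a measure))"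
          by (intro nn_integral_mono_AE) auto
        then show ?thesis by simp
      next
        case False
        then have e: "?e > 0" and A: "A > 0" using Apos by (auto simp: less_le)
        define S where "S = A * ?e powr (-\<mu>)"
        have S: "S > 0" using e A by (simp add: S_def)
        have "(\<integral>\<^sup>+x\<in>E. ennreal (g x) \<partial>lebesgue)
            = (\<integral>\<^sup>+s\<in>{0..}. (\<integral>\<^sup>+x. indicator E x * indicator {x. ennreal s < ennreal (g x)} x \<partial>lebesgue) \<partial>lborel)"
          by (rule layer_cake[OF sigma_finite_lebesgue]) auto
        also have "\<dots> = (\<integral>\<^sup>+s\<in>{0..}. ennreal (D s) \<partial>lborel)"
        proof (intro nn_integral_cong)
          fix s :: real
          have "(\<integral>\<^sup>+x. indicator E x * indicator {x. ennreal s < ennreal (g x)} x \<partial>lebesgue) = ennreal (D s)" if "s \<ge> 0"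
          proof -
            have "(\<integral>\<^sup>+x. indicator E x * indicator {x. ennreal s < ennreal (g x)} x \<partial>lebesgue)
                = (\<integral>\<^sup>+x. indicator (E \<inter> {x. s < g x}) x \<partial>lebesgue)"
              using that by (intro nn_integral_cong) (auto simp: indicator_def ennreal_less_iff)
            then show ?thesis using Dm[of s] by (simp add: D_def emeasure_eq_measure2 fmeasurableD)
          qed
          then show "(\<integral>\<^sup>+x. indicator E x * indicator {x. ennreal s < ennreal (g x)} x \<partial>lebesgue) * indicator {0..} s
              = ennreal (D s) * indicator {0..} s"
            by (auto simp: indicator_def)
        qed
        also have "\<dots> \<le> ennreal (?e * S * (1 / (1 - 0) + 1 / (y - 1)))"
        proof (rule nn_integral_two_powers_le)
          fix s :: real assume s: "s > 0"
          show "ennreal (D s) \<le> ennreal (?e * (s / S) powr - 0)"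
            using De s S by simp
          show "ennreal (D s) \<le> ennreal (?e * (s / S) powr - y)"
          proof (cases "D s = 0")
            case False
            then have Dp: "D s > 0" by (simp add: D_def less_le)
            show ?thesis
            proof (cases "\<mu> = 0")
              case True
              then have "s \<le> S" using Dw[OF s] Dp e by (simp add: S_def)
              then have "(s / S) powr (-y) \<ge> 1"
                using s S y powr_mono'[of "-y" 0 "s / S"] by simp
              then have "D s \<le> ?e * (s / S) powr (-y)"
                using De[of s] e mult_left_mono[of 1 "(s / S) powr (-y)" ?e] by linarith
              then show ?thesis by (rule ennreal_leI)
            next
              case False
              then have y': "y = 1 / \<mu>" and mp: "\<mu> > 0" using \<mu> by (auto simp: y_def)
              have "D s powr \<mu> \<le> A / s" using Dw[OF s] s by (simp add: field_simps)
              then have "(D s powr \<mu>) powr y \<le> (A / s) powr y" using y by (intro powr_mono2) auto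
              then have "D s \<le> (A / s) powr y" using Dp mp by (simp add: powr_powr y')
              also have "A = S * ?e powr \<mu>" using e by (simp add: S_def mult.assoc powr_add[symmetric])
              also have "(S * ?e powr \<mu> / s) powr y = ?e * (s / S) powr (-y)"
                using e s S mp by (simp add: powr_divide powr_mult powr_powr y' powr_minus field_simps)
              finally show ?thesis by (rule ennreal_leI)
            qed
          qed simp
        qed (use y S in auto)
        also have "?e * S * (1 / (1 - 0) + 1 / (y - 1)) = C * A * ?e powr (1 - \<mu>)"
          using e by (simp add: C_def S_def powr_diff powr_minus field_simps)
        finally show ?thesis .
      qed
    qed
  qed
qed


section \<open>Duality between weak spaces and kernels bounded on sets\<close>

lemma nn_integral_le_if_balls:
  fixes f :: "'a::euclidean_space \<Rightarrow> ennreal"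
  assumes [measurable]: "f \<in> borel_measurable borel"
    and "\<And>n::nat. (\<integral>\<^sup>+x\<in>ball 0 (real n). f x \<partial>lborel) \<le> c"
  shows "(\<integral>\<^sup>+x. f x \<partial>lborel) \<le> c"
proof -
  have "(\<integral>\<^sup>+x. f x \<partial>lborel) = (\<integral>\<^sup>+x. (SUP n. f x * indicator (ball 0 (real n)) x) \<partial>lborel)"
  proof (intro nn_integral_cong antisym)
    fix x :: 'a
    obtain n where "norm x < real n" using reals_Archimedean2 by blast
    then have "f x = f x * indicator (ball 0 (real n)) x" by simp
    also have "\<dots> \<le> (SUP n. f x * indicator (ball 0 (real n)) x)" by (rule SUP_upper) simp
    finally show "f x \<le> (SUP n. f x * indicator (ball 0 (real n)) x)" .
    show "(SUP n. f x * indicator (ball 0 (real n)) x) \<le> f x"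
      by (intro SUP_least) (auto simp: indicator_def)
  qed
  also have "\<dots> = (SUP n. \<integral>\<^sup>+x\<in>ball 0 (real n). f x \<partial>lborel)"
    by (rule nn_integral_monotone_convergence_SUP)
       (auto simp: incseq_def le_fun_def indicator_def)
  also have "\<dots> \<le> c" by (intro SUP_least assms)
  finally show ?thesis .
qed

lemma lmeasurable_borel: "E \<in> sets borel \<Longrightarrow> emeasure lborel E < \<infinity> \<Longrightarrow> E \<in> lmeasurable"
  by (auto simp: fmeasurable_def)

lemma emeasure_ball_finite: "emeasure lborel (ball (0::'a::euclidean_space) r \<inter> A) < \<infinity>" if "A \<in> sets borel"
proof -
  have "emeasure lborel (ball (0::'a) r \<inter> A) \<le> emeasure lborel (ball (0::'a) r)"
    by (intro emeasure_mono) auto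
  also have "\<dots> < \<infinity>" by (simp add: emeasure_lborel_ball_finite[unfolded infinity_ennreal_def])
  finally show ?thesis .
qed

text \<open>Chebyshev on the superlevel set F gives s|F| \<le> K|F|^m, hence |F|^{1-m} \<le> K/s.
  Dividing by |F|^m needs finite measure, so F is first cut by balls.\<close>

lemma emeasure_superlevel_le:
  fixes W :: "'a::euclidean_space \<Rightarrow> ennreal"
  assumes [measurable]: "W \<in> borel_measurable borel" and s: "s > 0" and m: "m < 1" and K: "K \<ge> 0"
    and W: "\<And>F. F \<in> sets borel \<Longrightarrow> emeasure lborel F < \<infinity> \<Longrightarrow>
       (\<integral>\<^sup>+x\<in>F. W x \<partial>lborel) \<le> ennreal (K * measure lborel F powr m)"
  shows "emeasure lborel {x. ennreal s < W x} \<le> ennreal ((K / s) powr (1 / (1 - m)))"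
proof -
  have "(\<integral>\<^sup>+x. indicator {x. ennreal s < W x} x \<partial>lborel) \<le> ennreal ((K / s) powr (1 / (1 - m)))"
  proof (rule nn_integral_le_if_balls)
    fix n :: nat
    define F where "F = ball 0 (real n) \<inter> {x. ennreal s < W x}"
    have [measurable]: "F \<in> sets borel" unfolding F_def by measurable
    have fin: "emeasure lborel F < \<infinity>" unfolding F_def by (rule emeasure_ball_finite) measurable
    let ?f = "measure lborel F"
    have em: "emeasure lborel F = ennreal ?f" using fin by (simp add: emeasure_eq_ennreal_measure)
    have "ennreal s * emeasure lborel F = (\<integral>\<^sup>+x\<in>F. ennreal s \<partial>lborel)"
      by (subst nn_integral_cmult_indicator) auto
    also have "\<dots> \<le> (\<integral>\<^sup>+x\<in>F. W x \<partial>lborel)"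
      by (intro nn_integral_mono) (auto simp: indicator_def F_def)
    also have "\<dots> \<le> ennreal (K * ?f powr m)" using fin by (intro W) auto
    finally have le: "s * ?f \<le> K * ?f powr m" using s K by (simp add: em ennreal_mult'[symmetric])
    have "?f \<le> (K / s) powr (1 / (1 - m))"
    proof (cases "?f = 0")
      case False
      then have fp: "?f > 0" by (simp add: less_le)
      then have "?f powr (1 - m) = ?f * ?f powr (-m)" by (simp add: powr_diff powr_minus field_simps)
      also have "\<dots> \<le> K / s * ?f powr m * ?f powr (-m)"
        using le s by (intro mult_right_mono) (auto simp: field_simps)
      also have "\<dots> = K / s" using fp by (simp add: mult.assoc powr_add[symmetric])
      finally have "?f powr (1 - m) \<le> K / s" .
      then have "(?f powr (1 - m)) powr (1 / (1 - m)) \<le> (K / s) powr (1 / (1 - m))"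
        using m by (intro powr_mono2) auto
      then show ?thesis using fp m by (simp add: powr_powr)
    qed simp
    then have "emeasure lborel F \<le> ennreal ((K / s) powr (1 / (1 - m)))" by (simp add: em ennreal_leI)
    moreover have "(\<integral>\<^sup>+x\<in>ball 0 (real n). indicator {x. ennreal s < W x} x \<partial>lborel) = emeasure lborel F"
      by (simp add: F_def Int_commute indicator_inter_arith[symmetric] nn_integral_indicator
            flip: indicator_inter_arith)
    ultimately show "(\<integral>\<^sup>+x\<in>ball 0 (real n). indicator {x. ennreal s < W x} x \<partial>lborel)
        \<le> ennreal ((K / s) powr (1 / (1 - m)))" by simp
  qed measurable
  then show ?thesis by (subst (asm) nn_integral_indicator) auto
qed

lemma nn_integral_lebesgue_borel_set:
  "(\<integral>\<^sup>+x\<in>E. f x \<partial>lebesgue) = (\<integral>\<^sup>+x\<in>E. f x \<partial>lborel)"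
  by (simp add: nn_integral_completion)

text \<open>The test set is the part of a ball where \<open>g\<close> exceeds \<open>B\<close>; the
  ball keeps the subtracted integral finite, so the excess has integral 0.\<close>

lemma AE_le_of_set_integral_le:
  fixes g :: "'a::euclidean_space \<Rightarrow> ennreal"
  assumes [measurable]: "g \<in> borel_measurable borel" and B: "B \<ge> 0"
    and g: "\<And>F. F \<in> sets borel \<Longrightarrow> emeasure lborel F < \<infinity> \<Longrightarrow>
       (\<integral>\<^sup>+x\<in>F. g x \<partial>lborel) \<le> ennreal (B * measure lborel F)"
  shows "AE x in lborel. g x \<le> ennreal B"
proof -
  have "AE x in lborel. x \<in> ball 0 (real n) \<longrightarrow> g x \<le> ennreal B" for n :: nat
  proof -
    define F where "F = ball 0 (real n) \<inter> {x. ennreal B < g x}"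
    have [measurable]: "F \<in> sets borel" unfolding F_def by measurable
    have fin: "emeasure lborel F < \<infinity>" unfolding F_def by (rule emeasure_ball_finite) measurable
    have "(\<integral>\<^sup>+x\<in>F. g x \<partial>lborel) \<le> ennreal (B * measure lborel F)"
      using fin by (intro g) auto
    also have "\<dots> = (\<integral>\<^sup>+x\<in>F. ennreal B \<partial>lborel)"
      using fin B by (subst nn_integral_cmult_indicator) (auto simp: emeasure_eq_ennreal_measure ennreal_mult')
    finally have le: "(\<integral>\<^sup>+x\<in>F. g x \<partial>lborel) \<le> (\<integral>\<^sup>+x\<in>F. ennreal B \<partial>lborel)" .
    have fin': "(\<integral>\<^sup>+x\<in>F. ennreal B \<partial>lborel) < \<infinity>"
      using fin by (subst nn_integral_cmult_indicator) (auto simp: ennreal_mult_less_top)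
    have "AE x in lborel. \<not> (ennreal B * indicator F x < g x * indicator F x)"
    proof -
      have "(\<integral>\<^sup>+x. g x * indicator F x - ennreal B * indicator F x \<partial>lborel)
          = (\<integral>\<^sup>+x\<in>F. g x \<partial>lborel) - (\<integral>\<^sup>+x\<in>F. ennreal B \<partial>lborel)"
        using fin' by (intro nn_integral_diff) (auto simp: F_def indicator_def)
      also have "\<dots> = 0" using le fin' by (simp add: diff_eq_0_iff_ennreal)
      finally have "AE x in lborel. g x * indicator F x - ennreal B * indicator F x = 0"
        by (subst (asm) nn_integral_0_iff_AE) auto
      then show ?thesis by eventually_elim (auto simp: diff_eq_0_iff_ennreal)
    qed
    then show ?thesis
      
      proof eventually_elim
        case (elim x)
        show ?case
        proof (intro impI, rule ccontr)
          assume "x \<in> ball 0 (real n)" "\<not> g x \<le> ennreal B"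
          then have "x \<in> F" "ennreal B < g x" by (auto simp: F_def)
          then show False using elim by simp
        qed
      qed
  qed
  then have "AE x in lborel. \<forall>n::nat. x \<in> ball 0 (real n) \<longrightarrow> g x \<le> ennreal B"
    unfolding AE_all_countable by blast
  then show ?thesis
  proof eventually_elim
    case (elim x)
    obtain n where "norm x < real n" using reals_Archimedean2 by blast
    then show ?case using elim by auto
  qed
qed

text \<open>Pairing of a weak space with its predual, a Lorentz space of second index 1. Bounds for
  \<open>W\<close> at the two neighbouring exponents \<mu> - \<delta> and \<mu> + \<delta> place
  \<open>W\<close> in that predual: over the superlevel sets of \<open>W\<close> the integral of
  \<open>g\<close> is bounded by two powers of s/K, one integrable at 0 and one at infinity. At
  \<mu> = 0 and \<mu> = 1 the neighbours are replaced by plain L^1-L^\<infinity> duality, for which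
  the bound at \<open>m = \<mu>\<close> is enough.\<close>

lemma marc_bound_duality:
  fixes \<mu> \<delta> :: real
  assumes \<mu>: "0 \<le> \<mu>" "\<mu> \<le> 1" and \<delta>: "\<delta> > 0" "0 < \<mu> \<Longrightarrow> \<mu> < 1 \<Longrightarrow> \<delta> \<le> \<mu> \<and> \<mu> + \<delta> < 1"
  obtains C where "C > 0"
    "\<And>(W :: 'a::euclidean_space \<Rightarrow> ennreal) g K B.
       W \<in> borel_measurable borel \<Longrightarrow> g \<in> borel_measurable borel \<Longrightarrow> 0 < K \<Longrightarrow> 0 \<le> B \<Longrightarrow> marc_bound \<mu> B g \<Longrightarrow>
       (\<And>m F. m \<in> {\<mu> - \<delta>, \<mu>, \<mu> + \<delta>} \<Longrightarrow> 0 \<le> m \<Longrightarrow> m \<le> 1 \<Longrightarrow> F \<in> sets borel \<Longrightarrow> emeasure lborel F < \<infinity> \<Longrightarrow>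
         (\<integral>\<^sup>+x\<in>F. W x \<partial>lborel) \<le> ennreal (K * measure lborel F powr m)) \<Longrightarrow>
       (\<integral>\<^sup>+x. W x * g x \<partial>lborel) \<le> ennreal (C * K * B)"
proof -
  consider "\<mu> = 0" | "\<mu> = 1" | "0 < \<mu>" "\<mu> < 1" using \<mu> by linarith
  then show ?thesis
  proof cases
    case 1
    show ?thesis
    proof (rule that[of 1])
      fix W g :: "'a \<Rightarrow> ennreal" and K B :: real
      assume [measurable]: "W \<in> borel_measurable borel" "g \<in> borel_measurable borel"
        and K: "0 < K" and B: "0 \<le> B" and g: "marc_bound \<mu> B g"
        and W: "\<And>m F. m \<in> {\<mu> - \<delta>, \<mu>, \<mu> + \<delta>} \<Longrightarrow> 0 \<le> m \<Longrightarrow> m \<le> 1 \<Longrightarrow> F \<in> sets borel \<Longrightarrow> emeasure lborel F < \<infinity> \<Longrightarrow>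
         (\<integral>\<^sup>+x\<in>F. W x \<partial>lborel) \<le> ennreal (K * measure lborel F powr m)"
      have "AE x in lborel. g x \<le> ennreal B"
        using marc_boundD[OF g lmeasurable_borel] 1 B
        by (intro AE_le_of_set_integral_le) (auto simp: nn_integral_lebesgue_borel_set)
      then have "(\<integral>\<^sup>+x. W x * g x \<partial>lborel) \<le> (\<integral>\<^sup>+x. ennreal B * W x \<partial>lborel)"
        by (intro nn_integral_mono_AE) (auto elim!: eventually_mono simp: mult.commute[of "W _"] intro: mult_right_mono)
      also have "\<dots> = ennreal B * (\<integral>\<^sup>+x. W x \<partial>lborel)" by (rule nn_integral_cmult) simp
      also have "(\<integral>\<^sup>+x. W x \<partial>lborel) \<le> ennreal K"
      proof (rule nn_integral_le_if_balls)
        fix n :: nat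
        have "(\<integral>\<^sup>+x\<in>ball 0 (real n). W x \<partial>lborel) \<le> ennreal (K * measure lborel (ball (0::'a) (real n)) powr 0)"
          using W[of 0 "ball 0 (real n)"] 1 emeasure_lborel_ball_finite[of "0::'a" "real n"] by simp
        also have "\<dots> \<le> ennreal K" using K by (intro ennreal_leI) (auto simp: powr_def)
        finally show "(\<integral>\<^sup>+x\<in>ball 0 (real n). W x \<partial>lborel) \<le> ennreal K" .
      qed simp
      finally show "(\<integral>\<^sup>+x. W x * g x \<partial>lborel) \<le> ennreal (1 * K * B)"
        using K B by (simp add: ennreal_mult' mult.commute mult_left_mono mult_right_mono)
    qed simp
  next
    case 2
    show ?thesis
    proof (rule that[of 1])
      fix W g :: "'a \<Rightarrow> ennreal" and K B :: real
      assume [measurable]: "W \<in> borel_measurable borel" "g \<in> borel_measurable borel"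
        and K: "0 < K" and B: "0 \<le> B" and g: "marc_bound \<mu> B g"
        and W: "\<And>m F. m \<in> {\<mu> - \<delta>, \<mu>, \<mu> + \<delta>} \<Longrightarrow> 0 \<le> m \<Longrightarrow> m \<le> 1 \<Longrightarrow> F \<in> sets borel \<Longrightarrow> emeasure lborel F < \<infinity> \<Longrightarrow>
         (\<integral>\<^sup>+x\<in>F. W x \<partial>lborel) \<le> ennreal (K * measure lborel F powr m)"
      have "AE x in lborel. W x \<le> ennreal K"
        using W[of 1] 2 K by (intro AE_le_of_set_integral_le) auto
      then have "(\<integral>\<^sup>+x. W x * g x \<partial>lborel) \<le> (\<integral>\<^sup>+x. ennreal K * g x \<partial>lborel)"
        by (intro nn_integral_mono_AE) (auto elim!: eventually_mono intro: mult_right_mono)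
      also have "\<dots> = ennreal K * (\<integral>\<^sup>+x. g x \<partial>lborel)" by (rule nn_integral_cmult) simp
      also have "(\<integral>\<^sup>+x. g x \<partial>lborel) \<le> ennreal B"
      proof (rule nn_integral_le_if_balls)
        fix n :: nat
        have "(\<integral>\<^sup>+x\<in>ball 0 (real n). g x \<partial>lborel) \<le> ennreal (B * measure lborel (ball (0::'a) (real n)) powr 0)"
          using marc_boundD[OF g, of "ball 0 (real n)"] 2 by (simp add: nn_integral_lebesgue_borel_set)
        also have "\<dots> \<le> ennreal B" using B by (intro ennreal_leI) (auto simp: powr_def)
        finally show "(\<integral>\<^sup>+x\<in>ball 0 (real n). g x \<partial>lborel) \<le> ennreal B" .
      qed simp
      finally show "(\<integral>\<^sup>+x. W x * g x \<partial>lborel) \<le> ennreal (1 * K * B)"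
        using K B by (simp add: ennreal_mult' mult_left_mono)
    qed simp
  next
    case 3
    \<comment> \<open>A superlevel set has measure at most (K/s)^{1/(1-m)}, and \<open>g\<close>
      integrates over it to a multiple of the (1-\<mu>)-th power of this. The resulting exponents
      for m = \<mu> - \<delta> and m = \<mu> + \<delta> lie on different sides of 1.\<close>
    define x where "x = (1 - \<mu>) / (1 - (\<mu> - \<delta>))"
    define y where "y = (1 - \<mu>) / (1 - (\<mu> + \<delta>))"
    have xy: "x < 1" "y > 1" using 3 \<delta> by (auto simp: x_def y_def field_simps)
    define C where "C = 1 / (1 - x) + 1 / (y - 1)"
    have C: "C > 0" using xy by (auto simp: C_def intro!: add_pos_pos)
    show ?thesis
    proof (rule that[OF C])
      fix W g :: "'a \<Rightarrow> ennreal" and K B :: real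
      assume [measurable]: "W \<in> borel_measurable borel" "g \<in> borel_measurable borel"
        and K: "0 < K" and B: "0 \<le> B" and g: "marc_bound \<mu> B g"
        and W: "\<And>m F. m \<in> {\<mu> - \<delta>, \<mu>, \<mu> + \<delta>} \<Longrightarrow> 0 \<le> m \<Longrightarrow> m \<le> 1 \<Longrightarrow> F \<in> sets borel \<Longrightarrow> emeasure lborel F < \<infinity> \<Longrightarrow>
         (\<integral>\<^sup>+x\<in>F. W x \<partial>lborel) \<le> ennreal (K * measure lborel F powr m)"
      have D: "(\<integral>\<^sup>+x. g x * indicator {x. ennreal s < W x} x \<partial>lborel)
          \<le> ennreal (B * (s / K) powr (-((1 - \<mu>) / (1 - m))))"
        if s: "s > 0" and m: "m \<in> {\<mu> - \<delta>, \<mu> + \<delta>}" for s m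
      proof -
        have m01: "0 \<le> m" "m < 1" using m 3 \<delta> by auto
        define F where "F = {x. ennreal s < W x}"
        have [measurable]: "F \<in> sets borel" unfolding F_def by measurable
        have em: "emeasure lborel F \<le> ennreal ((K / s) powr (1 / (1 - m)))"
          unfolding F_def using m m01 s K by (intro emeasure_superlevel_le W) auto
        then have fin: "emeasure lborel F < \<infinity>"
          by (rule order_le_less_trans) simp
        then have "measure lborel F \<le> (K / s) powr (1 / (1 - m))"
          using em by (simp add: emeasure_eq_ennreal_measure)
        then have "measure lborel F powr (1 - \<mu>) \<le> ((K / s) powr (1 / (1 - m))) powr (1 - \<mu>)"
          using 3 by (intro powr_mono2) auto
        also have "\<dots> = (s / K) powr (-((1 - \<mu>) / (1 - m)))"
          using s K by (simp add: powr_powr powr_minus powr_divide field_simps)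
        finally have le: "measure lborel F powr (1 - \<mu>) \<le> (s / K) powr (-((1 - \<mu>) / (1 - m)))" .
        have "(\<integral>\<^sup>+x\<in>F. g x \<partial>lborel) \<le> ennreal (B * measure lborel F powr (1 - \<mu>))"
          using marc_boundD[OF g lmeasurable_borel[OF _ fin]] by (simp add: nn_integral_lebesgue_borel_set)
        also have "\<dots> \<le> ennreal (B * (s / K) powr (-((1 - \<mu>) / (1 - m))))"
          using le B by (intro ennreal_leI mult_left_mono) auto
        finally show ?thesis unfolding F_def .
      qed
      have "(\<integral>\<^sup>+x. W x * g x \<partial>lborel)
          = (\<integral>\<^sup>+s\<in>{0..}. (\<integral>\<^sup>+x. g x * indicator {x. ennreal s < W x} x \<partial>lborel) \<partial>lborel)"
        by (rule layer_cake[OF sigma_finite_lborel]) auto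
      also have "\<dots> \<le> ennreal (B * K * (1 / (1 - x) + 1 / (y - 1)))"
        using D[of _ "\<mu> - \<delta>"] D[of _ "\<mu> + \<delta>"] xy K B
        by (intro nn_integral_two_powers_le) (auto simp: x_def y_def)
      finally show "(\<integral>\<^sup>+x. W x * g x \<partial>lborel) \<le> ennreal (C * K * B)"
        by (simp add: C_def mult_ac)
    qed
  qed
qed

section \<open>Lorentz norms\<close>

lemma recip_ennreal: "\<rho> > 0 \<Longrightarrow> recip (ennreal \<rho>) = 1 / \<rho>"
  by (simp add: recip_def inverse_ennreal inverse_eq_divide)

lemma recip_infinity [simp]: "recip \<infinity> = 0" "recip top = 0"
  by (simp_all add: recip_def)

lemma recip_one [simp]: "recip 1 = 1"
  using recip_ennreal[of 1] by simp

lemma recip_nonneg [simp]: "0 \<le> recip q"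
  by (simp add: recip_def)

lemma ennreal_ge_1_cases:
  assumes "(1::ennreal) \<le> q"
  obtains "q = \<infinity>" | "q = 1" | x where "q = ennreal x" "x > 1"
proof (cases q)
  case (real x)
  have "1 \<le> x" using assms real by (metis ennreal_1 ennreal_le_iff)
  then show ?thesis using that real by (cases "x = 1") auto
qed (use that in auto)

lemma recip_le_1: "1 \<le> q \<Longrightarrow> recip q \<le> 1"
  by (erule ennreal_ge_1_cases) (auto simp: recip_ennreal)

lemma ennreal_powr_ennreal: "x \<ge> 0 \<Longrightarrow> ennreal_powr (ennreal x) s = ennreal (x powr s)"
  by (simp add: ennreal_powr_def)

lemma ennreal_powr_top [simp]: "ennreal_powr top s = top"
  by (simp add: ennreal_powr_def)

lemma ennreal_powr_mono:
  assumes "x \<le> y" "s > 0" shows "ennreal_powr x s \<le> ennreal_powr y s"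
proof (cases y)
  case (real b)
  then obtain a where "x = ennreal a" "0 \<le> a" using assms by (cases x) (auto simp: top_unique)
  then show ?thesis using real assms by (simp add: ennreal_powr_ennreal powr_mono2 ennreal_leI)
qed simp

lemma ennreal_powr_powr:
  assumes "s > 0" "s' > 0" shows "ennreal_powr (ennreal_powr x s) s' = ennreal_powr x (s * s')"
  by (cases x) (simp_all add: ennreal_powr_ennreal powr_powr)

lemma ennreal_powr_1 [simp]: "ennreal_powr x 1 = x"
  by (cases x) (simp_all add: ennreal_powr_ennreal)

lemma ennreal_powr_cmult:
  assumes "c > 0" shows "ennreal_powr (ennreal c * x) s = ennreal (c powr s) * ennreal_powr x s"
  using assms
  by (cases x) (simp_all add: ennreal_powr_ennreal powr_mult ennreal_mult'[symmetric] ennreal_mult_top)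

lemma ennreal_powr_measurable [measurable]: "(\<lambda>x. ennreal_powr x s) \<in> borel_measurable borel"
  unfolding ennreal_powr_def by measurable

lemma ennreal_powr_add_le:
  assumes s: "s > 0"
  shows "ennreal_powr (x + y) s \<le> ennreal (2 powr s) * (ennreal_powr x s + ennreal_powr y s)"
proof -
  have *: "ennreal_powr (x + y) s \<le> ennreal (2 powr s) * (ennreal_powr x s + ennreal_powr y s)" if "x \<le> y" for x y
  proof -
    have "x + y \<le> ennreal 2 * y" using that by (simp add: mult_2 add_right_mono)
    then have "ennreal_powr (x + y) s \<le> ennreal (2 powr s) * ennreal_powr y s"
      using ennreal_powr_mono[OF _ s] ennreal_powr_cmult[of 2 y s] by (metis zero_less_numeral)
    also have "\<dots> \<le> ennreal (2 powr s) * (ennreal_powr x s + ennreal_powr y s)"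
      by (intro mult_left_mono) auto
    finally show ?thesis .
  qed
  show ?thesis using *[of x y] *[of y x] by (cases "x \<le> y") (auto simp: add.commute)
qed

text \<open>Weak bounds are tested on sets of finite measure only, while superlevel sets may have
  infinite measure; this passes from the latter to the former.\<close>

lemma finite_subset_of_large_measure:
  fixes S :: "'a::euclidean_space set"
  assumes S: "S \<in> sets lebesgue" and "ennreal t < emeasure lebesgue S"
  obtains E where "E \<in> lmeasurable" "E \<subseteq> S" "t < measure lebesgue E"
proof -
  have "(\<Union>n. S \<inter> ball 0 (real n)) = S" by (auto simp: reals_Archimedean2)
  moreover have "(SUP n. emeasure lebesgue (S \<inter> ball 0 (real n))) = emeasure lebesgue (\<Union>n. S \<inter> ball 0 (real n))"
    using S by (intro SUP_emeasure_incseq) (auto simp: incseq_def)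
  ultimately have "(SUP n. emeasure lebesgue (S \<inter> ball 0 (real n))) > ennreal t"
    using assms by simp
  then obtain n where n: "ennreal t < emeasure lebesgue (S \<inter> ball 0 (real n))"
    by (auto simp: less_SUP_iff)
  have E: "S \<inter> ball 0 (real n) \<in> lmeasurable"
    using fmeasurable_Int_fmeasurable[OF lmeasurable_ball S, of 0 "real n"] by (simp add: Int_commute)
  show ?thesis
  proof (rule that[OF E])
    show "t < measure lebesgue (S \<inter> ball 0 (real n))"
      using n E by (simp add: emeasure_eq_measure2) (metis ennreal_leI not_less)
  qed auto
qed

context
  fixes g :: "real ^ 'n \<Rightarrow> 'c::euclidean_space"
  assumes g[measurable]: "g \<in> borel_measurable lebesgue"
begin

lemma superlevel_lebesgue [measurable]: "{x. s < norm (g x)} \<in> sets lebesgue"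
proof -
  have "{x \<in> space lebesgue. s < norm (g x)} \<in> sets lebesgue" by measurable
  then show ?thesis by simp
qed

text \<open>The rearrangement is the generalised inverse of the distribution function. Strict
  inequalities on both sides are correct because the distribution function is right continuous: the
  superlevel sets at s + 1/(n+1) exhaust the one at s, so a strict excess of measure survives at a
  slightly higher level.\<close>

lemma less_rearrangement_iff:
  assumes s: "s \<ge> 0"
  shows "ennreal s < rearrangement g t \<longleftrightarrow> ennreal t < emeasure lebesgue {x. s < norm (g x)}"
proof
  assume *: "ennreal s < rearrangement g t"
  show "ennreal t < emeasure lebesgue {x. s < norm (g x)}"
  proof (rule ccontr)
    assume "\<not> ennreal t < emeasure lebesgue {x. s < norm (g x)}"
    then have "rearrangement g t \<le> ennreal s"
      unfolding rearrangement_def using s by (intro Inf_lower) (auto simp: not_less)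
    then show False using * by simp
  qed
next
  assume *: "ennreal t < emeasure lebesgue {x. s < norm (g x)}"
  let ?S = "\<lambda>n. {x. s + 1 / real (Suc n) < norm (g x)}"
  have "(\<Union>n. ?S n) = {x. s < norm (g x)}"
  proof (intro equalityI subsetI)
    fix x assume "x \<in> {x. s < norm (g x)}"
    then have "norm (g x) - s > 0" by simp
    then obtain n where "inverse (real (Suc n)) < norm (g x) - s" using reals_Archimedean by blast
    then show "x \<in> (\<Union>n. ?S n)" by (auto simp: inverse_eq_divide algebra_simps)
  qed (auto intro: le_less_trans[rotated])
  moreover have "(SUP n. emeasure lebesgue (?S n)) = emeasure lebesgue (\<Union>n. ?S n)"
  proof (rule SUP_emeasure_incseq)
    show "incseq ?S"
      unfolding incseq_def
    proof (intro allI impI subsetI CollectI)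
      fix m n :: nat and x assume "m \<le> n" "x \<in> ?S m"
      moreover have "1 / real (Suc n) \<le> 1 / real (Suc m)" using \<open>m \<le> n\<close> by (simp add: frac_le)
      ultimately show "s + 1 / real (Suc n) < norm (g x)" by simp
    qed
  qed auto
  ultimately obtain n where n: "ennreal t < emeasure lebesgue (?S n)"
    using * by (metis (no_types, lifting) less_SUP_iff)
  have "ennreal (s + 1 / real (Suc n)) \<le> rearrangement g t"
    unfolding rearrangement_def
  proof (rule Inf_greatest)
    fix y assume "y \<in> {ennreal s |s. 0 \<le> s \<and> emeasure lebesgue {x. s < norm (g x)} \<le> ennreal t}"
    then obtain s' where s': "0 \<le> s'" "emeasure lebesgue {x. s' < norm (g x)} \<le> ennreal t" "y = ennreal s'"
      by blast
    have "s + 1 / real (Suc n) \<le> s'"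
    proof (rule ccontr)
      assume "\<not> s + 1 / real (Suc n) \<le> s'"
      then have "emeasure lebesgue (?S n) \<le> emeasure lebesgue {x. s' < norm (g x)}"
        by (intro emeasure_mono) auto
      then show False using s' n by auto
    qed
    then show "ennreal (s + 1 / real (Suc n)) \<le> y" unfolding s'(3) by (rule ennreal_leI)
  qed
  moreover have "ennreal s < ennreal (s + 1 / real (Suc n))" using s by (intro ennreal_lessI add_nonneg_pos) auto
  ultimately show "ennreal s < rearrangement g t" by (rule less_le_trans[rotated])
qed

lemma rearrangement_measurable [measurable]: "rearrangement g \<in> borel_measurable borel"
proof (rule borel_measurableI_greater)
  fix y :: ennreal
  show "{x \<in> space borel. y < rearrangement g x} \<in> sets borel"
  proof (cases y)
    case (real s)
    then have "{x \<in> space borel. y < rearrangement g x} = {t. ennreal t < emeasure lebesgue {x. s < norm (g x)}}"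
      by (simp add: less_rearrangement_iff)
    also have "\<dots> \<in> sets borel" by measurable
    finally show ?thesis .
  qed simp
qed

lemma rearrangement_antimono: "t \<le> t' \<Longrightarrow> rearrangement g t' \<le> rearrangement g t"
  unfolding rearrangement_def
  by (intro Inf_superset_mono) (auto intro: order_trans[OF _ ennreal_leI])

lemma weak_bound_of_rearrangement:
  assumes *: "\<And>t. t > 0 \<Longrightarrow> ennreal (t powr \<mu>) * rearrangement g t \<le> ennreal A" and A: "A \<ge> 0" and \<mu>: "\<mu> \<ge> 0"
  shows "weak_bound \<mu> A (\<lambda>x. norm (g x))"
  unfolding weak_bound_def
proof (intro allI ballI impI)
  fix s :: real and E :: "(real ^ 'n) set"
  assume s: "s > 0" and E: "E \<in> lmeasurable" and gt: "\<forall>x\<in>E. s < norm (g x)"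
  let ?m = "measure lebesgue E"
  show "s * ?m powr \<mu> \<le> A"
  proof (cases "?m = 0")
    case False
    then have m: "?m > 0" by (simp add: less_le)
    have le: "s * t powr \<mu> \<le> A" if "0 < t" "t < ?m" for t
    proof -
      have "ennreal t < ennreal ?m" using that by (intro ennreal_lessI) auto
      also have "\<dots> = emeasure lebesgue E" using E by (simp add: emeasure_eq_measure2)
      also have "\<dots> \<le> emeasure lebesgue {x. s < norm (g x)}" using gt by (intro emeasure_mono) auto
      finally have "ennreal s < rearrangement g t" using s by (simp add: less_rearrangement_iff)
      then have "ennreal (t powr \<mu>) * ennreal s \<le> ennreal A"
        using *[OF that(1)] by (meson less_imp_le mult_left_mono order_trans zero_le)
      then show ?thesis using A s by (simp add: ennreal_mult'[symmetric] mult.commute)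
    qed
    \<comment> \<open>The rearrangement exceeds \<open>s\<close> only at times \<open>t\<close>
      strictly below the measure of \<open>E\<close>, so the bound at the measure itself is a left
      limit.\<close>
    have "((\<lambda>t. s * t powr \<mu>) \<longlongrightarrow> s * ?m powr \<mu>) (at_left ?m)"
      using m by (intro tendsto_intros) auto
    moreover have "\<forall>\<^sub>F t in at_left ?m. s * t powr \<mu> \<le> A"
      unfolding eventually_at_left[OF m] using le m by auto
    ultimately show ?thesis by (rule tendsto_upperbound) simp
  qed (use A in auto)
qed

lemma rearrangement_of_weak_bound:
  assumes w: "weak_bound \<mu> A (\<lambda>x. norm (g x))" and \<mu>: "\<mu> \<ge> 0" and t: "t > 0"
  shows "ennreal (t powr \<mu>) * rearrangement g t \<le> ennreal A"
proof -
  have A: "A \<ge> 0" using weak_bound_nonneg[OF w] .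
  have "rearrangement g t \<le> ennreal (A / t powr \<mu>)"
  proof (rule ccontr)
    assume "\<not> rearrangement g t \<le> ennreal (A / t powr \<mu>)"
    then obtain y where y: "ennreal (A / t powr \<mu>) < y" "y < rearrangement g t"
      by (auto simp: not_le dest: dense)
    then obtain s where s: "y = ennreal s" "s \<ge> 0" by (cases y) auto
    have "A / t powr \<mu> < s" using y(1) s A t by (simp add: ennreal_less_iff)
    moreover have "A / t powr \<mu> \<ge> 0" using A by simp
    ultimately have sp: "s > 0" and As: "A < s * t powr \<mu>" using t by (linarith, simp add: field_simps)
    have "ennreal t < emeasure lebesgue {x. s < norm (g x)}" using y s by (simp add: less_rearrangement_iff)
    then obtain E where E: "E \<in> lmeasurable" "E \<subseteq> {x. s < norm (g x)}" "t < measure lebesgue E"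
      using finite_subset_of_large_measure[OF superlevel_lebesgue] by blast
    have "s * t powr \<mu> \<le> s * measure lebesgue E powr \<mu>"
      using E t sp \<mu> by (intro mult_left_mono powr_mono2) auto
    also have "\<dots> \<le> A" using weak_boundD[OF w sp E(1)] E(2) by auto
    finally show False using As by simp
  qed
  then have "ennreal (t powr \<mu>) * rearrangement g t \<le> ennreal (t powr \<mu>) * ennreal (A / t powr \<mu>)"
    by (intro mult_left_mono) auto
  also have "\<dots> = ennreal A" using t A by (simp add: ennreal_mult'[symmetric])
  finally show ?thesis .
qed

lemma weak_bound_of_lorentz_infinity:
  assumes "lorentz_norm p \<infinity> g \<le> ennreal A" "A \<ge> 0"
  shows "weak_bound (recip p) A (\<lambda>x. norm (g x))"
proof (rule weak_bound_of_rearrangement)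
  fix t :: real assume "t > 0"
  then have "ennreal (t powr recip p) * rearrangement g t \<le> (SUP t\<in>{0<..}. ennreal (t powr recip p) * rearrangement g t)"
    by (intro SUP_upper) auto
  then show "ennreal (t powr recip p) * rearrangement g t \<le> ennreal A"
    using assms by (simp add: lorentz_norm_def)
qed (use assms in auto)

lemma lorentz_infinity_of_weak_bound:
  assumes "weak_bound (recip p) A (\<lambda>x. norm (g x))"
  shows "lorentz_norm p \<infinity> g \<le> ennreal A"
  unfolding lorentz_norm_def using rearrangement_of_weak_bound[OF assms] by (auto intro!: SUP_least)

text \<open>The rearrangement decreases, so its value at t is controlled by the integral over
  [t/2, t], which has measure at least 1/2 for dt/t. This costs 2^{1/\<rho>} \<le> 2, and replacing
  (t/2)^\<mu> by t^\<mu> costs 2^\<mu>; together they give the constant.\<close>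

lemma weak_bound_of_lorentz_finite:
  assumes le: "lorentz_norm q (ennreal \<rho>) g \<le> ennreal A" and A: "A \<ge> 0" and \<rho>: "\<rho> \<ge> 1"
  shows "weak_bound (recip q) (2 powr (recip q + 1) * A) (\<lambda>x. norm (g x))"
proof (rule weak_bound_of_rearrangement)
  fix t :: real assume t: "t > 0"
  define \<mu> where "\<mu> = recip q"
  define I where "I = (\<integral>\<^sup>+ t\<in>{0<..}. ennreal_powr (ennreal (t powr \<mu>) * rearrangement g t) \<rho> * ennreal (1 / t) \<partial>lborel)"
  have "ennreal_powr I (1 / \<rho>) \<le> ennreal A"
    using le \<rho> by (simp add: lorentz_norm_def I_def \<mu>_def recip_ennreal)
  then have "ennreal_powr (ennreal_powr I (1 / \<rho>)) \<rho> \<le> ennreal_powr (ennreal A) \<rho>"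
    using \<rho> by (intro ennreal_powr_mono) auto
  then have I: "I \<le> ennreal (A powr \<rho>)" using \<rho> A by (simp add: ennreal_powr_powr ennreal_powr_ennreal)
  define X where "X = ennreal ((t / 2) powr \<mu>) * rearrangement g t"
  have "ennreal_powr X \<rho> * ennreal (1 / 2) = ennreal_powr X \<rho> * ennreal (1 / t) * ennreal (t / 2)"
    using t by (simp add: mult.assoc ennreal_mult'[symmetric])
  also have "\<dots> = (\<integral>\<^sup>+s\<in>{t/2..t}. ennreal_powr X \<rho> * ennreal (1 / t) \<partial>lborel)"
    using t by (subst nn_integral_cmult_indicator) (auto simp: field_simps)
  also have "\<dots> \<le> I"
    unfolding I_def
  proof (rule nn_integral_mono)
    fix s :: real
    show "ennreal_powr X \<rho> * ennreal (1 / t) * indicator {t/2..t} s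
        \<le> ennreal_powr (ennreal (s powr \<mu>) * rearrangement g s) \<rho> * ennreal (1 / s) * indicator {0<..} s"
    proof (cases "s \<in> {t/2..t}")
      case True
      then have s: "s > 0" "t / 2 \<le> s" "s \<le> t" using t by auto
      have "X \<le> ennreal (s powr \<mu>) * rearrangement g s"
        unfolding X_def using s t
        by (intro mult_mono ennreal_leI powr_mono2 rearrangement_antimono) (auto simp: \<mu>_def)
      then show ?thesis using s t True \<rho> by (auto intro!: mult_mono ennreal_powr_mono ennreal_leI simp: frac_le)
    qed simp
  qed
  finally have "ennreal_powr X \<rho> * ennreal (1 / 2) \<le> ennreal (A powr \<rho>)" using I by simp
  then have "ennreal 2 * (ennreal_powr X \<rho> * ennreal (1 / 2)) \<le> ennreal 2 * ennreal (A powr \<rho>)"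
    by (intro mult_left_mono) auto
  also have "ennreal 2 * (ennreal_powr X \<rho> * ennreal (1 / 2)) = ennreal_powr X \<rho>"
  proof -
    have "ennreal 2 * ennreal (1 / 2) = 1" by (subst ennreal_mult'[symmetric]) auto
    then show ?thesis by (metis mult.left_commute mult.right_neutral)
  qed
  finally have "ennreal_powr (ennreal_powr X \<rho>) (1 / \<rho>) \<le> ennreal_powr (ennreal 2 * ennreal (A powr \<rho>)) (1 / \<rho>)"
    using \<rho> by (intro ennreal_powr_mono) auto
  then have "X \<le> ennreal ((2 * A powr \<rho>) powr (1 / \<rho>))"
    using \<rho> by (simp add: ennreal_powr_powr ennreal_powr_ennreal ennreal_mult'[symmetric] del: ennreal_numeral)
  also have "(2 * A powr \<rho>) powr (1 / \<rho>) = 2 powr (1 / \<rho>) * A"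
    using \<rho> A by (simp add: powr_mult powr_powr)
  also have "ennreal (2 powr (1 / \<rho>) * A) \<le> ennreal (2 * A)"
    using \<rho> A powr_mono[of "1 / \<rho>" 1 2] by (intro ennreal_leI mult_right_mono) auto
  finally have X: "X \<le> ennreal (2 * A)" .
  have "ennreal (t powr \<mu>) * rearrangement g t = ennreal (2 powr \<mu>) * X"
    using t by (simp add: X_def mult.assoc[symmetric] ennreal_mult'[symmetric] powr_divide)
  also have "\<dots> \<le> ennreal (2 powr \<mu>) * ennreal (2 * A)" using X by (intro mult_left_mono) auto
  also have "\<dots> = ennreal (2 powr (recip q + 1) * A)"
    using A by (simp add: \<mu>_def powr_add ennreal_mult'[symmetric] mult_ac)
  finally show "ennreal (t powr recip q) * rearrangement g t \<le> ennreal (2 powr (recip q + 1) * A)"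
    by (simp add: \<mu>_def)
qed (use A in auto)

lemma weak_bound_of_lorentz:
  assumes "1 \<le> r" "lorentz_norm q r g \<le> ennreal A" "A \<ge> 0"
  shows "weak_bound (recip q) (2 powr (recip q + 1) * A) (\<lambda>x. norm (g x))"
proof (cases r)
  case (real \<rho>)
  then have "\<rho> \<ge> 1" using assms by (metis ennreal_1 ennreal_le_iff)
  then show ?thesis using assms real weak_bound_of_lorentz_finite by simp
next
  case top
  have "weak_bound (recip q) A (\<lambda>x. norm (g x))"
    using weak_bound_of_lorentz_infinity assms top by simp
  moreover have "1 * A \<le> 2 powr (recip q + 1) * A"
    using assms by (intro mult_right_mono) (auto simp: ge_one_powr_ge_zero)
  ultimately show ?thesis by (auto intro: weak_bound_mono)
qed

text \<open>Layer cake on both sides: at each level the rearrangement and the norm of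
  \<open>g\<close> have superlevel sets of equal measure. At q = 1 this identity is needed because
  the bound of weak L^1 does not control integrals over sets.\<close>

lemma lorentz_norm_1_1: "lorentz_norm 1 1 g = (\<integral>\<^sup>+x. ennreal (norm (g x)) \<partial>lebesgue)"
proof -
  have "lorentz_norm 1 1 g = (\<integral>\<^sup>+t. ennreal_powr (ennreal (t powr 1) * rearrangement g t) 1 * ennreal (1 / t) * indicator {0<..} t \<partial>lborel)"
    by (simp add: lorentz_norm_def)
  also have "\<dots> = (\<integral>\<^sup>+t. rearrangement g t * indicator {0<..} t \<partial>lborel)"
    by (intro nn_integral_cong) (auto simp: indicator_def mult.commute[of "ennreal _" "rearrangement g _"] mult.assoc ennreal_mult'[symmetric])
  also have "\<dots> = (\<integral>\<^sup>+s\<in>{0..}. (\<integral>\<^sup>+t. indicator {0<..} t * indicator {t. ennreal s < rearrangement g t} t \<partial>lborel) \<partial>lborel)"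
    by (rule layer_cake[OF sigma_finite_lborel]) auto
  also have "\<dots> = (\<integral>\<^sup>+s\<in>{0..}. (\<integral>\<^sup>+x. 1 * indicator {x. ennreal s < ennreal (norm (g x))} x \<partial>lebesgue) \<partial>lborel)"
  proof (intro nn_integral_cong)
    fix s :: real
    show "(\<integral>\<^sup>+t. indicator {0<..} t * indicator {t. ennreal s < rearrangement g t} t \<partial>lborel) * indicator {0..} s
       = (\<integral>\<^sup>+x. 1 * indicator {x. ennreal s < ennreal (norm (g x))} x \<partial>lebesgue) * indicator {0..} s"
    proof (cases "s \<ge> 0")
      case True
      let ?m = "emeasure lebesgue {x. s < norm (g x)}"
      have "(\<integral>\<^sup>+t. indicator {0<..} t * indicator {t. ennreal s < rearrangement g t} t \<partial>lborel)
          = (\<integral>\<^sup>+t. indicator {0<..} t * indicator {t. ennreal t < ?m} t \<partial>lborel)"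
        using True by (simp add: less_rearrangement_iff)
      also have "\<dots> = (\<integral>\<^sup>+t. indicator {0..} t * indicator {t. ennreal t < ?m} t \<partial>lborel)"
      proof (rule nn_integral_cong_AE)
        have "AE s in lborel. s \<noteq> (0::real)" by (rule AE_lborel_singleton)
        then show "AE t in lborel. indicator {0<..} t * indicator {t. ennreal t < ?m} t
            = (indicator {0..} t * indicator {t. ennreal t < ?m} t :: ennreal)"
          by eventually_elim (auto simp: indicator_def)
      qed
      also have "\<dots> = ?m"
        using nn_integral_indicator_less[of ?m] by simp
      also have "?m = (\<integral>\<^sup>+x. 1 * indicator {x. ennreal s < ennreal (norm (g x))} x \<partial>lebesgue)"
        using True by (simp add: ennreal_less_iff)
      finally show ?thesis by simp
    qed simp
  qed
  also have "\<dots> = (\<integral>\<^sup>+x. ennreal (norm (g x)) * 1 \<partial>lebesgue)"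
    by (rule layer_cake[OF sigma_finite_lebesgue, symmetric]) auto
  finally show ?thesis by simp
qed

end


text \<open>Real interpolation between the weak spaces with exponents \<open>1/q \<plusminus> \<epsilon>\<close>, in a form that keeps track of scaling through \<open>\<rho>\<close>.\<close>

lemma lorentz_norm_le_of_marc_bounds:
  fixes q r :: ennreal and \<epsilon> :: real
  assumes q: "1 \<le> q" and r: "1 \<le> r" and qr: "q = 1 \<longrightarrow> r = 1" "q = \<infinity> \<longrightarrow> r = \<infinity>" and \<epsilon>: "\<epsilon> > 0"
    and \<epsilon>q: "1 < q \<Longrightarrow> q < \<infinity> \<Longrightarrow> \<epsilon> \<le> recip q \<and> recip q + \<epsilon> \<le> 1"
  obtains C where "C > 0"
    "\<And>(g :: real ^ 'n \<Rightarrow> 'c::euclidean_space) F K \<rho>. g \<in> borel_measurable lebesgue \<Longrightarrow> F \<in> borel_measurable borel \<Longrightarrow>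
        AE x in lebesgue. ennreal (norm (g x)) \<le> F x \<Longrightarrow> 0 \<le> K \<Longrightarrow> 0 < \<rho> \<Longrightarrow>
        (\<And>m. m \<in> {recip q - \<epsilon>, recip q, recip q + \<epsilon>} \<Longrightarrow> 0 \<le> m \<Longrightarrow> m \<le> 1 \<Longrightarrow>
           marc_bound m (K * \<rho> powr (m - recip q)) F) \<Longrightarrow>
        lorentz_norm q r g \<le> ennreal (C * K)"
proof -
  \<comment> \<open>For infinite r the bound at 1/q itself is the claim, and q = r = 1 is L^1,
    recovered from test sets by exhaustion with balls. Only the remaining case interpolates between
    neighbouring exponents.\<close>
  consider "r = \<infinity>" | "q = 1" "r = 1" | \<sigma> where "1 < q" "q < \<infinity>" "r = ennreal \<sigma>" "\<sigma> \<ge> 1"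
  proof -
    have 1: "1 < ennreal x" if "1 < x" for x using ennreal_lessI[of 1 x] that by simp
    show ?thesis
      using ennreal_ge_1_cases[OF q] ennreal_ge_1_cases[OF r] qr that 1
      by (metis ennreal_1 ennreal_less_top infinity_ennreal_def less_imp_le order_refl)
  qed
  then show ?thesis
  proof cases
    case 1
    show ?thesis
    proof (rule that[of 1])
      fix g :: "real ^ 'n \<Rightarrow> 'c" and F K and \<rho> :: real
      assume g: "g \<in> borel_measurable lebesgue" "F \<in> borel_measurable borel"
        "AE x in lebesgue. ennreal (norm (g x)) \<le> F x" "0 \<le> K" "0 < \<rho>"
        and m: "\<And>m. m \<in> {recip q - \<epsilon>, recip q, recip q + \<epsilon>} \<Longrightarrow> 0 \<le> m \<Longrightarrow> m \<le> 1 \<Longrightarrow>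
           marc_bound m (K * \<rho> powr (m - recip q)) F"
      have "marc_bound (recip q) K F" using m[of "recip q"] recip_le_1[OF q] g by simp
      then have "weak_bound (recip q) K (\<lambda>x. norm (g x))"
        by (rule weak_bound_of_marc_bound) (use g recip_le_1[OF q] in auto)
      then show "lorentz_norm q r g \<le> ennreal (1 * K)"
        using lorentz_infinity_of_weak_bound[OF g(1)] 1 by simp
    qed simp
  next
    case 2
    show ?thesis
    proof (rule that[of 1])
      fix g :: "real ^ 'n \<Rightarrow> 'c" and F K and \<rho> :: real
      assume g: "g \<in> borel_measurable lebesgue" "F \<in> borel_measurable borel"
        "AE x in lebesgue. ennreal (norm (g x)) \<le> F x" "0 \<le> K" "0 < \<rho>"
        and m: "\<And>m. m \<in> {recip q - \<epsilon>, recip q, recip q + \<epsilon>} \<Longrightarrow> 0 \<le> m \<Longrightarrow> m \<le> 1 \<Longrightarrow>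
           marc_bound m (K * \<rho> powr (m - recip q)) F"
      have mb: "marc_bound 1 K F" using m[of 1] 2 g by simp
      have "(\<integral>\<^sup>+x. ennreal (norm (g x)) \<partial>lebesgue) \<le> (\<integral>\<^sup>+x. F x \<partial>lebesgue)"
        using g by (intro nn_integral_mono_AE)
      also have "\<dots> = (\<integral>\<^sup>+x. F x \<partial>lborel)" by (simp add: nn_integral_completion)
      also have "\<dots> \<le> ennreal K"
      proof (rule nn_integral_le_if_balls)
        fix n :: nat
        have "(\<integral>\<^sup>+x\<in>ball 0 (real n). F x \<partial>lborel) \<le> ennreal (K * measure lborel (ball (0::real^'n) (real n)) powr 0)"
          using marc_boundD[OF mb, of "ball 0 (real n)"] by (simp add: nn_integral_lebesgue_borel_set)
        also have "\<dots> \<le> ennreal K" using g by (intro ennreal_leI) (auto simp: powr_def)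
        finally show "(\<integral>\<^sup>+x\<in>ball 0 (real n). F x \<partial>lborel) \<le> ennreal K" .
      qed (use g in simp)
      finally show "lorentz_norm q r g \<le> ennreal (1 * K)"
        using lorentz_norm_1_1[OF g(1)] 2 by simp
    qed simp
  next
    case (3 \<sigma>)
    define \<mu> where "\<mu> = recip q"
    have \<epsilon>\<mu>: "0 < \<mu>" "\<epsilon> \<le> \<mu>" "\<mu> + \<epsilon> \<le> 1" using \<epsilon>q 3 \<epsilon> by (auto simp: \<mu>_def)
    have es: "\<epsilon> * \<sigma> > 0" using \<epsilon> 3 by simp
    define C where "C = (2 / (\<epsilon> * \<sigma>)) powr (1 / \<sigma>)"
    have C: "C > 0" using \<epsilon> 3 by (simp add: C_def)
    show ?thesis
    proof (rule that[OF C])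
      fix g :: "real ^ 'n \<Rightarrow> 'c" and F K and \<rho> :: real
      assume g: "g \<in> borel_measurable lebesgue" "F \<in> borel_measurable borel"
        "AE x in lebesgue. ennreal (norm (g x)) \<le> F x" "0 \<le> K" "0 < \<rho>"
        and m: "\<And>m. m \<in> {recip q - \<epsilon>, recip q, recip q + \<epsilon>} \<Longrightarrow> 0 \<le> m \<Longrightarrow> m \<le> 1 \<Longrightarrow>
           marc_bound m (K * \<rho> powr (m - recip q)) F"
      \<comment> \<open>For m = \<mu> - \<epsilon> and m = \<mu> + \<epsilon> the integrand of the
        Lorentz norm is bounded by powers of t/\<rho> with exponents -(1 - \<epsilon>\<sigma>) and
        -(1 + \<epsilon>\<sigma>). Each side of the crossover t = \<rho> contributes
        1/(\<epsilon>\<sigma>), which explains \<open>C\<close>.\<close>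
      have R: "ennreal_powr (ennreal (t powr \<mu>) * rearrangement g t) \<sigma> * ennreal (1 / t)
          \<le> ennreal (K powr \<sigma> / \<rho> * (t / \<rho>) powr (- (1 + (m - \<mu>) * \<sigma>)))"
        if t: "t > 0" and mm: "m \<in> {\<mu> - \<epsilon>, \<mu> + \<epsilon>}" for t m
      proof -
        have m01: "0 \<le> m" "m \<le> 1" using mm \<epsilon>\<mu> \<epsilon> by auto
        have "marc_bound m (K * \<rho> powr (m - \<mu>)) F" using m[of m] mm m01 by (auto simp: \<mu>_def)
        then have "weak_bound m (K * \<rho> powr (m - \<mu>)) (\<lambda>x. norm (g x))"
          by (rule weak_bound_of_marc_bound) (use g m01 in auto)
        from rearrangement_of_weak_bound[OF g(1) this m01(1) t]
        have "ennreal (t powr m) * rearrangement g t \<le> ennreal (K * \<rho> powr (m - \<mu>))" .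
        then have "ennreal (t powr (\<mu> - m)) * (ennreal (t powr m) * rearrangement g t)
            \<le> ennreal (t powr (\<mu> - m)) * ennreal (K * \<rho> powr (m - \<mu>))" by (intro mult_left_mono) auto
        also have "ennreal (t powr (\<mu> - m)) * (ennreal (t powr m) * rearrangement g t)
            = ennreal (t powr \<mu>) * rearrangement g t"
          using t by (simp add: mult.assoc[symmetric] ennreal_mult'[symmetric] powr_add[symmetric])
        also have "ennreal (t powr (\<mu> - m)) * ennreal (K * \<rho> powr (m - \<mu>)) = ennreal (K * (t / \<rho>) powr (-(m - \<mu>)))"
          using t g by (simp add: ennreal_mult'[symmetric] powr_divide powr_minus powr_diff field_simps)
        finally have "ennreal_powr (ennreal (t powr \<mu>) * rearrangement g t) \<sigma>
            \<le> ennreal_powr (ennreal (K * (t / \<rho>) powr (-(m - \<mu>)))) \<sigma>"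
          using 3 by (intro ennreal_powr_mono) auto
        also have "\<dots> = ennreal (K powr \<sigma> * (t / \<rho>) powr (- ((m - \<mu>) * \<sigma>)))"
          using g t by (simp add: ennreal_powr_ennreal powr_mult powr_powr algebra_simps)
        finally have "ennreal_powr (ennreal (t powr \<mu>) * rearrangement g t) \<sigma> * ennreal (1 / t)
            \<le> ennreal (K powr \<sigma> * (t / \<rho>) powr (- ((m - \<mu>) * \<sigma>))) * ennreal (1 / t)"
          by (intro mult_right_mono) auto
        also have "\<dots> = ennreal (K powr \<sigma> * (t / \<rho>) powr (- ((m - \<mu>) * \<sigma>)) * (1 / t))"
          using t by (intro ennreal_mult'[symmetric]) auto
        also have "K powr \<sigma> * (t / \<rho>) powr (- ((m - \<mu>) * \<sigma>)) * (1 / t)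
            = K powr \<sigma> / \<rho> * ((t / \<rho>) powr (- ((m - \<mu>) * \<sigma>)) * (t / \<rho>) powr (-1))"
          using t g by (simp add: powr_minus field_simps)
        also have "(t / \<rho>) powr (- ((m - \<mu>) * \<sigma>)) * (t / \<rho>) powr (-1) = (t / \<rho>) powr (- (1 + (m - \<mu>) * \<sigma>))"
          by (simp only: powr_add[symmetric]) (simp add: algebra_simps)
        finally show ?thesis .
      qed
      define D where "D t = ennreal_powr (ennreal (t powr \<mu>) * rearrangement g t) \<sigma> * ennreal (1 / t)" for t
      have "(\<integral>\<^sup>+t\<in>{0<..}. D t \<partial>lborel) \<le> (\<integral>\<^sup>+t\<in>{0..}. D t \<partial>lborel)"
        by (intro nn_integral_mono) (auto simp: indicator_def)
      also have "\<dots> \<le> ennreal (K powr \<sigma> / \<rho> * \<rho> * (1 / (1 - (1 - \<epsilon> * \<sigma>)) + 1 / (1 + \<epsilon> * \<sigma> - 1)))"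
      proof (rule nn_integral_two_powers_le)
        fix t :: real assume t: "t > 0"
        show "D t \<le> ennreal (K powr \<sigma> / \<rho> * (t / \<rho>) powr - (1 - \<epsilon> * \<sigma>))"
          using R[OF t, of "\<mu> - \<epsilon>"] by (simp add: D_def)
        show "D t \<le> ennreal (K powr \<sigma> / \<rho> * (t / \<rho>) powr - (1 + \<epsilon> * \<sigma>))"
          using R[OF t, of "\<mu> + \<epsilon>"] by (simp add: D_def)
      qed (use es g in auto)
      also have "K powr \<sigma> / \<rho> * \<rho> * (1 / (1 - (1 - \<epsilon> * \<sigma>)) + 1 / (1 + \<epsilon> * \<sigma> - 1)) = 2 / (\<epsilon> * \<sigma>) * K powr \<sigma>"
        using g by simp
      finally have I: "(\<integral>\<^sup>+t\<in>{0<..}. D t \<partial>lborel) \<le> ennreal (2 / (\<epsilon> * \<sigma>) * K powr \<sigma>)" .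
      have "lorentz_norm q r g = ennreal_powr (\<integral>\<^sup>+t\<in>{0<..}. D t \<partial>lborel) (1 / \<sigma>)"
        using 3 by (simp add: lorentz_norm_def D_def \<mu>_def recip_ennreal)
      also have "\<dots> \<le> ennreal_powr (ennreal (2 / (\<epsilon> * \<sigma>) * K powr \<sigma>)) (1 / \<sigma>)"
        using I 3 by (intro ennreal_powr_mono) auto
      also have "\<dots> = ennreal ((2 / (\<epsilon> * \<sigma>) * K powr \<sigma>) powr (1 / \<sigma>))"
        using es by (intro ennreal_powr_ennreal) auto
      also have "(2 / (\<epsilon> * \<sigma>) * K powr \<sigma>) powr (1 / \<sigma>) = C * K"
        using es 3 g by (simp only: powr_mult C_def powr_powr) simp
      finally show "lorentz_norm q r g \<le> ennreal (C * K)" .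
    qed
  qed
qed

section \<open>Quasi-triangle inequality for Lorentz norms\<close>

lemma rearrangement_add_le:
  fixes f g :: "real ^ 'n \<Rightarrow> 'c::euclidean_space"
  assumes f[measurable]: "f \<in> borel_measurable lebesgue" and g[measurable]: "g \<in> borel_measurable lebesgue" and t: "t \<ge> 0"
  shows "rearrangement (\<lambda>x. f x + g x) t \<le> rearrangement f (t / 2) + rearrangement g (t / 2)"
proof (rule ccontr)
  assume "\<not> ?thesis"
  then have lt: "rearrangement f (t / 2) + rearrangement g (t / 2) < rearrangement (\<lambda>x. f x + g x) t"
    by (simp add: not_le)
  then have "rearrangement f (t / 2) + rearrangement g (t / 2) \<noteq> top" by (auto simp: less_top[symmetric])
  then obtain a b where a: "rearrangement f (t / 2) = ennreal a" "a \<ge> 0" and b: "rearrangement g (t / 2) = ennreal b" "b \<ge> 0"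
    by (metis ennreal_add_eq_top ennreal_cases)
  have fg[measurable]: "(\<lambda>x. f x + g x) \<in> borel_measurable lebesgue" by measurable
  have "ennreal (a + b) < rearrangement (\<lambda>x. f x + g x) t" using lt a b by (simp add: ennreal_plus)
  then have "ennreal t < emeasure lebesgue {x. a + b < norm (f x + g x)}"
    using less_rearrangement_iff[OF fg, of "a + b" t] a b by linarith
  also have "\<dots> \<le> emeasure lebesgue ({x. a < norm (f x)} \<union> {x. b < norm (g x)})"
  proof (rule emeasure_mono)
    show "{x. a + b < norm (f x + g x)} \<subseteq> {x. a < norm (f x)} \<union> {x. b < norm (g x)}"
      using norm_triangle_ineq by (smt (verit) Collect_mono_iff Un_def mem_Collect_eq)
  qed (use superlevel_lebesgue f g in auto)
  also have "\<dots> \<le> emeasure lebesgue {x. a < norm (f x)} + emeasure lebesgue {x. b < norm (g x)}"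
    by (intro emeasure_subadditive superlevel_lebesgue f g)
  also have "\<dots> \<le> ennreal (t / 2) + ennreal (t / 2)"
    using less_rearrangement_iff[OF f, of a "t / 2"] less_rearrangement_iff[OF g, of b "t / 2"] a b
    by (intro add_mono) (simp_all add: not_less[symmetric])
  also have "\<dots> = ennreal t" using t by (subst ennreal_plus[symmetric]) auto
  finally show False by simp
qed

lemma lorentz_norm_add_le:
  fixes q r :: ennreal
  assumes r: "1 \<le> r"
  obtains C where "C > 0"
    "\<And>f g :: real ^ 'n \<Rightarrow> 'c::euclidean_space. f \<in> borel_measurable lebesgue \<Longrightarrow> g \<in> borel_measurable lebesgue \<Longrightarrow>
       lorentz_norm q r (\<lambda>x. f x + g x) \<le> ennreal C * (lorentz_norm q r f + lorentz_norm q r g)"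
proof -
  define \<mu> where "\<mu> = recip q"
  have base: "ennreal (t powr \<mu>) * rearrangement (\<lambda>x. f x + g x) t
      \<le> ennreal (2 powr \<mu>) * (ennreal ((t / 2) powr \<mu>) * rearrangement f (t / 2) + ennreal ((t / 2) powr \<mu>) * rearrangement g (t / 2))"
    if "f \<in> borel_measurable lebesgue" "g \<in> borel_measurable lebesgue" "t > 0" for t and f g :: "real ^ 'n \<Rightarrow> 'c"
  proof -
    have "t powr \<mu> = 2 powr \<mu> * (t / 2) powr \<mu>" using that by (simp add: powr_divide)
    then have "ennreal (t powr \<mu>) * rearrangement (\<lambda>x. f x + g x) t
        \<le> ennreal (2 powr \<mu> * (t / 2) powr \<mu>) * (rearrangement f (t / 2) + rearrangement g (t / 2))"
      using rearrangement_add_le[OF that(1,2), of t] that(3) by (metis less_imp_le mult_left_mono zero_le)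
    then show ?thesis by (simp add: ennreal_mult' distrib_left mult.assoc)
  qed
  show ?thesis
  proof (cases r)
    case top
    show ?thesis
    proof (rule that[of "2 powr \<mu>"])
      fix f g :: "real ^ 'n \<Rightarrow> 'c" assume fg: "f \<in> borel_measurable lebesgue" "g \<in> borel_measurable lebesgue"
      have up: "ennreal ((t / 2) powr \<mu>) * rearrangement h (t / 2) \<le> lorentz_norm q r h" if "t > 0" for t and h :: "real ^ 'n \<Rightarrow> 'c"
        using that top by (auto simp: lorentz_norm_def \<mu>_def intro!: SUP_upper2[of "t / 2"])
      have "ennreal (t powr \<mu>) * rearrangement (\<lambda>x. f x + g x) t \<le> ennreal (2 powr \<mu>) * (lorentz_norm q r f + lorentz_norm q r g)"
        if "t > 0" for t
        by (rule order_trans[OF base[OF fg that]]) (intro mult_left_mono add_mono up that, auto)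
      then show "lorentz_norm q r (\<lambda>x. f x + g x) \<le> ennreal (2 powr \<mu>) * (lorentz_norm q r f + lorentz_norm q r g)"
        using top by (subst lorentz_norm_def) (auto simp: \<mu>_def intro!: SUP_least)
    qed simp
  next
    case (real \<sigma>)
    then have \<sigma>: "\<sigma> \<ge> 1" using r by (metis ennreal_1 ennreal_le_iff)
    define X where "X = (\<lambda>(h :: real ^ 'n \<Rightarrow> 'c) t. ennreal_powr (ennreal (t powr \<mu>) * rearrangement h t) \<sigma>)"
    define I where "I h = (\<integral>\<^sup>+t\<in>{0<..}. X h t * ennreal (1 / t) \<partial>lborel)" for h
    have ln: "lorentz_norm q r h = ennreal_powr (I h) (1 / \<sigma>)" for h
      using real \<sigma> by (simp add: lorentz_norm_def I_def X_def \<mu>_def recip_ennreal)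
    have Xm[measurable]: "X h \<in> borel_measurable borel" if "h \<in> borel_measurable lebesgue" for h
      using rearrangement_measurable[OF that] unfolding X_def by measurable
    define c where "c = (2 powr \<mu>) powr \<sigma> * 2 powr \<sigma>"
    have c: "c > 0" by (simp add: c_def)
    define C where "C = c powr (1 / \<sigma>) * 2 powr (1 / \<sigma>)"
    have C: "C > 0" using c by (simp add: C_def)
    show ?thesis
    proof (rule that[OF C])
      fix f g :: "real ^ 'n \<Rightarrow> 'c" assume fg: "f \<in> borel_measurable lebesgue" "g \<in> borel_measurable lebesgue"
      note [measurable] = Xm[OF fg(1)] Xm[OF fg(2)]
      \<comment> \<open>The rearrangement of a sum is bounded at t by values at t/2; the measure
        dt/t is invariant under this dilation.\<close>
      have half: "(\<integral>\<^sup>+t\<in>{0<..}. X h (t / 2) * ennreal (1 / t) \<partial>lborel) = I h" if h: "h \<in> borel_measurable lebesgue" for h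
      proof -
        note [measurable] = Xm[OF h]
        have "(\<integral>\<^sup>+t\<in>{0<..}. X h (t / 2) * ennreal (1 / t) \<partial>lborel)
            = ennreal 2 * (\<integral>\<^sup>+t. X h ((0 + 2 * t) / 2) * ennreal (1 / (0 + 2 * t)) * indicator {0<..} (0 + 2 * t) \<partial>lborel)"
          by (subst nn_integral_real_affine[where c=2 and t=0]) auto
        also have "\<dots> = (\<integral>\<^sup>+t. ennreal 2 * (X h ((0 + 2 * t) / 2) * ennreal (1 / (0 + 2 * t)) * indicator {0<..} (0 + 2 * t)) \<partial>lborel)"
          by (rule nn_integral_cmult[symmetric]) measurable
        also have "\<dots> = I h"
          unfolding I_def
        proof (rule nn_integral_cong)
          fix t :: real
          have "ennreal 2 * ennreal (1 / (2 * t)) = ennreal (1 / t)" if "t > 0"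
            using that by (subst ennreal_mult'[symmetric]) auto
          then show "ennreal 2 * (X h ((0 + 2 * t) / 2) * ennreal (1 / (0 + 2 * t)) * indicator {0<..} (0 + 2 * t))
              = X h t * ennreal (1 / t) * indicator {0<..} t"
            by (cases "t > 0") (simp_all add: mult.left_commute[of "ennreal 2"] del: ennreal_numeral)
        qed
        finally show ?thesis .
      qed
      have "I (\<lambda>x. f x + g x) \<le> (\<integral>\<^sup>+t. ennreal c * ((X f (t / 2) * ennreal (1 / t) * indicator {0<..} t) + (X g (t / 2) * ennreal (1 / t) * indicator {0<..} t)) \<partial>lborel)"
        unfolding I_def
      proof (rule nn_integral_mono)
        fix t :: real
        show "X (\<lambda>x. f x + g x) t * ennreal (1 / t) * indicator {0<..} t
          \<le> ennreal c * ((X f (t / 2) * ennreal (1 / t) * indicator {0<..} t) + (X g (t / 2) * ennreal (1 / t) * indicator {0<..} t))"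
        proof (cases "t > 0")
          case True
          have "X (\<lambda>x. f x + g x) t \<le> ennreal_powr (ennreal (2 powr \<mu>) * (ennreal ((t / 2) powr \<mu>) * rearrangement f (t / 2) + ennreal ((t / 2) powr \<mu>) * rearrangement g (t / 2))) \<sigma>"
            unfolding X_def using base[OF fg True] \<sigma> by (intro ennreal_powr_mono) auto
          also have "\<dots> = ennreal ((2 powr \<mu>) powr \<sigma>) * ennreal_powr (ennreal ((t / 2) powr \<mu>) * rearrangement f (t / 2) + ennreal ((t / 2) powr \<mu>) * rearrangement g (t / 2)) \<sigma>"
            by (rule ennreal_powr_cmult) simp
          also have "\<dots> \<le> ennreal ((2 powr \<mu>) powr \<sigma>) * (ennreal (2 powr \<sigma>) * (X f (t / 2) + X g (t / 2)))"
            unfolding X_def using \<sigma> by (intro mult_left_mono ennreal_powr_add_le) auto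
          also have "\<dots> = ennreal c * (X f (t / 2) + X g (t / 2))"
            by (simp add: c_def ennreal_mult' mult.assoc)
          finally have "X (\<lambda>x. f x + g x) t * ennreal (1 / t) \<le> ennreal c * (X f (t / 2) + X g (t / 2)) * ennreal (1 / t)"
            by (intro mult_right_mono) auto
          then show ?thesis using True by (simp add: algebra_simps)
        qed simp
      qed
      also have "\<dots> = ennreal c * (\<integral>\<^sup>+t. (X f (t / 2) * ennreal (1 / t) * indicator {0<..} t) + (X g (t / 2) * ennreal (1 / t) * indicator {0<..} t) \<partial>lborel)"
        by (rule nn_integral_cmult) measurable
      also have "\<dots> = ennreal c * (I f + I g)"
        using half fg by (subst nn_integral_add) auto
      finally have le: "I (\<lambda>x. f x + g x) \<le> ennreal c * (I f + I g)" .
      have "lorentz_norm q r (\<lambda>x. f x + g x) \<le> ennreal_powr (ennreal c * (I f + I g)) (1 / \<sigma>)"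
        unfolding ln using le \<sigma> by (intro ennreal_powr_mono) auto
      also have "\<dots> = ennreal (c powr (1 / \<sigma>)) * ennreal_powr (I f + I g) (1 / \<sigma>)"
        using c by (rule ennreal_powr_cmult)
      also have "\<dots> \<le> ennreal (c powr (1 / \<sigma>)) * (ennreal (2 powr (1 / \<sigma>)) * (lorentz_norm q r f + lorentz_norm q r g))"
        unfolding ln using \<sigma> by (intro mult_left_mono ennreal_powr_add_le) auto
      also have "\<dots> = ennreal C * (lorentz_norm q r f + lorentz_norm q r g)"
        by (simp add: C_def ennreal_mult' mult.assoc)
      finally show "lorentz_norm q r (\<lambda>x. f x + g x) \<le> ennreal C * (lorentz_norm q r f + lorentz_norm q r g)" .
    qed
  qed
qed

section \<open>Power weights\<close>

definition bracket :: "'a::real_normed_vector \<Rightarrow> real" where "bracket x = 1 + norm x"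

lemma bracket_ge_1: "1 \<le> bracket x" and bracket_pos: "0 < bracket x" and bracket_ge_norm: "norm x \<le> bracket x"
  by (simp_all add: bracket_def add_pos_nonneg)

lemma bracket_measurable [measurable]: "(bracket :: 'a::euclidean_space \<Rightarrow> real) \<in> borel_measurable borel"
  unfolding bracket_def[abs_def] by measurable

lemma bracket_minus_commute: "bracket (x - y) = bracket (y - x)"
  by (simp add: bracket_def norm_minus_commute)

lemma bracket_peetre: "bracket x \<le> bracket y * bracket (x - y)"
proof -
  have "norm x \<le> norm y + norm (x - y)" by (metis add_diff_cancel_left' diff_add_cancel norm_triangle_ineq add.commute)
  moreover have "0 \<le> norm y * norm (x - y)" by simp
  ultimately have "1 + norm x \<le> 1 + norm y + norm (x - y) + norm y * norm (x - y)" by linarith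
  then show ?thesis by (simp add: bracket_def algebra_simps)
qed

text \<open>Behaves like \<open>|x| powr (-c)\<close> near the origin and like \<open>|x| powr (-a)\<close> at infinity. At time 1 the weighted heat kernel
is dominated by such weights, after Peetre's inequality has moved the growing part of each weight to the other variable.\<close>

definition two_power :: "real \<Rightarrow> real \<Rightarrow> 'a::real_normed_vector \<Rightarrow> real" where
  "two_power c a x = norm x powr (-c) * bracket x powr (c - a)"

lemma two_power_nonneg [simp]: "0 \<le> two_power c a x"
  by (simp add: two_power_def)

lemma two_power_measurable [measurable]: "(two_power c a :: 'a::euclidean_space \<Rightarrow> real) \<in> borel_measurable borel"
  unfolding two_power_def[abs_def] by measurable

lemma two_power_mult_bracket: "two_power c a x * bracket x powr (-b) = two_power c (a + b) x"
  using bracket_pos[of x] by (simp add: two_power_def mult.assoc powr_add[symmetric] diff_diff_eq)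

lemma two_power_le:
  assumes "c \<ge> 0" "a \<ge> 0"
  shows "two_power c a x \<le> 2 powr (c + a) * (norm x powr (-c) * indicator (ball 0 1) x + bracket x powr (-a))"
proof (cases "norm x < 1")
  case True
  have "bracket x powr (c - a) \<le> 2 powr (c + a)"
  proof -
    have "bracket x powr (c - a) \<le> bracket x powr (c + a)" using assms bracket_ge_1 by (intro powr_mono) auto
    also have "\<dots> \<le> 2 powr (c + a)" using assms True bracket_pos[of x] by (intro powr_mono2) (auto simp: bracket_def)
    finally show ?thesis .
  qed
  then have "two_power c a x \<le> 2 powr (c + a) * (norm x powr (-c))"
    unfolding two_power_def by (subst mult.commute) (intro mult_right_mono, auto)
  also have "\<dots> \<le> 2 powr (c + a) * (norm x powr (-c) * indicator (ball 0 1) x + bracket x powr (-a))"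
    using True by (intro mult_left_mono) auto
  finally show ?thesis .
next
  case False
  have "norm x powr (-c) \<le> (bracket x / 2) powr (-c)"
    using False assms bracket_pos[of x] by (intro powr_mono2') (auto simp: bracket_def)
  also have "\<dots> = 2 powr c * bracket x powr (-c)" using bracket_pos[of x] by (simp add: powr_divide powr_minus field_simps)
  finally have "two_power c a x \<le> 2 powr c * bracket x powr (-c) * bracket x powr (c - a)"
    unfolding two_power_def by (intro mult_right_mono) auto
  also have "\<dots> = 2 powr c * bracket x powr (-a)" using bracket_pos[of x] by (simp add: mult.assoc powr_add[symmetric])
  also have "\<dots> \<le> 2 powr (c + a) * (norm x powr (-c) * indicator (ball 0 1) x + bracket x powr (-a))"
    using assms False by (intro mult_mono) auto
  finally show ?thesis .
qed

text \<open>The superlevel sets are balls around the origin, of radius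
  \<open>s powr (- (1 / c))\<close>. For c = 0 this radius makes no sense and the function is
  bounded by 1, so the case is separate.\<close>

lemma weak_bound_power:
  assumes c: "c \<ge> 0"
  obtains C where "weak_bound (c / DIM('a)) C (\<lambda>x::'a::euclidean_space. norm x powr (-c))"
proof (cases "c = 0")
  case True
  have "weak_bound (c / DIM('a)) 1 (\<lambda>x::'a::euclidean_space. norm x powr (-c))"
    unfolding weak_bound_def
  proof (intro allI ballI impI)
    fix s :: real and E :: "'a set"
    assume "s > 0" and E: "E \<in> lmeasurable" and gt: "\<forall>x\<in>E. s < norm x powr (-c)"
    show "s * measure lebesgue E powr (c / DIM('a)) \<le> 1"
    proof (cases "measure lebesgue E = 0")
      case False
      then obtain x where "x \<in> E" by fastforce
      then have "s \<le> 1" using gt True by (fastforce simp: powr_def split: if_splits)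
      then show ?thesis using True False by simp
    qed simp
  qed
  then show ?thesis by (rule that)
next
  case False
  then have c: "c > 0" using assms by simp
  define d where "d = real DIM('a)"
  have d: "d > 0" by (simp add: d_def)
  define V where "V = measure lborel (ball (0::'a) 1)"
  have "weak_bound (c / d) (V powr (c / d)) (\<lambda>x::'a. norm x powr (-c))"
    unfolding weak_bound_def
  proof (intro allI ballI impI)
    fix s :: real and E :: "'a set"
    assume s: "s > 0" and E: "E \<in> lmeasurable" and gt: "\<forall>x\<in>E. s < norm x powr (-c)"
    define r where "r = s powr (- (1 / c))"
    have r: "r > 0" using s by (simp add: r_def)
    have "E \<subseteq> ball 0 r"
    proof
      fix x assume "x \<in> E"
      then have lt: "s < norm x powr (-c)" using gt by auto
      then have xp: "norm x > 0" using s by (cases "norm x = 0") auto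
      have "(norm x powr (-c)) powr (- (1 / c)) < s powr (- (1 / c))"
        using lt s c by (intro powr_less_mono2_neg) auto
      then show "x \<in> ball 0 r" using xp c by (simp add: powr_powr r_def)
    qed
    then have "measure lebesgue E \<le> measure lebesgue (ball (0::'a) r)"
      using E by (intro measure_mono_fmeasurable) (auto simp: fmeasurableD)
    also have "\<dots> = V * r ^ DIM('a)"
      using r by (simp add: V_def content_ball)
    also have "r ^ DIM('a) = r powr d" using r by (simp add: d_def powr_realpow)
    finally have "measure lebesgue E powr (c / d) \<le> (V * r powr d) powr (c / d)"
      using c d by (intro powr_mono2) auto
    also have "\<dots> = V powr (c / d) * s powr (-1)"
      using r s c d by (simp only: powr_mult powr_powr r_def) simp
    finally have "s * measure lebesgue E powr (c / d) \<le> s * (V powr (c / d) * s powr (-1))"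
      using s by (intro mult_left_mono) auto
    then show "s * measure lebesgue E powr (c / d) \<le> V powr (c / d)"
      using s by (simp add: powr_minus mult.left_commute[of s])
  qed
  then show ?thesis using that by (simp add: d_def)
qed

lemma power_integral_le:
  fixes c :: real
  assumes c: "0 \<le> c" "c < DIM('a::euclidean_space)"
  obtains C where "C > 0" "\<And>E :: 'a set. E \<in> sets borel \<Longrightarrow> emeasure lborel E < \<infinity> \<Longrightarrow>
     (\<integral>\<^sup>+x\<in>E. ennreal (norm x powr (-c)) \<partial>lborel) \<le> ennreal (C * measure lborel E powr (1 - c / DIM('a)))"
proof -
  obtain A where A: "weak_bound (c / DIM('a)) A (\<lambda>x::'a. norm x powr (-c))"
    by (rule weak_bound_power[OF c(1)])
  have c1: "0 \<le> c / DIM('a)" "c / DIM('a) < 1" using c by auto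
  obtain C where C: "C > 0" "\<And>A (g :: 'a \<Rightarrow> real). g \<in> borel_measurable lebesgue \<Longrightarrow> weak_bound (c / DIM('a)) A g \<Longrightarrow>
        marc_bound (c / DIM('a)) (C * A) (\<lambda>x. ennreal (g x))"
    by (rule marc_bound_of_weak_bound[OF c1, where ?'a='a]) (rule that)
  have m: "marc_bound (c / DIM('a)) (C * A) (\<lambda>x::'a. ennreal (norm x powr (-c)))"
    by (rule C(2)[OF _ A]) (rule measurable_completion, measurable)
  have A0: "A \<ge> 0" using weak_bound_nonneg[OF A] .
  show ?thesis
  proof (rule that[of "C * A + 1"])
    fix E :: "'a set" assume E: "E \<in> sets borel" "emeasure lborel E < \<infinity>"
    have "(\<integral>\<^sup>+x\<in>E. ennreal (norm x powr (-c)) \<partial>lborel) \<le> ennreal (C * A * measure lborel E powr (1 - c / DIM('a)))"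
      using marc_boundD[OF m lmeasurable_borel[OF E]] E by (simp add: nn_integral_lebesgue_borel_set)
    also have "\<dots> \<le> ennreal ((C * A + 1) * measure lborel E powr (1 - c / DIM('a)))"
      by (intro ennreal_leI mult_right_mono) auto
    finally show "(\<integral>\<^sup>+x\<in>E. ennreal (norm x powr (-c)) \<partial>lborel) \<le> ennreal ((C * A + 1) * measure lborel E powr (1 - c / DIM('a)))" .
  qed (use C A0 in \<open>simp add: add_nonneg_pos\<close>)
qed

lemma bracket_integrable:
  fixes a :: real
  assumes a: "a > DIM('a::euclidean_space)"
  obtains C where "C > 0" "(\<integral>\<^sup>+x. ennreal (bracket (x::'a) powr (-a)) \<partial>lborel) \<le> ennreal C"
proof -
  define d where "d = real DIM('a)"
  have d: "d > 0" "a > d" using a by (auto simp: d_def)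
  define V where "V = measure lborel (ball (0::'a) 1)"
  have V: "V > 0" by (simp add: V_def content_ball_pos)
  have D: "emeasure lborel {x::'a. ennreal s < ennreal (bracket x powr (-a))} \<le> ennreal (V * s powr (- (d / a)))"
    and D0: "s \<ge> 1 \<Longrightarrow> {x::'a. ennreal s < ennreal (bracket x powr (-a))} = {}"
    if s: "s > 0" for s :: real
  proof -
    define r where "r = s powr (- (1 / a))"
    have r: "r > 0" using s by (simp add: r_def)
    have "{x::'a. ennreal s < ennreal (bracket x powr (-a))} \<subseteq> ball 0 r"
    proof
      fix x :: 'a assume "x \<in> {x. ennreal s < ennreal (bracket x powr (-a))}"
      then have lt: "s < bracket x powr (-a)" using s by (simp add: ennreal_less_iff)
      have "(bracket x powr (-a)) powr (- (1 / a)) < s powr (- (1 / a))"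
        using lt s d by (intro powr_less_mono2_neg) auto
      then have "bracket x < r" using bracket_pos[of x] d by (simp add: powr_powr r_def)
      then show "x \<in> ball 0 r" using bracket_ge_norm[of x] by simp
    qed
    then have "emeasure lborel {x::'a. ennreal s < ennreal (bracket x powr (-a))} \<le> emeasure lborel (ball (0::'a) r)"
      by (intro emeasure_mono) auto
    also have "\<dots> = ennreal (measure lborel (ball (0::'a) r))"
      using emeasure_lborel_ball_finite[of "0::'a" r] by (simp add: emeasure_eq_ennreal_measure)
    also have "measure lborel (ball (0::'a) r) = V * r ^ DIM('a)"
      using r by (simp add: V_def content_ball)
    also have "r ^ DIM('a) = r powr d" using r by (simp add: d_def powr_realpow)
    also have "r powr d = s powr (- (d / a))" by (simp add: r_def powr_powr)
    finally show "emeasure lborel {x::'a. ennreal s < ennreal (bracket x powr (-a))} \<le> ennreal (V * s powr (- (d / a)))" .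
    show "{x::'a. ennreal s < ennreal (bracket x powr (-a))} = {}" if "s \<ge> 1"
    proof -
      have "bracket x powr (-a) \<le> 1" for x :: 'a
        using bracket_ge_1[of x] d powr_mono2'[of "-a" 1 "bracket x"] by simp
      then have "\<not> s < bracket x powr (-a)" for x :: 'a using that by (meson not_less order_trans)
      then show ?thesis using s by (auto simp: ennreal_less_iff)
    qed
  qed
  have "(\<integral>\<^sup>+x. ennreal (bracket (x::'a) powr (-a)) * 1 \<partial>lborel)
      = (\<integral>\<^sup>+s\<in>{0..}. (\<integral>\<^sup>+x. 1 * indicator {x::'a. ennreal s < ennreal (bracket x powr (-a))} x \<partial>lborel) \<partial>lborel)"
    by (rule layer_cake[OF sigma_finite_lborel]) auto
  \<comment> \<open>The superlevel sets are empty from level 1 on, and below level 1 the power with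
    exponent d/a < 1 is smaller than any steeper one. The second exponent can thus be any number
    above 1; it is 2.\<close>
  also have "\<dots> \<le> ennreal (V * 1 * (1 / (1 - d / a) + 1 / (2 - 1)))"
  proof (rule nn_integral_two_powers_le)
    fix s :: real assume s: "s > 0"
    have eq: "(\<integral>\<^sup>+x. 1 * indicator {x::'a. ennreal s < ennreal (bracket x powr (-a))} x \<partial>lborel)
      = emeasure lborel {x::'a. ennreal s < ennreal (bracket x powr (-a))}" by simp
    show "(\<integral>\<^sup>+x. 1 * indicator {x::'a. ennreal s < ennreal (bracket x powr (-a))} x \<partial>lborel) \<le> ennreal (V * (s / 1) powr (- (d / a)))"
      using D[OF s] unfolding eq by simp
    show "(\<integral>\<^sup>+x. 1 * indicator {x::'a. ennreal s < ennreal (bracket x powr (-a))} x \<partial>lborel) \<le> ennreal (V * (s / 1) powr (- 2))"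
    proof (cases "s \<ge> 1")
      case True
      then show ?thesis unfolding eq D0[OF s True] by simp
    next
      case False
      have "s powr (- (d / a)) \<le> s powr (- 2)" using False s d by (intro powr_mono') (auto simp: field_simps)
      then have "V * s powr (- (d / a)) \<le> V * (s / 1) powr (- 2)" using V by (intro mult_left_mono) auto
      then show ?thesis using D[OF s] unfolding eq by (meson ennreal_leI order_trans)
    qed
  qed (use V d in auto)
  finally show ?thesis
    by (intro that[of "V * 1 * (1 / (1 - d / a) + 1 / (2 - 1))"]) (use V d in \<open>auto intro!: mult_pos_pos add_pos_pos\<close>)
qed

text \<open>The weight splits into its singularity inside the unit ball and its tail. The first
  estimate of the singular part vanishes with the measure of \<open>E\<close> and serves small sets;
  the second is bounded independently of \<open>E\<close> and serves large ones.\<close>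

lemma two_power_integral_le:
  fixes a c :: real
  assumes c: "0 \<le> c" "c < DIM('a::euclidean_space)" and a: "0 \<le> a"
  obtains C where "C > 0"
    "\<And>E :: 'a set. E \<in> sets borel \<Longrightarrow> emeasure lborel E < \<infinity> \<Longrightarrow>
     (\<integral>\<^sup>+x\<in>E. ennreal (two_power c a x) \<partial>lborel)
       \<le> ennreal (C * measure lborel E powr (1 - c / DIM('a))) + ennreal C * (\<integral>\<^sup>+x\<in>E. ennreal (bracket x powr (-a)) \<partial>lborel)"
    "\<And>E :: 'a set. E \<in> sets borel \<Longrightarrow> emeasure lborel E < \<infinity> \<Longrightarrow>
     (\<integral>\<^sup>+x\<in>E. ennreal (two_power c a x) \<partial>lborel)
       \<le> ennreal C + ennreal C * (\<integral>\<^sup>+x\<in>E. ennreal (bracket x powr (-a)) \<partial>lborel)"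
proof -
  obtain C where C: "C > 0" "\<And>E :: 'a set. E \<in> sets borel \<Longrightarrow> emeasure lborel E < \<infinity> \<Longrightarrow>
     (\<integral>\<^sup>+x\<in>E. ennreal (norm x powr (-c)) \<partial>lborel) \<le> ennreal (C * measure lborel E powr (1 - c / DIM('a)))"
    by (rule power_integral_le[OF c]) (rule that)
  define V where "V = measure lborel (ball (0::'a) 1) powr (1 - c / DIM('a))"
  have V: "V \<ge> 0" by (simp add: V_def)
  define K where "K = 2 powr (c + a)"
  have K: "K > 0" by (simp add: K_def)
  define C' where "C' = K * C * (V + 1) + K"
  have C': "C' > 0" "K * C \<le> C'" "K * C * V \<le> C'" "K \<le> C'"
  proof -
    have "0 \<le> K * C * V" "0 < K * C" using C(1) K V by auto
    then show "C' > 0" "K * C \<le> C'" "K * C * V \<le> C'" "K \<le> C'" using K by (auto simp: C'_def distrib_left)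
  qed
  have gen: "(\<integral>\<^sup>+x\<in>E. ennreal (two_power c a x) \<partial>lborel)
       \<le> ennreal K * (\<integral>\<^sup>+x\<in>E \<inter> ball 0 1. ennreal (norm x powr (-c)) \<partial>lborel) + ennreal K * (\<integral>\<^sup>+x\<in>E. ennreal (bracket x powr (-a)) \<partial>lborel)"
    if [measurable]: "E \<in> sets borel" for E :: "'a set"
  proof -
    have "(\<integral>\<^sup>+x\<in>E. ennreal (two_power c a x) \<partial>lborel)
       \<le> (\<integral>\<^sup>+x. ennreal K * (ennreal (norm x powr (-c)) * indicator (E \<inter> ball 0 1) x)
             + ennreal K * (ennreal (bracket x powr (-a)) * indicator E x) \<partial>lborel)"
    proof (rule nn_integral_mono)
      fix x :: 'a
      have "ennreal (two_power c a x) \<le> ennreal (K * (norm x powr (-c) * indicator (ball 0 1) x + bracket x powr (-a)))"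
        unfolding K_def using two_power_le[OF c(1) a] by (rule ennreal_leI)
      also have "\<dots> = ennreal K * (ennreal (norm x powr (-c)) * indicator (ball 0 1) x) + ennreal K * ennreal (bracket x powr (-a))"
        using K by (simp add: ennreal_mult' ennreal_plus distrib_left indicator_def)
      finally show "ennreal (two_power c a x) * indicator E x \<le> ennreal K * (ennreal (norm x powr (-c)) * indicator (E \<inter> ball 0 1) x)
             + ennreal K * (ennreal (bracket x powr (-a)) * indicator E x)"
        by (auto simp: indicator_def)
    qed
    also have "\<dots> = ennreal K * (\<integral>\<^sup>+x\<in>E \<inter> ball 0 1. ennreal (norm x powr (-c)) \<partial>lborel) + ennreal K * (\<integral>\<^sup>+x\<in>E. ennreal (bracket x powr (-a)) \<partial>lborel)"
    proof -
      have [measurable]: "E \<inter> ball 0 1 \<in> sets borel" by simp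
      show ?thesis by (subst nn_integral_add, measurable) (subst nn_integral_cmult, measurable)+
    qed
    finally show ?thesis .
  qed
  show ?thesis
  proof (rule that[OF C'(1)])
    fix E :: "'a set" assume E[measurable]: "E \<in> sets borel" and fin: "emeasure lborel E < \<infinity>"
    have "(\<integral>\<^sup>+x\<in>E \<inter> ball 0 1. ennreal (norm x powr (-c)) \<partial>lborel) \<le> (\<integral>\<^sup>+x\<in>E. ennreal (norm x powr (-c)) \<partial>lborel)"
      by (intro nn_integral_mono) (auto simp: indicator_def)
    also have "\<dots> \<le> ennreal (C * measure lborel E powr (1 - c / DIM('a)))" using C(2)[OF E fin] .
    finally have "ennreal K * (\<integral>\<^sup>+x\<in>E \<inter> ball 0 1. ennreal (norm x powr (-c)) \<partial>lborel)
        \<le> ennreal K * ennreal (C * measure lborel E powr (1 - c / DIM('a)))" by (intro mult_left_mono) auto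
    also have "\<dots> = ennreal (K * C * measure lborel E powr (1 - c / DIM('a)))"
      using K by (simp add: ennreal_mult'[symmetric] mult.assoc)
    also have "\<dots> \<le> ennreal (C' * measure lborel E powr (1 - c / DIM('a)))"
      using C' by (intro ennreal_leI mult_right_mono) auto
    finally show "(\<integral>\<^sup>+x\<in>E. ennreal (two_power c a x) \<partial>lborel)
       \<le> ennreal (C' * measure lborel E powr (1 - c / DIM('a))) + ennreal C' * (\<integral>\<^sup>+x\<in>E. ennreal (bracket x powr (-a)) \<partial>lborel)"
      using gen[OF E] C' by (elim order_trans) (intro add_mono mult_right_mono ennreal_leI, auto)
    have "(\<integral>\<^sup>+x\<in>E \<inter> ball 0 1. ennreal (norm x powr (-c)) \<partial>lborel) \<le> (\<integral>\<^sup>+x\<in>ball 0 1. ennreal (norm (x::'a) powr (-c)) \<partial>lborel)"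
      by (intro nn_integral_mono) (auto simp: indicator_def)
    also have "\<dots> \<le> ennreal (C * V)"
      unfolding V_def using C(2)[of "ball 0 1"] emeasure_lborel_ball_finite[of "0::'a" 1] by simp
    finally have "ennreal K * (\<integral>\<^sup>+x\<in>E \<inter> ball 0 1. ennreal (norm x powr (-c)) \<partial>lborel)
        \<le> ennreal K * ennreal (C * V)" by (intro mult_left_mono) auto
    also have "\<dots> = ennreal (K * C * V)"
      using K by (simp add: ennreal_mult'[symmetric] mult.assoc)
    also have "\<dots> \<le> ennreal C'"
      using C' by (intro ennreal_leI) auto
    finally show "(\<integral>\<^sup>+x\<in>E. ennreal (two_power c a x) \<partial>lborel)
       \<le> ennreal C' + ennreal C' * (\<integral>\<^sup>+x\<in>E. ennreal (bracket x powr (-a)) \<partial>lborel)"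
      using gen[OF E] C' by (elim order_trans) (intro add_mono mult_right_mono ennreal_leI, auto)
  qed
qed

text \<open>On sets of measure at most 1 the singularity at the origin decides: the tail contributes
  at most |E|, which is below |E|^{1 - c/d}.\<close>

lemma two_power_integral_small:
  fixes a c :: real
  assumes c: "0 \<le> c" "c < DIM('a::euclidean_space)" and a: "0 \<le> a"
  obtains C where "C > 0"
    "\<And>E :: 'a set. E \<in> sets borel \<Longrightarrow> emeasure lborel E \<le> 1 \<Longrightarrow>
     (\<integral>\<^sup>+x\<in>E. ennreal (two_power c a x) \<partial>lborel) \<le> ennreal (C * measure lborel E powr (1 - c / DIM('a)))"
proof -
  obtain C where C: "C > 0" 
    "\<And>E :: 'a set. E \<in> sets borel \<Longrightarrow> emeasure lborel E < \<infinity> \<Longrightarrow>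
     (\<integral>\<^sup>+x\<in>E. ennreal (two_power c a x) \<partial>lborel)
       \<le> ennreal (C * measure lborel E powr (1 - c / DIM('a))) + ennreal C * (\<integral>\<^sup>+x\<in>E. ennreal (bracket x powr (-a)) \<partial>lborel)"
    by (rule two_power_integral_le[OF c a]) (rule that)
  show ?thesis
  proof (rule that[of "2 * C"])
    fix E :: "'a set" assume E[measurable]: "E \<in> sets borel" and le1: "emeasure lborel E \<le> 1"
    then have fin: "emeasure lborel E < \<infinity>" by (rule_tac order_le_less_trans) auto
    let ?e = "measure lborel E"
    have em: "emeasure lborel E = ennreal ?e" using fin by (simp add: emeasure_eq_ennreal_measure)
    have e1: "?e \<le> 1" using le1 em by (simp add: ennreal_le_1)
    have "(\<integral>\<^sup>+x\<in>E. ennreal (bracket x powr (-a)) \<partial>lborel) \<le> (\<integral>\<^sup>+x\<in>E. 1 \<partial>lborel)"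
    proof (intro nn_integral_mono mult_right_mono)
      fix x :: 'a show "ennreal (bracket x powr (-a)) \<le> 1"
        using bracket_ge_1[of x] a powr_mono2'[of "-a" 1 "bracket x"] by (simp add: ennreal_le_1)
    qed simp
    also have "\<dots> = ennreal ?e" using em by simp
    also have "\<dots> \<le> ennreal (?e powr (1 - c / DIM('a)))"
    proof (intro ennreal_leI)
      have "?e powr 1 \<le> ?e powr (1 - c / DIM('a))" using e1 c by (intro powr_mono') auto
      then show "?e \<le> ?e powr (1 - c / DIM('a))" by simp
    qed
    finally have "ennreal C * (\<integral>\<^sup>+x\<in>E. ennreal (bracket x powr (-a)) \<partial>lborel) \<le> ennreal C * ennreal (?e powr (1 - c / DIM('a)))"
      by (intro mult_left_mono) auto
    then have "(\<integral>\<^sup>+x\<in>E. ennreal (two_power c a x) \<partial>lborel)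
        \<le> ennreal (C * ?e powr (1 - c / DIM('a))) + ennreal C * ennreal (?e powr (1 - c / DIM('a)))"
      using C(2)[OF E fin] by (meson add_left_mono order_trans)
    also have "\<dots> = ennreal (2 * C * ?e powr (1 - c / DIM('a)))"
      using C(1) by (simp add: ennreal_mult'[symmetric] ennreal_plus[symmetric] del: ennreal_plus)
    finally show "(\<integral>\<^sup>+x\<in>E. ennreal (two_power c a x) \<partial>lborel) \<le> ennreal (2 * C * ?e powr (1 - c / DIM('a)))" .
  qed (use C in simp)
qed

text \<open>On sets of measure at least 1 the decay at infinity decides. The exponent \<kappa> = 1
  is the bound of the bracket power by 1, \<kappa> = 0 is integrability over the whole space, and in
  between the tail is compared with a pure power that is singular at the origin.\<close>

lemma two_power_integral_large:
  fixes a c :: real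
  assumes c: "0 \<le> c" "c < DIM('a::euclidean_space)" and a: "0 \<le> a"
    and \<kappa>: "\<kappa> = 1 \<or> 0 \<le> \<kappa> \<and> \<kappa> < 1 \<and> \<kappa> > 1 - a / DIM('a)"
  obtains C where "C > 0"
    "\<And>E :: 'a set. E \<in> sets borel \<Longrightarrow> 1 \<le> emeasure lborel E \<Longrightarrow> emeasure lborel E < \<infinity> \<Longrightarrow>
     (\<integral>\<^sup>+x\<in>E. ennreal (two_power c a x) \<partial>lborel) \<le> ennreal (C * measure lborel E powr \<kappa>)"
proof -
  obtain C where C: "C > 0" 
    "\<And>E :: 'a set. E \<in> sets borel \<Longrightarrow> emeasure lborel E < \<infinity> \<Longrightarrow>
     (\<integral>\<^sup>+x\<in>E. ennreal (two_power c a x) \<partial>lborel) \<le> ennreal C + ennreal C * (\<integral>\<^sup>+x\<in>E. ennreal (bracket x powr (-a)) \<partial>lborel)"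
    by (rule two_power_integral_le[OF c a]) (rule that)
  have "\<exists>J>0. \<forall>E :: 'a set. E \<in> sets borel \<longrightarrow> 1 \<le> emeasure lborel E \<longrightarrow> emeasure lborel E < \<infinity> \<longrightarrow>
     (\<integral>\<^sup>+x\<in>E. ennreal (bracket x powr (-a)) \<partial>lborel) \<le> ennreal (J * measure lborel E powr \<kappa>)"
  proof -
    consider "\<kappa> = 1" | "\<kappa> = 0" "a > DIM('a)" | "0 < \<kappa>" "\<kappa> < 1" "\<kappa> > 1 - a / DIM('a)"
      using \<kappa> by (cases "\<kappa> = 0") (auto simp: field_simps)
    then show ?thesis
    proof cases
      case 1
      show ?thesis
      proof (intro exI[of _ 1] conjI allI impI)
        fix E :: "'a set" assume E[measurable]: "E \<in> sets borel" and fin: "emeasure lborel E < \<infinity>"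
        have "(\<integral>\<^sup>+x\<in>E. ennreal (bracket x powr (-a)) \<partial>lborel) \<le> (\<integral>\<^sup>+x\<in>E. 1 \<partial>lborel)"
        proof (intro nn_integral_mono mult_right_mono)
          fix x :: 'a show "ennreal (bracket x powr (-a)) \<le> 1"
            using bracket_ge_1[of x] a powr_mono2'[of "-a" 1 "bracket x"] by (simp add: ennreal_le_1)
        qed simp
        also have "\<dots> = ennreal (measure lborel E)" using fin by (simp add: emeasure_eq_ennreal_measure)
        finally show "(\<integral>\<^sup>+x\<in>E. ennreal (bracket x powr (-a)) \<partial>lborel) \<le> ennreal (1 * measure lborel E powr \<kappa>)"
          using 1 by simp
      qed simp
    next
      case 2
      obtain J where J: "J > 0" "(\<integral>\<^sup>+x. ennreal (bracket (x::'a) powr (-a)) \<partial>lborel) \<le> ennreal J"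
        by (rule bracket_integrable[OF 2(2)])
      show ?thesis
      proof (intro exI[of _ J] conjI allI impI)
        fix E :: "'a set" assume E[measurable]: "E \<in> sets borel" and e1: "1 \<le> emeasure lborel E" and fin: "emeasure lborel E < \<infinity>"
        have "(\<integral>\<^sup>+x\<in>E. ennreal (bracket x powr (-a)) \<partial>lborel) \<le> (\<integral>\<^sup>+x. ennreal (bracket (x::'a) powr (-a)) \<partial>lborel)"
          by (intro nn_integral_mono) (auto simp: indicator_def)
        also have "\<dots> \<le> ennreal J" by (rule J)
        also have "J = J * measure lborel E powr \<kappa>"
          using e1 2 fin by (auto simp: emeasure_eq_ennreal_measure)
        finally show "(\<integral>\<^sup>+x\<in>E. ennreal (bracket x powr (-a)) \<partial>lborel) \<le> ennreal (J * measure lborel E powr \<kappa>)" .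
      qed (rule J)
    next
      case 3
      \<comment> \<open>Chosen so that integrals of |x|^{-\<theta>} over sets scale like
        |E|^\<kappa>. The assumption \<kappa> > 1 - a/d gives \<theta> \<le> a, so the bracket power
        is dominated by |x|^{-\<theta>}.\<close>
      define \<theta> where "\<theta> = DIM('a) * (1 - \<kappa>)"
      have \<theta>: "0 \<le> \<theta>" "\<theta> < DIM('a)" "\<theta> \<le> a" "1 - \<theta> / DIM('a) = \<kappa>"
        using 3 by (auto simp: \<theta>_def field_simps)
      obtain J where J: "J > 0" "\<And>E :: 'a set. E \<in> sets borel \<Longrightarrow> emeasure lborel E < \<infinity> \<Longrightarrow>
         (\<integral>\<^sup>+x\<in>E. ennreal (norm x powr (-\<theta>)) \<partial>lborel) \<le> ennreal (J * measure lborel E powr (1 - \<theta> / DIM('a)))"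
        by (rule power_integral_le[OF \<theta>(1,2)]) (rule that)
      show ?thesis
      proof (intro exI[of _ J] conjI allI impI)
        fix E :: "'a set" assume E[measurable]: "E \<in> sets borel" and fin: "emeasure lborel E < \<infinity>"
        have "(\<integral>\<^sup>+x\<in>E. ennreal (bracket x powr (-a)) \<partial>lborel) \<le> (\<integral>\<^sup>+x\<in>E. ennreal (norm x powr (-\<theta>)) \<partial>lborel)"
        proof (rule nn_integral_mono_AE)
          have "AE x in lborel. x \<noteq> (0::'a)" by (rule AE_lborel_singleton)
          then show "AE x in lborel. ennreal (bracket x powr (-a)) * indicator E x \<le> ennreal (norm x powr (-\<theta>)) * indicator E x"
          proof eventually_elim
            case (elim x)
            have "bracket x powr (-a) \<le> bracket x powr (-\<theta>)" using \<theta> bracket_ge_1[of x] by (intro powr_mono) auto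
            also have "\<dots> \<le> norm x powr (-\<theta>)" using \<theta> elim bracket_ge_norm[of x] by (intro powr_mono2') auto
            finally show ?case by (intro mult_right_mono ennreal_leI) auto
          qed
        qed
        also have "\<dots> \<le> ennreal (J * measure lborel E powr \<kappa>)" using J(2)[OF E fin] \<theta> by simp
        finally show "(\<integral>\<^sup>+x\<in>E. ennreal (bracket x powr (-a)) \<partial>lborel) \<le> ennreal (J * measure lborel E powr \<kappa>)" .
      qed (rule J)
    qed
  qed
  then obtain J where J: "J > 0" "\<And>E :: 'a set. E \<in> sets borel \<Longrightarrow> 1 \<le> emeasure lborel E \<Longrightarrow> emeasure lborel E < \<infinity> \<Longrightarrow>
     (\<integral>\<^sup>+x\<in>E. ennreal (bracket x powr (-a)) \<partial>lborel) \<le> ennreal (J * measure lborel E powr \<kappa>)" by blast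
  show ?thesis
  proof (rule that[of "C + C * J"])
    fix E :: "'a set" assume E: "E \<in> sets borel" "1 \<le> emeasure lborel E" "emeasure lborel E < \<infinity>"
    let ?e = "measure lborel E"
    have e1: "1 \<le> ?e" using E(2,3) by (auto simp: emeasure_eq_ennreal_measure)
    have ek: "1 \<le> ?e powr \<kappa>" using e1 \<kappa> by (auto intro: ge_one_powr_ge_zero)
    have "(\<integral>\<^sup>+x\<in>E. ennreal (two_power c a x) \<partial>lborel) \<le> ennreal C + ennreal C * ennreal (J * ?e powr \<kappa>)"
      using C(2)[OF E(1,3)] J(2)[OF E] by (meson add_left_mono mult_left_mono order_trans zero_le)
    also have "\<dots> = ennreal (C + C * (J * ?e powr \<kappa>))"
      using C J by (simp add: ennreal_mult'[symmetric] ennreal_plus[symmetric] del: ennreal_plus)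
    also have "\<dots> \<le> ennreal ((C + C * J) * ?e powr \<kappa>)"
      using ek C by (intro ennreal_leI) (simp add: algebra_simps)
    finally show "(\<integral>\<^sup>+x\<in>E. ennreal (two_power c a x) \<partial>lborel) \<le> ennreal ((C + C * J) * ?e powr \<kappa>)" .
  qed (use C J in \<open>simp add: add_pos_pos\<close>)
qed


text \<open>Convolution with a rapidly decaying kernel removes the singularity and keeps the decay.
  Peetre's inequality moves b' powers of the bracket from y to x and pays with as many powers of the
  bracket of x - y; what remains of them must be integrable, hence N > d + b'.\<close>

lemma two_power_conv_bracket_le:
  fixes b b' N :: real
  assumes b: "0 \<le> b'" "b' \<le> b" "b < DIM('a::euclidean_space)" and N: "N > DIM('a) + b'"
  obtains C where "C > 0"
    "\<And>x :: 'a. (\<integral>\<^sup>+y. ennreal (two_power b b' y * bracket (x - y) powr (-N)) \<partial>lborel) \<le> ennreal (C * bracket x powr (-b'))"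
proof -
  obtain C1 where C1: "C1 > 0" "\<And>E :: 'a set. E \<in> sets borel \<Longrightarrow> emeasure lborel E < \<infinity> \<Longrightarrow>
         (\<integral>\<^sup>+x\<in>E. ennreal (norm x powr (-b)) \<partial>lborel) \<le> ennreal (C1 * measure lborel E powr (1 - b / DIM('a)))"
    by (rule power_integral_le[of b, where ?'a='a]) (use b that in auto)
  define A where "A = C1 * measure lborel (ball (0::'a) 1) powr (1 - b / DIM('a))"
  have A: "A \<ge> 0" "(\<integral>\<^sup>+x\<in>ball 0 1. ennreal (norm (x::'a) powr (-b)) \<partial>lborel) \<le> ennreal A"
    unfolding A_def using C1(1) C1(2)[of "ball 0 1"] emeasure_lborel_ball_finite[of "0::'a" 1] by auto
  obtain J where J: "J > 0" "(\<integral>\<^sup>+x. ennreal (bracket (x::'a) powr (-(N - b'))) \<partial>lborel) \<le> ennreal J"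
    by (rule bracket_integrable[of "N - b'", where ?'a='a]) (use N that in auto)
  define K where "K = 2 powr b"
  have K: "K > 0" by (simp add: K_def)
  show ?thesis
  proof (rule that[of "K * (A + J)"])
    fix x :: 'a
    have pt: "two_power b b' y * bracket (x - y) powr (-N)
        \<le> bracket x powr (-b') * K * (norm y powr (-b) * indicator (ball 0 1) y + bracket (x - y) powr (-(N - b')))" for y
    proof -
      have "bracket y powr (-b') \<le> (bracket x / bracket (x - y)) powr (-b')"
        using b bracket_peetre[of x y] bracket_pos[of x] bracket_pos[of "x - y"] by (intro powr_mono2') (auto simp: field_simps)
      also have "\<dots> = bracket x powr (-b') * bracket (x - y) powr b'"
        using bracket_pos[of x] bracket_pos[of "x - y"] by (simp add: powr_divide powr_minus field_simps)
      finally have 1: "bracket y powr (-b') \<le> bracket x powr (-b') * bracket (x - y) powr b'" .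
      have "two_power b b' y = two_power b 0 y * bracket y powr (-b')" by (simp add: two_power_mult_bracket)
      then have "two_power b b' y * bracket (x - y) powr (-N) \<le> two_power b 0 y * (bracket x powr (-b') * bracket (x - y) powr b') * bracket (x - y) powr (-N)"
        using 1 by (simp add: mult_left_mono mult_right_mono)
      also have "\<dots> = bracket x powr (-b') * (two_power b 0 y * bracket (x - y) powr (-(N - b')))"
        using bracket_pos[of "x - y"] by (simp add: mult_ac powr_add[symmetric])
      also have "\<dots> \<le> bracket x powr (-b') * (K * (norm y powr (-b) * indicator (ball 0 1) y + 1) * bracket (x - y) powr (-(N - b')))"
        using two_power_le[of b 0 y] b bracket_pos[of y] unfolding K_def
        by (intro mult_left_mono mult_right_mono) auto
      also have "\<dots> \<le> bracket x powr (-b') * (K * (norm y powr (-b) * indicator (ball 0 1) y + bracket (x - y) powr (-(N - b'))))"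
      proof (intro mult_left_mono)
        have "bracket (x - y) powr (-(N - b')) \<le> 1"
          using bracket_ge_1[of "x - y"] N powr_mono2'[of "-(N - b')" 1 "bracket (x - y)"] by simp
        then have "norm y powr (-b) * indicator (ball 0 1) y * bracket (x - y) powr (-(N - b')) \<le> norm y powr (-b) * indicator (ball 0 1) y * 1"
          by (intro mult_left_mono) auto
        then show "K * (norm y powr (-b) * indicator (ball 0 1) y + 1) * bracket (x - y) powr (-(N - b'))
            \<le> K * (norm y powr (-b) * indicator (ball 0 1) y + bracket (x - y) powr (-(N - b')))"
          using K by (simp add: algebra_simps)
      qed simp
      finally show ?thesis by (simp add: mult_ac)
    qed
    have sh: "(\<integral>\<^sup>+y. ennreal (bracket (x - y) powr (-(N - b'))) \<partial>lborel) \<le> ennreal J"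
    proof -
      have "(\<integral>\<^sup>+y. ennreal (bracket (x - y) powr (-(N - b'))) \<partial>lborel)
          = (\<integral>\<^sup>+y. ennreal (bracket y powr (-(N - b'))) \<partial>distr lborel borel (\<lambda>y. (-x) + y))"
        by (subst nn_integral_distr) (auto simp: bracket_minus_commute[of x])
      also have "distr lborel borel (\<lambda>y. (-x) + y) = (lborel :: 'a measure)" by (rule lborel_distr_plus)
      finally show ?thesis using J by simp
    qed
    define c where "c = bracket x powr (-b') * K"
    have c: "c \<ge> 0" using K by (simp add: c_def)
    have "(\<integral>\<^sup>+y. ennreal (two_power b b' y * bracket (x - y) powr (-N)) \<partial>lborel)
      \<le> (\<integral>\<^sup>+y. ennreal c * (ennreal (norm y powr (-b)) * indicator (ball 0 1) y + ennreal (bracket (x - y) powr (-(N - b')))) \<partial>lborel)"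
    proof (rule nn_integral_mono)
      fix y :: 'a
      have "ennreal (two_power b b' y * bracket (x - y) powr (-N)) \<le> ennreal (c * (norm y powr (-b) * indicator (ball 0 1) y + bracket (x - y) powr (-(N - b'))))"
        using pt[of y] unfolding c_def by (intro ennreal_leI)
      also have "\<dots> = ennreal c * (ennreal (norm y powr (-b)) * indicator (ball 0 1) y + ennreal (bracket (x - y) powr (-(N - b'))))"
        using c by (auto simp: ennreal_mult' ennreal_plus indicator_def)
      finally show "ennreal (two_power b b' y * bracket (x - y) powr (-N)) \<le> \<dots>" .
    qed
    also have "\<dots> = ennreal c * ((\<integral>\<^sup>+y\<in>ball 0 1. ennreal (norm (y::'a) powr (-b)) \<partial>lborel) + (\<integral>\<^sup>+y. ennreal (bracket (x - y) powr (-(N - b'))) \<partial>lborel))"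
    proof -
      have [measurable]: "ball (0::'a) 1 \<in> sets borel" by simp
      have [measurable]: "(\<lambda>y. ennreal (norm (y :: 'a) powr (-b))) \<in> borel_measurable lborel"
        "(\<lambda>y. ennreal (bracket (x - y) powr (-(N - b')))) \<in> borel_measurable lborel" by measurable
      show ?thesis by (simp add: nn_integral_cmult nn_integral_add del: ennreal_plus)
    qed
    also have "\<dots> \<le> ennreal c * (ennreal A + ennreal J)"
      using A sh by (intro mult_left_mono add_mono) auto
    also have "\<dots> = ennreal (K * (A + J) * bracket x powr (-b'))"
      using A J c by (simp add: c_def ennreal_mult'[symmetric] ennreal_plus[symmetric] mult_ac del: ennreal_plus)
    finally show "(\<integral>\<^sup>+y. ennreal (two_power b b' y * bracket (x - y) powr (-N)) \<partial>lborel) \<le> ennreal (K * (A + J) * bracket x powr (-b'))" .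
  qed (rule mult_pos_pos[OF K add_nonneg_pos[OF A(1) J(1)]])
qed

text \<open>Model for the heat kernel at time 1 conjugated with power weights. The orders of the
  singularity at the origin are \<open>b\<close> in the input y and \<open>c\<close> in the output
  x; \<open>b'\<close> and \<open>c'\<close> are the orders of decay at infinity.\<close>

definition weighted_kernel :: "real \<Rightarrow> real \<Rightarrow> real \<Rightarrow> real \<Rightarrow> real \<Rightarrow> 'a::real_normed_vector \<Rightarrow> 'a \<Rightarrow> ennreal" where
  "weighted_kernel b b' c c' N y x = ennreal (two_power b b' y * (two_power c c' x * bracket (x - y) powr (-N)))"

lemma weighted_kernel_measurable [measurable]:
  "(\<lambda>(y, x). weighted_kernel b b' c c' N y x) \<in> borel_measurable (borel \<Otimes>\<^sub>M (borel :: 'a::euclidean_space measure))"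
  unfolding weighted_kernel_def[abs_def] by measurable

lemma weighted_kernel_commute: "weighted_kernel b b' c c' N y x = weighted_kernel c c' b b' N x y"
  by (simp add: weighted_kernel_def bracket_minus_commute[of x y] mult_ac)

text \<open>Forgetting the restriction to \<open>F\<close> turns the y-integral into a convolution
  over the whole space; its only trace is that the decay b' of the input is added to that of the
  output.\<close>

lemma weighted_kernel_one_sided:
  fixes b b' c c' N :: real
  assumes b: "0 \<le> b'" "b' \<le> b" "b < DIM('a::euclidean_space)" and N: "N > DIM('a) + b'"
  obtains C where "C > 0" "\<And>E F :: 'a set. E \<in> sets borel \<Longrightarrow> F \<in> sets borel \<Longrightarrow>
    (\<integral>\<^sup>+x\<in>E. (\<integral>\<^sup>+y\<in>F. weighted_kernel b b' c c' N y x \<partial>lborel) \<partial>lborel) \<le> ennreal C * (\<integral>\<^sup>+x\<in>E. ennreal (two_power c (c' + b') x) \<partial>lborel)"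
proof -
  obtain C where C: "C > 0"
    "\<And>x :: 'a. (\<integral>\<^sup>+y. ennreal (two_power b b' y * bracket (x - y) powr (-N)) \<partial>lborel) \<le> ennreal (C * bracket x powr (-b'))"
    by (rule two_power_conv_bracket_le[OF b N]) (rule that)
  show ?thesis
  proof (rule that[OF C(1)])
    fix E F :: "'a set" assume [measurable]: "E \<in> sets borel" "F \<in> sets borel"
    have "(\<integral>\<^sup>+x\<in>E. (\<integral>\<^sup>+y\<in>F. weighted_kernel b b' c c' N y x \<partial>lborel) \<partial>lborel) \<le> (\<integral>\<^sup>+x. ennreal C * (ennreal (two_power c (c' + b') x) * indicator E x) \<partial>lborel)"
    proof (rule nn_integral_mono)
      fix x :: 'a
      have "(\<integral>\<^sup>+y\<in>F. weighted_kernel b b' c c' N y x \<partial>lborel) \<le> (\<integral>\<^sup>+y. ennreal (two_power c c' x) * ennreal (two_power b b' y * bracket (x - y) powr (-N)) \<partial>lborel)"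
        by (intro nn_integral_mono) (auto simp: weighted_kernel_def indicator_def ennreal_mult'[symmetric] mult_ac)
      also have "\<dots> \<le> ennreal (two_power c c' x) * ennreal (C * bracket x powr (-b'))"
        by (subst nn_integral_cmult) (auto intro: mult_left_mono C)
      also have "\<dots> = ennreal (C * (two_power c c' x * bracket x powr (-b')))"
        using C(1) by (simp add: ennreal_mult'[symmetric] mult_ac)
      also have "\<dots> = ennreal C * ennreal (two_power c (c' + b') x)"
        using C(1) by (simp add: two_power_mult_bracket ennreal_mult')
      finally show "(\<integral>\<^sup>+y\<in>F. weighted_kernel b b' c c' N y x \<partial>lborel) * indicator E x \<le> ennreal C * (ennreal (two_power c (c' + b') x) * indicator E x)"
        by (auto simp: indicator_def)
    qed
    also have "\<dots> = ennreal C * (\<integral>\<^sup>+x\<in>E. ennreal (two_power c (c' + b') x) \<partial>lborel)"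
      by (rule nn_integral_cmult) measurable
    finally show "(\<integral>\<^sup>+x\<in>E. (\<integral>\<^sup>+y\<in>F. weighted_kernel b b' c c' N y x \<partial>lborel) \<partial>lborel) \<le> ennreal C * (\<integral>\<^sup>+x\<in>E. ennreal (two_power c (c' + b') x) \<partial>lborel)" .
  qed
qed

lemma weighted_kernel_swap:
  assumes [measurable]: "E \<in> sets borel" "F \<in> sets (borel :: 'a::euclidean_space measure)"
  shows "(\<integral>\<^sup>+y\<in>F. (\<integral>\<^sup>+x\<in>E. weighted_kernel b b' c c' N y x \<partial>lborel) \<partial>lborel) = (\<integral>\<^sup>+x\<in>E. (\<integral>\<^sup>+y\<in>F. weighted_kernel b b' c c' N y x \<partial>lborel) \<partial>lborel)"
proof -
  have "(\<integral>\<^sup>+y\<in>F. (\<integral>\<^sup>+x\<in>E. weighted_kernel b b' c c' N y x \<partial>lborel) \<partial>lborel)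
      = (\<integral>\<^sup>+y. (\<integral>\<^sup>+x. weighted_kernel b b' c c' N y x * indicator E x * indicator F y \<partial>lborel) \<partial>lborel)"
    by (subst nn_integral_multc) auto
  also have "\<dots> = (\<integral>\<^sup>+x. (\<integral>\<^sup>+y. weighted_kernel b b' c c' N y x * indicator E x * indicator F y \<partial>lborel) \<partial>lborel)"
    by (rule pair_sigma_finite.Fubini') (auto intro: pair_sigma_finite.intro sigma_finite_lborel)
  also have "\<dots> = (\<integral>\<^sup>+x. (\<integral>\<^sup>+y. weighted_kernel b b' c c' N y x * indicator F y * indicator E x \<partial>lborel) \<partial>lborel)"
    by (simp add: mult.assoc mult.left_commute mult.commute[of "indicator E _"])
  also have "\<dots> = (\<integral>\<^sup>+x\<in>E. (\<integral>\<^sup>+y\<in>F. weighted_kernel b b' c c' N y x \<partial>lborel) \<partial>lborel)"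
    by (intro nn_integral_cong) (subst nn_integral_multc, auto)
  finally show ?thesis .
qed


lemma powr_le_powr_nonneg_base:
  fixes x s t :: real
  assumes "0 \<le> x" "x \<le> 1" "s \<le> t"
  shows "x powr t \<le> x powr s"
  using assms by (rule_tac powr_mono') auto

text \<open>Four cases according to whether the measures of \<open>E\<close> and \<open>F\<close>
  are below or above 1. If both are small, the bracket factor is bounded by 1 and the kernel becomes
  a product of two singular weights. If one is small and the other large, the large one is dropped.
  If both are large, the larger one is dropped and the combined decay b' + c' is available for the
  smaller one, whose \<kappa>-th power is at most |E|^\<nu> |F|^m.\<close>

lemma weighted_kernel_bound:
  fixes b b' c c' N \<nu> m :: real
  assumes b: "0 \<le> b'" "b' \<le> b" "b < DIM('a::euclidean_space)"
    and c: "0 \<le> c'" "c' \<le> c" "c < DIM('a)" and N: "N > DIM('a) + b' + c'"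
    and \<nu>: "0 \<le> \<nu>" "\<nu> \<le> 1 - c / DIM('a)" and m: "0 \<le> m" "m \<le> 1 - b / DIM('a)"
    and sum: "m + \<nu> > 1 - (b' + c') / DIM('a)"
  obtains C where "C > 0"
    "\<And>E F :: 'a set. E \<in> sets borel \<Longrightarrow> F \<in> sets borel \<Longrightarrow> emeasure lborel E < \<infinity> \<Longrightarrow> emeasure lborel F < \<infinity> \<Longrightarrow>
      (\<integral>\<^sup>+y\<in>F. (\<integral>\<^sup>+x\<in>E. weighted_kernel b b' c c' N y x \<partial>lborel) \<partial>lborel)
        \<le> ennreal (C * measure lborel E powr \<nu> * measure lborel F powr m)"
proof -
  \<comment> \<open>If m + \<nu> exceeds 1, the trivial linear bound in the measure is already
    sufficient for sets of measure at least 1, so the exponent is capped there.\<close>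
  define \<kappa> where "\<kappa> = min 1 (m + \<nu>)"
  have \<kappa>: "\<kappa> = 1 \<or> 0 \<le> \<kappa> \<and> \<kappa> < 1 \<and> \<kappa> > 1 - (c' + b') / DIM('a)"
    "\<kappa> = 1 \<or> 0 \<le> \<kappa> \<and> \<kappa> < 1 \<and> \<kappa> > 1 - (b' + c') / DIM('a)" "0 \<le> \<kappa>" "\<kappa> \<le> m + \<nu>"
    using sum m \<nu> by (auto simp: \<kappa>_def min_def add.commute)
  have N': "N > DIM('a) + b'" "N > DIM('a) + c'" using N b c by auto
  have c0: "0 \<le> c" "0 \<le> b" using b c by auto
  have bc0: "0 \<le> c' + b'" "0 \<le> b' + c'" using b c by auto
  obtain A1 where A1: "A1 > 0" "\<And>E F :: 'a set. E \<in> sets borel \<Longrightarrow> F \<in> sets borel \<Longrightarrow>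
    (\<integral>\<^sup>+x\<in>E. (\<integral>\<^sup>+y\<in>F. weighted_kernel b b' c c' N y x \<partial>lborel) \<partial>lborel) \<le> ennreal A1 * (\<integral>\<^sup>+x\<in>E. ennreal (two_power c (c' + b') x) \<partial>lborel)"
    by (rule weighted_kernel_one_sided[OF b N'(1), where c=c and c'=c']) (rule that)
  obtain A2 where A2: "A2 > 0" "\<And>F E :: 'a set. F \<in> sets borel \<Longrightarrow> E \<in> sets borel \<Longrightarrow>
    (\<integral>\<^sup>+y\<in>F. (\<integral>\<^sup>+x\<in>E. weighted_kernel c c' b b' N x y \<partial>lborel) \<partial>lborel) \<le> ennreal A2 * (\<integral>\<^sup>+y\<in>F. ennreal (two_power b (b' + c') y) \<partial>lborel)"
    by (rule weighted_kernel_one_sided[OF c N'(2), where c=b and c'=b']) (rule that)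
  obtain S1 where S1: "S1 > 0" "\<And>E :: 'a set. E \<in> sets borel \<Longrightarrow> emeasure lborel E \<le> 1 \<Longrightarrow>
     (\<integral>\<^sup>+x\<in>E. ennreal (two_power c (c' + b') x) \<partial>lborel) \<le> ennreal (S1 * measure lborel E powr (1 - c / DIM('a)))"
    by (rule two_power_integral_small[OF c0(1) c(3) bc0(1)]) (rule that)
  obtain S2 where S2: "S2 > 0" "\<And>E :: 'a set. E \<in> sets borel \<Longrightarrow> emeasure lborel E \<le> 1 \<Longrightarrow>
     (\<integral>\<^sup>+x\<in>E. ennreal (two_power b (b' + c') x) \<partial>lborel) \<le> ennreal (S2 * measure lborel E powr (1 - b / DIM('a)))"
    by (rule two_power_integral_small[OF c0(2) b(3) bc0(2)]) (rule that)
  obtain S3 where S3: "S3 > 0" "\<And>E :: 'a set. E \<in> sets borel \<Longrightarrow> emeasure lborel E \<le> 1 \<Longrightarrow>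
     (\<integral>\<^sup>+x\<in>E. ennreal (two_power c c' x) \<partial>lborel) \<le> ennreal (S3 * measure lborel E powr (1 - c / DIM('a)))"
    by (rule two_power_integral_small[OF c0(1) c(3) c(1)]) (rule that)
  obtain S4 where S4: "S4 > 0" "\<And>E :: 'a set. E \<in> sets borel \<Longrightarrow> emeasure lborel E \<le> 1 \<Longrightarrow>
     (\<integral>\<^sup>+x\<in>E. ennreal (two_power b b' x) \<partial>lborel) \<le> ennreal (S4 * measure lborel E powr (1 - b / DIM('a)))"
    by (rule two_power_integral_small[OF c0(2) b(3) b(1)]) (rule that)
  obtain L1 where L1: "L1 > 0" "\<And>E :: 'a set. E \<in> sets borel \<Longrightarrow> 1 \<le> emeasure lborel E \<Longrightarrow> emeasure lborel E < \<infinity> \<Longrightarrow>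
     (\<integral>\<^sup>+x\<in>E. ennreal (two_power c (c' + b') x) \<partial>lborel) \<le> ennreal (L1 * measure lborel E powr \<kappa>)"
    by (rule two_power_integral_large[OF c0(1) c(3) bc0(1) \<kappa>(1)]) (rule that)
  obtain L2 where L2: "L2 > 0" "\<And>E :: 'a set. E \<in> sets borel \<Longrightarrow> 1 \<le> emeasure lborel E \<Longrightarrow> emeasure lborel E < \<infinity> \<Longrightarrow>
     (\<integral>\<^sup>+x\<in>E. ennreal (two_power b (b' + c') x) \<partial>lborel) \<le> ennreal (L2 * measure lborel E powr \<kappa>)"
    by (rule two_power_integral_large[OF c0(2) b(3) bc0(2) \<kappa>(2)]) (rule that)
  define C where "C = Max {A1 * S1, A2 * S2, A1 * L1, A2 * L2, S3 * S4}"
  have C: "A1 * S1 \<le> C" "A2 * S2 \<le> C" "A1 * L1 \<le> C" "A2 * L2 \<le> C" "S3 * S4 \<le> C"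
    by (simp_all add: C_def)
  have Cp: "C > 0" using C(1) A1(1) S1(1) by (meson less_le_trans mult_pos_pos)
  show ?thesis
  proof (rule that[OF Cp])
    fix E F :: "'a set"
    assume E[measurable]: "E \<in> sets borel" and F[measurable]: "F \<in> sets borel"
      and Ef: "emeasure lborel E < \<infinity>" and Ff: "emeasure lborel F < \<infinity>"
    define e f where "e = measure lborel E" and "f = measure lborel F"
    have em: "emeasure lborel E = ennreal e" "emeasure lborel F = ennreal f"
      using Ef Ff by (simp_all add: e_def f_def emeasure_eq_ennreal_measure)
    have ef0: "0 \<le> e" "0 \<le> f" by (simp_all add: e_def f_def)
    define I where "I = (\<integral>\<^sup>+y\<in>F. (\<integral>\<^sup>+x\<in>E. weighted_kernel b b' c c' N y x \<partial>lborel) \<partial>lborel)"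
    have I1: "I \<le> ennreal A1 * (\<integral>\<^sup>+x\<in>E. ennreal (two_power c (c' + b') x) \<partial>lborel)"
      unfolding I_def using A1(2)[OF E F] by (simp add: weighted_kernel_swap)
    have I2: "I \<le> ennreal A2 * (\<integral>\<^sup>+y\<in>F. ennreal (two_power b (b' + c') y) \<partial>lborel)"
      unfolding I_def using A2(2)[OF F E] by (simp add: weighted_kernel_commute[of c])
    have comb: "I \<le> ennreal (A * S * x)" if "I \<le> ennreal A * J" "J \<le> ennreal (S * x)" "A > 0" for A J S x
    proof -
      have "I \<le> ennreal A * ennreal (S * x)" using that by (meson mult_left_mono order_trans zero_le)
      then show ?thesis using that by (simp add: ennreal_mult'[symmetric] mult.assoc)
    qed
    have mono: "I \<le> ennreal (C * e powr \<nu> * f powr m)"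
      if "I \<le> ennreal (K * x)" "K \<le> C" "0 \<le> x" "x \<le> e powr \<nu> * f powr m" for K x
    proof -
      have "K * x \<le> C * (e powr \<nu> * f powr m)" using that Cp by (intro mult_mono) auto
      then show ?thesis using that by (metis ennreal_leI mult.assoc order_trans)
    qed
    show "(\<integral>\<^sup>+y\<in>F. (\<integral>\<^sup>+x\<in>E. weighted_kernel b b' c c' N y x \<partial>lborel) \<partial>lborel) \<le> ennreal (C * measure lborel E powr \<nu> * measure lborel F powr m)"
      unfolding I_def[symmetric] e_def[symmetric] f_def[symmetric]
    proof (cases "e = 0 \<or> f = 0")
      case True
      then have "I \<le> 0"
      proof
        assume "e = 0"
        then have "(\<integral>\<^sup>+x\<in>E. ennreal (two_power c (c' + b') x) \<partial>lborel) = 0"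
          using em by (intro nn_integral_null_set) (auto simp: null_sets_def)
        then show ?thesis using I1 by simp
      next
        assume "f = 0"
        then have "(\<integral>\<^sup>+x\<in>F. ennreal (two_power b (b' + c') x) \<partial>lborel) = 0"
          using em by (intro nn_integral_null_set) (auto simp: null_sets_def)
        then show ?thesis using I2 by simp
      qed
      then show "I \<le> ennreal (C * e powr \<nu> * f powr m)" by simp
    next
      case False
      then have ef: "e > 0" "f > 0" using ef0 by auto
      consider "e \<le> 1" "f \<le> 1" | "e \<le> 1" "1 \<le> f" | "1 \<le> e" "f \<le> 1" | "1 \<le> e" "1 \<le> f" by linarith
      then show "I \<le> ennreal (C * e powr \<nu> * f powr m)"
      proof cases
        case 1
        have "I \<le> (\<integral>\<^sup>+y. ennreal (two_power b b' y) * indicator F y * (\<integral>\<^sup>+x\<in>E. ennreal (two_power c c' x) \<partial>lborel) \<partial>lborel)"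
          unfolding I_def
        proof (rule nn_integral_mono)
          fix y :: 'a
          have "(\<integral>\<^sup>+x\<in>E. weighted_kernel b b' c c' N y x \<partial>lborel) \<le> (\<integral>\<^sup>+x. ennreal (two_power b b' y) * (ennreal (two_power c c' x) * indicator E x) \<partial>lborel)"
          proof (rule nn_integral_mono)
            fix x :: 'a
            have "bracket (x - y) powr (-N) \<le> 1"
              using bracket_ge_1[of "x - y"] N b c powr_mono2'[of "-N" 1 "bracket (x - y)"] by simp
            then have "two_power b b' y * (two_power c c' x * bracket (x - y) powr (-N)) \<le> two_power b b' y * (two_power c c' x * 1)"
              by (intro mult_left_mono) auto
            then show "weighted_kernel b b' c c' N y x * indicator E x \<le> ennreal (two_power b b' y) * (ennreal (two_power c c' x) * indicator E x)"
              by (auto simp: weighted_kernel_def indicator_def ennreal_mult'[symmetric] intro!: ennreal_leI)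
          qed
          also have "\<dots> = ennreal (two_power b b' y) * (\<integral>\<^sup>+x\<in>E. ennreal (two_power c c' x) \<partial>lborel)"
            by (rule nn_integral_cmult) measurable
          finally show "(\<integral>\<^sup>+x\<in>E. weighted_kernel b b' c c' N y x \<partial>lborel) * indicator F y
              \<le> ennreal (two_power b b' y) * indicator F y * (\<integral>\<^sup>+x\<in>E. ennreal (two_power c c' x) \<partial>lborel)"
            by (auto simp: indicator_def)
        qed
        also have "\<dots> = (\<integral>\<^sup>+y\<in>F. ennreal (two_power b b' y) \<partial>lborel) * (\<integral>\<^sup>+x\<in>E. ennreal (two_power c c' x) \<partial>lborel)"
          by (rule nn_integral_multc) measurable
        also have "\<dots> \<le> ennreal (S4 * f powr (1 - b / DIM('a))) * ennreal (S3 * e powr (1 - c / DIM('a)))"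
          using S3(2)[OF E] S4(2)[OF F] 1 em by (intro mult_mono) (auto simp: e_def f_def)
        also have "\<dots> = ennreal (S3 * S4 * (e powr (1 - c / DIM('a)) * f powr (1 - b / DIM('a))))"
          using S3 S4 by (simp add: ennreal_mult'[symmetric] mult_ac)
        finally show ?thesis
        proof (rule mono[OF _ C(5)])
          show "e powr (1 - c / DIM('a)) * f powr (1 - b / DIM('a)) \<le> e powr \<nu> * f powr m"
            using 1 ef0 \<nu> m by (intro mult_mono powr_le_powr_nonneg_base) auto
        qed simp
      next
        case 2
        have "I \<le> ennreal (A1 * S1 * e powr (1 - c / DIM('a)))"
          using comb[OF I1 S1(2)[OF E] A1(1)] 2 em by (auto simp: e_def)
        then show ?thesis
        proof (rule mono[OF _ C(1)])
          have "e powr (1 - c / DIM('a)) * 1 \<le> e powr \<nu> * f powr m"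
            using 2 ef0 \<nu> m by (intro mult_mono powr_le_powr_nonneg_base ge_one_powr_ge_zero) auto
          then show "e powr (1 - c / DIM('a)) \<le> e powr \<nu> * f powr m" by simp
        qed simp
      next
        case 3
        have "I \<le> ennreal (A2 * S2 * f powr (1 - b / DIM('a)))"
          using comb[OF I2 S2(2)[OF F] A2(1)] 3 em by (auto simp: f_def)
        then show ?thesis
        proof (rule mono[OF _ C(2)])
          have "1 * f powr (1 - b / DIM('a)) \<le> e powr \<nu> * f powr m"
            using 3 ef0 \<nu> m by (intro mult_mono powr_le_powr_nonneg_base ge_one_powr_ge_zero) auto
          then show "f powr (1 - b / DIM('a)) \<le> e powr \<nu> * f powr m" by simp
        qed simp
      next
        case 4
        have split: "x powr \<kappa> \<le> e powr \<nu> * f powr m" if "1 \<le> x" "x \<le> e" "x \<le> f" for x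
        proof -
          have "x powr \<kappa> \<le> x powr (\<nu> + m)" using that \<kappa> by (intro powr_mono) auto
          also have "\<dots> = x powr \<nu> * x powr m" by (rule powr_add)
          also have "\<dots> \<le> e powr \<nu> * f powr m" using that \<nu> m by (intro mult_mono powr_mono2) auto
          finally show ?thesis .
        qed
        show ?thesis
        proof (cases "e \<le> f")
          case True
          have "I \<le> ennreal (A1 * L1 * e powr \<kappa>)"
            using comb[OF I1 L1(2)[OF E] A1(1)] 4 em Ef by (auto simp: e_def)
          then show ?thesis by (rule mono[OF _ C(3)]) (use split[of e] True 4 in auto)
        next
          case False
          have "I \<le> ennreal (A2 * L2 * f powr \<kappa>)"
            using comb[OF I2 L2(2)[OF F] A2(1)] 4 em Ff by (auto simp: f_def)
          then show ?thesis by (rule mono[OF _ C(4)]) (use split[of f] False 4 in auto)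
        qed
      qed
    qed
  qed
qed


section \<open>Weighted smoothing by the heat semigroup\<close>

text \<open>Majorant of the heat flow with values in [0,\<infinity>], so that estimates, semigroup
  law and Tonelli can be used before any integral is known to converge.\<close>

definition nnheat :: "real \<Rightarrow> (real ^ 'n \<Rightarrow> ennreal) \<Rightarrow> real ^ 'n \<Rightarrow> ennreal" where
  "nnheat t f x = (\<integral>\<^sup>+y. ennreal (heat_kernel t (x - y)) * f y \<partial>lborel)"

lemma heat_kernel_nonneg [simp]: "0 \<le> heat_kernel t x"
  by (simp add: heat_kernel_def)

lemma heat_kernel_measurable [measurable]:
  "(\<lambda>(t, x :: real ^ 'n). heat_kernel t x) \<in> borel_measurable (borel \<Otimes>\<^sub>M borel)"
  unfolding heat_kernel_def[abs_def] by measurable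

lemma heat_kernel_measurable' [measurable (raw)]:
  assumes [measurable]: "f \<in> borel_measurable M" "g \<in> borel_measurable M"
  shows "(\<lambda>z. heat_kernel (f z) (g z :: real ^ 'n)) \<in> borel_measurable M"
proof -
  have "(\<lambda>z. (\<lambda>(t, x). heat_kernel t x) (f z, g z)) \<in> borel_measurable M" by measurable
  then show ?thesis by simp
qed

lemma heat_kernel_1_le_bracket:
  fixes N :: real
  assumes N: "N \<ge> 0"
  obtains C where "C > 0" "\<And>z :: real ^ 'n. heat_kernel 1 z \<le> C * bracket z powr (-N)"
proof (rule that[of "exp (N\<^sup>2)"])
  fix z :: "real ^ 'n"
  have jz: "bracket z > 0" by (rule bracket_pos)
  have "(4 * pi * 1) powr (- (real CARD('n) / 2)) \<le> 1"
  proof -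
    have "1 \<le> 4 * pi" using pi_ge_two by linarith
    then show ?thesis using powr_mono2'[of "- (real CARD('n) / 2)" 1 "4 * pi"] by simp
  qed
  then have "heat_kernel 1 z \<le> 1 * exp (- (norm z)\<^sup>2 / 4)"
    unfolding heat_kernel_def by (intro mult_mono) auto
  also have "\<dots> \<le> exp (N\<^sup>2) * bracket z powr (-N)"
  proof -
    have "ln (bracket z) \<le> norm z" unfolding bracket_def by (rule ln_add_one_self_le_self) simp
    then have "N * ln (bracket z) \<le> N * norm z" using N by (intro mult_left_mono) auto
    \<comment> \<open>The square of N - |z|/2 is nonnegative; the term N^2 left over is the origin
      of the constant \<open>exp (N\<^sup>2)\<close>.\<close>
    moreover have "N * norm z \<le> N\<^sup>2 + (norm z)\<^sup>2 / 4"
      using sum_squares_ge_zero[of "N - norm z / 2" 0] by (simp add: power2_eq_square algebra_simps)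
    ultimately have "- (norm z)\<^sup>2 / 4 \<le> N\<^sup>2 + (-N) * ln (bracket z)" by linarith
    then have "exp (- (norm z)\<^sup>2 / 4) \<le> exp (N\<^sup>2 + (-N) * ln (bracket z))" by simp
    also have "\<dots> = exp (N\<^sup>2) * bracket z powr (-N)" using jz by (subst exp_add) (simp add: powr_def)
    finally show ?thesis by simp
  qed
  finally show "heat_kernel 1 z \<le> exp (N\<^sup>2) * bracket z powr (-N)" .
qed simp

lemma nnheat_measurable [measurable]:
  assumes [measurable]: "f \<in> borel_measurable borel"
  shows "nnheat t f \<in> borel_measurable borel"
  unfolding nnheat_def[abs_def] by measurable

text \<open>A negative power of |x| or |y| is a genuine singularity and stays with its variable. A
  positive power grows at infinity; Peetre's inequality moves it to the other variable, where it
  reduces the decay from b to b - n1 or from c to c - n2. The powers of the bracket of x - y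
  produced on the way are paid for by the Gaussian, which is why it is estimated with N + n1 +
  n2.\<close>

lemma weighted_heat_kernel_le:
  fixes \<sigma>1 \<sigma>2 N :: real
  assumes \<sigma>: "\<sigma>2 \<le> \<sigma>1" and N: "N \<ge> 0"
  obtains C where "C > 0" "\<And>x y :: real ^ 'n.
    ennreal (norm y powr (-\<sigma>1) * (norm x powr \<sigma>2 * heat_kernel 1 (x - y)))
     \<le> ennreal C * weighted_kernel (max \<sigma>1 0) (max \<sigma>1 0 - max \<sigma>2 0) (max (-\<sigma>2) 0) (max (-\<sigma>2) 0 - max (-\<sigma>1) 0) N y x"
proof -
  define n1 n2 where "n1 = max \<sigma>2 0" and "n2 = max (-\<sigma>1) 0"
  define b c where "b = max \<sigma>1 0" and "c = max (-\<sigma>2) 0"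
  have n: "n1 \<ge> 0" "n2 \<ge> 0" by (auto simp: n1_def n2_def)
  obtain C where C: "C > 0" "\<And>z :: real ^ 'n. heat_kernel 1 z \<le> C * bracket z powr (-(N + n1 + n2))"
    by (rule heat_kernel_1_le_bracket[of "N + n1 + n2", where ?'n='n]) (use N n that in auto)
  show ?thesis
  proof (rule that[OF C(1)])
    fix x y :: "real ^ 'n"
    have 1: "norm x powr \<sigma>2 \<le> norm x powr (-c) * (bracket y * bracket (x - y)) powr n1"
    proof -
      have "norm x powr \<sigma>2 = norm x powr (-c) * norm x powr n1"
        by (cases "\<sigma>2 \<ge> 0"; cases "x = 0") (auto simp: c_def n1_def)
      also have "norm x powr n1 \<le> (bracket y * bracket (x - y)) powr n1"
        using bracket_peetre[of x y] bracket_ge_norm[of x] n by (intro powr_mono2) auto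
      finally show ?thesis by (simp add: mult_left_mono)
    qed
    have 2: "norm y powr (-\<sigma>1) \<le> norm y powr (-b) * (bracket x * bracket (x - y)) powr n2"
    proof -
      have "norm y powr (-\<sigma>1) = norm y powr (-b) * norm y powr n2"
        by (cases "\<sigma>1 \<ge> 0"; cases "y = 0") (auto simp: b_def n2_def)
      also have "norm y powr n2 \<le> (bracket x * bracket (x - y)) powr n2"
        using bracket_peetre[of y x] bracket_ge_norm[of y] n by (intro powr_mono2) (auto simp: bracket_minus_commute[of y])
      finally show ?thesis by (simp add: mult_left_mono)
    qed
    have "norm y powr (-\<sigma>1) * (norm x powr \<sigma>2 * heat_kernel 1 (x - y))
       \<le> norm y powr (-b) * (bracket x * bracket (x - y)) powr n2 * (norm x powr (-c) * (bracket y * bracket (x - y)) powr n1 * (C * bracket (x - y) powr (-(N + n1 + n2))))"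
      using 1 2 C by (intro mult_mono) auto
    also have "\<dots> = C * (norm y powr (-b) * bracket y powr n1 * (norm x powr (-c) * bracket x powr n2 * bracket (x - y) powr (n1 + n2 + -(N + n1 + n2))))"
      using bracket_pos[of x] bracket_pos[of y] bracket_pos[of "x - y"] by (simp only: powr_mult powr_add mult_ac)
    also have "\<dots> = C * (two_power b (b - n1) y * (two_power c (c - n2) x * bracket (x - y) powr (-N)))"
      by (simp add: two_power_def)
    finally show "ennreal (norm y powr (-\<sigma>1) * (norm x powr \<sigma>2 * heat_kernel 1 (x - y)))
     \<le> ennreal C * weighted_kernel (max \<sigma>1 0) (max \<sigma>1 0 - max \<sigma>2 0) (max (-\<sigma>2) 0) (max (-\<sigma>2) 0 - max (-\<sigma>1) 0) N y x"
      using C(1) by (simp add: weighted_kernel_def ennreal_mult'[symmetric] b_def c_def n1_def n2_def)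
  qed
qed

lemma finite_uniform_constant:
  fixes P :: "'a \<Rightarrow> real \<Rightarrow> bool"
  assumes "finite S" "\<And>m. m \<in> S \<Longrightarrow> \<exists>K>0. P m K" "\<And>m K K'. P m K \<Longrightarrow> K \<le> K' \<Longrightarrow> P m K'"
  obtains K where "K > 0" "\<And>m. m \<in> S \<Longrightarrow> P m K"
proof -
  have "\<exists>K>0. \<forall>m\<in>S. P m K"
    using assms(1,2)
  proof (induction S rule: finite_induct)
    case (insert x F)
    obtain K1 where "K1 > 0" "\<And>m. m \<in> F \<Longrightarrow> P m K1" using insert by blast
    moreover obtain K2 where "K2 > 0" "P x K2" using insert by blast
    ultimately show ?case
      using assms(3)[of _ K1 "max K1 K2"] assms(3)[of x K2 "max K1 K2"] by (intro exI[of _ "max K1 K2"]) auto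
  qed (auto intro: exI[of _ 1])
  then show ?thesis using that by blast
qed

text \<open>The three conditions on the exponents are those of the model kernel bound.
  \<open>s1\<close> says that the singular weight in y is integrable to the order demanded by
  \<mu>1, \<open>s2\<close> does the same in x for \<nu> = 1 - \<mu>2, and the gap
  \<open>s12\<close> says that the total decay b' + c' = \<sigma>1 - \<sigma>2 compensates m + \<nu>
  on large sets.\<close>

lemma heat_marc_bound_time_1:
  fixes \<sigma>1 \<sigma>2 \<mu>1 \<mu>2 :: real
  assumes \<mu>1: "0 \<le> \<mu>1" "\<mu>1 \<le> 1" and \<mu>2: "0 \<le> \<mu>2" "\<mu>2 \<le> 1" and \<sigma>: "\<sigma>2 \<le> \<sigma>1" "- real CARD('n) < \<sigma>2"
    and s1: "\<sigma>1 / CARD('n) + \<mu>1 < 1" and s2: "0 \<le> \<sigma>2 / CARD('n) + \<mu>2"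
    and s12: "\<sigma>2 / CARD('n) + \<mu>2 < \<sigma>1 / CARD('n) + \<mu>1"
  obtains C where "C > 0" "\<And>(f :: real ^ 'n \<Rightarrow> ennreal) B. f \<in> borel_measurable borel \<Longrightarrow> 0 \<le> B \<Longrightarrow>
    marc_bound \<mu>1 B (\<lambda>y. ennreal (norm y powr \<sigma>1) * f y) \<Longrightarrow>
    marc_bound \<mu>2 (C * B) (\<lambda>x. ennreal (norm x powr \<sigma>2) * nnheat 1 f x)"
proof -
  define d where "d = real CARD('n)"
  have d: "d > 0" by (simp add: d_def)
  have dim: "real DIM(real ^ 'n) = d" by (simp add: d_def)
  define \<nu> where "\<nu> = 1 - \<mu>2"
  define b b' c c' where "b = max \<sigma>1 0" and "b' = max \<sigma>1 0 - max \<sigma>2 0"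
    and "c = max (-\<sigma>2) 0" and "c' = max (-\<sigma>2) 0 - max (-\<sigma>1) 0"
  have b: "0 \<le> b'" "b' \<le> b" "b < d" and c: "0 \<le> c'" "c' \<le> c" "c < d"
    and bc: "b' + c' = \<sigma>1 - \<sigma>2"
    using \<sigma> s1 \<mu>1 d by (auto simp: b_def b'_def c_def c'_def d_def[symmetric] max_def field_simps)
      (smt (verit) mult_nonneg_nonneg)+
  have \<nu>: "0 \<le> \<nu>" "\<nu> \<le> 1 - c / d"
    using \<mu>2 s2 d by (auto simp: \<nu>_def c_def max_def d_def[symmetric] field_simps)
  have mb: "\<mu>1 \<le> 1 - b / d" using \<mu>1 s1 d by (auto simp: b_def max_def d_def[symmetric])
  have mb': "\<mu>1 < 1 - b / d" if "\<mu>1 < 1" using \<mu>1 s1 d that by (auto simp: b_def max_def d_def[symmetric])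
  have gap: "0 < \<mu>1 + \<nu> - (1 - (b' + c') / d)"
    using s12 d unfolding bc by (simp add: \<nu>_def d_def[symmetric] diff_divide_distrib)
  define gp where "gp = \<mu>1 + \<nu> - (1 - (b' + c') / d)"
  have gp: "gp > 0" using gap by (simp add: gp_def)
  \<comment> \<open>Room for the neighbours \<mu>1 + \<delta> and \<mu>1 - \<delta> that the duality
    lemma asks for. At an endpoint of [0,1] one neighbour falls outside and imposes nothing; there
    the value 1 is a placeholder.\<close>
  define x2 x3 where "x2 = (if \<mu>1 < 1 then min (1 - b / d - \<mu>1) ((1 - \<mu>1) / 2) else 1)"
    and "x3 = (if \<mu>1 > 0 then \<mu>1 else 1)"
  have x: "x2 > 0" "x3 > 0" using mb' by (auto simp: x2_def x3_def)
  define \<delta> where "\<delta> = min (gp / 2) (min x2 x3)"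
  have "\<delta> \<le> x2" "\<delta> \<le> x3" and le: "\<delta> \<le> gp / 2" by (simp_all add: \<delta>_def)
  then have \<delta>x: "\<mu>1 < 1 \<Longrightarrow> \<delta> \<le> 1 - b / d - \<mu>1 \<and> \<delta> \<le> (1 - \<mu>1) / 2" "\<mu>1 > 0 \<Longrightarrow> \<delta> \<le> \<mu>1"
    by (auto simp: x2_def x3_def)
  have "\<delta> > 0" using gp x by (simp add: \<delta>_def)
  moreover have "\<delta> < gp" using le gp by linarith
  moreover have "\<delta> \<le> \<mu>1 \<and> \<mu>1 + \<delta> < 1" if "0 < \<mu>1" "\<mu>1 < 1"
    using \<delta>x(1)[OF that(2)] \<delta>x(2)[OF that(1)] that by argo
  moreover have "\<mu>1 + \<delta> \<le> 1 - b / d" if "\<mu>1 < 1" using \<delta>x(1)[OF that] by linarith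
  ultimately have \<delta>: "\<delta> > 0" "0 < \<mu>1 \<Longrightarrow> \<mu>1 < 1 \<Longrightarrow> \<delta> \<le> \<mu>1 \<and> \<mu>1 + \<delta> < 1" "\<delta> < gp" "\<mu>1 < 1 \<Longrightarrow> \<mu>1 + \<delta> \<le> 1 - b / d"
    by auto
  define N where "N = d + b' + c' + 1"
  have N: "N > d + b' + c'" "N \<ge> 0" using b c d by (auto simp: N_def)
  define P where "P m K \<longleftrightarrow> (0 \<le> m \<longrightarrow> m \<le> 1 \<longrightarrow> (\<forall>E F :: (real ^ 'n) set. E \<in> sets borel \<longrightarrow> F \<in> sets borel \<longrightarrow>
      emeasure lborel E < \<infinity> \<longrightarrow> emeasure lborel F < \<infinity> \<longrightarrow>
      (\<integral>\<^sup>+y\<in>F. (\<integral>\<^sup>+x\<in>E. weighted_kernel b b' c c' N y x \<partial>lborel) \<partial>lborel) \<le> ennreal (K * measure lborel E powr \<nu> * measure lborel F powr m)))"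
    for m K :: real
  have ex: "\<exists>K>0. P m K" if m: "m \<in> {\<mu>1 - \<delta>, \<mu>1, \<mu>1 + \<delta>}" for m
  proof (cases "0 \<le> m \<and> m \<le> 1")
    case True
    have m2: "m \<le> 1 - b / d" using m mb \<delta> True \<mu>1 by (cases "\<mu>1 < 1") auto
    have m3: "m + \<nu> > 1 - (b' + c') / d" using m \<delta> by (auto simp: gp_def)
    obtain K where "K > 0"
      "\<And>E F :: (real ^ 'n) set. E \<in> sets borel \<Longrightarrow> F \<in> sets borel \<Longrightarrow> emeasure lborel E < \<infinity> \<Longrightarrow> emeasure lborel F < \<infinity> \<Longrightarrow>
      (\<integral>\<^sup>+y\<in>F. (\<integral>\<^sup>+x\<in>E. weighted_kernel b b' c c' N y x \<partial>lborel) \<partial>lborel)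
        \<le> ennreal (K * measure lborel E powr \<nu> * measure lborel F powr m)"
      by (rule weighted_kernel_bound[where ?'a="real ^ 'n", unfolded dim, OF b c N(1) \<nu> conjunct1[OF True] m2 m3]) (rule that)
    then show ?thesis unfolding P_def by blast
  qed (auto intro: exI[of _ 1] simp: P_def)
  have P_mono: "P m K'" if "P m K" "K \<le> K'" for m K K'
    unfolding P_def
  proof (intro allI impI)
    fix E F :: "(real ^ 'n) set"
    assume *: "0 \<le> m" "m \<le> 1" "E \<in> sets borel" "F \<in> sets borel" "emeasure lborel E < \<infinity>" "emeasure lborel F < \<infinity>"
    have "(\<integral>\<^sup>+y\<in>F. (\<integral>\<^sup>+x\<in>E. weighted_kernel b b' c c' N y x \<partial>lborel) \<partial>lborel) \<le> ennreal (K * measure lborel E powr \<nu> * measure lborel F powr m)"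
      using that(1) * unfolding P_def by simp
    also have "\<dots> \<le> ennreal (K' * measure lborel E powr \<nu> * measure lborel F powr m)"
      using that(2) by (intro ennreal_leI mult_right_mono) auto
    finally show "(\<integral>\<^sup>+y\<in>F. (\<integral>\<^sup>+x\<in>E. weighted_kernel b b' c c' N y x \<partial>lborel) \<partial>lborel) \<le> \<dots>" .
  qed
  obtain K where K: "K > 0" and KP: "\<And>m. m \<in> {\<mu>1 - \<delta>, \<mu>1, \<mu>1 + \<delta>} \<Longrightarrow> P m K"
    by (rule finite_uniform_constant[of "{\<mu>1 - \<delta>, \<mu>1, \<mu>1 + \<delta>}" P]) (use ex P_mono that in simp_all)
  have Kb: "(\<integral>\<^sup>+y\<in>F. (\<integral>\<^sup>+x\<in>E. weighted_kernel b b' c c' N y (x :: real ^ 'n) \<partial>lborel) \<partial>lborel) \<le> ennreal (K * measure lborel E powr \<nu> * measure lborel F powr m)"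
    if "m \<in> {\<mu>1 - \<delta>, \<mu>1, \<mu>1 + \<delta>}" "0 \<le> m" "m \<le> 1" "E \<in> sets borel" "F \<in> sets borel" "emeasure lborel E < \<infinity>" "emeasure lborel F < \<infinity>" for m E F
    using KP[OF that(1)] that(2-) unfolding P_def by simp
  obtain D where D: "D > 0" "\<And>(W :: real ^ 'n \<Rightarrow> ennreal) g K B.
       W \<in> borel_measurable borel \<Longrightarrow> g \<in> borel_measurable borel \<Longrightarrow> 0 < K \<Longrightarrow> 0 \<le> B \<Longrightarrow> marc_bound \<mu>1 B g \<Longrightarrow>
       (\<And>m F. m \<in> {\<mu>1 - \<delta>, \<mu>1, \<mu>1 + \<delta>} \<Longrightarrow> 0 \<le> m \<Longrightarrow> m \<le> 1 \<Longrightarrow> F \<in> sets borel \<Longrightarrow> emeasure lborel F < \<infinity> \<Longrightarrow>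
         (\<integral>\<^sup>+x\<in>F. W x \<partial>lborel) \<le> ennreal (K * measure lborel F powr m)) \<Longrightarrow>
       (\<integral>\<^sup>+x. W x * g x \<partial>lborel) \<le> ennreal (D * K * B)"
  proof (rule marc_bound_duality[OF \<mu>1 \<delta>(1), where ?'a="real ^ 'n"], goal_cases)
    case 1
    then show ?case using \<delta>(2) by simp
  next
    case (2 C)
    show ?case by (rule 2(1)[OF 2(2,3)])
  qed
  obtain H where H: "H > 0" "\<And>x y :: real ^ 'n. ennreal (norm y powr (-\<sigma>1) * (norm x powr \<sigma>2 * heat_kernel 1 (x - y)))
     \<le> ennreal H * weighted_kernel b b' c c' N y x"
    by (rule weighted_heat_kernel_le[OF \<sigma>(1) N(2), where ?'n='n])
      (rule that, assumption, simp only: b_def b'_def c_def c'_def)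
  show ?thesis
  proof (rule that[of "D * (H * K)"])
    fix f :: "real ^ 'n \<Rightarrow> ennreal" and B :: real
    assume f[measurable]: "f \<in> borel_measurable borel" and B: "0 \<le> B"
      and mf: "marc_bound \<mu>1 B (\<lambda>y. ennreal (norm y powr \<sigma>1) * f y)"
    show "marc_bound \<mu>2 (D * (H * K) * B) (\<lambda>x. ennreal (norm x powr \<sigma>2) * nnheat 1 f x)"
    proof (rule marc_bound_borelI)
      fix E :: "(real ^ 'n) set" assume E[measurable]: "E \<in> sets borel" and Ef: "emeasure lborel E < \<infinity>"
      let ?e = "measure lborel E"
      \<comment> \<open>By Tonelli the integral of the weighted heat flow over \<open>E\<close> is
        the pairing of \<open>|y| powr \<sigma>1 * f\<close> with \<open>W\<close>, the adjoint
        operator applied to the weighted indicator of \<open>E\<close>.\<close>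
      define W where "W = (\<lambda>y :: real ^ 'n. \<integral>\<^sup>+x\<in>E. ennreal (norm y powr (-\<sigma>1) * (norm x powr \<sigma>2 * heat_kernel 1 (x - y))) \<partial>lborel)"
      have [measurable]: "W \<in> borel_measurable borel" unfolding W_def by measurable
      show "(\<integral>\<^sup>+x\<in>E. ennreal (norm x powr \<sigma>2) * nnheat 1 f x \<partial>lborel) \<le> ennreal (D * (H * K) * B * ?e powr (1 - \<mu>2))"
      \<comment> \<open>The duality lemma requires a positive constant, here
        \<open>H * K * ?e powr \<nu>\<close>, so test sets of measure 0 are treated apart.\<close>
      proof (cases "?e = 0")
        case True
        then have "(\<integral>\<^sup>+x\<in>E. ennreal (norm x powr \<sigma>2) * nnheat 1 f x \<partial>lborel) = 0"
          using Ef by (intro nn_integral_null_set) (auto simp: null_sets_def emeasure_eq_ennreal_measure)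
        then show ?thesis by simp
      next
        case False
        then have e: "?e > 0" by (simp add: less_le)
        have WF: "(\<integral>\<^sup>+y\<in>F. W y \<partial>lborel) \<le> ennreal (H * K * ?e powr \<nu> * measure lborel F powr m)"
          if m: "m \<in> {\<mu>1 - \<delta>, \<mu>1, \<mu>1 + \<delta>}" "0 \<le> m" "m \<le> 1" and F[measurable]: "F \<in> sets borel" and Ff: "emeasure lborel F < \<infinity>" for m F
        proof -
          have "(\<integral>\<^sup>+y\<in>F. W y \<partial>lborel) \<le> (\<integral>\<^sup>+y. ennreal H * ((\<integral>\<^sup>+x\<in>E. weighted_kernel b b' c c' N y x \<partial>lborel) * indicator F y) \<partial>lborel)"
          proof (rule nn_integral_mono)
            fix y :: "real ^ 'n"
            have "W y \<le> (\<integral>\<^sup>+x. ennreal H * (weighted_kernel b b' c c' N y x * indicator E x) \<partial>lborel)"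
              unfolding W_def using H(2)[of y] by (intro nn_integral_mono) (auto simp: indicator_def)
            also have "\<dots> = ennreal H * (\<integral>\<^sup>+x\<in>E. weighted_kernel b b' c c' N y x \<partial>lborel)"
              by (rule nn_integral_cmult) measurable
            finally show "W y * indicator F y \<le> ennreal H * ((\<integral>\<^sup>+x\<in>E. weighted_kernel b b' c c' N y x \<partial>lborel) * indicator F y)"
              by (auto simp: indicator_def)
          qed
          also have "\<dots> = ennreal H * (\<integral>\<^sup>+y\<in>F. (\<integral>\<^sup>+x\<in>E. weighted_kernel b b' c c' N y x \<partial>lborel) \<partial>lborel)"
            by (rule nn_integral_cmult) measurable
          also have "\<dots> \<le> ennreal H * ennreal (K * ?e powr \<nu> * measure lborel F powr m)"
            using Kb[OF m E F Ef Ff] by (intro mult_left_mono) auto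
          also have "\<dots> = ennreal (H * K * ?e powr \<nu> * measure lborel F powr m)"
            using H(1) K by (simp add: ennreal_mult'[symmetric] mult_ac)
          finally show ?thesis .
        qed
        have "(\<integral>\<^sup>+x\<in>E. ennreal (norm x powr \<sigma>2) * nnheat 1 f x \<partial>lborel)
            = (\<integral>\<^sup>+x. (\<integral>\<^sup>+y. ennreal (norm x powr \<sigma>2) * indicator E x * (ennreal (heat_kernel 1 (x - y)) * f y) \<partial>lborel) \<partial>lborel)"
        proof (rule nn_integral_cong)
          fix x :: "real ^ 'n"
          have "(\<integral>\<^sup>+y. ennreal (norm x powr \<sigma>2) * indicator E x * (ennreal (heat_kernel 1 (x - y)) * f y) \<partial>lborel)
              = ennreal (norm x powr \<sigma>2) * indicator E x * nnheat 1 f x"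
            unfolding nnheat_def by (rule nn_integral_cmult) measurable
          then show "ennreal (norm x powr \<sigma>2) * nnheat 1 f x * indicator E x
              = (\<integral>\<^sup>+y. ennreal (norm x powr \<sigma>2) * indicator E x * (ennreal (heat_kernel 1 (x - y)) * f y) \<partial>lborel)"
            by (simp add: mult_ac)
        qed
        also have "\<dots> = (\<integral>\<^sup>+y. (\<integral>\<^sup>+x. ennreal (norm x powr \<sigma>2) * indicator E x * (ennreal (heat_kernel 1 (x - y)) * f y) \<partial>lborel) \<partial>lborel)"
          by (rule pair_sigma_finite.Fubini') (auto intro: pair_sigma_finite.intro sigma_finite_lborel)
        also have "\<dots> = (\<integral>\<^sup>+y. W y * (ennreal (norm y powr \<sigma>1) * f y) \<partial>lborel)"
        proof (rule nn_integral_cong_AE)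
          have "AE y in lborel. y \<noteq> (0 :: real ^ 'n)" by (rule AE_lborel_singleton)
          then show "AE y in lborel. (\<integral>\<^sup>+x. ennreal (norm x powr \<sigma>2) * indicator E x * (ennreal (heat_kernel 1 (x - y)) * f y) \<partial>lborel)
              = W y * (ennreal (norm y powr \<sigma>1) * f y)"
          proof eventually_elim
            case (elim y)
            have "W y * (ennreal (norm y powr \<sigma>1) * f y)
              = (\<integral>\<^sup>+x. ennreal (norm y powr (-\<sigma>1) * (norm x powr \<sigma>2 * heat_kernel 1 (x - y))) * indicator E x * (ennreal (norm y powr \<sigma>1) * f y) \<partial>lborel)"
              unfolding W_def by (rule nn_integral_multc[symmetric]) measurable
            also have "\<dots> = (\<integral>\<^sup>+x. ennreal (norm x powr \<sigma>2) * indicator E x * (ennreal (heat_kernel 1 (x - y)) * f y) \<partial>lborel)"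
            proof (rule nn_integral_cong)
              fix x :: "real ^ 'n"
              let ?A = "ennreal (norm y powr (-\<sigma>1) * (norm x powr \<sigma>2 * heat_kernel 1 (x - y)))"
              have eq: "?A * ennreal (norm y powr \<sigma>1) = ennreal (norm x powr \<sigma>2) * ennreal (heat_kernel 1 (x - y))"
                using elim by (simp add: ennreal_mult'[symmetric] powr_minus)
              have "?A * indicator E x * (ennreal (norm y powr \<sigma>1) * f y) = (?A * ennreal (norm y powr \<sigma>1)) * (indicator E x * f y)"
                by (simp only: mult_ac)
              also have "\<dots> = ennreal (norm x powr \<sigma>2) * indicator E x * (ennreal (heat_kernel 1 (x - y)) * f y)"
                unfolding eq by (simp only: mult_ac)
              finally show "?A * indicator E x * (ennreal (norm y powr \<sigma>1) * f y)
                 = ennreal (norm x powr \<sigma>2) * indicator E x * (ennreal (heat_kernel 1 (x - y)) * f y)" .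
            qed
            finally show ?case by simp
          qed
        qed
        also have "\<dots> \<le> ennreal (D * (H * K * ?e powr \<nu>) * B)"
          using H(1) K e B mf WF by (intro D) auto
        also have "D * (H * K * ?e powr \<nu>) * B = D * (H * K) * B * ?e powr (1 - \<mu>2)" by (simp add: \<nu>_def)
        finally show ?thesis .
      qed
    qed measurable
  qed (use D H K in simp)
qed

section \<open>Parabolic scaling\<close>

lemma nn_integral_scaleR:
  fixes f :: "'a::euclidean_space \<Rightarrow> ennreal"
  assumes [measurable]: "f \<in> borel_measurable borel" and c: "c > 0"
  shows "(\<integral>\<^sup>+x. f x \<partial>lborel) = ennreal (c powr real DIM('a)) * (\<integral>\<^sup>+x. f (c *\<^sub>R x) \<partial>lborel)"
proof -
  have "(\<integral>\<^sup>+x. f x \<partial>lborel) = (\<integral>\<^sup>+x. f x \<partial>density (distr lborel borel (\<lambda>x. 0 + c *\<^sub>R x)) (\<lambda>_. \<bar>c\<bar> ^ DIM('a)))"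
    by (subst lborel_affine[of c 0]) (use c in auto)
  also have "\<dots> = (\<integral>\<^sup>+x. ennreal (c powr real DIM('a)) * f (c *\<^sub>R x) \<partial>lborel)"
    using c by (simp add: nn_integral_density nn_integral_distr powr_realpow)
  also have "\<dots> = ennreal (c powr real DIM('a)) * (\<integral>\<^sup>+x. f (c *\<^sub>R x) \<partial>lborel)"
    by (rule nn_integral_cmult) measurable
  finally show ?thesis .
qed

lemma emeasure_scaleR_vimage:
  fixes E :: "'a::euclidean_space set"
  assumes [measurable]: "E \<in> sets borel" and c: "c > 0" and fin: "emeasure lborel E < \<infinity>"
  shows "emeasure lborel {x. c *\<^sub>R x \<in> E} < \<infinity>"
    "measure lborel {x. c *\<^sub>R x \<in> E} = c powr (- real DIM('a)) * measure lborel E"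
proof -
  have m[measurable]: "{x. c *\<^sub>R x \<in> E} \<in> sets borel" by measurable
  have "(\<integral>\<^sup>+x. indicator E x \<partial>lborel) = ennreal (c powr real DIM('a)) * (\<integral>\<^sup>+x. indicator E (c *\<^sub>R x) \<partial>lborel)"
    by (rule nn_integral_scaleR[OF _ c]) measurable
  also have "(\<integral>\<^sup>+x. indicator E (c *\<^sub>R x) \<partial>lborel) = (\<integral>\<^sup>+x. indicator {x. c *\<^sub>R x \<in> E} x \<partial>lborel)"
    by (intro nn_integral_cong) (auto simp: indicator_def)
  finally have eq: "emeasure lborel E = ennreal (c powr real DIM('a)) * emeasure lborel {x. c *\<^sub>R x \<in> E}" by simp
  then have "ennreal (c powr (- real DIM('a))) * emeasure lborel E
      = ennreal (c powr (- real DIM('a)) * c powr real DIM('a)) * emeasure lborel {x. c *\<^sub>R x \<in> E}"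
    by (simp add: ennreal_mult' mult.assoc)
  also have "c powr (- real DIM('a)) * c powr real DIM('a) = 1" using c by (simp add: powr_add[symmetric])
  finally have eq2: "emeasure lborel {x. c *\<^sub>R x \<in> E} = ennreal (c powr (- real DIM('a))) * emeasure lborel E" by simp
  show 1: "emeasure lborel {x. c *\<^sub>R x \<in> E} < \<infinity>"
    unfolding eq2 using fin by (simp add: ennreal_mult_less_top)
  show "measure lborel {x. c *\<^sub>R x \<in> E} = c powr (- real DIM('a)) * measure lborel E"
    unfolding measure_def eq2 by (simp add: enn2real_mult)
qed

lemma nnheat_scale:
  fixes f :: "real ^ 'n \<Rightarrow> ennreal"
  assumes [measurable]: "f \<in> borel_measurable borel" and t: "t > 0"
  shows "nnheat t f (sqrt t *\<^sub>R x) = nnheat 1 (\<lambda>y. f (sqrt t *\<^sub>R y)) x"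
proof -
  have "nnheat t f (sqrt t *\<^sub>R x) = ennreal (sqrt t powr real DIM(real ^ 'n)) *
      (\<integral>\<^sup>+y. ennreal (heat_kernel t (sqrt t *\<^sub>R x - sqrt t *\<^sub>R y)) * f (sqrt t *\<^sub>R y) \<partial>lborel)"
    unfolding nnheat_def by (rule nn_integral_scaleR) (use t in auto)
  also have "\<dots> = (\<integral>\<^sup>+y. ennreal (sqrt t powr real DIM(real ^ 'n)) * (ennreal (heat_kernel t (sqrt t *\<^sub>R x - sqrt t *\<^sub>R y)) * f (sqrt t *\<^sub>R y)) \<partial>lborel)"
    by (rule nn_integral_cmult[symmetric]) measurable
  also have "\<dots> = nnheat 1 (\<lambda>y. f (sqrt t *\<^sub>R y)) x"
    unfolding nnheat_def
  proof (rule nn_integral_cong)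
    fix y :: "real ^ 'n"
    have "norm (sqrt t *\<^sub>R x - sqrt t *\<^sub>R y) = sqrt t * norm (x - y)"
      using t by (simp add: scaleR_diff_right[symmetric] del: scaleR_diff_right)
    then have "(norm (sqrt t *\<^sub>R x - sqrt t *\<^sub>R y))\<^sup>2 = t * (norm (x - y))\<^sup>2"
      using t by (simp add: power_mult_distrib)
    then have "sqrt t powr real DIM(real ^ 'n) * heat_kernel t (sqrt t *\<^sub>R x - sqrt t *\<^sub>R y) = heat_kernel 1 (x - y)"
      using t by (simp add: heat_kernel_def powr_mult powr_half_sqrt[symmetric] powr_powr powr_minus)
    then show "ennreal (sqrt t powr real DIM(real ^ 'n)) * (ennreal (heat_kernel t (sqrt t *\<^sub>R x - sqrt t *\<^sub>R y)) * f (sqrt t *\<^sub>R y))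
       = ennreal (heat_kernel 1 (x - y)) * f (sqrt t *\<^sub>R y)"
      by (simp add: mult.assoc[symmetric] ennreal_mult'[symmetric])
  qed
  finally show ?thesis .
qed

text \<open>Dilation by c = sqrt t reduces to time 1. The weighted bound of weight \<sigma> and
  exponent \<mu> is multiplied by c^{-\<sigma> - d\<mu>} when f(x) is replaced by f(cx); applying
  this before and after the flow produces the power of t, which is therefore forced by
  scaling.\<close>

lemma heat_marc_bound:
  fixes \<sigma>1 \<sigma>2 \<mu>1 \<mu>2 :: real
  assumes \<mu>1: "0 \<le> \<mu>1" "\<mu>1 \<le> 1" and \<mu>2: "0 \<le> \<mu>2" "\<mu>2 \<le> 1" and \<sigma>: "\<sigma>2 \<le> \<sigma>1" "- real CARD('n) < \<sigma>2"
    and s1: "\<sigma>1 / CARD('n) + \<mu>1 < 1" and s2: "0 \<le> \<sigma>2 / CARD('n) + \<mu>2"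
    and s12: "\<sigma>2 / CARD('n) + \<mu>2 < \<sigma>1 / CARD('n) + \<mu>1"
  obtains C where "C > 0" "\<And>(f :: real ^ 'n \<Rightarrow> ennreal) B t. f \<in> borel_measurable borel \<Longrightarrow> 0 \<le> B \<Longrightarrow> 0 < t \<Longrightarrow>
    marc_bound \<mu>1 B (\<lambda>y. ennreal (norm y powr \<sigma>1) * f y) \<Longrightarrow>
    marc_bound \<mu>2 (C * t powr (- (CARD('n) / 2 * ((\<sigma>1 / CARD('n) + \<mu>1) - (\<sigma>2 / CARD('n) + \<mu>2)))) * B)
      (\<lambda>x. ennreal (norm x powr \<sigma>2) * nnheat t f x)"
proof -
  define d where "d = real CARD('n)"
  have d: "d > 0" by (simp add: d_def)
  have dim: "real DIM(real ^ 'n) = d" by (simp add: d_def)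
  obtain C where C: "C > 0" "\<And>(f :: real ^ 'n \<Rightarrow> ennreal) B. f \<in> borel_measurable borel \<Longrightarrow> 0 \<le> B \<Longrightarrow>
    marc_bound \<mu>1 B (\<lambda>y. ennreal (norm y powr \<sigma>1) * f y) \<Longrightarrow>
    marc_bound \<mu>2 (C * B) (\<lambda>x. ennreal (norm x powr \<sigma>2) * nnheat 1 f x)"
    by (rule heat_marc_bound_time_1[OF assms]) (rule that)
  show ?thesis
  proof (rule that[OF C(1)])
    fix f :: "real ^ 'n \<Rightarrow> ennreal" and B t :: real
    assume f[measurable]: "f \<in> borel_measurable borel" and B: "0 \<le> B" and t: "0 < t"
      and mf: "marc_bound \<mu>1 B (\<lambda>y. ennreal (norm y powr \<sigma>1) * f y)"
    define c where "c = sqrt t"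
    have c: "c > 0" using t by (simp add: c_def)
    define g where "g = (\<lambda>y. f (c *\<^sub>R y))"
    have g[measurable]: "g \<in> borel_measurable borel" unfolding g_def by measurable
    have mg: "marc_bound \<mu>1 (c powr (- \<sigma>1 - d * \<mu>1) * B) (\<lambda>y. ennreal (norm y powr \<sigma>1) * g y)"
    proof (rule marc_bound_borelI)
      fix F :: "(real ^ 'n) set" assume F[measurable]: "F \<in> sets borel" and Ff: "emeasure lborel F < \<infinity>"
      define F' where "F' = {x. (1 / c) *\<^sub>R x \<in> F}"
      have [measurable]: "F' \<in> sets borel" unfolding F'_def by measurable
      have F': "emeasure lborel F' < \<infinity>" "measure lborel F' = c powr d * measure lborel F"
        using emeasure_scaleR_vimage[of F "1 / c"] c Ff unfolding F'_def dim
        by (auto simp: powr_divide powr_minus)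
      have "(\<integral>\<^sup>+y\<in>F'. ennreal (norm y powr \<sigma>1) * f y \<partial>lborel)
          = ennreal (c powr d) * (\<integral>\<^sup>+y. ennreal (norm (c *\<^sub>R y) powr \<sigma>1) * f (c *\<^sub>R y) * indicator F' (c *\<^sub>R y) \<partial>lborel)"
        using nn_integral_scaleR[of "\<lambda>y. ennreal (norm y powr \<sigma>1) * f y * indicator F' y" c] c unfolding dim by simp
      also have "(\<integral>\<^sup>+y. ennreal (norm (c *\<^sub>R y) powr \<sigma>1) * f (c *\<^sub>R y) * indicator F' (c *\<^sub>R y) \<partial>lborel)
          = (\<integral>\<^sup>+y. ennreal (c powr \<sigma>1) * (ennreal (norm y powr \<sigma>1) * g y * indicator F y) \<partial>lborel)"
        using c by (intro nn_integral_cong) (auto simp: F'_def g_def indicator_def powr_mult ennreal_mult' mult.assoc)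
      also have "\<dots> = ennreal (c powr \<sigma>1) * (\<integral>\<^sup>+y\<in>F. ennreal (norm y powr \<sigma>1) * g y \<partial>lborel)"
        by (rule nn_integral_cmult) measurable
      finally have eq: "(\<integral>\<^sup>+y\<in>F'. ennreal (norm y powr \<sigma>1) * f y \<partial>lborel)
          = ennreal (c powr d * c powr \<sigma>1) * (\<integral>\<^sup>+y\<in>F. ennreal (norm y powr \<sigma>1) * g y \<partial>lborel)"
        by (simp add: ennreal_mult' mult.assoc)
      have "(\<integral>\<^sup>+y\<in>F. ennreal (norm y powr \<sigma>1) * g y \<partial>lborel)
          = ennreal (c powr (-d - \<sigma>1)) * (ennreal (c powr d * c powr \<sigma>1) * (\<integral>\<^sup>+y\<in>F. ennreal (norm y powr \<sigma>1) * g y \<partial>lborel))"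
        using c by (simp add: mult.assoc[symmetric] ennreal_mult'[symmetric] powr_add[symmetric])
      also have "\<dots> \<le> ennreal (c powr (-d - \<sigma>1)) * ennreal (B * measure lborel F' powr (1 - \<mu>1))"
        unfolding eq[symmetric] using marc_boundD[OF mf lmeasurable_borel[OF _ F'(1)]]
        by (intro mult_left_mono) (auto simp: nn_integral_lebesgue_borel_set)
      also have "\<dots> = ennreal (c powr (-d - \<sigma>1) * (B * (c powr d * measure lborel F) powr (1 - \<mu>1)))"
        using B by (simp add: F' ennreal_mult'[symmetric])
      also have "c powr (-d - \<sigma>1) * (B * (c powr d * measure lborel F) powr (1 - \<mu>1))
          = c powr (- \<sigma>1 - d * \<mu>1) * B * measure lborel F powr (1 - \<mu>1)"
        using c by (simp add: powr_mult powr_powr powr_add[symmetric] mult_ac)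
          (simp add: mult.left_commute[of _ "measure lborel F powr (1 - \<mu>1)"] powr_add[symmetric] algebra_simps)
      finally show "(\<integral>\<^sup>+y\<in>F. ennreal (norm y powr \<sigma>1) * g y \<partial>lborel) \<le> ennreal (c powr (- \<sigma>1 - d * \<mu>1) * B * measure lborel F powr (1 - \<mu>1))" .
    qed measurable
    have mh: "marc_bound \<mu>2 (C * (c powr (- \<sigma>1 - d * \<mu>1) * B)) (\<lambda>x. ennreal (norm x powr \<sigma>2) * nnheat 1 g x)"
      using B by (intro C(2) g mg) auto
    have final: "marc_bound \<mu>2 (C * c powr (\<sigma>2 + d * \<mu>2 - \<sigma>1 - d * \<mu>1) * B) (\<lambda>x. ennreal (norm x powr \<sigma>2) * nnheat t f x)"
    proof (rule marc_bound_borelI)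
      fix E :: "(real ^ 'n) set" assume E[measurable]: "E \<in> sets borel" and Ef: "emeasure lborel E < \<infinity>"
      define E' where "E' = {x. c *\<^sub>R x \<in> E}"
      have [measurable]: "E' \<in> sets borel" unfolding E'_def by measurable
      have E': "emeasure lborel E' < \<infinity>" "measure lborel E' = c powr (-d) * measure lborel E"
        using emeasure_scaleR_vimage[of E c] c Ef unfolding E'_def dim by auto
      have "(\<integral>\<^sup>+x\<in>E. ennreal (norm x powr \<sigma>2) * nnheat t f x \<partial>lborel)
          = ennreal (c powr d) * (\<integral>\<^sup>+x. ennreal (norm (c *\<^sub>R x) powr \<sigma>2) * nnheat t f (c *\<^sub>R x) * indicator E (c *\<^sub>R x) \<partial>lborel)"
        using nn_integral_scaleR[of "\<lambda>x. ennreal (norm x powr \<sigma>2) * nnheat t f x * indicator E x" c] c unfolding dim by simp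
      also have "(\<integral>\<^sup>+x. ennreal (norm (c *\<^sub>R x) powr \<sigma>2) * nnheat t f (c *\<^sub>R x) * indicator E (c *\<^sub>R x) \<partial>lborel)
          = (\<integral>\<^sup>+x. ennreal (c powr \<sigma>2) * (ennreal (norm x powr \<sigma>2) * nnheat 1 g x * indicator E' x) \<partial>lborel)"
        using c t nnheat_scale[OF f t]
        by (intro nn_integral_cong) (auto simp: E'_def g_def c_def indicator_def powr_mult ennreal_mult' mult.assoc)
      also have "\<dots> = ennreal (c powr \<sigma>2) * (\<integral>\<^sup>+x\<in>E'. ennreal (norm x powr \<sigma>2) * nnheat 1 g x \<partial>lborel)"
        by (rule nn_integral_cmult) measurable
      also have "\<dots> \<le> ennreal (c powr \<sigma>2) * ennreal (C * (c powr (- \<sigma>1 - d * \<mu>1) * B) * measure lborel E' powr (1 - \<mu>2))"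
        using marc_boundD[OF mh lmeasurable_borel[OF _ E'(1)]]
        by (intro mult_left_mono) (auto simp: nn_integral_lebesgue_borel_set)
      finally have "(\<integral>\<^sup>+x\<in>E. ennreal (norm x powr \<sigma>2) * nnheat t f x \<partial>lborel)
          \<le> ennreal (c powr d) * (ennreal (c powr \<sigma>2) * ennreal (C * (c powr (- \<sigma>1 - d * \<mu>1) * B) * measure lborel E' powr (1 - \<mu>2)))"
        by (simp add: mult_left_mono)
      also have "\<dots> = ennreal (c powr d * (c powr \<sigma>2 * (C * (c powr (- \<sigma>1 - d * \<mu>1) * B) * (c powr (-d) * measure lborel E) powr (1 - \<mu>2))))"
        using B C(1) by (simp add: E' ennreal_mult'[symmetric])
      also have "c powr d * (c powr \<sigma>2 * (C * (c powr (- \<sigma>1 - d * \<mu>1) * B) * (c powr (-d) * measure lborel E) powr (1 - \<mu>2)))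
          = C * (c powr d * c powr \<sigma>2 * c powr (- \<sigma>1 - d * \<mu>1) * c powr (- d * (1 - \<mu>2))) * B * measure lborel E powr (1 - \<mu>2)"
        using c by (simp add: powr_mult powr_powr)
      also have "c powr d * c powr \<sigma>2 * c powr (- \<sigma>1 - d * \<mu>1) * c powr (- d * (1 - \<mu>2)) = c powr (\<sigma>2 + d * \<mu>2 - \<sigma>1 - d * \<mu>1)"
        by (simp only: powr_add[symmetric]) (simp add: algebra_simps)
      finally show "(\<integral>\<^sup>+x\<in>E. ennreal (norm x powr \<sigma>2) * nnheat t f x \<partial>lborel)
         \<le> ennreal (C * c powr (\<sigma>2 + d * \<mu>2 - \<sigma>1 - d * \<mu>1) * B * measure lborel E powr (1 - \<mu>2))" .
    qed measurable
    have "c powr (\<sigma>2 + d * \<mu>2 - \<sigma>1 - d * \<mu>1) = t powr ((\<sigma>2 + d * \<mu>2 - \<sigma>1 - d * \<mu>1) / 2)"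
      using t by (simp add: c_def powr_half_sqrt[symmetric] powr_powr)
    also have "(\<sigma>2 + d * \<mu>2 - \<sigma>1 - d * \<mu>1) / 2 = - (CARD('n) / 2 * ((\<sigma>1 / CARD('n) + \<mu>1) - (\<sigma>2 / CARD('n) + \<mu>2)))"
      using d unfolding d_def[symmetric] by (simp add: field_simps)
    finally show "marc_bound \<mu>2 (C * t powr (- (CARD('n) / 2 * ((\<sigma>1 / CARD('n) + \<mu>1) - (\<sigma>2 / CARD('n) + \<mu>2)))) * B)
      (\<lambda>x. ennreal (norm x powr \<sigma>2) * nnheat t f x)"
      using final by simp
  qed
qed

section \<open>Semigroup property and Duhamel integrals\<close>

lemma heat_kernel_eq_prod:
  assumes t: "t > 0"
  shows "heat_kernel t (x :: real ^ 'n) = (\<Prod>b\<in>Basis. normal_density 0 (sqrt (2 * t)) (x \<bullet> b))"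
proof -
  have "(\<Prod>b\<in>Basis. normal_density 0 (sqrt (2 * t)) (x \<bullet> b))
      = (\<Prod>b\<in>(Basis :: (real ^ 'n) set). 1 / sqrt (4 * pi * t)) * (\<Prod>b\<in>Basis. exp (- (x \<bullet> b)\<^sup>2 / (4 * t)))"
    unfolding prod.distrib[symmetric] using t by (intro prod.cong refl) (simp add: normal_density_def mult_ac)
  also have "(\<Prod>b\<in>Basis. exp (- (x \<bullet> b)\<^sup>2 / (4 * t))) = exp (\<Sum>b\<in>Basis. - (x \<bullet> b)\<^sup>2 / (4 * t))"
    by (simp add: exp_sum)
  also have "(\<Sum>b\<in>Basis. - (x \<bullet> b)\<^sup>2 / (4 * t)) = - (norm x)\<^sup>2 / (4 * t)"
  proof -
    have "(norm x)\<^sup>2 = (\<Sum>b\<in>Basis. (x \<bullet> b)\<^sup>2)"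
      unfolding power2_norm_eq_inner by (subst euclidean_inner) (simp add: power2_eq_square)
    then show ?thesis by (simp add: sum_divide_distrib[symmetric] sum_negf)
  qed
  also have "(\<Prod>b\<in>(Basis :: (real ^ 'n) set). 1 / sqrt (4 * pi * t)) = (4 * pi * t) powr (- (real CARD('n) / 2))"
  proof -
    have p: "4 * pi * t > 0" using t by simp
    have "1 / sqrt (4 * pi * t) = (4 * pi * t) powr (- (1 / 2))"
      using p by (simp add: powr_minus powr_half_sqrt inverse_eq_divide)
    then have "(\<Prod>b\<in>(Basis :: (real ^ 'n) set). 1 / sqrt (4 * pi * t)) = ((4 * pi * t) powr (- (1 / 2))) ^ CARD('n)" by simp
    also have "\<dots> = (4 * pi * t) powr (real CARD('n) * (- (1 / 2)))" by (rule powr_power) (use p in auto)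
    finally show ?thesis by simp
  qed
  finally show ?thesis by (simp add: heat_kernel_def)
qed

lemma normal_density_convolution:
  assumes "\<sigma> > 0" "\<tau> > 0"
  shows "(\<integral>\<^sup>+r. ennreal (normal_density 0 \<sigma> (x - r) * normal_density 0 \<tau> (r - z)) \<partial>lborel)
    = ennreal (normal_density 0 (sqrt (\<sigma>\<^sup>2 + \<tau>\<^sup>2)) (x - z))"
proof -
  have "(\<integral>\<^sup>+r. ennreal (normal_density 0 \<sigma> (x - r) * normal_density 0 \<tau> (r - z)) \<partial>lborel)
      = (\<integral>\<^sup>+r. ennreal (normal_density 0 \<sigma> ((x - z) - r) * normal_density 0 \<tau> r) \<partial>lborel)"
    by (subst nn_integral_real_affine[where c=1 and t=z]) (auto simp: algebra_simps)
  also have "\<dots> = ennreal (normal_density 0 (sqrt (\<sigma>\<^sup>2 + \<tau>\<^sup>2)) (x - z))"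
    using fun_cong[OF conv_normal_density_zero_mean[OF assms], of "x - z"] by simp
  finally show ?thesis .
qed

text \<open>Both kernels factor over the coordinates into centred normal densities of variances 2s
  and 2t, so this is the convolution of normal densities in each coordinate, where the variances
  add.\<close>

lemma heat_kernel_convolution:
  fixes x z :: "real ^ 'n"
  assumes s: "s > 0" and t: "t > 0"
  shows "(\<integral>\<^sup>+y. ennreal (heat_kernel s (x - y) * heat_kernel t (y - z)) \<partial>lborel) = ennreal (heat_kernel (s + t) (x - z))"
proof -
  let ?f = "\<lambda>b r. ennreal (normal_density 0 (sqrt (2 * s)) (x \<bullet> b - r) * normal_density 0 (sqrt (2 * t)) (r - z \<bullet> b))"
  have "(\<integral>\<^sup>+y. ennreal (heat_kernel s (x - y) * heat_kernel t (y - z)) \<partial>lborel)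
      = (\<integral>\<^sup>+y. (\<Prod>b\<in>Basis. ?f b (y \<bullet> b)) \<partial>lborel)"
    using s t by (intro nn_integral_cong)
      (simp add: heat_kernel_eq_prod prod.distrib[symmetric] prod_ennreal inner_diff_left)
  also have "\<dots> = (\<Prod>b\<in>Basis. (\<integral>\<^sup>+r. ?f b r \<partial>lborel))"
    by (rule nn_integral_lborel_prod) auto
  also have "\<dots> = (\<Prod>b\<in>Basis. ennreal (normal_density 0 (sqrt (2 * (s + t))) ((x - z) \<bullet> b)))"
    using s t by (intro prod.cong refl) (subst normal_density_convolution, auto simp: inner_diff_left algebra_simps)
  also have "\<dots> = ennreal (heat_kernel (s + t) (x - z))"
    using s t by (simp add: heat_kernel_eq_prod prod_ennreal)
  finally show ?thesis .
qed

lemma nnheat_semigroup: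
  fixes f :: "real ^ 'n \<Rightarrow> ennreal"
  assumes s: "s > 0" and t: "t > 0" and [measurable]: "f \<in> borel_measurable borel"
  shows "nnheat s (nnheat t f) x = nnheat (s + t) f x"
proof -
  have "nnheat s (nnheat t f) x = (\<integral>\<^sup>+y. (\<integral>\<^sup>+z. ennreal (heat_kernel s (x - y)) * (ennreal (heat_kernel t (y - z)) * f z) \<partial>lborel) \<partial>lborel)"
    unfolding nnheat_def by (intro nn_integral_cong nn_integral_cmult[symmetric]) measurable
  also have "\<dots> = (\<integral>\<^sup>+z. (\<integral>\<^sup>+y. ennreal (heat_kernel s (x - y)) * (ennreal (heat_kernel t (y - z)) * f z) \<partial>lborel) \<partial>lborel)"
    by (rule pair_sigma_finite.Fubini') (auto intro: pair_sigma_finite.intro sigma_finite_lborel)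
  also have "\<dots> = (\<integral>\<^sup>+z. (\<integral>\<^sup>+y. ennreal (heat_kernel s (x - y) * heat_kernel t (y - z)) * f z \<partial>lborel) \<partial>lborel)"
    by (simp add: ennreal_mult' mult.assoc)
  also have "\<dots> = nnheat (s + t) f x"
    unfolding nnheat_def using s t
    by (intro nn_integral_cong) (simp add: nn_integral_multc heat_kernel_convolution)
  finally show ?thesis .
qed

text \<open>On Borel functions the heat semigroup is jointly measurable in time and space, which is not available for
Lebesgue measurable representatives.\<close>

definition heatB :: "real \<Rightarrow> (real ^ 'n \<Rightarrow> 'c::euclidean_space) \<Rightarrow> real ^ 'n \<Rightarrow> 'c" where
  "heatB t f x = (LINT y|lborel. heat_kernel t (x - y) *\<^sub>R f y)"

lemma heat_eq_heatB:
  assumes f: "f \<in> borel_measurable lebesgue" and f': "f' \<in> borel_measurable borel"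
    and eq: "AE y in lebesgue. f y = f' y" and t: "t > 0"
  shows "heat t f x = heatB t f' x"
proof -
  have k: "(\<lambda>y. heat_kernel t (x - y)) \<in> borel_measurable lebesgue"
    by (rule measurable_completion) measurable
  have "f' \<in> borel_measurable lebesgue" by (rule measurable_completion) (use f' in simp)
  then have "heat t f x = (LINT y|lebesgue. heat_kernel t (x - y) *\<^sub>R f' y)"
    unfolding heat_def using t eq f k
    by (auto intro!: integral_cong_AE borel_measurable_scaleR)
  also have "\<dots> = heatB t f' x" unfolding heatB_def using f' by (intro integral_completion) measurable
  finally show ?thesis .
qed

lemma nnheat_finite_of_converges:
  assumes f: "f \<in> borel_measurable lebesgue" and f': "f' \<in> borel_measurable borel"
    and eq: "AE y in lebesgue. f y = f' y" and conv: "heat_converges t f x"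
  shows "nnheat t (\<lambda>y. ennreal (norm (f' y))) x < \<infinity>"
proof -
  have "(\<integral>\<^sup>+y. ennreal (norm (heat_kernel t (x - y) *\<^sub>R f y)) \<partial>lebesgue) < \<infinity>"
    using conv unfolding heat_converges_def by (simp add: integrable_iff_bounded)
  also have "(\<integral>\<^sup>+y. ennreal (norm (heat_kernel t (x - y) *\<^sub>R f y)) \<partial>lebesgue)
      = (\<integral>\<^sup>+y. ennreal (norm (heat_kernel t (x - y) *\<^sub>R f' y)) \<partial>lebesgue)"
    using eq by (intro nn_integral_cong_AE) (auto elim!: eventually_mono)
  also have "\<dots> = nnheat t (\<lambda>y. ennreal (norm (f' y))) x"
    by (simp add: nnheat_def nn_integral_completion ennreal_mult')
  finally show ?thesis .
qed

lemma heatB_measurable [measurable]: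
  assumes [measurable]: "f \<in> borel_measurable borel"
  shows "heatB t f \<in> borel_measurable borel"
  unfolding heatB_def[abs_def] by measurable

lemma integrable_heatB:
  fixes f :: "real ^ 'n \<Rightarrow> 'c::euclidean_space"
  assumes [measurable]: "f \<in> borel_measurable borel" and "nnheat t (\<lambda>y. ennreal (norm (f y))) x < \<infinity>"
  shows "integrable lborel (\<lambda>y. heat_kernel t (x - y) *\<^sub>R f y)"
proof (rule integrableI_bounded)
  show "(\<integral>\<^sup>+y. ennreal (norm (heat_kernel t (x - y) *\<^sub>R f y)) \<partial>lborel) < \<infinity>"
    using assms(2) by (simp add: nnheat_def ennreal_mult')
qed measurable

text \<open>Valid without integrability, since the Bochner integral is then 0 by convention. This is
  what allows majorants to be written down before convergence is known.\<close>

lemma norm_integral_le_nn_integral: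
  fixes f :: "'a \<Rightarrow> 'b::{banach, second_countable_topology}"
  shows "ennreal (norm (integral\<^sup>L M f)) \<le> (\<integral>\<^sup>+x. ennreal (norm (f x)) \<partial>M)"
  by (cases "integrable M f") (auto intro: integral_norm_bound_ennreal simp: not_integrable_integral_eq)

lemma norm_heatB_le: "ennreal (norm (heatB t f x)) \<le> nnheat t (\<lambda>y. ennreal (norm (f y))) x"
  using norm_integral_le_nn_integral[of lborel "\<lambda>y. heat_kernel t (x - y) *\<^sub>R f y"]
  by (simp add: heatB_def nnheat_def ennreal_mult')

lemma nnheat_mono: "(\<And>y. f y \<le> g y) \<Longrightarrow> nnheat t f x \<le> nnheat t g x"
  unfolding nnheat_def by (intro nn_integral_mono mult_left_mono) auto

text \<open>Fubini is justified by the semigroup law of the majorant: the double integral of the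
  norms is exactly the flow of the norm of \<open>f\<close> at time s + t, which is finite by
  assumption.\<close>

lemma heatB_semigroup:
  fixes f :: "real ^ 'n \<Rightarrow> 'c::euclidean_space"
  assumes s: "s > 0" and t: "t > 0" and [measurable]: "f \<in> borel_measurable borel"
    and fin: "nnheat (s + t) (\<lambda>y. ennreal (norm (f y))) x < \<infinity>"
  shows "heatB s (heatB t f) x = heatB (s + t) f x"
proof -
  have conv: "(LINT y|lborel. heat_kernel s (x - y) * heat_kernel t (y - z)) = heat_kernel (s + t) (x - z)" for z
    using heat_kernel_convolution[OF s t, of x z]
    by (subst integral_eq_nn_integral) (auto simp: enn2real_ennreal)
  have int: "integrable (lborel \<Otimes>\<^sub>M lborel) (\<lambda>(z, y). heat_kernel s (x - y) *\<^sub>R (heat_kernel t (y - z) *\<^sub>R f z))"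
  proof (rule integrableI_bounded)
    show "(\<lambda>(z, y). heat_kernel s (x - y) *\<^sub>R (heat_kernel t (y - z) *\<^sub>R f z)) \<in> borel_measurable (lborel \<Otimes>\<^sub>M lborel)"
      by measurable
    have "(\<integral>\<^sup>+p. ennreal (norm (case p of (z, y) \<Rightarrow> heat_kernel s (x - y) *\<^sub>R (heat_kernel t (y - z) *\<^sub>R f z))) \<partial>(lborel \<Otimes>\<^sub>M lborel))
        = (\<integral>\<^sup>+z. (\<integral>\<^sup>+y. ennreal (heat_kernel s (x - y) * heat_kernel t (y - z)) * ennreal (norm (f z)) \<partial>lborel) \<partial>lborel)"
      by (subst lborel.nn_integral_fst[symmetric]) (auto simp: ennreal_mult' mult_ac)
    also have "\<dots> = nnheat (s + t) (\<lambda>y. ennreal (norm (f y))) x"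
      unfolding nnheat_def using s t by (intro nn_integral_cong) (simp add: nn_integral_multc heat_kernel_convolution)
    finally show "(\<integral>\<^sup>+p. ennreal (norm (case p of (z, y) \<Rightarrow> heat_kernel s (x - y) *\<^sub>R (heat_kernel t (y - z) *\<^sub>R f z))) \<partial>(lborel \<Otimes>\<^sub>M lborel)) < \<infinity>"
      using fin by simp
  qed
  have "heatB s (heatB t f) x = (LINT y|lborel. (LINT z|lborel. heat_kernel s (x - y) *\<^sub>R (heat_kernel t (y - z) *\<^sub>R f z)))"
    unfolding heatB_def by (intro Bochner_Integration.integral_cong refl) (simp del: scaleR_scaleR)
  also have "\<dots> = (LINT z|lborel. (LINT y|lborel. heat_kernel s (x - y) *\<^sub>R (heat_kernel t (y - z) *\<^sub>R f z)))"
    by (rule lborel_pair.Fubini_integral[OF int])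
  also have "\<dots> = (LINT z|lborel. heat_kernel (s + t) (x - z) *\<^sub>R f z)"
  proof (intro Bochner_Integration.integral_cong refl)
    fix z :: "real ^ 'n"
    have i: "integrable lborel (\<lambda>y. heat_kernel s (x - y) * heat_kernel t (y - z))"
      using heat_kernel_convolution[OF s t, of x z] by (intro integrableI_nonneg) auto
    have "(LINT y|lborel. heat_kernel s (x - y) *\<^sub>R (heat_kernel t (y - z) *\<^sub>R f z))
        = (LINT y|lborel. (heat_kernel s (x - y) * heat_kernel t (y - z)) *\<^sub>R f z)" by simp
    also have "\<dots> = (LINT y|lborel. heat_kernel s (x - y) * heat_kernel t (y - z)) *\<^sub>R f z"
      by (cases "f z = 0") (auto intro!: integral_scaleR_left i)
    finally show "(LINT y|lborel. heat_kernel s (x - y) *\<^sub>R (heat_kernel t (y - z) *\<^sub>R f z)) = heat_kernel (s + t) (x - z) *\<^sub>R f z"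
      by (simp add: conv)
  qed
  finally show ?thesis by (simp add: heatB_def)
qed

lemma nnheat_joint_measurable [measurable (raw)]:
  fixes h :: "'b \<Rightarrow> real ^ 'n \<Rightarrow> ennreal"
  assumes [measurable]: "f \<in> borel_measurable M" "g \<in> borel_measurable M"
    "(\<lambda>p. h (fst p) (snd p)) \<in> borel_measurable (M \<Otimes>\<^sub>M borel)"
  shows "(\<lambda>p. nnheat (f p) (h p) (g p)) \<in> borel_measurable M"
proof -
  have "(\<lambda>q. h (fst q) (snd q)) \<in> borel_measurable (M \<Otimes>\<^sub>M lborel)" by measurable
  then have [measurable]: "(\<lambda>(p, y). h p y) \<in> borel_measurable (M \<Otimes>\<^sub>M lborel)" by (simp add: case_prod_beta')
  show ?thesis unfolding nnheat_def by measurable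
qed

lemma heatB_joint_measurable:
  fixes h :: "'b \<Rightarrow> real ^ 'n \<Rightarrow> 'c::euclidean_space"
  assumes [measurable]: "f \<in> borel_measurable M" "g \<in> borel_measurable M"
    "(\<lambda>p. h (fst p) (snd p)) \<in> borel_measurable (M \<Otimes>\<^sub>M borel)"
  shows "(\<lambda>p. heatB (f p) (h p) (g p)) \<in> borel_measurable M"
proof -
  have "(\<lambda>q. h (fst q) (snd q)) \<in> borel_measurable (M \<Otimes>\<^sub>M lborel)" by measurable
  then have [measurable]: "(\<lambda>(p, y). h p y) \<in> borel_measurable (M \<Otimes>\<^sub>M lborel)" by (simp add: case_prod_beta')
  show ?thesis unfolding heatB_def by measurable
qed

section \<open>Duhamel integrals and restarting\<close>

definition duhamel_nn :: "(real \<Rightarrow> real ^ 'n \<Rightarrow> 'c::euclidean_space) \<Rightarrow> real \<Rightarrow> real \<Rightarrow> real ^ 'n \<Rightarrow> ennreal" where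
  "duhamel_nn n a t x = (\<integral>\<^sup>+\<tau>\<in>{a<..<t}. nnheat (t - \<tau>) (\<lambda>y. ennreal (norm (n \<tau> y))) x \<partial>lborel)"

text \<open>The end \<open>b\<close> of the source interval is separate from the time
  \<open>t\<close> of evaluation: restarting at a time a < t involves the sources up to a, seen at
  time t.\<close>

definition duhamel :: "(real \<Rightarrow> real ^ 'n \<Rightarrow> 'c::euclidean_space) \<Rightarrow> real \<Rightarrow> real \<Rightarrow> real \<Rightarrow> real ^ 'n \<Rightarrow> 'c" where
  "duhamel n a b t x = (LINT \<tau>:{a<..<b}|lborel. heatB (t - \<tau>) (n \<tau>) x)"

context
  fixes n :: "real \<Rightarrow> real ^ 'n \<Rightarrow> 'c::euclidean_space"
  assumes n [measurable]: "(\<lambda>(\<tau>, x). n \<tau> x) \<in> borel_measurable (borel \<Otimes>\<^sub>M borel)"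
begin

lemma nnheat_source_measurable [measurable]:
  "(\<lambda>p. nnheat (t - fst p) (\<lambda>y. ennreal (norm (n (fst p) y))) (snd p)) \<in> borel_measurable (borel \<Otimes>\<^sub>M borel)"
  by measurable

lemma heatB_source_measurable [measurable]:
  "(\<lambda>p. heatB (t - fst p) (n (fst p)) (snd p)) \<in> borel_measurable (borel \<Otimes>\<^sub>M borel)"
  by (rule heatB_joint_measurable) measurable

lemma source_slice_measurable [measurable]: "n \<tau> \<in> borel_measurable borel"
  using measurable_Pair2[OF n, of \<tau>] by simp

lemma duhamel_nn_measurable [measurable]: "duhamel_nn n a t \<in> borel_measurable borel"
proof -
  have "(\<lambda>p. nnheat (t - fst p) (\<lambda>y. ennreal (norm (n (fst p) y))) (snd p) * indicator {a<..<t} (fst p)) \<in> borel_measurable (borel \<Otimes>\<^sub>M borel)"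
    by measurable
  then have [measurable]: "(\<lambda>(x, \<tau>). nnheat (t - \<tau>) (\<lambda>y. ennreal (norm (n \<tau> y))) x * indicator {a<..<t} \<tau>) \<in> borel_measurable (borel \<Otimes>\<^sub>M lborel)"
    by (subst measurable_pair_swap_iff) (simp add: case_prod_beta' cong: measurable_cong_sets)
  show ?thesis unfolding duhamel_nn_def[abs_def] by measurable
qed

lemma duhamel_measurable [measurable]: "duhamel n a b t \<in> borel_measurable borel"
proof -
  have "(\<lambda>p. indicator {a<..<b} (fst p) *\<^sub>R heatB (t - fst p) (n (fst p)) (snd p)) \<in> borel_measurable (borel \<Otimes>\<^sub>M borel)"
    by measurable
  then have [measurable]: "(\<lambda>(x, \<tau>). indicator {a<..<b} \<tau> *\<^sub>R heatB (t - \<tau>) (n \<tau>) x) \<in> borel_measurable (borel \<Otimes>\<^sub>M lborel)"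
    by (subst measurable_pair_swap_iff) (simp add: case_prod_beta' cong: measurable_cong_sets)
  show ?thesis unfolding duhamel_def[abs_def] set_lebesgue_integral_def by measurable
qed

lemma norm_duhamel_le:
  "b \<le> t \<Longrightarrow> ennreal (norm (duhamel n a b t x)) \<le> (\<integral>\<^sup>+\<tau>\<in>{a<..<b}. nnheat (t - \<tau>) (\<lambda>y. ennreal (norm (n \<tau> y))) x \<partial>lborel)"
  unfolding duhamel_def set_lebesgue_integral_def
  by (rule order_trans[OF norm_integral_le_nn_integral])
     (auto intro!: nn_integral_mono norm_heatB_le simp: indicator_def)

lemma duhamel_split:
  assumes ab: "0 \<le> a" "a < t" and fin: "duhamel_nn n 0 t x < \<infinity>"
  shows "duhamel n 0 t t x = duhamel n 0 a t x + duhamel n a t t x"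
proof -
  have [measurable]: "(\<lambda>\<tau>. heatB (t - \<tau>) (n \<tau>) x) \<in> borel_measurable borel"
    using measurable_compose[OF measurable_Pair2' heatB_source_measurable[of t], of x] by simp
  have int: "set_integrable lborel {0<..<t} (\<lambda>\<tau>. heatB (t - \<tau>) (n \<tau>) x)"
    unfolding set_integrable_def
  proof (rule integrableI_bounded)
    have "(\<integral>\<^sup>+\<tau>. ennreal (norm (indicator {0<..<t} \<tau> *\<^sub>R heatB (t - \<tau>) (n \<tau>) x)) \<partial>lborel) \<le> duhamel_nn n 0 t x"
      unfolding duhamel_nn_def by (auto intro!: nn_integral_mono norm_heatB_le simp: indicator_def)
    then show "(\<integral>\<^sup>+\<tau>. ennreal (norm (indicator {0<..<t} \<tau> *\<^sub>R heatB (t - \<tau>) (n \<tau>) x)) \<partial>lborel) < \<infinity>"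
      using fin by (rule order_le_less_trans)
  qed measurable
  have "duhamel n 0 t t x = (LINT \<tau>:{0<..<a} \<union> {a<..<t}|lborel. heatB (t - \<tau>) (n \<tau>) x)"
    unfolding duhamel_def set_lebesgue_integral_def
  proof (rule integral_cong_AE)
    have "AE \<tau> in lborel. \<tau> \<noteq> a" by (rule AE_lborel_singleton)
    then show "AE \<tau> in lborel. indicat_real {0<..<t} \<tau> *\<^sub>R heatB (t - \<tau>) (n \<tau>) x
        = indicat_real ({0<..<a} \<union> {a<..<t}) \<tau> *\<^sub>R heatB (t - \<tau>) (n \<tau>) x"
      by eventually_elim (use ab in \<open>auto simp: indicator_def\<close>)
  qed measurable
  also have "\<dots> = duhamel n 0 a t x + duhamel n a t t x"
    unfolding duhamel_def
    by (rule set_integral_Un) (use ab in \<open>auto intro!: set_integrable_subset[OF int]\<close>)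
  finally show ?thesis .
qed

text \<open>Flowing the Duhamel term of time a for a further time t - a lets each source act for t -
  \<tau> in total. Exchanging the flow with the time integral is controlled by the majorant at time
  t, which also gives the finiteness needed to split the flow of a sum.\<close>

lemma heatB_duhamel:
  assumes a: "0 < a" "a < t" and fin: "duhamel_nn n 0 t x < \<infinity>"
  shows "heatB (t - a) (duhamel n 0 a a) x = duhamel n 0 a t x"
    "nnheat (t - a) (\<lambda>y. ennreal (norm (duhamel n 0 a a y))) x < \<infinity>"
proof -
  let ?F = "\<lambda>\<tau> y. indicator {0<..<a} \<tau> *\<^sub>R (heat_kernel (t - a) (x - y) *\<^sub>R heatB (a - \<tau>) (n \<tau>) y)"
  have m[measurable]: "(\<lambda>p. ?F (fst p) (snd p)) \<in> borel_measurable (borel \<Otimes>\<^sub>M borel)"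
    using heatB_source_measurable[of a] by measurable
  have sg: "nnheat (t - a) (nnheat (a - \<tau>) (\<lambda>y. ennreal (norm (n \<tau> y)))) x = nnheat (t - \<tau>) (\<lambda>y. ennreal (norm (n \<tau> y))) x"
    if "\<tau> \<in> {0<..<a}" for \<tau>
    using that a by (subst nnheat_semigroup) auto
  have sub: "(\<integral>\<^sup>+\<tau>\<in>{0<..<a}. nnheat (t - \<tau>) (\<lambda>y. ennreal (norm (n \<tau> y))) x \<partial>lborel) \<le> duhamel_nn n 0 t x"
    unfolding duhamel_nn_def using a by (intro nn_integral_mono) (auto simp: indicator_def)
  have bd: "(\<integral>\<^sup>+\<tau>. (\<integral>\<^sup>+y. indicator {0<..<a} \<tau> * (ennreal (heat_kernel (t - a) (x - y)) * nnheat (a - \<tau>) (\<lambda>y. ennreal (norm (n \<tau> y))) y) \<partial>lborel) \<partial>lborel)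
      \<le> duhamel_nn n 0 t x"
  proof -
    have "(\<integral>\<^sup>+\<tau>. (\<integral>\<^sup>+y. indicator {0<..<a} \<tau> * (ennreal (heat_kernel (t - a) (x - y)) * nnheat (a - \<tau>) (\<lambda>y. ennreal (norm (n \<tau> y))) y) \<partial>lborel) \<partial>lborel)
        = (\<integral>\<^sup>+\<tau>\<in>{0<..<a}. nnheat (t - \<tau>) (\<lambda>y. ennreal (norm (n \<tau> y))) x \<partial>lborel)"
    proof (rule nn_integral_cong)
      fix \<tau> :: real
      have "(\<integral>\<^sup>+y. indicator {0<..<a} \<tau> * (ennreal (heat_kernel (t - a) (x - y)) * nnheat (a - \<tau>) (\<lambda>y. ennreal (norm (n \<tau> y))) y) \<partial>lborel)
          = indicator {0<..<a} \<tau> * nnheat (t - a) (nnheat (a - \<tau>) (\<lambda>y. ennreal (norm (n \<tau> y)))) x"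
        by (subst nn_integral_cmult) (auto simp: nnheat_def[of "t - a"])
      then show "(\<integral>\<^sup>+y. indicator {0<..<a} \<tau> * (ennreal (heat_kernel (t - a) (x - y)) * nnheat (a - \<tau>) (\<lambda>y. ennreal (norm (n \<tau> y))) y) \<partial>lborel)
          = nnheat (t - \<tau>) (\<lambda>y. ennreal (norm (n \<tau> y))) x * indicator {0<..<a} \<tau>"
        using sg[of \<tau>] by (auto simp: indicator_def)
    qed
    then show ?thesis using sub by simp
  qed
  have int: "integrable (lborel \<Otimes>\<^sub>M lborel) (\<lambda>(\<tau>, y). ?F \<tau> y)"
  proof (rule integrableI_bounded)
    show "(\<lambda>(\<tau>, y). ?F \<tau> y) \<in> borel_measurable (lborel \<Otimes>\<^sub>M lborel)"
      using m by (simp add: case_prod_beta' cong: measurable_cong_sets)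
    have "(\<integral>\<^sup>+p. ennreal (norm (case p of (\<tau>, y) \<Rightarrow> ?F \<tau> y)) \<partial>(lborel \<Otimes>\<^sub>M lborel))
        = (\<integral>\<^sup>+\<tau>. (\<integral>\<^sup>+y. ennreal (norm (?F \<tau> y)) \<partial>lborel) \<partial>lborel)"
      using m by (subst lborel.nn_integral_fst[symmetric]) (auto simp: case_prod_beta' cong: measurable_cong_sets)
    also have "\<dots> \<le> (\<integral>\<^sup>+\<tau>. (\<integral>\<^sup>+y. indicator {0<..<a} \<tau> * (ennreal (heat_kernel (t - a) (x - y)) * nnheat (a - \<tau>) (\<lambda>y. ennreal (norm (n \<tau> y))) y) \<partial>lborel) \<partial>lborel)"
      by (intro nn_integral_mono) (auto simp: indicator_def ennreal_mult' intro!: mult_left_mono norm_heatB_le)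
    also have "\<dots> < \<infinity>" using bd fin by (rule order_le_less_trans)
    finally show "(\<integral>\<^sup>+p. ennreal (norm (case p of (\<tau>, y) \<Rightarrow> ?F \<tau> y)) \<partial>(lborel \<Otimes>\<^sub>M lborel)) < \<infinity>" .
  qed
  have "heatB (t - a) (duhamel n 0 a a) x = (LINT y|lborel. (LINT \<tau>|lborel. ?F \<tau> y))"
    unfolding heatB_def[of "t - a"] duhamel_def set_lebesgue_integral_def
    by (intro Bochner_Integration.integral_cong refl)
       (simp add: scaleR_left_commute[of "indicat_real _ _"] del: scaleR_scaleR)
  also have "\<dots> = (LINT \<tau>|lborel. (LINT y|lborel. ?F \<tau> y))"
    by (rule lborel_pair.Fubini_integral[OF int])
  also have "\<dots> = duhamel n 0 a t x"
    unfolding duhamel_def set_lebesgue_integral_def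
  proof (rule integral_cong_AE)
    have "(\<integral>\<^sup>+\<tau>\<in>{0<..<a}. nnheat (t - \<tau>) (\<lambda>y. ennreal (norm (n \<tau> y))) x \<partial>lborel) \<noteq> \<infinity>"
      using sub fin by (auto simp: less_top[symmetric] top_unique)
    \<comment> \<open>Finiteness of the time integral gives finiteness for almost every \<tau>,
      which is the hypothesis of the semigroup law at that \<tau>.\<close>
    then have "AE \<tau> in lborel. nnheat (t - \<tau>) (\<lambda>y. ennreal (norm (n \<tau> y))) x * indicator {0<..<a} \<tau> \<noteq> \<infinity>"
      using nnheat_source_measurable[of t] by (intro nn_integral_noteq_infinite) measurable
    then show "AE \<tau> in lborel. (LINT y|lborel. ?F \<tau> y) = indicat_real {0<..<a} \<tau> *\<^sub>R heatB (t - \<tau>) (n \<tau>) x"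
    proof eventually_elim
      case (elim \<tau>)
      show ?case
      proof (cases "\<tau> \<in> {0<..<a}")
        case True
        then have "heatB (t - a) (heatB (a - \<tau>) (n \<tau>)) x = heatB (t - \<tau>) (n \<tau>) x"
          using elim a by (subst heatB_semigroup) (auto simp: less_top)
        then show ?thesis using True by (simp add: heatB_def[of "t - a"])
      qed simp
    qed
    show "(\<lambda>\<tau>. LINT y|lborel. ?F \<tau> y) \<in> borel_measurable lborel"
      using m by (intro lborel.borel_measurable_lebesgue_integral) (simp add: case_prod_beta' cong: measurable_cong_sets)
    show "(\<lambda>\<tau>. indicat_real {0<..<a} \<tau> *\<^sub>R heatB (t - \<tau>) (n \<tau>) x) \<in> borel_measurable lborel"
      using measurable_compose[OF measurable_Pair2' heatB_source_measurable[of t], of x] by simp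
  qed
  finally show "heatB (t - a) (duhamel n 0 a a) x = duhamel n 0 a t x" .
  have "nnheat (t - a) (\<lambda>y. ennreal (norm (duhamel n 0 a a y))) x
      \<le> (\<integral>\<^sup>+y. (\<integral>\<^sup>+\<tau>. indicator {0<..<a} \<tau> * (ennreal (heat_kernel (t - a) (x - y)) * nnheat (a - \<tau>) (\<lambda>y. ennreal (norm (n \<tau> y))) y) \<partial>lborel) \<partial>lborel)"
    unfolding nnheat_def[of "t - a"]
  proof (rule nn_integral_mono)
    fix y :: "real ^ 'n"
    have "ennreal (heat_kernel (t - a) (x - y)) * ennreal (norm (duhamel n 0 a a y))
        \<le> ennreal (heat_kernel (t - a) (x - y)) * (\<integral>\<^sup>+\<tau>\<in>{0<..<a}. nnheat (a - \<tau>) (\<lambda>y. ennreal (norm (n \<tau> y))) y \<partial>lborel)"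
      by (intro mult_left_mono norm_duhamel_le) auto
    also have "\<dots> = (\<integral>\<^sup>+\<tau>. ennreal (heat_kernel (t - a) (x - y)) * (nnheat (a - \<tau>) (\<lambda>y. ennreal (norm (n \<tau> y))) y * indicator {0<..<a} \<tau>) \<partial>lborel)"
      using nnheat_source_measurable[of a] by (intro nn_integral_cmult[symmetric]) measurable
    finally show "ennreal (heat_kernel (t - a) (x - y)) * ennreal (norm (duhamel n 0 a a y))
        \<le> (\<integral>\<^sup>+\<tau>. indicator {0<..<a} \<tau> * (ennreal (heat_kernel (t - a) (x - y)) * nnheat (a - \<tau>) (\<lambda>y. ennreal (norm (n \<tau> y))) y) \<partial>lborel)"
      by (simp add: mult_ac)
  qed
  also have "\<dots> = (\<integral>\<^sup>+\<tau>. (\<integral>\<^sup>+y. indicator {0<..<a} \<tau> * (ennreal (heat_kernel (t - a) (x - y)) * nnheat (a - \<tau>) (\<lambda>y. ennreal (norm (n \<tau> y))) y) \<partial>lborel) \<partial>lborel)"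
    using nnheat_source_measurable[of a]
    by (intro lborel_pair.Fubini') (simp add: case_prod_beta' cong: measurable_cong_sets)
  also have "\<dots> < \<infinity>" using bd fin by (rule order_le_less_trans)
  finally show "nnheat (t - a) (\<lambda>y. ennreal (norm (duhamel n 0 a a y))) x < \<infinity>" .
qed

end


declare nnheat_source_measurable [measurable del] heatB_source_measurable [measurable del]
  source_slice_measurable [measurable del] duhamel_nn_measurable [measurable del] duhamel_measurable [measurable del]

text \<open>Integration over a fixed test set commutes with the time integral, so the heat estimate
  applies to each instant separately. The bound \<open>w\<close> is an explicit measurable function
  of time; hence no measurability of the slice norms in \<tau> has to be shown.\<close>

lemma duhamel_marc_bound:
  fixes \<sigma>1 \<sigma>2 \<mu>1 \<mu>2 e :: real
  assumes \<mu>1: "0 \<le> \<mu>1" "\<mu>1 \<le> 1" and \<mu>2: "0 \<le> \<mu>2" "\<mu>2 \<le> 1" and \<sigma>: "\<sigma>2 \<le> \<sigma>1" "- real CARD('n) < \<sigma>2"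
    and s1: "\<sigma>1 / CARD('n) + \<mu>1 < 1" and s2: "0 \<le> \<sigma>2 / CARD('n) + \<mu>2"
    and s12: "\<sigma>2 / CARD('n) + \<mu>2 < \<sigma>1 / CARD('n) + \<mu>1"
    and e: "e = CARD('n) / 2 * ((\<sigma>1 / CARD('n) + \<mu>1) - (\<sigma>2 / CARD('n) + \<mu>2))"
  obtains C where "C > 0"
    "\<And>(n :: real \<Rightarrow> real ^ 'n \<Rightarrow> 'c::euclidean_space) w a t I.
      (\<lambda>(\<tau>, x). n \<tau> x) \<in> borel_measurable (borel \<Otimes>\<^sub>M borel) \<Longrightarrow> w \<in> borel_measurable borel \<Longrightarrow> 0 \<le> I \<Longrightarrow>
      AE \<tau> in lborel. \<tau> \<in> {a<..<t} \<longrightarrow> 0 \<le> w \<tau> \<and> marc_bound \<mu>1 (w \<tau>) (\<lambda>y. ennreal (norm y powr \<sigma>1) * ennreal (norm (n \<tau> y))) \<Longrightarrow>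
      (\<integral>\<^sup>+\<tau>\<in>{a<..<t}. ennreal ((t - \<tau>) powr (-e) * w \<tau>) \<partial>lborel) \<le> ennreal I \<Longrightarrow>
      marc_bound \<mu>2 (C * I) (\<lambda>x. ennreal (norm x powr \<sigma>2) * duhamel_nn n a t x)"
proof -
  obtain C where C: "C > 0" "\<And>(f :: real ^ 'n \<Rightarrow> ennreal) B t. f \<in> borel_measurable borel \<Longrightarrow> 0 \<le> B \<Longrightarrow> 0 < t \<Longrightarrow>
    marc_bound \<mu>1 B (\<lambda>y. ennreal (norm y powr \<sigma>1) * f y) \<Longrightarrow>
    marc_bound \<mu>2 (C * t powr (- e) * B) (\<lambda>x. ennreal (norm x powr \<sigma>2) * nnheat t f x)"
    unfolding e by (rule heat_marc_bound[OF \<mu>1 \<mu>2 \<sigma> s1 s2 s12]) (rule that, auto simp: e)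
  show ?thesis
  proof (rule that[OF C(1)])
    fix n :: "real \<Rightarrow> real ^ 'n \<Rightarrow> 'c" and w a t I
    assume n[measurable]: "(\<lambda>(\<tau>, x). n \<tau> x) \<in> borel_measurable (borel \<Otimes>\<^sub>M borel)"
      and w[measurable]: "w \<in> borel_measurable borel" and I: "0 \<le> I"
      and mw: "AE \<tau> in lborel. \<tau> \<in> {a<..<t} \<longrightarrow> 0 \<le> w \<tau> \<and> marc_bound \<mu>1 (w \<tau>) (\<lambda>y. ennreal (norm y powr \<sigma>1) * ennreal (norm (n \<tau> y)))"
      and wI: "(\<integral>\<^sup>+\<tau>\<in>{a<..<t}. ennreal ((t - \<tau>) powr (-e) * w \<tau>) \<partial>lborel) \<le> ennreal I"
    let ?h = "\<lambda>\<tau> x. nnheat (t - \<tau>) (\<lambda>y. ennreal (norm (n \<tau> y))) x"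
    note hm = nnheat_source_measurable[OF n, of t]
    note [measurable] = duhamel_nn_measurable[OF n] source_slice_measurable[OF n]
    have hm1[measurable]: "(\<lambda>(x, \<tau>). ?h \<tau> x) \<in> borel_measurable (borel \<Otimes>\<^sub>M borel)"
      using hm by (subst measurable_pair_swap_iff) (simp add: case_prod_beta')
    show "marc_bound \<mu>2 (C * I) (\<lambda>x. ennreal (norm x powr \<sigma>2) * duhamel_nn n a t x)"
    proof (rule marc_bound_borelI)
      fix E :: "(real ^ 'n) set" assume E[measurable]: "E \<in> sets borel" and Ef: "emeasure lborel E < \<infinity>"
      let ?m = "measure lborel E powr (1 - \<mu>2)"
      have "(\<integral>\<^sup>+x\<in>E. ennreal (norm x powr \<sigma>2) * duhamel_nn n a t x \<partial>lborel)
          = (\<integral>\<^sup>+x. (\<integral>\<^sup>+\<tau>. ennreal (norm x powr \<sigma>2) * indicator E x * (?h \<tau> x * indicator {a<..<t} \<tau>) \<partial>lborel) \<partial>lborel)"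
      proof (rule nn_integral_cong)
        fix x :: "real ^ 'n"
        have [measurable]: "(\<lambda>\<tau>. ?h \<tau> x) \<in> borel_measurable borel"
          using measurable_compose[OF measurable_Pair2' hm, of x] by simp
        show "ennreal (norm x powr \<sigma>2) * duhamel_nn n a t x * indicator E x
            = (\<integral>\<^sup>+\<tau>. ennreal (norm x powr \<sigma>2) * indicator E x * (?h \<tau> x * indicator {a<..<t} \<tau>) \<partial>lborel)"
          unfolding duhamel_nn_def by (subst nn_integral_cmult) (simp_all add: mult_ac)
      qed
      also have "\<dots> = (\<integral>\<^sup>+\<tau>. (\<integral>\<^sup>+x. ennreal (norm x powr \<sigma>2) * indicator E x * (?h \<tau> x * indicator {a<..<t} \<tau>) \<partial>lborel) \<partial>lborel)"
      proof (rule lborel_pair.Fubini'[symmetric])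
        have "(\<lambda>p. ennreal (norm (fst p) powr \<sigma>2) * indicator E (fst p) * ((\<lambda>(x, \<tau>). ?h \<tau> x) p * indicator {a<..<t} (snd p)))
            \<in> borel_measurable (borel \<Otimes>\<^sub>M borel)"
          by (intro borel_measurable_times_ennreal hm1) measurable
        then show "(\<lambda>(x, \<tau>). ennreal (norm x powr \<sigma>2) * indicator E x * (?h \<tau> x * indicator {a<..<t} \<tau>)) \<in> borel_measurable (lborel \<Otimes>\<^sub>M lborel)"
          by (simp add: case_prod_beta' cong: measurable_cong_sets)
      qed
      also have "\<dots> \<le> (\<integral>\<^sup>+\<tau>. ennreal (C * ?m) * (ennreal ((t - \<tau>) powr (-e) * w \<tau>) * indicator {a<..<t} \<tau>) \<partial>lborel)"
      proof (rule nn_integral_mono_AE)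
        show "AE \<tau> in lborel. (\<integral>\<^sup>+x. ennreal (norm x powr \<sigma>2) * indicator E x * (?h \<tau> x * indicator {a<..<t} \<tau>) \<partial>lborel)
            \<le> ennreal (C * ?m) * (ennreal ((t - \<tau>) powr (-e) * w \<tau>) * indicator {a<..<t} \<tau>)"
          using mw
        proof eventually_elim
          case (elim \<tau>)
          show ?case
          proof (cases "\<tau> \<in> {a<..<t}")
            case True
            then have w0: "0 \<le> w \<tau>" and mb: "marc_bound \<mu>1 (w \<tau>) (\<lambda>y. ennreal (norm y powr \<sigma>1) * ennreal (norm (n \<tau> y)))"
              using elim by auto
            have "marc_bound \<mu>2 (C * (t - \<tau>) powr (- e) * w \<tau>) (\<lambda>x. ennreal (norm x powr \<sigma>2) * ?h \<tau> x)"
              using True w0 mb by (intro C(2)) auto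
            from marc_boundD[OF this lmeasurable_borel[OF E Ef]]
            have "(\<integral>\<^sup>+x\<in>E. ennreal (norm x powr \<sigma>2) * ?h \<tau> x \<partial>lborel) \<le> ennreal (C * (t - \<tau>) powr (- e) * w \<tau> * ?m)"
              by (simp add: nn_integral_lebesgue_borel_set)
            also have "\<dots> = ennreal (C * ?m) * ennreal ((t - \<tau>) powr (-e) * w \<tau>)"
              using C(1) w0 by (subst ennreal_mult'[symmetric]) (auto simp: mult_ac)
            finally show ?thesis using True by (simp add: mult_ac)
          qed simp
        qed
      qed
      also have "\<dots> = ennreal (C * ?m) * (\<integral>\<^sup>+\<tau>\<in>{a<..<t}. ennreal ((t - \<tau>) powr (-e) * w \<tau>) \<partial>lborel)"
        by (rule nn_integral_cmult) measurable
      also have "\<dots> \<le> ennreal (C * ?m) * ennreal I" using wI by (intro mult_left_mono) auto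
      also have "\<dots> = ennreal (C * I * ?m)"
        using C(1) I by (subst ennreal_mult'[symmetric]) (auto simp: mult_ac)
      finally show "(\<integral>\<^sup>+x\<in>E. ennreal (norm x powr \<sigma>2) * duhamel_nn n a t x \<partial>lborel) \<le> ennreal (C * I * ?m)" .
    qed measurable
  qed
qed

section \<open>Integrals in time\<close>

lemma time_integral_left:
  fixes e \<theta> c t :: real
  assumes "0 \<le> e" "0 \<le> \<theta>" "\<theta> < 1" "0 < c" "c < t"
  shows "(\<integral>\<^sup>+\<tau>\<in>{0<..<c}. ennreal ((t - \<tau>) powr (-e) * \<tau> powr (-\<theta>)) \<partial>lborel)
    \<le> ennreal ((t - c) powr (-e) * (c powr (1 - \<theta>) / (1 - \<theta>)))"
proof -
  have "(\<integral>\<^sup>+\<tau>\<in>{0<..<c}. ennreal ((t - \<tau>) powr (-e) * \<tau> powr (-\<theta>)) \<partial>lborel)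
      \<le> (\<integral>\<^sup>+\<tau>. ennreal ((t - c) powr (-e)) * (ennreal (\<tau> powr (-\<theta>)) * indicator {0..c} \<tau>) \<partial>lborel)"
  proof (rule nn_integral_mono)
    fix \<tau> :: real
    show "ennreal ((t - \<tau>) powr (-e) * \<tau> powr (-\<theta>)) * indicator {0<..<c} \<tau>
        \<le> ennreal ((t - c) powr (-e)) * (ennreal (\<tau> powr (-\<theta>)) * indicator {0..c} \<tau>)"
    proof (cases "\<tau> \<in> {0<..<c}")
      case True
      then have "(t - \<tau>) powr (-e) \<le> (t - c) powr (-e)" using assms by (intro powr_mono2') auto
      then have "(t - \<tau>) powr (-e) * \<tau> powr (-\<theta>) \<le> (t - c) powr (-e) * \<tau> powr (-\<theta>)" by (intro mult_right_mono) auto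
      then show ?thesis using True by (simp add: ennreal_mult'[symmetric] ennreal_leI)
    qed simp
  qed
  also have "\<dots> = ennreal ((t - c) powr (-e)) * ennreal (c powr (1 - \<theta>) / (1 - \<theta>))"
    using assms by (simp add: nn_integral_cmult nn_integral_powr_near_0)
  also have "\<dots> = ennreal ((t - c) powr (-e) * (c powr (1 - \<theta>) / (1 - \<theta>)))"
    using assms by (simp add: ennreal_mult'[symmetric])
  finally show ?thesis .
qed

text \<open>Reflecting \<tau> into t - \<tau> exchanges the two exponents and reduces to the
  estimate near 0.\<close>

lemma time_integral_right:
  fixes e \<theta> c t :: real
  assumes "0 \<le> \<theta>" "0 \<le> e" "e < 1" "0 < c" "c < t"
  shows "(\<integral>\<^sup>+\<tau>\<in>{c<..<t}. ennreal ((t - \<tau>) powr (-e) * \<tau> powr (-\<theta>)) \<partial>lborel)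
    \<le> ennreal (c powr (-\<theta>) * ((t - c) powr (1 - e) / (1 - e)))"
proof -
  have "(\<integral>\<^sup>+\<tau>\<in>{c<..<t}. ennreal ((t - \<tau>) powr (-e) * \<tau> powr (-\<theta>)) \<partial>lborel)
      = (\<integral>\<^sup>+r. ennreal ((t - (t + -1 * r)) powr (-e) * (t + -1 * r) powr (-\<theta>)) * indicator {c<..<t} (t + -1 * r) \<partial>lborel)"
    by (subst nn_integral_real_affine[where c="-1" and t=t]) auto
  also have "\<dots> = (\<integral>\<^sup>+r\<in>{0<..<t - c}. ennreal ((t - r) powr (-\<theta>) * r powr (-e)) \<partial>lborel)"
    by (intro nn_integral_cong) (auto simp: indicator_def mult.commute)
  also have "\<dots> \<le> ennreal ((t - (t - c)) powr (-\<theta>) * ((t - c) powr (1 - e) / (1 - e)))"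
    by (rule time_integral_left) (use assms in auto)
  finally show ?thesis by simp
qed

text \<open>On the last fraction \<epsilon> of the interval the factor \<tau>^{-\<theta>} is
  comparable to t^{-\<theta>}, with constant 2^\<theta> since \<tau> \<ge> t/2. The integrable
  singularity at t leaves the gain \<epsilon>^{1-e}, uniformly in t; this replaces smallness of the
  solutions when the equation is restarted.\<close>

lemma time_integral_tail:
  fixes e \<theta> :: real
  assumes e: "0 \<le> e" "e < 1" and \<theta>: "0 \<le> \<theta>"
  obtains C where "C > 0"
    "\<And>\<epsilon> t :: real. 0 < \<epsilon> \<Longrightarrow> \<epsilon> \<le> 1 / 2 \<Longrightarrow> 0 < t \<Longrightarrow>
      (\<integral>\<^sup>+\<tau>\<in>{(1 - \<epsilon>) * t<..<t}. ennreal ((t - \<tau>) powr (-e) * \<tau> powr (-\<theta>)) \<partial>lborel)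
        \<le> ennreal (C * \<epsilon> powr (1 - e) * t powr (1 - e - \<theta>))"
proof (rule that[of "2 powr \<theta> / (1 - e)"])
  fix \<epsilon> t :: real assume \<epsilon>: "0 < \<epsilon>" "\<epsilon> \<le> 1 / 2" and t: "0 < t"
  have c: "0 < (1 - \<epsilon>) * t" "(1 - \<epsilon>) * t < t" using \<epsilon> t by auto
  have "((1 - \<epsilon>) * t) powr (-\<theta>) \<le> (t / 2) powr (-\<theta>)"
    using \<epsilon> t \<theta> by (intro powr_mono2') (auto simp: field_simps)
  also have "\<dots> = 2 powr \<theta> * t powr (-\<theta>)" using t by (simp add: powr_divide powr_minus field_simps)
  finally have 1: "((1 - \<epsilon>) * t) powr (-\<theta>) \<le> 2 powr \<theta> * t powr (-\<theta>)" .
  have "(t - (1 - \<epsilon>) * t) = \<epsilon> * t" by (simp add: algebra_simps)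
  then have 2: "(t - (1 - \<epsilon>) * t) powr (1 - e) = \<epsilon> powr (1 - e) * t powr (1 - e)"
    using \<epsilon> t by (simp add: powr_mult)
  have "((1 - \<epsilon>) * t) powr (-\<theta>) * ((t - (1 - \<epsilon>) * t) powr (1 - e) / (1 - e))
      \<le> 2 powr \<theta> * t powr (-\<theta>) * (\<epsilon> powr (1 - e) * t powr (1 - e) / (1 - e))"
    unfolding 2 using 1 e by (intro mult_right_mono) auto
  also have "\<dots> = 2 powr \<theta> / (1 - e) * \<epsilon> powr (1 - e) * (t powr (-\<theta>) * t powr (1 - e))" by simp
  also have "t powr (-\<theta>) * t powr (1 - e) = t powr (1 - e - \<theta>)" by (simp add: powr_add[symmetric])
  finally show "(\<integral>\<^sup>+\<tau>\<in>{(1 - \<epsilon>) * t<..<t}. ennreal ((t - \<tau>) powr (-e) * \<tau> powr (-\<theta>)) \<partial>lborel)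
        \<le> ennreal (2 powr \<theta> / (1 - e) * \<epsilon> powr (1 - e) * t powr (1 - e - \<theta>))"
    using time_integral_right[OF \<theta> e c] by (meson ennreal_leI order_trans)
qed (use e in simp)

text \<open>Before T only a crude bound \<open>H\<close> is available, afterwards a good bound
  \<open>\<eta>\<close>. The early times carry the factor (T/t)^{1-\<theta>}, so the past is
  forgotten as t grows. For the estimate \<eta> is charged on the whole interval, split at t/2, and
  \<open>H\<close> is added on (0,T); this is larger than the actual integrand.\<close>

lemma time_integral_step:
  fixes e \<theta> :: real
  assumes e: "0 \<le> e" "e < 1" and \<theta>: "0 \<le> \<theta>" "\<theta> < 1"
  obtains C where "C > 0"
    "\<And>t T H \<eta> :: real. 0 < T \<Longrightarrow> T \<le> t / 2 \<Longrightarrow> 0 \<le> H \<Longrightarrow> 0 \<le> \<eta> \<Longrightarrow>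
      (\<integral>\<^sup>+\<tau>\<in>{0<..<t}. ennreal ((t - \<tau>) powr (-e) * (\<tau> powr (-\<theta>) * (if \<tau> < T then H else \<eta>))) \<partial>lborel)
        \<le> ennreal (C * t powr (1 - e - \<theta>) * (\<eta> + H * (T / t) powr (1 - \<theta>)))"
proof -
  define D where "D = 1 / (1 - \<theta>) + 1 / (1 - e)"
  have D: "D > 0" "1 / (1 - \<theta>) \<le> D" using e \<theta> by (auto simp: D_def add_pos_pos)
  show ?thesis
  proof (rule that[of "4 * D"])
    fix t T H \<eta> :: real
    assume T: "0 < T" "T \<le> t / 2" and H: "0 \<le> H" and \<eta>: "0 \<le> \<eta>"
    have t: "t > 0" using T by simp
    let ?g = "\<lambda>\<tau>. ennreal ((t - \<tau>) powr (-e) * \<tau> powr (-\<theta>))"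
    have "(\<integral>\<^sup>+\<tau>\<in>{0<..<t}. ennreal ((t - \<tau>) powr (-e) * (\<tau> powr (-\<theta>) * (if \<tau> < T then H else \<eta>))) \<partial>lborel)
        \<le> (\<integral>\<^sup>+\<tau>. ennreal \<eta> * (?g \<tau> * indicator {0<..<t/2} \<tau>) + ennreal \<eta> * (?g \<tau> * indicator {t/2<..<t} \<tau>)
              + ennreal H * (?g \<tau> * indicator {0<..<T} \<tau>) \<partial>lborel)"
    proof (rule nn_integral_mono_AE)
      have "AE \<tau> in lborel. \<tau> \<noteq> t / 2" by (rule AE_lborel_singleton)
      then show "AE \<tau> in lborel. ennreal ((t - \<tau>) powr (-e) * (\<tau> powr (-\<theta>) * (if \<tau> < T then H else \<eta>))) * indicator {0<..<t} \<tau>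
        \<le> ennreal \<eta> * (?g \<tau> * indicator {0<..<t/2} \<tau>) + ennreal \<eta> * (?g \<tau> * indicator {t/2<..<t} \<tau>)
              + ennreal H * (?g \<tau> * indicator {0<..<T} \<tau>)"
      proof eventually_elim
        case (elim \<tau>)
        have m: "ennreal ((t - \<tau>) powr (-e) * (\<tau> powr (-\<theta>) * x)) = ennreal x * ?g \<tau>" if "x \<ge> 0" for x
          using that by (simp add: ennreal_mult'[symmetric] mult_ac)
        show ?case using elim H \<eta> T m[of H] m[of \<eta>] by (auto simp: indicator_def)
      qed
    qed
    also have "\<dots> = ennreal \<eta> * (\<integral>\<^sup>+\<tau>\<in>{0<..<t/2}. ?g \<tau> \<partial>lborel) + ennreal \<eta> * (\<integral>\<^sup>+\<tau>\<in>{t/2<..<t}. ?g \<tau> \<partial>lborel)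
        + ennreal H * (\<integral>\<^sup>+\<tau>\<in>{0<..<T}. ?g \<tau> \<partial>lborel)"
      by (simp add: nn_integral_add nn_integral_cmult)
    also have "\<dots> \<le> ennreal \<eta> * ennreal ((t/2) powr (-e) * ((t/2) powr (1 - \<theta>) / (1 - \<theta>)))
        + ennreal \<eta> * ennreal ((t/2) powr (-\<theta>) * ((t/2) powr (1 - e) / (1 - e)))
        + ennreal H * ennreal ((t - T) powr (-e) * (T powr (1 - \<theta>) / (1 - \<theta>)))"
      using time_integral_left[of e \<theta> "t/2" t] time_integral_right[of \<theta> e "t/2" t] time_integral_left[of e \<theta> T t] e \<theta> t T
      by (intro add_mono mult_left_mono) auto
    also have "\<dots> = ennreal (\<eta> * ((t/2) powr (-e) * ((t/2) powr (1 - \<theta>) / (1 - \<theta>)))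
        + \<eta> * ((t/2) powr (-\<theta>) * ((t/2) powr (1 - e) / (1 - e)))
        + H * ((t - T) powr (-e) * (T powr (1 - \<theta>) / (1 - \<theta>))))"
      using \<eta> H e \<theta> by (simp add: ennreal_mult'[symmetric] ennreal_plus[symmetric] del: ennreal_plus)
    also have "\<dots> \<le> ennreal (4 * D * t powr (1 - e - \<theta>) * (\<eta> + H * (T / t) powr (1 - \<theta>)))"
    proof (rule ennreal_leI)
      have "(t/2) powr (-e) * (t/2) powr (1 - \<theta>) = (t/2) powr (1 - e - \<theta>)" "(t/2) powr (-\<theta>) * (t/2) powr (1 - e) = (t/2) powr (1 - e - \<theta>)"
        by (simp_all add: powr_add[symmetric] algebra_simps)
      then have "\<eta> * ((t/2) powr (-e) * ((t/2) powr (1 - \<theta>) / (1 - \<theta>))) + \<eta> * ((t/2) powr (-\<theta>) * ((t/2) powr (1 - e) / (1 - e)))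
          = \<eta> * ((t/2) powr (1 - e - \<theta>) * D)"
        by (simp add: D_def distrib_left)
      also have "(t/2) powr (1 - e - \<theta>) = 2 powr (e + \<theta> - 1) * t powr (1 - e - \<theta>)"
        using t by (simp add: powr_divide powr_minus[symmetric] powr_diff powr_add field_simps)
      also have "\<eta> * (2 powr (e + \<theta> - 1) * t powr (1 - e - \<theta>) * D) \<le> \<eta> * (4 * t powr (1 - e - \<theta>) * D)"
      proof (intro mult_left_mono mult_right_mono)
        have "2 powr (e + \<theta> - 1) \<le> 2 powr (1::real)" using e \<theta> by (intro powr_mono) auto
        then show "2 powr (e + \<theta> - 1) \<le> (4::real)" by simp
      qed (use D \<eta> in auto)
      finally have 1: "\<eta> * ((t/2) powr (-e) * ((t/2) powr (1 - \<theta>) / (1 - \<theta>))) + \<eta> * ((t/2) powr (-\<theta>) * ((t/2) powr (1 - e) / (1 - e)))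
          \<le> \<eta> * (4 * t powr (1 - e - \<theta>) * D)" .
      have "(t - T) powr (-e) \<le> (t / 2) powr (-e)" using T t e by (intro powr_mono2') auto
      also have "\<dots> = 2 powr e * t powr (-e)" using t by (simp add: powr_divide powr_minus field_simps)
      also have "\<dots> \<le> 4 * t powr (-e)"
      proof (intro mult_right_mono)
        have "2 powr e \<le> 2 powr (1::real)" using e by (intro powr_mono) auto
        then show "2 powr e \<le> (4::real)" by simp
      qed simp
      finally have a: "(t - T) powr (-e) \<le> 4 * t powr (-e)" .
      have b: "T powr (1 - \<theta>) / (1 - \<theta>) \<le> T powr (1 - \<theta>) * D"
        using mult_left_mono[OF D(2), of "T powr (1 - \<theta>)"] by simp
      have "H * ((t - T) powr (-e) * (T powr (1 - \<theta>) / (1 - \<theta>))) \<le> H * (4 * t powr (-e) * (T powr (1 - \<theta>) * D))"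
        using H \<theta> by (intro mult_left_mono mult_mono a b) auto
      also have "H * (4 * t powr (-e) * (T powr (1 - \<theta>) * D)) = 4 * D * (t powr (-e) * t powr (1 - \<theta>)) * (H * (T / t) powr (1 - \<theta>))"
      proof -
        have c: "T powr (1 - \<theta>) = (T / t) powr (1 - \<theta>) * t powr (1 - \<theta>)" using T t by (simp add: powr_divide)
        show ?thesis unfolding c by (simp only: mult_ac)
      qed
      also have "t powr (-e) * t powr (1 - \<theta>) = t powr (1 - e - \<theta>)" by (simp add: powr_add[symmetric] algebra_simps)
      finally have 2: "H * ((t - T) powr (-e) * (T powr (1 - \<theta>) / (1 - \<theta>))) \<le> 4 * D * t powr (1 - e - \<theta>) * (H * (T / t) powr (1 - \<theta>))" .
      show "\<eta> * ((t/2) powr (-e) * ((t/2) powr (1 - \<theta>) / (1 - \<theta>))) + \<eta> * ((t/2) powr (-\<theta>) * ((t/2) powr (1 - e) / (1 - e)))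
        + H * ((t - T) powr (-e) * (T powr (1 - \<theta>) / (1 - \<theta>))) \<le> 4 * D * t powr (1 - e - \<theta>) * (\<eta> + H * (T / t) powr (1 - \<theta>))"
        using add_mono[OF 1 2] by (simp add: distrib_left mult_ac)
    qed
    finally show "(\<integral>\<^sup>+\<tau>\<in>{0<..<t}. ennreal ((t - \<tau>) powr (-e) * (\<tau> powr (-\<theta>) * (if \<tau> < T then H else \<eta>))) \<partial>lborel)
        \<le> ennreal (4 * D * t powr (1 - e - \<theta>) * (\<eta> + H * (T / t) powr (1 - \<theta>)))" .
  qed (use D in simp)
qed

section \<open>The nonlinearity\<close>

text \<open>Mean value theorem. For m < 1 the derivative m z^{m-1} is unbounded near 0; the factor
  y, which is at most z, turns it into z^m.\<close>

lemma powr_difference_times_le: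
  fixes x y m :: real
  assumes m: "m > 0" and xy: "0 \<le> y" "y \<le> x"
  shows "(x powr m - y powr m) * y \<le> m * x powr m * (x - y)"
proof (cases "y = 0 \<or> x = y")
  case True
  then show ?thesis using m xy by auto
next
  case False
  then have y: "0 < y" "y < x" using xy by auto
  have "\<exists>z. y < z \<and> z < x \<and> x powr m - y powr m = (x - y) * (m * z powr (m - 1))"
    using y by (intro MVT2) (auto intro!: derivative_eq_intros simp: field_simps)
  then obtain z where z: "y < z" "z < x" "x powr m - y powr m = (x - y) * (m * z powr (m - 1))" by blast
  have "y * z powr (m - 1) \<le> z * z powr (m - 1)" using z by (intro mult_right_mono) auto
  also have "\<dots> = z powr m" using y z by (simp add: powr_diff)
  also have "\<dots> \<le> x powr m" using y z m by (intro powr_mono2) auto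
  finally have "y * z powr (m - 1) \<le> x powr m" .
  then have "(x - y) * m * (y * z powr (m - 1)) \<le> (x - y) * m * x powr m"
    using y m by (intro mult_left_mono) auto
  then show ?thesis unfolding z(3) by (simp add: mult_ac)
qed

lemma norm_power_nonlinearity_diff_le:
  fixes a b :: "'c::real_normed_vector"
  assumes m: "m > 0"
  shows "norm (norm a powr m *\<^sub>R a - norm b powr m *\<^sub>R b) \<le> (1 + m) * max (norm a) (norm b) powr m * norm (a - b)"
proof -
  have *: "norm (norm a powr m *\<^sub>R a - norm b powr m *\<^sub>R b) \<le> (1 + m) * norm a powr m * norm (a - b)"
    if "norm b \<le> norm a" for a b :: 'c
  proof -
    have "norm a powr m *\<^sub>R a - norm b powr m *\<^sub>R b = norm a powr m *\<^sub>R (a - b) + (norm a powr m - norm b powr m) *\<^sub>R b"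
      by (simp add: algebra_simps)
    also have "norm \<dots> \<le> norm a powr m * norm (a - b) + \<bar>norm a powr m - norm b powr m\<bar> * norm b"
      by (rule order_trans[OF norm_triangle_ineq]) simp
    also have "\<bar>norm a powr m - norm b powr m\<bar> = norm a powr m - norm b powr m"
      using that m by (simp add: powr_mono2)
    also have "(norm a powr m - norm b powr m) * norm b \<le> m * norm a powr m * (norm a - norm b)"
      using that m by (intro powr_difference_times_le) auto
    also have "\<dots> \<le> m * norm a powr m * norm (a - b)"
      using m norm_triangle_ineq2[of a b] by (intro mult_left_mono) auto
    finally show ?thesis by (simp add: algebra_simps)
  qed
  show ?thesis
  proof (cases "norm b \<le> norm a")
    case True
    then show ?thesis using *[OF True] by (simp add: max_def)
  next
    case False
    then show ?thesis using *[of a b] *[of b a] by (simp add: max_def norm_minus_commute)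
  qed
qed

text \<open>The weight \<alpha>k - \<gamma> is the one that, once |x|^\<gamma> from the nonlinearity
  is absorbed, gives weight k to each of the \<alpha> factors.\<close>

lemma weighted_nonlinearity_diff_le:
  fixes f g :: "real ^ 'n \<Rightarrow> 'c::euclidean_space"
  assumes \<alpha>: "\<alpha> > 1"
  shows "norm x powr (\<alpha> * k - \<gamma>) * norm (nonlinearity \<gamma> \<alpha> f x - nonlinearity \<gamma> \<alpha> g x)
    \<le> \<alpha> * (max (norm x powr k * norm (f x)) (norm x powr k * norm (g x)) powr (\<alpha> - 1) * (norm x powr k * norm (f x - g x)))"
proof (cases "x = 0")
  case False
  then have x: "norm x > 0" by simp
  have "nonlinearity \<gamma> \<alpha> f x - nonlinearity \<gamma> \<alpha> g x
      = norm x powr \<gamma> *\<^sub>R (norm (f x) powr (\<alpha> - 1) *\<^sub>R f x - norm (g x) powr (\<alpha> - 1) *\<^sub>R g x)"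
    by (simp add: nonlinearity_def scaleR_diff_right)
  then have "norm (nonlinearity \<gamma> \<alpha> f x - nonlinearity \<gamma> \<alpha> g x)
      = norm x powr \<gamma> * norm (norm (f x) powr (\<alpha> - 1) *\<^sub>R f x - norm (g x) powr (\<alpha> - 1) *\<^sub>R g x)" by simp
  also have "\<dots> \<le> norm x powr \<gamma> * ((1 + (\<alpha> - 1)) * max (norm (f x)) (norm (g x)) powr (\<alpha> - 1) * norm (f x - g x))"
    using \<alpha> by (intro mult_left_mono norm_power_nonlinearity_diff_le) auto
  finally have "norm x powr (\<alpha> * k - \<gamma>) * norm (nonlinearity \<gamma> \<alpha> f x - nonlinearity \<gamma> \<alpha> g x)
      \<le> norm x powr (\<alpha> * k - \<gamma>) * (norm x powr \<gamma> * (\<alpha> * max (norm (f x)) (norm (g x)) powr (\<alpha> - 1) * norm (f x - g x)))"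
    by (intro mult_left_mono) auto
  also have "\<dots> = (norm x powr (\<alpha> * k - \<gamma>) * norm x powr \<gamma>) * (\<alpha> * max (norm (f x)) (norm (g x)) powr (\<alpha> - 1) * norm (f x - g x))"
    by (simp only: mult.assoc)
  also have "norm x powr (\<alpha> * k - \<gamma>) * norm x powr \<gamma> = (norm x powr k) powr (\<alpha> - 1) * norm x powr k"
    using x by (simp add: powr_add[symmetric] powr_powr algebra_simps)
  also have "(norm x powr k) powr (\<alpha> - 1) * norm x powr k * (\<alpha> * max (norm (f x)) (norm (g x)) powr (\<alpha> - 1) * norm (f x - g x))
      = \<alpha> * ((norm x powr k * max (norm (f x)) (norm (g x))) powr (\<alpha> - 1) * (norm x powr k * norm (f x - g x)))"
    by (simp add: powr_mult mult_ac)
  also have "norm x powr k * max (norm (f x)) (norm (g x)) = max (norm x powr k * norm (f x)) (norm x powr k * norm (g x))"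
    by (simp add: max_mult_distrib_left)
  finally show ?thesis .
qed (use \<alpha> in simp)

section \<open>Products and sums in weak spaces\<close>

lemma measure_three_cover:
  assumes "E \<in> lmeasurable" "E1 \<in> lmeasurable" "E2 \<in> lmeasurable" "E3 \<in> lmeasurable" "E \<subseteq> E1 \<union> E2 \<union> E3"
    "measure lebesgue E > 0"
  shows "measure lebesgue E / 3 \<le> measure lebesgue E1 \<or> measure lebesgue E / 3 \<le> measure lebesgue E2 \<or> measure lebesgue E / 3 \<le> measure lebesgue E3"
proof (rule ccontr)
  assume "\<not> ?thesis"
  then have lt: "measure lebesgue E1 < measure lebesgue E / 3" "measure lebesgue E2 < measure lebesgue E / 3"
    "measure lebesgue E3 < measure lebesgue E / 3" by (simp_all only: de_Morgan_disj not_le)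
  have s: "E1 \<in> sets lebesgue" "E2 \<in> sets lebesgue" "E3 \<in> sets lebesgue" "E1 \<union> E2 \<in> sets lebesgue" "E \<in> sets lebesgue"
    using assms(1-4) by (auto dest: fmeasurableD)
  have "measure lebesgue E \<le> measure lebesgue (E1 \<union> E2 \<union> E3)"
    by (rule measure_mono_fmeasurable[OF assms(5) s(5)]) (intro fmeasurable.Un assms)
  also have "\<dots> \<le> measure lebesgue (E1 \<union> E2) + measure lebesgue E3" by (rule measure_Un_le[OF s(4,3)])
  also have "measure lebesgue (E1 \<union> E2) \<le> measure lebesgue E1 + measure lebesgue E2" by (rule measure_Un_le[OF s(1,2)])
  finally show False using lt by linarith
qed

lemma superlevel_Int_lmeasurable:
  fixes f :: "'a::euclidean_space \<Rightarrow> real"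
  assumes f: "f \<in> borel_measurable lebesgue" and E: "E \<in> lmeasurable"
  shows "E \<inter> {x. s < f x} \<in> lmeasurable"
proof -
  have "{x \<in> space lebesgue. s < f x} \<in> sets lebesgue" using f by measurable
  then have "{x. s < f x} \<in> sets lebesgue" by (simp only: space_completion space_lborel space_borel UNIV_I simp_thms)
  then show ?thesis by (rule fmeasurable_Int_fmeasurable[OF E])
qed

text \<open>Hoelder's inequality for weak spaces by thresholds: where the product exceeds s =
  z^{\<alpha>-1} w, one of \<open>U\<close>, \<open>V\<close> exceeds z or \<open>W\<close> exceeds
  w. One of these three sets contains a third of the measure of \<open>E\<close>.\<close>

lemma weak_bound_product:
  fixes U V W g :: "'a::euclidean_space \<Rightarrow> real"
  assumes \<alpha>: "\<alpha> > 1" and \<mu>: "\<mu> \<ge> 0" and A: "A > 0" and B: "B > 0"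
    and meas: "U \<in> borel_measurable lebesgue" "V \<in> borel_measurable lebesgue" "W \<in> borel_measurable lebesgue"
    and wU: "weak_bound \<mu> A U" and wV: "weak_bound \<mu> A V" and wW: "weak_bound \<mu> B W"
    and nonneg: "\<And>x. 0 \<le> U x" "\<And>x. 0 \<le> V x" "\<And>x. 0 \<le> W x"
    and g: "\<And>x. g x \<le> max (U x) (V x) powr (\<alpha> - 1) * W x"
  shows "weak_bound (\<alpha> * \<mu>) (3 powr (\<alpha> * \<mu>) * (A powr (\<alpha> - 1) * B)) g"
  unfolding weak_bound_def
proof (intro allI ballI impI)
  fix s :: real and E :: "'a set"
  assume s: "s > 0" and E: "E \<in> lmeasurable" and gt: "\<forall>x\<in>E. s < g x"
  let ?m = "measure lebesgue E"
  \<comment> \<open>The thresholds below are \<open>A\<close> and \<open>B\<close> times the same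
    power of \<open>S\<close>, so that all three alternatives give the same bound
    \<open>S powr (1 / \<alpha>)\<close>; the power is fixed by z^{\<alpha>-1} w = s.\<close>
  define S where "S = A powr (\<alpha> - 1) * B / s"
  have S: "S > 0" using A B s by (simp add: S_def)
  define z w where "z = A * S powr (- (1 / \<alpha>))" and "w = B * S powr (- (1 / \<alpha>))"
  have zw: "z > 0" "w > 0" using A B S by (auto simp: z_def w_def)
  have zws: "z powr (\<alpha> - 1) * w = s"
  proof -
    have "z powr (\<alpha> - 1) * w = A powr (\<alpha> - 1) * B * (S powr (- (1 / \<alpha>) * (\<alpha> - 1)) * S powr (- (1 / \<alpha>)))"
      using A S by (simp add: z_def w_def powr_mult powr_powr mult_ac)
    also have "S powr (- (1 / \<alpha>) * (\<alpha> - 1)) * S powr (- (1 / \<alpha>)) = S powr (-1)"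
      unfolding powr_add[symmetric] using \<alpha> by (intro arg_cong[of _ _ "\<lambda>x. S powr x"]) (simp add: field_simps)
    also have "A powr (\<alpha> - 1) * B * S powr (-1) = s" using A B s by (simp add: S_def powr_minus field_simps)
    finally show ?thesis .
  qed
  show "s * ?m powr (\<alpha> * \<mu>) \<le> 3 powr (\<alpha> * \<mu>) * (A powr (\<alpha> - 1) * B)"
  proof (cases "?m = 0")
    case True
    then show ?thesis using A B by simp
  next
    case False
    then have m: "?m > 0" by (simp add: less_le)
    let ?E1 = "E \<inter> {x. z < U x}" and ?E2 = "E \<inter> {x. z < V x}" and ?E3 = "E \<inter> {x. w < W x}"
    have Em: "?E1 \<in> lmeasurable" "?E2 \<in> lmeasurable" "?E3 \<in> lmeasurable"
      using superlevel_Int_lmeasurable[OF _ E] meas by auto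
    have "E \<subseteq> ?E1 \<union> ?E2 \<union> ?E3"
    proof (rule subsetI, rule ccontr)
      fix x assume x: "x \<in> E" and "x \<notin> ?E1 \<union> ?E2 \<union> ?E3"
      then have "max (U x) (V x) \<le> z" "W x \<le> w" by auto
      then have "max (U x) (V x) powr (\<alpha> - 1) * W x \<le> z powr (\<alpha> - 1) * w"
        using nonneg[of x] \<alpha> by (intro mult_mono powr_mono2) auto
      then show False using g[of x] gt x zws by force
    qed
    then have or: "?m / 3 \<le> measure lebesgue ?E1 \<or> ?m / 3 \<le> measure lebesgue ?E2 \<or> ?m / 3 \<le> measure lebesgue ?E3"
      using measure_three_cover[OF E Em] m by blast
    have le: "(?m / 3) powr \<mu> \<le> S powr (1 / \<alpha>)"
    proof -
      have aux: "(?m / 3) powr \<mu> \<le> S powr (1 / \<alpha>)"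
        if "K > 0" "c = K * S powr (- (1 / \<alpha>))" "?m / 3 \<le> measure lebesgue F" "c * measure lebesgue F powr \<mu> \<le> K" for K c and F :: "'a set"
      proof -
        have "(?m / 3) powr \<mu> \<le> measure lebesgue F powr \<mu>" using that m \<mu> by (intro powr_mono2) auto
        also have "\<dots> \<le> S powr (1 / \<alpha>)"
        proof -
          have "S powr (- (1 / \<alpha>)) * measure lebesgue F powr \<mu> \<le> 1" using that(1,4) unfolding that(2) by (simp add: mult.assoc)
          then show ?thesis using S by (simp add: powr_minus field_simps)
        qed
        finally show ?thesis .
      qed
      show ?thesis
        using or
      proof (elim disjE)
        assume "?m / 3 \<le> measure lebesgue ?E1"
        then show ?thesis by (rule aux[OF A z_def _ weak_boundD[OF wU zw(1) Em(1)]]) (simp only: Int_iff mem_Collect_eq)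
      next
        assume "?m / 3 \<le> measure lebesgue ?E2"
        then show ?thesis by (rule aux[OF A z_def _ weak_boundD[OF wV zw(1) Em(2)]]) (simp only: Int_iff mem_Collect_eq)
      next
        assume "?m / 3 \<le> measure lebesgue ?E3"
        then show ?thesis by (rule aux[OF B w_def _ weak_boundD[OF wW zw(2) Em(3)]]) (simp only: Int_iff mem_Collect_eq)
      qed
    qed
    have "(?m / 3) powr (\<alpha> * \<mu>) = ((?m / 3) powr \<mu>) powr \<alpha>" using m by (simp add: powr_powr mult.commute)
    also have "\<dots> \<le> (S powr (1 / \<alpha>)) powr \<alpha>" using le \<alpha> by (intro powr_mono2) auto
    also have "\<dots> = S" using S \<alpha> by (simp add: powr_powr)
    finally have "s * (?m / 3) powr (\<alpha> * \<mu>) \<le> A powr (\<alpha> - 1) * B" using s by (simp add: S_def field_simps)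
    then have "3 powr (\<alpha> * \<mu>) * (s * (?m / 3) powr (\<alpha> * \<mu>)) \<le> 3 powr (\<alpha> * \<mu>) * (A powr (\<alpha> - 1) * B)"
      by (intro mult_left_mono) auto
    also have "3 powr (\<alpha> * \<mu>) * (s * (?m / 3) powr (\<alpha> * \<mu>)) = s * ?m powr (\<alpha> * \<mu>)"
      using m by (simp add: powr_divide)
    finally show ?thesis .
  qed
qed

text \<open>Where the sum exceeds s, one summand exceeds s/2. The cover by three sets is reused with
  one set repeated, which explains the constant \<open>3 powr \<mu>\<close>.\<close>

lemma weak_bound_add:
  fixes U V g :: "'a::euclidean_space \<Rightarrow> real"
  assumes \<mu>: "\<mu> \<ge> 0" and A: "A > 0"
    and meas: "U \<in> borel_measurable lebesgue" "V \<in> borel_measurable lebesgue"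
    and wU: "weak_bound \<mu> A U" and wV: "weak_bound \<mu> A V" and g: "\<And>x. g x \<le> U x + V x"
  shows "weak_bound \<mu> (2 * 3 powr \<mu> * A) g"
  unfolding weak_bound_def
proof (intro allI ballI impI)
  fix s :: real and E :: "'a set"
  assume s: "s > 0" and E: "E \<in> lmeasurable" and gt: "\<forall>x\<in>E. s < g x"
  let ?m = "measure lebesgue E"
  show "s * ?m powr \<mu> \<le> 2 * 3 powr \<mu> * A"
  proof (cases "?m = 0")
    case False
    then have m: "?m > 0" by (simp add: less_le)
    let ?E1 = "E \<inter> {x. s / 2 < U x}" and ?E2 = "E \<inter> {x. s / 2 < V x}"
    have Em: "?E1 \<in> lmeasurable" "?E2 \<in> lmeasurable"
      using superlevel_Int_lmeasurable[OF _ E] meas by auto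
    have "E \<subseteq> ?E1 \<union> ?E2 \<union> ?E2"
    proof (rule subsetI, rule ccontr)
      fix x assume x: "x \<in> E" and "x \<notin> ?E1 \<union> ?E2 \<union> ?E2"
      then have "U x \<le> s / 2" "V x \<le> s / 2" by auto
      then show False using g[of x] gt x by force
    qed
    then have or: "?m / 3 \<le> measure lebesgue ?E1 \<or> ?m / 3 \<le> measure lebesgue ?E2"
      using measure_three_cover[OF E Em Em(2)] m by blast
    have s2: "s / 2 > 0" using s by simp
    have e1: "s / 2 * measure lebesgue ?E1 powr \<mu> \<le> A"
      by (rule weak_boundD[OF wU s2 Em(1)]) (simp only: Int_iff mem_Collect_eq)
    have e2: "s / 2 * measure lebesgue ?E2 powr \<mu> \<le> A"
      by (rule weak_boundD[OF wV s2 Em(2)]) (simp only: Int_iff mem_Collect_eq)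
    from or have "\<exists>F :: 'a set. ?m / 3 \<le> measure lebesgue F \<and> s / 2 * measure lebesgue F powr \<mu> \<le> A"
    proof
      assume "?m / 3 \<le> measure lebesgue ?E1"
      then show ?thesis by (intro exI[of _ ?E1] conjI e1)
    next
      assume "?m / 3 \<le> measure lebesgue ?E2"
      then show ?thesis by (intro exI[of _ ?E2] conjI e2)
    qed
    then obtain F :: "'a set" where F: "?m / 3 \<le> measure lebesgue F" "s / 2 * measure lebesgue F powr \<mu> \<le> A"
      by (elim exE conjE)
    have "(?m / 3) powr \<mu> \<le> measure lebesgue F powr \<mu>" using F m \<mu> by (intro powr_mono2) auto
    then have "s / 2 * (?m / 3) powr \<mu> \<le> s / 2 * measure lebesgue F powr \<mu>" using s by (intro mult_left_mono) auto
    then have "s / 2 * (?m / 3) powr \<mu> \<le> A" using F by linarith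
    then have "2 * 3 powr \<mu> * (s / 2 * (?m / 3) powr \<mu>) \<le> 2 * 3 powr \<mu> * A" by (intro mult_left_mono) auto
    then show ?thesis using m by (simp add: powr_divide)
  qed (use A in simp)
qed

lemma weak_bound_scale:
  assumes c: "c > 0" and w: "weak_bound \<mu> A (\<lambda>x. g x / c)"
  shows "weak_bound \<mu> (c * A) g"
  unfolding weak_bound_def
proof (intro allI ballI impI)
  fix s :: real and E :: "'a set"
  assume s: "s > 0" and E: "E \<in> lmeasurable" and gt: "\<forall>x\<in>E. s < g x"
  have "s / c * measure lebesgue E powr \<mu> \<le> A"
    by (rule weak_boundD[OF w _ E]) (use s c gt in \<open>auto simp: divide_strict_right_mono\<close>)
  then show "s * measure lebesgue E powr \<mu> \<le> c * A" using c by (simp add: field_simps)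
qed

lemma norm_measurable_lebesgue: "(\<lambda>x::'a::euclidean_space. norm x powr k) \<in> borel_measurable lebesgue"
  by (rule measurable_completion) measurable

lemma nonlinearity_measurable_lebesgue:
  fixes u :: "real ^ 'n \<Rightarrow> 'c::euclidean_space"
  assumes u: "u \<in> borel_measurable lebesgue"
  shows "(\<lambda>x. nonlinearity \<gamma> \<alpha> u x) \<in> borel_measurable lebesgue"
  unfolding nonlinearity_def
  by (intro borel_measurable_scaleR borel_measurable_times powr_real_measurable measurable_compose[OF _ borel_measurable_norm]
      borel_measurable_const norm_measurable_lebesgue u)

lemma weighted_norm_measurable_lebesgue:
  fixes u :: "'a::euclidean_space \<Rightarrow> 'c::euclidean_space"
  assumes "u \<in> borel_measurable lebesgue"
  shows "(\<lambda>x. norm x powr k * norm (u x)) \<in> borel_measurable lebesgue"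
  by (intro borel_measurable_times norm_measurable_lebesgue measurable_compose[OF assms borel_measurable_norm])

text \<open>Here p > \<alpha> enters, as \<alpha>\<mu> < 1 with \<mu> = 1/p: the product of \<alpha>
  factors lies in a weak space of exponent above 1, where the quasinorm controls integrals over
  sets. The bound is linear in the difference and carries the factor
  \<open>A powr (\<alpha> - 1)\<close>.\<close>

lemma nonlinearity_difference_marc_bound:
  fixes \<alpha> \<gamma> k \<mu> :: real
  assumes \<alpha>: "\<alpha> > 1" and \<mu>: "\<mu> \<ge> 0" "\<alpha> * \<mu> < 1"
  obtains C where "C > 0"
    "\<And>(u :: real ^ 'n \<Rightarrow> 'c::euclidean_space) v A B. u \<in> borel_measurable lebesgue \<Longrightarrow> v \<in> borel_measurable lebesgue \<Longrightarrow> 0 < A \<Longrightarrow> 0 < B \<Longrightarrow>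
       weak_bound \<mu> A (\<lambda>x. norm x powr k * norm (u x)) \<Longrightarrow> weak_bound \<mu> A (\<lambda>x. norm x powr k * norm (v x)) \<Longrightarrow>
       weak_bound \<mu> B (\<lambda>x. norm x powr k * norm (u x - v x)) \<Longrightarrow>
       marc_bound (\<alpha> * \<mu>) (C * (A powr (\<alpha> - 1) * B))
         (\<lambda>x. ennreal (norm x powr (\<alpha> * k - \<gamma>)) * ennreal (norm (nonlinearity \<gamma> \<alpha> u x - nonlinearity \<gamma> \<alpha> v x)))"
proof -
  have \<alpha>\<mu>: "0 \<le> \<alpha> * \<mu>" using \<alpha> \<mu> by simp
  obtain C where C: "C > 0" "\<And>A (g :: real ^ 'n \<Rightarrow> real). g \<in> borel_measurable lebesgue \<Longrightarrow> weak_bound (\<alpha> * \<mu>) A g \<Longrightarrow>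
        marc_bound (\<alpha> * \<mu>) (C * A) (\<lambda>x. ennreal (g x))"
    by (rule marc_bound_of_weak_bound[OF \<alpha>\<mu> \<mu>(2), where ?'a="real ^ 'n"]) (rule that)
  show ?thesis
  proof (rule that[of "C * (3 powr (\<alpha> * \<mu>) * \<alpha>)"])
    fix u v :: "real ^ 'n \<Rightarrow> 'c" and A B :: real
    assume uv[measurable]: "u \<in> borel_measurable lebesgue" "v \<in> borel_measurable lebesgue" and A: "0 < A" and B: "0 < B"
      and wu: "weak_bound \<mu> A (\<lambda>x. norm x powr k * norm (u x))" and wv: "weak_bound \<mu> A (\<lambda>x. norm x powr k * norm (v x))"
      and ww: "weak_bound \<mu> B (\<lambda>x. norm x powr k * norm (u x - v x))"
    let ?g = "\<lambda>x. norm x powr (\<alpha> * k - \<gamma>) * norm (nonlinearity \<gamma> \<alpha> u x - nonlinearity \<gamma> \<alpha> v x)"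
    have gm: "?g \<in> borel_measurable lebesgue" 
      by (intro weighted_norm_measurable_lebesgue borel_measurable_diff nonlinearity_measurable_lebesgue uv)
    have "weak_bound (\<alpha> * \<mu>) (3 powr (\<alpha> * \<mu>) * (A powr (\<alpha> - 1) * B)) (\<lambda>x. ?g x / \<alpha>)"
      using weighted_nonlinearity_diff_le[OF \<alpha>, of _ k \<gamma> u v] \<alpha>
      by (intro weak_bound_product[OF \<alpha> \<mu>(1) A B _ _ _ wu wv ww] weighted_norm_measurable_lebesgue
          borel_measurable_diff uv) (simp_all add: field_simps)
    then have "weak_bound (\<alpha> * \<mu>) (\<alpha> * (3 powr (\<alpha> * \<mu>) * (A powr (\<alpha> - 1) * B))) ?g"
      by (rule weak_bound_scale[rotated]) (use \<alpha> in simp)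
    then have "marc_bound (\<alpha> * \<mu>) (C * (\<alpha> * (3 powr (\<alpha> * \<mu>) * (A powr (\<alpha> - 1) * B)))) (\<lambda>x. ennreal (?g x))"
      by (rule C(2)[OF gm])
    then show "marc_bound (\<alpha> * \<mu>) (C * (3 powr (\<alpha> * \<mu>) * \<alpha>) * (A powr (\<alpha> - 1) * B))
         (\<lambda>x. ennreal (norm x powr (\<alpha> * k - \<gamma>)) * ennreal (norm (nonlinearity \<gamma> \<alpha> u x - nonlinearity \<gamma> \<alpha> v x)))"
      by (simp add: ennreal_mult'[symmetric] mult_ac)
  qed (use C(1) \<alpha> in simp)
qed

section \<open>Borel representatives jointly in time and space\<close>

lemma borel_representative:
  fixes f :: "'a::euclidean_space \<Rightarrow> 'c::euclidean_space"
  assumes f: "f \<in> borel_measurable lebesgue"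
  obtains f' where "f' \<in> borel_measurable borel" "AE x in lebesgue. f x = f' x"
proof -
  have "\<exists>g. g \<in> borel_measurable borel \<and> (AE x in lborel. f x \<bullet> b = g x)" for b
  proof -
    have "(\<lambda>x. f x \<bullet> b) \<in> borel_measurable (completion lborel)" using f by measurable
    from completion_ex_borel_measurable_real[OF this] show ?thesis by auto
  qed
  then obtain g where g: "\<And>b. g b \<in> borel_measurable borel" "\<And>b. AE x in lborel. f x \<bullet> b = g b x" by metis
  show ?thesis
  proof (rule that)
    show "(\<lambda>x. \<Sum>b\<in>Basis. g b x *\<^sub>R b) \<in> borel_measurable borel" using g(1) by measurable
    have "AE x in lborel. \<forall>b\<in>Basis. f x \<bullet> b = g b x" using g(2) by (intro AE_finite_allI) auto
    then have "AE x in lborel. f x = (\<Sum>b\<in>Basis. g b x *\<^sub>R b)"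
    proof eventually_elim
      case (elim x)
      then have "(\<Sum>b\<in>Basis. g b x *\<^sub>R b) = (\<Sum>b\<in>Basis. (f x \<bullet> b) *\<^sub>R b)" by (intro sum.cong) auto
      then show ?case by (simp add: euclidean_representation)
    qed
    then show "AE x in lebesgue. f x = (\<Sum>b\<in>Basis. g b x *\<^sub>R b)" by (rule AE_completion)
  qed
qed

text \<open>Joint measurability is hidden in the distributional part of the definition: local
  integrability makes the restriction to each compact set measurable, and compact sets exhaust the
  open half space. Membership says nothing about nonpositive times, hence the cut-off.\<close>

lemma K_space_joint_measurable:
  fixes u :: "real \<Rightarrow> real ^ 'n \<Rightarrow> 'c::euclidean_space"
  assumes "u \<in> K_space \<gamma> \<alpha> p k"
  shows "(\<lambda>(t, x). indicator {0<..} t *\<^sub>R u t x) \<in> borel_measurable lebesgue"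
proof -
  define C where "C = (\<lambda>n. {1 / real (Suc n)..real n} \<times> cball (0 :: real ^ 'n) (real n))"
  have "compact (C n)" for n unfolding C_def by (intro compact_Times compact_Icc compact_cball)
  moreover have "C n \<subseteq> {0<..} \<times> UNIV" for n
  proof
    fix p assume "p \<in> C n"
    then have "1 / real (Suc n) \<le> fst p" by (auto simp: C_def)
    moreover have "0 < 1 / real (Suc n)" by simp
    ultimately have "0 < fst p" by linarith
    then show "p \<in> {0<..} \<times> UNIV" by (cases p) auto
  qed
  moreover have "\<forall>C. compact C \<and> C \<subseteq> {0<..} \<times> UNIV \<longrightarrow> set_integrable lebesgue C (\<lambda>(t, x). u t x)"
    using assms unfolding K_space_def mem_Collect_eq by (rule conjunct1)
  ultimately have "set_integrable lebesgue (C n) (\<lambda>(t, x). u t x)" for n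
    by blast
  then have m: "(\<lambda>p. indicator (C n) p *\<^sub>R (case p of (t, x) \<Rightarrow> u t x)) \<in> borel_measurable lebesgue" for n
    unfolding set_integrable_def by (rule borel_measurable_integrable)
  show ?thesis
  proof (rule borel_measurable_LIMSEQ_metric[OF m])
    fix p :: "real \<times> (real ^ 'n)"
    obtain t x where p: "p = (t, x)" by (cases p)
    show "(\<lambda>n. indicator (C n) p *\<^sub>R (case p of (t, x) \<Rightarrow> u t x)) \<longlonglongrightarrow> (case p of (t, x) \<Rightarrow> indicator {0<..} t *\<^sub>R u t x)"
    proof (cases "t > 0")
      case True
      obtain N1 where N1: "inverse (real (Suc N1)) < t" using reals_Archimedean[OF True] by blast
      obtain N2 where N2: "max t (norm x) < real N2" using reals_Archimedean2 by blast
      have "p \<in> C n" if "n \<ge> max N1 N2" for n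
      proof -
        have "1 / real (Suc n) \<le> 1 / real (Suc N1)" using that by (intro divide_left_mono) auto
        moreover have "real N2 \<le> real n" using that by simp
        ultimately show ?thesis using N1 N2 unfolding p C_def by (auto simp: inverse_eq_divide)
      qed
      then have "\<forall>\<^sub>F n in sequentially. indicator (C n) p *\<^sub>R (case p of (t, x) \<Rightarrow> u t x) = (case p of (t, x) \<Rightarrow> indicator {0<..} t *\<^sub>R u t x)"
        unfolding eventually_sequentially using True p by (intro exI[of _ "max N1 N2"]) auto
      then show ?thesis by (rule tendsto_eventually)
    next
      case False
      then have "p \<notin> C n" for n using \<open>\<And>n. C n \<subseteq> {0<..} \<times> UNIV\<close> unfolding p by force
      then show ?thesis using False p by simp
    qed
  qed
qed

text \<open>A Borel function replaces the source off a null set of space-time; by Fubini for null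
  sets the slices then agree for almost every time only. This suffices, since the source is used
  solely under time integrals.\<close>

lemma nonlinearity_difference_representative:
  fixes u v :: "real \<Rightarrow> real ^ 'n \<Rightarrow> 'c::euclidean_space"
  assumes u: "u \<in> K_space \<gamma> \<alpha> p k" and v: "v \<in> K_space \<gamma> \<alpha> p k"
  obtains n :: "real \<Rightarrow> real ^ 'n \<Rightarrow> 'c" where "(\<lambda>(\<tau>, x). n \<tau> x) \<in> borel_measurable (borel \<Otimes>\<^sub>M borel)"
    "AE \<tau> in lborel. 0 < \<tau> \<longrightarrow> (AE x in lebesgue. nonlinearity \<gamma> \<alpha> (u \<tau>) x - nonlinearity \<gamma> \<alpha> (v \<tau>) x = n \<tau> x)"
proof -
  let ?u = "\<lambda>(t, x). indicator {0<..} t *\<^sub>R u t x" and ?v = "\<lambda>(t, x). indicator {0<..} t *\<^sub>R v t x"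
  let ?N = "\<lambda>w (p :: real \<times> (real ^ 'n)). (norm (snd p) powr \<gamma> * norm (w p) powr (\<alpha> - 1)) *\<^sub>R (w p :: 'c)"
  have uv: "?u \<in> borel_measurable lebesgue" "?v \<in> borel_measurable lebesgue"
    using K_space_joint_measurable u v by blast+
  have "(\<lambda>p :: real \<times> (real ^ 'n). norm (snd p) powr \<gamma>) \<in> borel_measurable (borel \<Otimes>\<^sub>M borel)" by measurable
  then have "(\<lambda>p :: real \<times> (real ^ 'n). norm (snd p) powr \<gamma>) \<in> borel_measurable lborel"
    unfolding borel_prod by (simp only: measurable_lborel2)
  then have w: "(\<lambda>p :: real \<times> (real ^ 'n). norm (snd p) powr \<gamma>) \<in> borel_measurable lebesgue"
    by (rule measurable_completion)
  have "(\<lambda>p. ?N ?u p - ?N ?v p) \<in> borel_measurable lebesgue"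
  proof -
    have N: "?N z \<in> borel_measurable lebesgue" if z: "z \<in> borel_measurable lebesgue" for z :: "real \<times> (real ^ 'n) \<Rightarrow> 'c"
      by (rule borel_measurable_scaleR[OF borel_measurable_times[OF w powr_real_measurable[OF measurable_compose[OF z borel_measurable_norm] borel_measurable_const]] z])
    show ?thesis by (rule borel_measurable_diff[OF N[OF uv(1)] N[OF uv(2)]])
  qed
  then obtain f where f: "f \<in> borel_measurable borel" "AE p in lebesgue. ?N ?u p - ?N ?v p = f p"
    by (rule borel_representative)
  have aep: "AE p in (lborel :: real measure) \<Otimes>\<^sub>M (lborel :: (real ^ 'n) measure). ?N ?u p - ?N ?v p = f p"
    using f(2) unfolding AE_completion_iff lborel_prod .
  from lborel_pair.AE_pair[OF aep]
  have ae: "AE \<tau> in lborel. AE x in lborel. ?N ?u (\<tau>, x) - ?N ?v (\<tau>, x) = f (\<tau>, x)" .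
  show ?thesis
  proof (rule that[of "\<lambda>\<tau> x. f (\<tau>, x)"])
    show "(\<lambda>(\<tau>, x). f (\<tau>, x)) \<in> borel_measurable (borel \<Otimes>\<^sub>M borel)"
      using f(1) unfolding borel_prod case_prod_eta .
    show "AE \<tau> in lborel. 0 < \<tau> \<longrightarrow> (AE x in lebesgue. nonlinearity \<gamma> \<alpha> (u \<tau>) x - nonlinearity \<gamma> \<alpha> (v \<tau>) x = f (\<tau>, x))"
      using ae
    proof eventually_elim
      case (elim \<tau>)
      show ?case
      proof (intro impI AE_completion)
        assume "0 < \<tau>"
        then show "AE x in lborel. nonlinearity \<gamma> \<alpha> (u \<tau>) x - nonlinearity \<gamma> \<alpha> (v \<tau>) x = f (\<tau>, x)"
          using elim by (simp add: nonlinearity_def)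
      qed
    qed
  qed
qed

section \<open>Differences of solutions\<close>

lemma tendsto_0_ennreal_iff:
  fixes f :: "'a \<Rightarrow> ennreal"
  shows "(f \<longlongrightarrow> 0) F \<longleftrightarrow> (\<forall>e>0. \<forall>\<^sub>F x in F. f x \<le> ennreal e)"
proof
  assume f: "(f \<longlongrightarrow> 0) F"
  show "\<forall>e>0. \<forall>\<^sub>F x in F. f x \<le> ennreal e"
  proof (intro allI impI)
    fix e :: real assume "e > 0"
    then have "\<forall>\<^sub>F x in F. f x < ennreal e" by (intro order_tendstoD(2)[OF f]) simp
    then show "\<forall>\<^sub>F x in F. f x \<le> ennreal e" by eventually_elim (rule less_imp_le)
  qed
next
  assume *: "\<forall>e>0. \<forall>\<^sub>F x in F. f x \<le> ennreal e"
  show "(f \<longlongrightarrow> 0) F"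
  proof (rule order_tendstoI)
    fix a :: ennreal assume "0 < a"
    then obtain b where b: "0 < b" "b < a" using dense by blast
    then obtain e where e: "b = ennreal e" "0 \<le> e" by (cases b) auto
    then have "e > 0" using b by (auto simp: less_le)
    then have "\<forall>\<^sub>F x in F. f x \<le> ennreal e" using * by simp
    then show "\<forall>\<^sub>F x in F. f x < a" by eventually_elim (use e b in auto)
  qed simp
qed

section \<open>The integral equation for the difference\<close>

lemma heat_difference:
  fixes f g n :: "real ^ 'n \<Rightarrow> 'c::euclidean_space"
  assumes t: "t > 0" and f: "heat_converges t f x" and g: "heat_converges t g x"
    and eq: "AE y in lebesgue. f y - g y = n y" and n: "n \<in> borel_measurable borel"
  shows "heat t f x - heat t g x = heatB t n x"
proof -
  have i: "integrable lebesgue (\<lambda>y. heat_kernel t (x - y) *\<^sub>R f y)" "integrable lebesgue (\<lambda>y. heat_kernel t (x - y) *\<^sub>R g y)"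
    using f g by (simp_all add: heat_converges_def)
  have m: "(\<lambda>y. heat_kernel t (x - y) *\<^sub>R n y) \<in> borel_measurable lborel" using n by measurable
  have "heat t f x - heat t g x = (LINT y|lebesgue. heat_kernel t (x - y) *\<^sub>R f y - heat_kernel t (x - y) *\<^sub>R g y)"
    unfolding heat_def if_P[OF t] by (rule Bochner_Integration.integral_diff[OF i, symmetric])
  also have "\<dots> = (LINT y|lebesgue. heat_kernel t (x - y) *\<^sub>R n y)"
  proof (rule integral_cong_AE)
    show "(\<lambda>y. heat_kernel t (x - y) *\<^sub>R f y - heat_kernel t (x - y) *\<^sub>R g y) \<in> borel_measurable lebesgue"
      using i by (intro borel_measurable_diff borel_measurable_integrable)
    show "(\<lambda>y. heat_kernel t (x - y) *\<^sub>R n y) \<in> borel_measurable lebesgue" using m by (rule measurable_completion)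
    show "AE y in lebesgue. heat_kernel t (x - y) *\<^sub>R f y - heat_kernel t (x - y) *\<^sub>R g y = heat_kernel t (x - y) *\<^sub>R n y"
      using eq by eventually_elim (simp add: scaleR_diff_right[symmetric])
  qed
  also have "\<dots> = heatB t n x" unfolding heatB_def by (rule integral_completion[OF m])
  finally show ?thesis .
qed

text \<open>The integral equation for u - v in the form in which it is used: \<zeta> is a Borel
  representative of \<phi> - \<psi>, and \<open>n\<close> a jointly Borel representative of the
  difference of the nonlinearities.\<close>

definition difference_representation ::
  "real \<Rightarrow> real \<Rightarrow> real \<Rightarrow> (real ^ 'n \<Rightarrow> 'c::euclidean_space) \<Rightarrow> (real ^ 'n \<Rightarrow> 'c) \<Rightarrow> (real \<Rightarrow> real ^ 'n \<Rightarrow> 'c) \<Rightarrow> (real \<Rightarrow> real ^ 'n \<Rightarrow> 'c)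
    \<Rightarrow> (real ^ 'n \<Rightarrow> 'c) \<Rightarrow> (real \<Rightarrow> real ^ 'n \<Rightarrow> 'c) \<Rightarrow> bool" where
  "difference_representation a \<gamma> \<alpha> \<phi> \<psi> u v \<zeta> n \<longleftrightarrow>
     \<zeta> \<in> borel_measurable borel \<and> (\<lambda>(\<tau>, x). n \<tau> x) \<in> borel_measurable (borel \<Otimes>\<^sub>M borel) \<and>
     (\<forall>t>0. \<forall>x. heat t (\<lambda>x. \<phi> x - \<psi> x) x = heatB t \<zeta> x) \<and>
     (\<forall>t>0. AE x in lebesgue. nnheat t (\<lambda>y. ennreal (norm (\<zeta> y))) x < \<infinity>) \<and>
     (AE \<tau> in lborel. 0 < \<tau> \<longrightarrow> (AE x in lebesgue. nonlinearity \<gamma> \<alpha> (u \<tau>) x - nonlinearity \<gamma> \<alpha> (v \<tau>) x = n \<tau> x)) \<and>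
     (\<forall>t>0. AE x in lebesgue. u t x - v t x = heatB t \<zeta> x + a *\<^sub>R duhamel n 0 t t x)"

lemma difference_representation_exists:
  fixes u v :: "real \<Rightarrow> real ^ 'n \<Rightarrow> 'c::euclidean_space"
  assumes u: "global_mild_solution a \<gamma> \<alpha> q r l \<phi> u" "u \<in> K_space \<gamma> \<alpha> p k"
    and v: "global_mild_solution a \<gamma> \<alpha> q r l \<psi> v" "v \<in> K_space \<gamma> \<alpha> p k"
  obtains \<zeta> n where "difference_representation a \<gamma> \<alpha> \<phi> \<psi> u v \<zeta> n"
proof -
  have \<phi>m: "\<phi> \<in> borel_measurable lebesgue" and \<psi>m: "\<psi> \<in> borel_measurable lebesgue"
    using u(1) v(1) by (simp_all add: global_mild_solution_def wlorentz_def)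
  have su: "solves_integral_eq a \<gamma> \<alpha> \<phi> u" and sv: "solves_integral_eq a \<gamma> \<alpha> \<psi> v"
    using u(1) v(1) by (simp_all add: global_mild_solution_def)
  obtain n :: "real \<Rightarrow> real ^ 'n \<Rightarrow> 'c" where n: "(\<lambda>(\<tau>, x). n \<tau> x) \<in> borel_measurable (borel \<Otimes>\<^sub>M borel)"
    "AE \<tau> in lborel. 0 < \<tau> \<longrightarrow> (AE x in lebesgue. nonlinearity \<gamma> \<alpha> (u \<tau>) x - nonlinearity \<gamma> \<alpha> (v \<tau>) x = n \<tau> x)"
    by (rule nonlinearity_difference_representative[OF u(2) v(2)])
  obtain \<phi>' where \<phi>': "\<phi>' \<in> borel_measurable borel" "AE x in lebesgue. \<phi> x = \<phi>' x"
    by (rule borel_representative[OF \<phi>m])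
  obtain \<psi>' where \<psi>': "\<psi>' \<in> borel_measurable borel" "AE x in lebesgue. \<psi> x = \<psi>' x"
    by (rule borel_representative[OF \<psi>m])
  define \<zeta> where "\<zeta> = (\<lambda>x. \<phi>' x - \<psi>' x)"
  have \<zeta>m: "\<zeta> \<in> borel_measurable borel" unfolding \<zeta>_def using \<phi>'(1) \<psi>'(1) by (rule borel_measurable_diff)
  have \<zeta>eq: "AE x in lebesgue. \<phi> x - \<psi> x = \<zeta> x" using \<phi>'(2) \<psi>'(2) by eventually_elim (simp add: \<zeta>_def)
  have diffm: "(\<lambda>x. \<phi> x - \<psi> x) \<in> borel_measurable lebesgue" using \<phi>m \<psi>m by (rule borel_measurable_diff)
  show ?thesis
  proof (rule that[of \<zeta> n], unfold difference_representation_def, intro conjI allI impI \<zeta>m n)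
    fix t :: real and x :: "real ^ 'n" assume t: "t > 0"
    show "heat t (\<lambda>x. \<phi> x - \<psi> x) x = heatB t \<zeta> x" by (rule heat_eq_heatB[OF diffm \<zeta>m \<zeta>eq t])
  next
    fix t :: real assume t: "t > 0"
    have "AE x in lebesgue. heat_converges t \<phi> x" "AE x in lebesgue. heat_converges t \<psi> x"
      using su sv t unfolding solves_integral_eq_def by (blast intro: AE_mp AE_I2)+
    then show "AE x in lebesgue. nnheat t (\<lambda>y. ennreal (norm (\<zeta> y))) x < \<infinity>"
    proof eventually_elim
      case (elim x)
      then have "heat_converges t (\<lambda>x. \<phi> x - \<psi> x) x"
        unfolding heat_converges_def scaleR_diff_right by (rule Bochner_Integration.integrable_diff)
      then show ?case by (rule nnheat_finite_of_converges[OF diffm \<zeta>m \<zeta>eq])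
    qed
  next
    fix t :: real assume t: "t > 0"
    from su t have eu: "AE x in lebesgue.
        heat_converges t \<phi> x \<and>
        (AE \<tau>\<in>{0<..<t} in lebesgue. heat_converges (t - \<tau>) (nonlinearity \<gamma> \<alpha> (u \<tau>)) x) \<and>
        set_integrable lebesgue {0<..<t} (\<lambda>\<tau>. heat (t - \<tau>) (nonlinearity \<gamma> \<alpha> (u \<tau>)) x) \<and>
        u t x = heat t \<phi> x
          + a *\<^sub>R (LINT \<tau>:{0<..<t}|lebesgue. heat (t - \<tau>) (nonlinearity \<gamma> \<alpha> (u \<tau>)) x)"
      unfolding solves_integral_eq_def by (elim allE[of _ t]) (erule (1) mp)
    from sv t have ev: "AE x in lebesgue.
        heat_converges t \<psi> x \<and>
        (AE \<tau>\<in>{0<..<t} in lebesgue. heat_converges (t - \<tau>) (nonlinearity \<gamma> \<alpha> (v \<tau>)) x) \<and>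
        set_integrable lebesgue {0<..<t} (\<lambda>\<tau>. heat (t - \<tau>) (nonlinearity \<gamma> \<alpha> (v \<tau>)) x) \<and>
        v t x = heat t \<psi> x
          + a *\<^sub>R (LINT \<tau>:{0<..<t}|lebesgue. heat (t - \<tau>) (nonlinearity \<gamma> \<alpha> (v \<tau>)) x)"
      unfolding solves_integral_eq_def by (elim allE[of _ t]) (erule (1) mp)
    show "AE x in lebesgue. u t x - v t x = heatB t \<zeta> x + a *\<^sub>R duhamel n 0 t t x"
      using eu ev
    proof eventually_elim
      case (elim x)
      let ?u = "\<lambda>\<tau>. heat (t - \<tau>) (nonlinearity \<gamma> \<alpha> (u \<tau>)) x" and ?v = "\<lambda>\<tau>. heat (t - \<tau>) (nonlinearity \<gamma> \<alpha> (v \<tau>)) x"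
      note cu = elim(1)[THEN conjunct1] elim(1)[THEN conjunct2, THEN conjunct1]
        elim(1)[THEN conjunct2, THEN conjunct2, THEN conjunct1] elim(1)[THEN conjunct2, THEN conjunct2, THEN conjunct2]
      note cv = elim(2)[THEN conjunct1] elim(2)[THEN conjunct2, THEN conjunct1]
        elim(2)[THEN conjunct2, THEN conjunct2, THEN conjunct1] elim(2)[THEN conjunct2, THEN conjunct2, THEN conjunct2]
      have ae: "AE \<tau> in lebesgue. 0 < \<tau> \<longrightarrow> (AE x in lebesgue. nonlinearity \<gamma> \<alpha> (u \<tau>) x - nonlinearity \<gamma> \<alpha> (v \<tau>) x = n \<tau> x)"
        using n(2) by (rule AE_completion)
      have nm: "(\<lambda>\<tau>. indicat_real {0<..<t} \<tau> *\<^sub>R heatB (t - \<tau>) (n \<tau>) x) \<in> borel_measurable lborel"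
        using measurable_compose[OF measurable_Pair2' heatB_source_measurable[OF n(1), of t], of x] by simp
      have "(LINT \<tau>:{0<..<t}|lebesgue. ?u \<tau>) - (LINT \<tau>:{0<..<t}|lebesgue. ?v \<tau>) = (LINT \<tau>:{0<..<t}|lebesgue. ?u \<tau> - ?v \<tau>)"
        by (rule set_integral_diff(2)[OF cu(3) cv(3), symmetric])
      also have "\<dots> = (LINT \<tau>:{0<..<t}|lebesgue. heatB (t - \<tau>) (n \<tau>) x)"
        unfolding set_lebesgue_integral_def
      proof (rule integral_cong_AE)
        show "(\<lambda>\<tau>. indicat_real {0<..<t} \<tau> *\<^sub>R (?u \<tau> - ?v \<tau>)) \<in> borel_measurable lebesgue"
          using set_integral_diff(1)[OF cu(3) cv(3)] unfolding set_integrable_def by (rule borel_measurable_integrable)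
        show "(\<lambda>\<tau>. indicat_real {0<..<t} \<tau> *\<^sub>R heatB (t - \<tau>) (n \<tau>) x) \<in> borel_measurable lebesgue"
          using nm by (rule measurable_completion)
        show "AE \<tau> in lebesgue. indicat_real {0<..<t} \<tau> *\<^sub>R (?u \<tau> - ?v \<tau>) = indicat_real {0<..<t} \<tau> *\<^sub>R heatB (t - \<tau>) (n \<tau>) x"
          using cu(2) cv(2) ae
        proof eventually_elim
          case (elim \<tau>)
          show ?case
          proof (cases "\<tau> \<in> {0<..<t}")
            case True
            then have "?u \<tau> - ?v \<tau> = heatB (t - \<tau>) (n \<tau>) x"
              using elim source_slice_measurable[OF n(1)] by (intro heat_difference) auto
            then show ?thesis by simp
          qed simp
        qed
      qed
      also have "\<dots> = duhamel n 0 t t x"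
        unfolding duhamel_def set_lebesgue_integral_def by (rule integral_completion[OF nm])
      finally have D: "(LINT \<tau>:{0<..<t}|lebesgue. ?u \<tau>) - (LINT \<tau>:{0<..<t}|lebesgue. ?v \<tau>) = duhamel n 0 t t x" .
      have "u t x - v t x = (heat t \<phi> x - heat t \<psi> x) + a *\<^sub>R ((LINT \<tau>:{0<..<t}|lebesgue. ?u \<tau>) - (LINT \<tau>:{0<..<t}|lebesgue. ?v \<tau>))"
        unfolding cu(4) cv(4) by (simp add: algebra_simps)
      also have "heat t \<phi> x - heat t \<psi> x = heatB t \<zeta> x"
        by (rule heat_difference[OF t cu(1) cv(1) \<zeta>eq \<zeta>m])
      finally show "u t x - v t x = heatB t \<zeta> x + a *\<^sub>R duhamel n 0 t t x" unfolding D .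
    qed
  qed
qed

text \<open>Three ways to use the equation. The first compares u - v with the linear flow and leads
  to the Lorentz norm limit. The second restarts the linear part at s, which converts decay of the
  linear flow in L^{q,r}_l into decay in the scale invariant norm. The third restarts the whole
  equation at s, so that only sources after s remain.\<close>

lemma difference_pointwise_bounds:
  fixes u v :: "real \<Rightarrow> real ^ 'n \<Rightarrow> 'c::euclidean_space"
  assumes rep: "difference_representation a \<gamma> \<alpha> \<phi> \<psi> u v \<zeta> n" and a: "a \<in> {-1, 1}" and t: "t > 0"
    and fin: "AE x in lebesgue. duhamel_nn n 0 t x < \<infinity>"
  shows "AE x in lebesgue. ennreal (norm (u t x - v t x - heat t (\<lambda>x. \<phi> x - \<psi> x) x)) \<le> duhamel_nn n 0 t x"
    and "0 < s \<Longrightarrow> s < t \<Longrightarrow> AE x in lebesgue.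
       ennreal (norm (u t x - v t x)) \<le> nnheat (t - s) (\<lambda>y. ennreal (norm (heat s (\<lambda>x. \<phi> x - \<psi> x) y))) x + duhamel_nn n 0 t x"
    and "0 < s \<Longrightarrow> s < t \<Longrightarrow> \<exists>W. W \<in> borel_measurable borel \<and> (AE x in lebesgue. u s x - v s x = W x) \<and> (AE x in lebesgue.
       ennreal (norm (u t x - v t x)) \<le> nnheat (t - s) (\<lambda>y. ennreal (norm (W y))) x + duhamel_nn n s t x)"
proof -
  have \<zeta>m: "\<zeta> \<in> borel_measurable borel" and nm: "(\<lambda>(\<tau>, x). n \<tau> x) \<in> borel_measurable (borel \<Otimes>\<^sub>M borel)"
    and he: "\<And>t x. t > 0 \<Longrightarrow> heat t (\<lambda>x. \<phi> x - \<psi> x) x = heatB t \<zeta> x"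
    and \<zeta>f: "\<And>t. t > 0 \<Longrightarrow> AE x in lebesgue. nnheat t (\<lambda>y. ennreal (norm (\<zeta> y))) x < \<infinity>"
    and eq: "\<And>t. t > 0 \<Longrightarrow> AE x in lebesgue. u t x - v t x = heatB t \<zeta> x + a *\<^sub>R duhamel n 0 t t x"
    using rep unfolding difference_representation_def by simp_all
  have na: "norm (a *\<^sub>R z) = norm z" for z :: 'c using a by auto
  have duh: "ennreal (norm (duhamel n b t t x)) \<le> duhamel_nn n b t x" for b x
    unfolding duhamel_nn_def by (rule norm_duhamel_le[OF nm order_refl])
  show "AE x in lebesgue. ennreal (norm (u t x - v t x - heat t (\<lambda>x. \<phi> x - \<psi> x) x)) \<le> duhamel_nn n 0 t x"
    using eq[OF t] by eventually_elim (simp add: he[OF t] na duh del: norm_scaleR)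
  have add: "ennreal (norm (x + y)) \<le> P + Q" if "ennreal (norm x) \<le> P" "ennreal (norm y) \<le> Q" for x y :: 'c and P Q
  proof -
    have "ennreal (norm (x + y)) \<le> ennreal (norm x + norm y)" by (intro ennreal_leI norm_triangle_ineq)
    also have "\<dots> \<le> P + Q" using that by (simp add: ennreal_plus add_mono)
    finally show ?thesis .
  qed
  {
    assume s: "0 < s" "s < t"
    then have ts: "t - s > 0" "t - s + s = t" by auto
    have sg: "heatB (t - s) (heatB s \<zeta>) x = heatB t \<zeta> x" if "nnheat t (\<lambda>y. ennreal (norm (\<zeta> y))) x < \<infinity>" for x
      using heatB_semigroup[OF ts(1) s(1) \<zeta>m, of x] that ts(2) by simp
    show "AE x in lebesgue.
       ennreal (norm (u t x - v t x)) \<le> nnheat (t - s) (\<lambda>y. ennreal (norm (heat s (\<lambda>x. \<phi> x - \<psi> x) y))) x + duhamel_nn n 0 t x"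
      using eq[OF t] \<zeta>f[OF t]
    proof eventually_elim
      case (elim x)
      show ?case
        unfolding elim(1) sg[OF elim(2), symmetric] he[OF s(1)]
        by (rule add) (rule norm_heatB_le, unfold na, rule duh)
    qed
    define W where "W = (\<lambda>x. heatB s \<zeta> x + a *\<^sub>R duhamel n 0 s s x)"
    have dm: "duhamel n 0 s s \<in> borel_measurable borel" by (rule duhamel_measurable[OF nm])
    have Wm: "W \<in> borel_measurable borel" unfolding W_def using heatB_measurable[OF \<zeta>m, of s] dm by measurable
    have "AE x in lebesgue. ennreal (norm (u t x - v t x)) \<le> nnheat (t - s) (\<lambda>y. ennreal (norm (W y))) x + duhamel_nn n s t x"
      using eq[OF t] \<zeta>f[OF t] fin
    proof eventually_elim
      case (elim x)
      have hs: "nnheat (t - s) (\<lambda>y. ennreal (norm (heatB s \<zeta> y))) x < \<infinity>"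
      proof -
        have "nnheat (t - s) (\<lambda>y. ennreal (norm (heatB s \<zeta> y))) x \<le> nnheat (t - s) (nnheat s (\<lambda>y. ennreal (norm (\<zeta> y)))) x"
          by (intro nnheat_mono norm_heatB_le)
        also have "\<dots> = nnheat t (\<lambda>y. ennreal (norm (\<zeta> y))) x"
          using nnheat_semigroup[OF ts(1) s(1), of "\<lambda>y. ennreal (norm (\<zeta> y))" x] \<zeta>m ts(2) by simp
        finally show ?thesis using elim(2) by (rule order_le_less_trans)
      qed
      have i1: "integrable lborel (\<lambda>y. heat_kernel (t - s) (x - y) *\<^sub>R heatB s \<zeta> y)"
        by (rule integrable_heatB[OF heatB_measurable[OF \<zeta>m] hs])
      have i2: "integrable lborel (\<lambda>y. heat_kernel (t - s) (x - y) *\<^sub>R duhamel n 0 s s y)"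
        by (rule integrable_heatB[OF dm heatB_duhamel(2)[OF nm s elim(3)]])
      have "heatB (t - s) W x = heatB (t - s) (heatB s \<zeta>) x + a *\<^sub>R heatB (t - s) (duhamel n 0 s s) x"
      proof -
        have "heatB (t - s) W x = (LINT y|lborel. heat_kernel (t - s) (x - y) *\<^sub>R heatB s \<zeta> y + a *\<^sub>R (heat_kernel (t - s) (x - y) *\<^sub>R duhamel n 0 s s y))"
          unfolding heatB_def[of "t - s"] W_def by (intro Bochner_Integration.integral_cong refl) (simp add: scaleR_add_right)
        also have "\<dots> = (LINT y|lborel. heat_kernel (t - s) (x - y) *\<^sub>R heatB s \<zeta> y) + (LINT y|lborel. a *\<^sub>R (heat_kernel (t - s) (x - y) *\<^sub>R duhamel n 0 s s y))"
          by (rule Bochner_Integration.integral_add[OF i1 integrable_scaleR_right]) (rule i2)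
        also have "(LINT y|lborel. a *\<^sub>R (heat_kernel (t - s) (x - y) *\<^sub>R duhamel n 0 s s y)) = a *\<^sub>R (LINT y|lborel. heat_kernel (t - s) (x - y) *\<^sub>R duhamel n 0 s s y)"
          by (rule integral_scaleR_right)
        finally show ?thesis unfolding heatB_def[of "t - s"] .
      qed
      also have "\<dots> = heatB t \<zeta> x + a *\<^sub>R duhamel n 0 s t x"
        unfolding sg[OF elim(2)] heatB_duhamel(1)[OF nm s elim(3)] ..
      finally have "u t x - v t x = heatB (t - s) W x + a *\<^sub>R duhamel n s t t x"
        unfolding elim(1) duhamel_split[OF nm less_imp_le[OF s(1)] s(2) elim(3)] by (simp add: algebra_simps)
      then show ?case
        by (simp only:) (rule add, rule norm_heatB_le, unfold na, rule duh)
    qed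
    then show "\<exists>W. W \<in> borel_measurable borel \<and> (AE x in lebesgue. u s x - v s x = W x) \<and> (AE x in lebesgue.
       ennreal (norm (u t x - v t x)) \<le> nnheat (t - s) (\<lambda>y. ennreal (norm (W y))) x + duhamel_nn n s t x)"
      using Wm eq[OF s(1)] unfolding W_def by blast
  }
qed

lemma lorentz_norm_cong_norm:
  assumes "\<And>x. norm (f x) = norm (g x)"
  shows "lorentz_norm q r f = lorentz_norm q r g"
  unfolding lorentz_norm_def rearrangement_def by (simp only: assms)

lemma wlorentz_norm_minus_commute:
  "wlorentz_norm q r l (\<lambda>x. f x - g x) = wlorentz_norm q r l (\<lambda>x. g x - f x)"
  unfolding wlorentz_norm_def by (rule lorentz_norm_cong_norm) (simp add: norm_minus_commute)

lemma wlorentz_norm_tendsto_0_add: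
  fixes f g :: "real \<Rightarrow> real ^ 'n \<Rightarrow> 'c::euclidean_space"
  assumes r: "1 \<le> r" and m: "\<And>t. t > 0 \<Longrightarrow> f t \<in> borel_measurable lebesgue" "\<And>t. t > 0 \<Longrightarrow> g t \<in> borel_measurable lebesgue"
    and f: "((\<lambda>t. wlorentz_norm q r l (f t)) \<longlongrightarrow> 0) at_top" and g: "((\<lambda>t. wlorentz_norm q r l (g t)) \<longlongrightarrow> 0) at_top"
  shows "((\<lambda>t. wlorentz_norm q r l (\<lambda>x. f t x + g t x)) \<longlongrightarrow> 0) at_top"
proof -
  obtain C where C: "C > 0"
    "\<And>f g :: real ^ 'n \<Rightarrow> 'c. f \<in> borel_measurable lebesgue \<Longrightarrow> g \<in> borel_measurable lebesgue \<Longrightarrow>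
       lorentz_norm q r (\<lambda>x. f x + g x) \<le> ennreal C * (lorentz_norm q r f + lorentz_norm q r g)"
    by (rule lorentz_norm_add_le[OF r, where ?'n='n and ?'c='c]) (rule that)
  have wm: "(\<lambda>x. (norm x powr l) *\<^sub>R h x) \<in> borel_measurable lebesgue" if "h \<in> borel_measurable lebesgue" for h :: "real ^ 'n \<Rightarrow> 'c"
    using norm_measurable_lebesgue that by (rule borel_measurable_scaleR)
  show ?thesis
    unfolding tendsto_0_ennreal_iff
  proof (intro allI impI)
    fix e :: real assume e: "e > 0"
    define \<delta> where "\<delta> = e / (2 * C)"
    have \<delta>: "\<delta> > 0" using e C(1) by (simp add: \<delta>_def)
    show "\<forall>\<^sub>F t in at_top. wlorentz_norm q r l (\<lambda>x. f t x + g t x) \<le> ennreal e"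
      using f[unfolded tendsto_0_ennreal_iff, rule_format, OF \<delta>] g[unfolded tendsto_0_ennreal_iff, rule_format, OF \<delta>] eventually_gt_at_top[of 0]
    proof eventually_elim
      case (elim t)
      have "wlorentz_norm q r l (\<lambda>x. f t x + g t x) \<le> ennreal C * (wlorentz_norm q r l (f t) + wlorentz_norm q r l (g t))"
        unfolding wlorentz_norm_def scaleR_right_distrib by (rule C(2)[OF wm[OF m(1)[OF elim(3)]] wm[OF m(2)[OF elim(3)]]])
      also have "\<dots> \<le> ennreal C * (ennreal \<delta> + ennreal \<delta>)" using elim by (intro mult_left_mono add_mono) auto
      also have "ennreal \<delta> + ennreal \<delta> = ennreal (\<delta> + \<delta>)" using \<delta> by (intro ennreal_plus[symmetric]) auto
      also have "ennreal C * ennreal (\<delta> + \<delta>) = ennreal (C * (\<delta> + \<delta>))" using C(1) by (intro ennreal_mult'[symmetric]) simp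
      also have "C * (\<delta> + \<delta>) = e" using C(1) by (simp add: \<delta>_def)
      finally show ?case .
    qed
  qed
qed

lemma marc_bound_1_of_integral:
  assumes "(\<integral>\<^sup>+x. f x \<partial>lebesgue) \<le> ennreal B"
  shows "marc_bound 1 B f"
  unfolding marc_bound_def
proof
  fix E :: "'a set" assume E: "E \<in> lmeasurable"
  show "(\<integral>\<^sup>+x\<in>E. f x \<partial>lebesgue) \<le> ennreal (B * measure lebesgue E powr (1 - 1))"
  proof (cases "measure lebesgue E = 0")
    case True
    then have "E \<in> null_sets lebesgue"
      using E by (intro null_setsI) (simp_all only: emeasure_eq_measure2 fmeasurableD ennreal_0)
    then show ?thesis by (simp only: nn_integral_null_set zero_le)
  next
    case False
    have "(\<integral>\<^sup>+x\<in>E. f x \<partial>lebesgue) \<le> (\<integral>\<^sup>+x. f x \<partial>lebesgue)"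
      by (intro nn_integral_mono) (auto simp: indicator_def)
    then show ?thesis using assms False by simp
  qed
qed

lemma AE_finite_of_marc_bound:
  fixes F :: "'a::euclidean_space \<Rightarrow> ennreal"
  assumes F[measurable]: "F \<in> borel_measurable borel" and mb: "marc_bound \<mu> B (\<lambda>x. ennreal (norm x powr \<sigma>) * F x)"
  shows "AE x in lebesgue. F x < \<infinity>"
proof -
  have "AE x in lborel. \<forall>n::nat. ennreal (norm x powr \<sigma>) * F x * indicator (ball 0 (real n)) x \<noteq> \<infinity>"
    unfolding AE_all_countable
  proof
    fix n :: nat
    have [measurable]: "ball (0::'a) (real n) \<in> sets borel" by simp
    have "(\<integral>\<^sup>+x\<in>ball 0 (real n). ennreal (norm x powr \<sigma>) * F x \<partial>lborel) \<le> ennreal (B * measure lebesgue (ball (0::'a) (real n)) powr (1 - \<mu>))"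
      using marc_boundD[OF mb lmeasurable_ball, of 0 "real n"] unfolding nn_integral_lebesgue_borel_set .
    then have "(\<integral>\<^sup>+x\<in>ball 0 (real n). ennreal (norm x powr \<sigma>) * F x \<partial>lborel) \<noteq> \<infinity>"
      by (metis ennreal_neq_top infinity_ennreal_def top_unique)
    then show "AE x in lborel. ennreal (norm x powr \<sigma>) * F x * indicator (ball 0 (real n)) x \<noteq> \<infinity>"
      by (intro nn_integral_noteq_infinite) measurable
  qed
  moreover have "AE x in lborel. x \<noteq> (0::'a)" by (rule AE_lborel_singleton)
  ultimately have "AE x in lborel. F x < \<infinity>"
  proof eventually_elim
    case (elim x)
    obtain n where "norm x < real n" using reals_Archimedean2 by blast
    then have "ennreal (norm x powr \<sigma>) * F x \<noteq> \<infinity>" using elim(1)[rule_format, of n] by simp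
    moreover have "norm x powr \<sigma> > 0" using elim(2) by simp
    ultimately show "F x < \<infinity>" by (auto simp: ennreal_mult_eq_top_iff less_top[symmetric])
  qed
  then show ?thesis by (rule AE_completion)
qed

section \<open>Asymptotic equivalence\<close>

locale hardy_henon =
  fixes d \<gamma> \<alpha> l k :: real and q r p :: ennreal
  assumes d: "d > 0" and gamma: "\<gamma> > - min 2 d" and alpha: "\<alpha> > 1 + (2 + \<gamma>) / d"
    and q: "1 \<le> q" and r: "1 \<le> r" and lq: "l / d + recip q = (2 + \<gamma>) / (d * (\<alpha> - 1))"
    and l: "\<gamma> / (\<alpha> - 1) \<le> l" and q1: "q = 1 \<longrightarrow> r = 1" and qinf: "q = \<infinity> \<longrightarrow> r = \<infinity>"
    and p: "ennreal \<alpha> < p" and kl1: "(l + \<gamma>) / \<alpha> \<le> k" and kl: "k \<le> l" and s0: "0 \<le> k / d + recip p"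
    and s_lower: "(2 + \<gamma> * \<alpha>) / (d * \<alpha> * (\<alpha> - 1)) < k / d + recip p"
    and s_upper: "k / d + recip p < (2 + \<gamma>) / (d * (\<alpha> - 1))" "k / d + recip p < (d + \<gamma>) / (d * \<alpha>)"
begin

text \<open>\<open>A\<close> is 1/q_c(\<gamma>). The quantity weight/d + 1/exponent, which governs
  scaling, is \<open>s\<close> for the solutions in K and \<open>s1\<close> for the source, whose
  weight is \<open>sg\<close>. \<open>beta\<close> is the time exponent in the norm of K, and the
  source is of size \<open>\<tau> powr (- theta)\<close>, each of its \<alpha> factors contributing
  \<open>beta\<close>.\<close>

definition A where "A = (2 + \<gamma>) / (d * (\<alpha> - 1))"
definition mu where "mu = recip p"
definition s where "s = k / d + mu"
definition beta where "beta = d / 2 * (A - s)"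
definition theta where "theta = \<alpha> * beta"
definition sg where "sg = \<alpha> * k - \<gamma>"
definition s1 where "s1 = sg / d + \<alpha> * mu"

lemma alpha1: "\<alpha> > 1"
proof -
  have "(2 + \<gamma>) / d > 0" using d gamma by simp
  then show ?thesis using alpha by linarith
qed

lemma dA: "d * (\<alpha> - 1) * A = 2 + \<gamma>"
  using d alpha1 by (simp add: A_def)

lemma A_pos: "0 < A" and A_less_1: "A < 1"
proof -
  have "(2 + \<gamma>) / d < \<alpha> - 1" using alpha by simp
  then have "2 + \<gamma> < d * (\<alpha> - 1)" using d by (simp add: pos_divide_less_eq mult.commute)
  then show "0 < A" "A < 1" using gamma d alpha1 by (simp_all add: A_def)
qed

lemma mu: "0 \<le> mu" "\<alpha> * mu < 1" "mu \<le> 1"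
proof -
  have "0 \<le> mu \<and> \<alpha> * mu < 1"
  proof (cases p)
    case (real x)
    then have "\<alpha> < x" using p alpha1 by (simp add: ennreal_less_iff)
    then have "mu = 1 / x" unfolding mu_def using alpha1 real by (simp add: recip_ennreal)
    then show ?thesis using alpha1 \<open>\<alpha> < x\<close> by simp
  next
    case top
    then have "mu = 0" unfolding mu_def by simp
    then show ?thesis by simp
  qed
  moreover from this have "mu \<le> \<alpha> * mu" using alpha1 mult_right_mono[of 1 \<alpha> mu] by simp
  ultimately show "0 \<le> mu" "\<alpha> * mu < 1" "mu \<le> 1" by auto
qed

lemma s_bounds: "0 \<le> s" "s < A" "s * (d * \<alpha>) < d + \<gamma>" "2 + \<gamma> * \<alpha> < s * (d * \<alpha> * (\<alpha> - 1))"
  using s0 s_upper s_lower d alpha1 by (simp_all add: s_def mu_def A_def pos_less_divide_eq pos_divide_less_eq)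

lemma ds: "d * s = k + d * mu"
  using d by (simp add: s_def distrib_left)

lemma ds1: "d * s1 = \<alpha> * (d * s) - \<gamma>"
proof -
  have "d * s1 = sg + \<alpha> * (d * mu)" using d by (simp add: s1_def distrib_left)
  then show ?thesis unfolding ds sg_def by (simp add: algebra_simps)
qed

lemma two_theta: "2 * theta = \<alpha> * (d * (A - s))"
  by (simp add: theta_def beta_def)

lemma beta_pos: "0 < beta"
  using d s_bounds by (simp add: beta_def)

text \<open>Integrability of the source at time 0. The upper bound is the lower bound on k/d + 1/p
  in the theorem, rewritten with the help of the definition of q_c.\<close>

lemma theta: "0 < theta" "theta < 1"
proof -
  show "0 < theta" using beta_pos alpha1 by (simp add: theta_def)
  have "2 * ((\<alpha> - 1) * theta) = (\<alpha> - 1) * (\<alpha> * (d * (A - s)))"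
    unfolding two_theta[symmetric] by simp
  also have "\<dots> = \<alpha> * (d * (\<alpha> - 1) * A) - s * (d * \<alpha> * (\<alpha> - 1))"
    by (simp add: algebra_simps)
  also have "\<dots> < \<alpha> * (2 + \<gamma>) - (2 + \<gamma> * \<alpha>)" unfolding dA using s_bounds(4) by linarith
  also have "\<dots> = 2 * (\<alpha> - 1)" by (simp add: algebra_simps)
  finally have "(\<alpha> - 1) * theta < (\<alpha> - 1) * 1" by simp
  moreover have "0 < \<alpha> - 1" using alpha1 by simp
  ultimately show "theta < 1" by (simp only: mult_less_cancel_left_pos)
qed

text \<open>s1 < 1 is the bound of k/d + 1/p by (d + \<gamma>)/(d\<alpha>); it lets the heat flow
  act on the source. A < s1 is once more the lower bound on k/d + 1/p; it says that the flow from
  the source space to L^{q,r}_l smooths strictly.\<close>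

lemma s1_bounds: "s1 < 1" "A < s1" "s < s1"
proof -
  have "d * s1 < d" unfolding ds1 using s_bounds(3) by (simp add: algebra_simps)
  then show "s1 < 1" using d by simp
  have "d * (\<alpha> - 1) * s1 = (\<alpha> - 1) * (\<alpha> * (d * s) - \<gamma>)" unfolding ds1[symmetric] by (simp add: mult_ac)
  also have "\<dots> = s * (d * \<alpha> * (\<alpha> - 1)) - \<gamma> * \<alpha> + \<gamma>" by (simp add: algebra_simps)
  also have "\<dots> > d * (\<alpha> - 1) * A" unfolding dA using s_bounds(4) by linarith
  finally show "A < s1" using d alpha1 by (simp add: mult_less_cancel_left_pos)
  then show "s < s1" using s_bounds by linarith
qed

text \<open>The heat estimates only lower weights. The order k \<le> l \<le> sg is exactly (l +
  \<gamma>)/\<alpha> \<le> k \<le> l, so the source may be mapped to both target spaces, and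
  L^{q,r}_l to K.\<close>

lemma weights: "k \<le> sg" "l \<le> sg" "k \<le> l" "- d < k" "- d < l"
proof -
  have "l + \<gamma> \<le> k * \<alpha>" using kl1 alpha1 by (simp add: pos_divide_le_eq)
  then show "l \<le> sg" by (simp add: sg_def mult.commute)
  then show "k \<le> sg" "k \<le> l" using kl by auto
  have mu1: "mu < 1" using mu alpha1 mult_right_mono[of 1 \<alpha> mu] by simp
  have "d * mu < d" using mu1 d by simp
  moreover have "0 \<le> d * s" using d s_bounds by simp
  ultimately show "- d < k" using ds by linarith
  then show "- d < l" using kl by linarith
qed

lemma lA: "l / d + recip q = A"
  using lq by (simp add: A_def)

text \<open>Scale invariance of the problem: the Duhamel operator takes a source of rate
  \<open>theta\<close> to exactly the rate \<open>beta\<close> of K. The identity comes from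
  d(\<alpha> - 1)A = 2 + \<gamma>.\<close>

lemma exponent_K: "1 - d / 2 * (s1 - s) - theta = - beta"
proof -
  have "2 * (d / 2 * (s1 - s) + theta - beta) = d * s1 - d * s + (\<alpha> - 1) * (d * A) - (\<alpha> - 1) * (d * s)"
    by (simp add: theta_def beta_def algebra_simps)
  also have "\<dots> = d * (\<alpha> - 1) * A - \<gamma>" unfolding ds1 by (simp add: algebra_simps)
  also have "\<dots> = 2" unfolding dA by simp
  finally show ?thesis by simp
qed

lemma exponent_K_bounds: "0 \<le> d / 2 * (s1 - s)" "d / 2 * (s1 - s) < 1"
proof -
  show "0 \<le> d / 2 * (s1 - s)" using d s1_bounds by simp
  have "beta < theta" using beta_pos alpha1 by (simp add: theta_def)
  then show "d / 2 * (s1 - s) < 1" using exponent_K by linarith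
qed

text \<open>At m = 1/q no power of t is left, since L^{q,r}_l is scale invariant. Off this exponent
  the power is (t^{d/2})^{m - 1/q}, the form that interpolation with \<rho> = t^{d/2}
  requires.\<close>

lemma exponent_L: "1 - d / 2 * (s1 - (l / d + m)) - theta = d / 2 * (m - recip q)"
proof -
  have l: "l / d = A - recip q" using lA by simp
  have "2 * (d / 2 * (s1 - (l / d + m)) + theta + d / 2 * (m - recip q))
      = d * (s1 - (l / d + m)) + 2 * theta + d * (m - recip q)"
    by (simp only: distrib_left)
  also have "\<dots> = d * s1 - d * A + \<alpha> * (d * A) - \<alpha> * (d * s)"
    unfolding l two_theta by (simp add: algebra_simps)
  also have "\<dots> = d * (\<alpha> - 1) * A - \<gamma>" unfolding ds1 by (simp add: algebra_simps)
  also have "\<dots> = 2" unfolding dA by simp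
  finally show ?thesis by simp
qed

text \<open>Tolerance for moving the target exponent 1/q by \<epsilon>. The bounds by s1 - A and A
  keep the heat estimate available, the one by \<open>theta\<close> keeps the singularity of the
  time integral at t integrable, and the last one keeps the exponents in [0,1].\<close>

lemma margin:
  obtains \<epsilon> where "\<epsilon> > 0" "\<epsilon> < s1 - A" "\<epsilon> < A" "d / 2 * \<epsilon> < theta"
    "1 < q \<Longrightarrow> q < \<infinity> \<Longrightarrow> \<epsilon> \<le> recip q \<and> recip q + \<epsilon> \<le> 1"
proof -
  define x where "x = (if 1 < q \<and> q < \<infinity> then min (recip q) (1 - recip q) else 1)"
  have x: "x > 0"
  proof (cases "1 < q \<and> q < \<infinity>")
    case True
    then obtain y where "q = ennreal y" "y > 1"
      using ennreal_ge_1_cases[OF q] by (metis infinity_ennreal_def order_less_irrefl)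
    then show ?thesis using True by (simp add: x_def recip_ennreal)
  qed (simp only: x_def if_False zero_less_one)
  define \<epsilon> where "\<epsilon> = min (min ((s1 - A) / 2) (A / 2)) (min (theta / d) x)"
  have m: "\<epsilon> \<le> (s1 - A) / 2" "\<epsilon> \<le> A / 2" "\<epsilon> \<le> theta / d" "\<epsilon> \<le> x"
    by (simp_all only: \<epsilon>_def min.cobounded1 min.cobounded2 min.coboundedI1 min.coboundedI2)
  show ?thesis
  proof (rule that)
    show "\<epsilon> > 0" using s1_bounds A_pos theta d x by (simp add: \<epsilon>_def)
    have h: "(s1 - A) / 2 < s1 - A" "A / 2 < A" using s1_bounds(2) A_pos by simp_all
    show "\<epsilon> < s1 - A" by (rule order_le_less_trans[OF m(1) h(1)])
    show "\<epsilon> < A" by (rule order_le_less_trans[OF m(2) h(2)])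
    have "d * \<epsilon> \<le> theta" using m(3) d by (simp add: pos_le_divide_eq mult.commute)
    then show "d / 2 * \<epsilon> < theta" using theta by simp
    show "\<epsilon> \<le> recip q \<and> recip q + \<epsilon> \<le> 1" if "1 < q" "q < \<infinity>" using m(4) that by (simp add: x_def)
  qed
qed

text \<open>One instant of the scale invariant norm of u - v: \<eta> bounds the weak norm multiplied
  by \<open>\<tau> powr beta\<close>. Fixing the time avoids suprema over late times, and \<eta>
  need not be optimal.\<close>

definition diff_bound :: "(real \<Rightarrow> real ^ 'n \<Rightarrow> 'c::euclidean_space) \<Rightarrow> (real \<Rightarrow> real ^ 'n \<Rightarrow> 'c) \<Rightarrow> real \<Rightarrow> real \<Rightarrow> bool" where
  "diff_bound u v \<eta> \<tau> \<longleftrightarrow> weak_bound mu (\<tau> powr (- beta) * \<eta>) (\<lambda>x. norm x powr k * norm (u \<tau> x - v \<tau> x))"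

definition solution_pair where
  "solution_pair a \<phi> \<psi> u v M \<zeta> n \<longleftrightarrow> a \<in> {-1, 1} \<and> 0 < M
     \<and> global_mild_solution a \<gamma> \<alpha> q r l \<phi> u \<and> u \<in> K_space \<gamma> \<alpha> p k
     \<and> global_mild_solution a \<gamma> \<alpha> q r l \<psi> v \<and> v \<in> K_space \<gamma> \<alpha> p k
     \<and> max (K_norm \<gamma> \<alpha> p k u) (K_norm \<gamma> \<alpha> p k v) \<le> ennreal M
     \<and> difference_representation a \<gamma> \<alpha> \<phi> \<psi> u v \<zeta> n"

lemma decay_exponent_eq:
  assumes "d = real CARD('n::finite)"
  shows "decay_exponent CARD('n) \<gamma> \<alpha> p k = beta"
  unfolding decay_exponent_def beta_def inv_qc_def A_def s_def mu_def assms[symmetric] by (simp only: diff_diff_eq)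

lemma norm_weighted: "norm ((norm x powr k) *\<^sub>R y) = norm x powr k * norm y"
  by simp

lemma weighted_measurable:
  fixes f :: "real ^ 'n \<Rightarrow> 'c::euclidean_space"
  assumes "f \<in> borel_measurable lebesgue"
  shows "(\<lambda>x. (norm x powr j) *\<^sub>R f x) \<in> borel_measurable lebesgue"
  using norm_measurable_lebesgue assms by (rule borel_measurable_scaleR)

lemma weak_bound_of_wlorentz:
  fixes f :: "real ^ 'n \<Rightarrow> 'c::euclidean_space"
  assumes "f \<in> borel_measurable lebesgue" "wlorentz_norm p \<infinity> k f \<le> ennreal B" "0 \<le> B"
  shows "weak_bound mu B (\<lambda>x. norm x powr k * norm (f x))"
  using weak_bound_of_lorentz_infinity[OF weighted_measurable[OF assms(1)], of p k B] assms(2,3)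
  unfolding wlorentz_norm_def mu_def norm_weighted by simp

lemma wlorentz_of_weak_bound:
  fixes f :: "real ^ 'n \<Rightarrow> 'c::euclidean_space"
  assumes "f \<in> borel_measurable lebesgue" "weak_bound mu B (\<lambda>x. norm x powr k * norm (f x))"
  shows "wlorentz_norm p \<infinity> k f \<le> ennreal B"
  using lorentz_infinity_of_weak_bound[OF weighted_measurable[OF assms(1)], of p B k] assms(2)
  unfolding wlorentz_norm_def mu_def norm_weighted by simp

lemma K_norm_weak_bound:
  fixes u :: "real \<Rightarrow> real ^ 'n \<Rightarrow> 'c::euclidean_space"
  assumes dn: "d = real CARD('n)" and M: "0 \<le> M" and K: "K_norm \<gamma> \<alpha> p k u \<le> ennreal M" and t: "t > 0"
    and m: "u t \<in> borel_measurable lebesgue"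
  shows "weak_bound mu (t powr (- beta) * M) (\<lambda>x. norm x powr k * norm (u t x))"
proof (rule weak_bound_of_wlorentz[OF m])
  have "ennreal (t powr beta) * wlorentz_norm p \<infinity> k (u t) \<le> K_norm \<gamma> \<alpha> p k u"
    unfolding K_norm_def decay_exponent_eq[OF dn] using t by (intro SUP_upper) simp
  then have "ennreal (t powr beta) * wlorentz_norm p \<infinity> k (u t) \<le> ennreal M" using K by (rule order_trans)
  then have "ennreal (t powr (- beta)) * (ennreal (t powr beta) * wlorentz_norm p \<infinity> k (u t)) \<le> ennreal (t powr (- beta)) * ennreal M"
    by (intro mult_left_mono) auto
  also have "ennreal (t powr (- beta)) * (ennreal (t powr beta) * wlorentz_norm p \<infinity> k (u t)) = wlorentz_norm p \<infinity> k (u t)"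
    using t by (simp add: mult.assoc[symmetric] ennreal_mult'[symmetric] powr_add[symmetric])
  also have "ennreal (t powr (- beta)) * ennreal M = ennreal (t powr (- beta) * M)"
    using M by (simp add: ennreal_mult')
  finally show "wlorentz_norm p \<infinity> k (u t) \<le> ennreal (t powr (- beta) * M)" .
qed (use M in simp)

lemma solution_pairD:
  assumes "solution_pair a \<phi> \<psi> u v M \<zeta> n"
  shows "a \<in> {-1, 1}" "0 < M" "K_norm \<gamma> \<alpha> p k u \<le> ennreal M" "K_norm \<gamma> \<alpha> p k v \<le> ennreal M"
    "\<And>t. t > 0 \<Longrightarrow> u t \<in> borel_measurable lebesgue" "\<And>t. t > 0 \<Longrightarrow> v t \<in> borel_measurable lebesgue"
    "difference_representation a \<gamma> \<alpha> \<phi> \<psi> u v \<zeta> n"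
  using assms unfolding solution_pair_def by (simp_all add: K_space_def)

text \<open>The a priori bound, called \<open>H\<close> below, which holds at all positive times and
  is the starting point of every asymptotic argument. The factor \<open>2 * 3 powr mu\<close> is
  that of the sum in weak spaces.\<close>

lemma diff_bound_initial:
  fixes u v :: "real \<Rightarrow> real ^ 'n \<Rightarrow> 'c::euclidean_space"
  assumes dn: "d = real CARD('n)" and sp: "solution_pair a \<phi> \<psi> u v M \<zeta> n" and t: "t > 0"
  shows "diff_bound u v (2 * 3 powr mu * M) t"
proof -
  note S = solution_pairD[OF sp]
  have b: "0 < t powr (- beta) * M" using t S(2) by simp
  have "weak_bound mu (2 * 3 powr mu * (t powr (- beta) * M)) (\<lambda>x. norm x powr k * norm (u t x - v t x))"
  proof (rule weak_bound_add[OF mu(1) b])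
    show "weak_bound mu (t powr (- beta) * M) (\<lambda>x. norm x powr k * norm (u t x))"
      by (rule K_norm_weak_bound[OF dn less_imp_le[OF S(2)] S(3) t S(5)[OF t]])
    show "weak_bound mu (t powr (- beta) * M) (\<lambda>x. norm x powr k * norm (v t x))"
      by (rule K_norm_weak_bound[OF dn less_imp_le[OF S(2)] S(4) t S(6)[OF t]])
    show "norm x powr k * norm (u t x - v t x) \<le> norm x powr k * norm (u t x) + norm x powr k * norm (v t x)" for x
      unfolding distrib_left[symmetric] by (intro mult_left_mono norm_triangle_ineq4) simp
  qed (rule weighted_norm_measurable_lebesgue S(5)[OF t] S(6)[OF t])+
  then show ?thesis unfolding diff_bound_def by (simp add: mult_ac)
qed

text \<open>Of the \<alpha> factors of size \<open>\<tau> powr (- beta)\<close>, \<alpha> - 1 are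
  bounded by \<open>M\<close> and one by \<eta>; this is where the small factor
  \<open>M powr (\<alpha> - 1)\<close> originates. The quantifier over \<eta> stands inside the
  almost everywhere statement, so the exceptional times do not depend on \<eta>, which may then vary
  with \<tau>.\<close>

lemma source_bound:
  assumes dn: "d = real CARD('n::finite)"
  obtains C where "C > 0"
    "\<And>a \<phi> \<psi> (u :: real \<Rightarrow> real ^ 'n \<Rightarrow> 'c::euclidean_space) v M \<zeta> n. solution_pair a \<phi> \<psi> u v M \<zeta> n \<Longrightarrow>
       AE \<tau> in lborel. 0 < \<tau> \<longrightarrow> (\<forall>\<eta>>0. diff_bound u v \<eta> \<tau> \<longrightarrow>
         marc_bound (\<alpha> * mu) (C * M powr (\<alpha> - 1) * (\<tau> powr (- theta) * \<eta>)) (\<lambda>y. ennreal (norm y powr sg) * ennreal (norm (n \<tau> y))))"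
proof -
  obtain C where C: "C > 0"
    "\<And>(u :: real ^ 'n \<Rightarrow> 'c) v A B. u \<in> borel_measurable lebesgue \<Longrightarrow> v \<in> borel_measurable lebesgue \<Longrightarrow> 0 < A \<Longrightarrow> 0 < B \<Longrightarrow>
       weak_bound mu A (\<lambda>x. norm x powr k * norm (u x)) \<Longrightarrow> weak_bound mu A (\<lambda>x. norm x powr k * norm (v x)) \<Longrightarrow>
       weak_bound mu B (\<lambda>x. norm x powr k * norm (u x - v x)) \<Longrightarrow>
       marc_bound (\<alpha> * mu) (C * (A powr (\<alpha> - 1) * B))
         (\<lambda>x. ennreal (norm x powr (\<alpha> * k - \<gamma>)) * ennreal (norm (nonlinearity \<gamma> \<alpha> u x - nonlinearity \<gamma> \<alpha> v x)))"
    by (rule nonlinearity_difference_marc_bound[OF alpha1 mu(1,2)]) (rule that)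
  show ?thesis
  proof (rule that[OF C(1)])
    fix a \<phi> \<psi> and u v :: "real \<Rightarrow> real ^ 'n \<Rightarrow> 'c" and M \<zeta> n
    assume sp: "solution_pair a \<phi> \<psi> u v M \<zeta> n"
    note S = solution_pairD[OF sp]
    have ae: "AE \<tau> in lborel. 0 < \<tau> \<longrightarrow> (AE x in lebesgue. nonlinearity \<gamma> \<alpha> (u \<tau>) x - nonlinearity \<gamma> \<alpha> (v \<tau>) x = n \<tau> x)"
      using S(7) unfolding difference_representation_def by (elim conjE)
    show "AE \<tau> in lborel. 0 < \<tau> \<longrightarrow> (\<forall>\<eta>>0. diff_bound u v \<eta> \<tau> \<longrightarrow>
         marc_bound (\<alpha> * mu) (C * M powr (\<alpha> - 1) * (\<tau> powr (- theta) * \<eta>)) (\<lambda>y. ennreal (norm y powr sg) * ennreal (norm (n \<tau> y))))"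
      using ae
    proof eventually_elim
      case (elim \<tau>)
      show ?case
      proof (intro impI allI)
        fix \<eta> :: real assume \<tau>: "0 < \<tau>" and \<eta>: "0 < \<eta>" and diff_bound: "diff_bound u v \<eta> \<tau>"
        have eq: "AE x in lebesgue. nonlinearity \<gamma> \<alpha> (u \<tau>) x - nonlinearity \<gamma> \<alpha> (v \<tau>) x = n \<tau> x" using elim \<tau> by (rule mp)
        have pos: "0 < \<tau> powr (- beta) * M" "0 < \<tau> powr (- beta) * \<eta>" using \<tau> \<eta> S(2) by simp_all
        have M0: "0 \<le> M" using S(2) by simp
        have mb: "marc_bound (\<alpha> * mu) (C * ((\<tau> powr (- beta) * M) powr (\<alpha> - 1) * (\<tau> powr (- beta) * \<eta>)))
            (\<lambda>x. ennreal (norm x powr (\<alpha> * k - \<gamma>)) * ennreal (norm (nonlinearity \<gamma> \<alpha> (u \<tau>) x - nonlinearity \<gamma> \<alpha> (v \<tau>) x)))"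
          by (rule C(2)[OF S(5)[OF \<tau>] S(6)[OF \<tau>] pos K_norm_weak_bound[OF dn M0 S(3) \<tau> S(5)[OF \<tau>]] K_norm_weak_bound[OF dn M0 S(4) \<tau> S(6)[OF \<tau>]] diff_bound[unfolded diff_bound_def]])
        have "C * ((\<tau> powr (- beta) * M) powr (\<alpha> - 1) * (\<tau> powr (- beta) * \<eta>)) = C * M powr (\<alpha> - 1) * ((\<tau> powr (- beta)) powr (\<alpha> - 1) * \<tau> powr (- beta) * \<eta>)"
          using S(2) by (simp add: powr_mult mult_ac)
        also have "(\<tau> powr (- beta)) powr (\<alpha> - 1) * \<tau> powr (- beta) = \<tau> powr (- theta)"
          unfolding powr_powr powr_add[symmetric] by (simp add: theta_def algebra_simps)
        finally have ceq: "C * ((\<tau> powr (- beta) * M) powr (\<alpha> - 1) * (\<tau> powr (- beta) * \<eta>)) \<le> C * M powr (\<alpha> - 1) * (\<tau> powr (- theta) * \<eta>)"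
          by (rule eq_refl)
        show "marc_bound (\<alpha> * mu) (C * M powr (\<alpha> - 1) * (\<tau> powr (- theta) * \<eta>)) (\<lambda>y. ennreal (norm y powr sg) * ennreal (norm (n \<tau> y)))"
          by (rule marc_bound_mono[OF mb ceq]) (use eq in eventually_elim, simp add: sg_def)
      qed
    qed
  qed
qed

text \<open>Both estimates are for a general target of weight \<sigma>2 and exponent \<mu>2, as they
  are applied to K and to neighbours of L^{q,r}_l. The first weighs early against late times, the
  second uses only the a priori bound on a short final interval and gains a power of
  \<epsilon>.\<close>

lemma duhamel_bounds:
  fixes \<sigma>2 \<mu>2 e :: real
  assumes dn: "d = real CARD('n::finite)" and \<mu>2: "0 \<le> \<mu>2" "\<mu>2 \<le> 1" and \<sigma>2: "\<sigma>2 \<le> sg" "- d < \<sigma>2"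
    and s2: "0 \<le> \<sigma>2 / d + \<mu>2" "\<sigma>2 / d + \<mu>2 < s1"
    and e: "e = d / 2 * (s1 - (\<sigma>2 / d + \<mu>2))" "e < 1"
  obtains C where "C > 0"
    "\<And>a \<phi> \<psi> (u :: real \<Rightarrow> real ^ 'n \<Rightarrow> 'c::euclidean_space) v M \<zeta> n T t H \<eta>. solution_pair a \<phi> \<psi> u v M \<zeta> n \<Longrightarrow>
       0 < T \<Longrightarrow> T \<le> t / 2 \<Longrightarrow> 0 < H \<Longrightarrow> 0 < \<eta> \<Longrightarrow> \<forall>\<tau>>0. diff_bound u v H \<tau> \<Longrightarrow> \<forall>\<tau>\<ge>T. diff_bound u v \<eta> \<tau> \<Longrightarrow>
       marc_bound \<mu>2 (C * M powr (\<alpha> - 1) * t powr (1 - e - theta) * (\<eta> + H * (T / t) powr (1 - theta)))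
         (\<lambda>x. ennreal (norm x powr \<sigma>2) * duhamel_nn n 0 t x)"
    "\<And>a \<phi> \<psi> (u :: real \<Rightarrow> real ^ 'n \<Rightarrow> 'c::euclidean_space) v M \<zeta> n \<epsilon> t H. solution_pair a \<phi> \<psi> u v M \<zeta> n \<Longrightarrow>
       0 < \<epsilon> \<Longrightarrow> \<epsilon> \<le> 1 / 2 \<Longrightarrow> 0 < t \<Longrightarrow> 0 < H \<Longrightarrow> \<forall>\<tau>>0. diff_bound u v H \<tau> \<Longrightarrow>
       marc_bound \<mu>2 (C * M powr (\<alpha> - 1) * H * \<epsilon> powr (1 - e) * t powr (1 - e - theta))
         (\<lambda>x. ennreal (norm x powr \<sigma>2) * duhamel_nn n ((1 - \<epsilon>) * t) t x)"
proof -
  have \<alpha>mu: "0 \<le> \<alpha> * mu" "\<alpha> * mu \<le> 1" using mu alpha1 by auto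
  have e0: "0 \<le> e" unfolding e(1) using s2 d by (intro mult_nonneg_nonneg) auto
  have th: "0 \<le> theta" "theta < 1" using theta by auto
  obtain CS where CS: "CS > 0"
    "\<And>a \<phi> \<psi> (u :: real \<Rightarrow> real ^ 'n \<Rightarrow> 'c) v M \<zeta> n. solution_pair a \<phi> \<psi> u v M \<zeta> n \<Longrightarrow>
       AE \<tau> in lborel. 0 < \<tau> \<longrightarrow> (\<forall>\<eta>>0. diff_bound u v \<eta> \<tau> \<longrightarrow>
         marc_bound (\<alpha> * mu) (CS * M powr (\<alpha> - 1) * (\<tau> powr (- theta) * \<eta>)) (\<lambda>y. ennreal (norm y powr sg) * ennreal (norm (n \<tau> y))))"
    by (rule source_bound[OF dn]) (rule that)
  obtain CD where CD: "CD > 0"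
    "\<And>(n :: real \<Rightarrow> real ^ 'n \<Rightarrow> 'c) w a t I.
      (\<lambda>(\<tau>, x). n \<tau> x) \<in> borel_measurable (borel \<Otimes>\<^sub>M borel) \<Longrightarrow> w \<in> borel_measurable borel \<Longrightarrow> 0 \<le> I \<Longrightarrow>
      AE \<tau> in lborel. \<tau> \<in> {a<..<t} \<longrightarrow> 0 \<le> w \<tau> \<and> marc_bound (\<alpha> * mu) (w \<tau>) (\<lambda>y. ennreal (norm y powr sg) * ennreal (norm (n \<tau> y))) \<Longrightarrow>
      (\<integral>\<^sup>+\<tau>\<in>{a<..<t}. ennreal ((t - \<tau>) powr (-e) * w \<tau>) \<partial>lborel) \<le> ennreal I \<Longrightarrow>
      marc_bound \<mu>2 (CD * I) (\<lambda>x. ennreal (norm x powr \<sigma>2) * duhamel_nn n a t x)"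
  proof (rule duhamel_marc_bound[where ?'n='n and ?'c='c, OF \<alpha>mu \<mu>2 \<sigma>2(1)])
    show "- real CARD('n) < \<sigma>2" using \<sigma>2 dn by simp
    show "sg / real CARD('n) + \<alpha> * mu < 1" using s1_bounds(1) unfolding s1_def dn[symmetric] .
    show "0 \<le> \<sigma>2 / real CARD('n) + \<mu>2" using s2(1) unfolding dn[symmetric] .
    show "\<sigma>2 / real CARD('n) + \<mu>2 < sg / real CARD('n) + \<alpha> * mu" using s2(2) unfolding s1_def dn[symmetric] .
    show "e = real CARD('n) / 2 * (sg / real CARD('n) + \<alpha> * mu - (\<sigma>2 / real CARD('n) + \<mu>2))" using e(1) unfolding s1_def dn[symmetric] .
  qed (rule that)
  obtain C1 where C1: "C1 > 0" "\<And>t T H \<eta> :: real. 0 < T \<Longrightarrow> T \<le> t / 2 \<Longrightarrow> 0 \<le> H \<Longrightarrow> 0 \<le> \<eta> \<Longrightarrow>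
      (\<integral>\<^sup>+\<tau>\<in>{0<..<t}. ennreal ((t - \<tau>) powr (-e) * (\<tau> powr (-theta) * (if \<tau> < T then H else \<eta>))) \<partial>lborel)
        \<le> ennreal (C1 * t powr (1 - e - theta) * (\<eta> + H * (T / t) powr (1 - theta)))"
    by (rule time_integral_step[OF e0 e(2) th]) (rule that)
  obtain C2 where C2: "C2 > 0" "\<And>\<epsilon> t :: real. 0 < \<epsilon> \<Longrightarrow> \<epsilon> \<le> 1 / 2 \<Longrightarrow> 0 < t \<Longrightarrow>
      (\<integral>\<^sup>+\<tau>\<in>{(1 - \<epsilon>) * t<..<t}. ennreal ((t - \<tau>) powr (-e) * \<tau> powr (-theta)) \<partial>lborel)
        \<le> ennreal (C2 * \<epsilon> powr (1 - e) * t powr (1 - e - theta))"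
    by (rule time_integral_tail[OF e0 e(2) th(1)]) (rule that)
  have weight: "(\<integral>\<^sup>+\<tau>\<in>S. ennreal (f \<tau> * (c * g \<tau>)) \<partial>lborel) \<le> ennreal (c * J)"
    if "(\<integral>\<^sup>+\<tau>\<in>S. ennreal (f \<tau> * g \<tau>) \<partial>lborel) \<le> ennreal J" "0 \<le> c"
      and m: "(\<lambda>\<tau>. f \<tau> * g \<tau>) \<in> borel_measurable borel" "S \<in> sets borel" for S :: "real set" and f g c J
  proof -
    note [measurable] = m
    have "(\<integral>\<^sup>+\<tau>\<in>S. ennreal (f \<tau> * (c * g \<tau>)) \<partial>lborel) = (\<integral>\<^sup>+\<tau>. ennreal c * (ennreal (f \<tau> * g \<tau>) * indicator S \<tau>) \<partial>lborel)"
      using that(2) by (intro nn_integral_cong) (simp add: ennreal_mult'[symmetric] mult_ac indicator_def)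
    also have "\<dots> = ennreal c * (\<integral>\<^sup>+\<tau>\<in>S. ennreal (f \<tau> * g \<tau>) \<partial>lborel)" by (rule nn_integral_cmult) measurable
    also have "\<dots> \<le> ennreal c * ennreal J" using that(1) by (intro mult_left_mono) auto
    also have "\<dots> = ennreal (c * J)" using that(2) by (simp add: ennreal_mult')
    finally show ?thesis .
  qed
  define C where "C = CD * CS * (C1 + C2)"
  have C: "C > 0" using CD(1) CS(1) C1(1) C2(1) by (simp add: C_def)
  have Cle: "CD * CS * C1 \<le> C" "CD * CS * C2 \<le> C"
    using CD(1) CS(1) C1(1) C2(1) by (simp_all add: C_def distrib_left)
  show ?thesis
  proof (rule that[OF C])
    fix a \<phi> \<psi> and u v :: "real \<Rightarrow> real ^ 'n \<Rightarrow> 'c" and M \<zeta> n and T t H \<eta> :: real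
    assume sp: "solution_pair a \<phi> \<psi> u v M \<zeta> n" and T: "0 < T" "T \<le> t / 2" and H: "0 < H" and \<eta>: "0 < \<eta>"
      and hH: "\<forall>\<tau>>0. diff_bound u v H \<tau>" and h\<eta>: "\<forall>\<tau>\<ge>T. diff_bound u v \<eta> \<tau>"
    note S = solution_pairD[OF sp]
    have nm: "(\<lambda>(\<tau>, x). n \<tau> x) \<in> borel_measurable (borel \<Otimes>\<^sub>M borel)"
      using S(7) unfolding difference_representation_def by (elim conjE)
    define c where "c = CS * M powr (\<alpha> - 1)"
    have c: "c \<ge> 0" using CS(1) by (simp add: c_def)
    define w where "w = (\<lambda>\<tau>. c * (\<tau> powr (- theta) * (if \<tau> < T then H else \<eta>)))"
    define J where "J = C1 * t powr (1 - e - theta) * (\<eta> + H * (T / t) powr (1 - theta))"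
    have J: "J \<ge> 0" using C1(1) \<eta> H by (simp add: J_def)
    have wm: "w \<in> borel_measurable borel" unfolding w_def by measurable
    have "marc_bound \<mu>2 (CD * (c * J)) (\<lambda>x. ennreal (norm x powr \<sigma>2) * duhamel_nn n 0 t x)"
    proof (rule CD(2)[OF nm wm])
      show "0 \<le> c * J" using c J by simp
      show "AE \<tau> in lborel. \<tau> \<in> {0<..<t} \<longrightarrow> 0 \<le> w \<tau> \<and> marc_bound (\<alpha> * mu) (w \<tau>) (\<lambda>y. ennreal (norm y powr sg) * ennreal (norm (n \<tau> y)))"
        using CS(2)[OF sp]
      proof eventually_elim
        case (elim \<tau>)
        show ?case
        proof (intro impI conjI)
          assume \<tau>: "\<tau> \<in> {0<..<t}"
          show "0 \<le> w \<tau>" using c H \<eta> by (simp add: w_def)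
          have "diff_bound u v (if \<tau> < T then H else \<eta>) \<tau>" using hH h\<eta> \<tau> by simp
          then show "marc_bound (\<alpha> * mu) (w \<tau>) (\<lambda>y. ennreal (norm y powr sg) * ennreal (norm (n \<tau> y)))"
            using elim \<tau> H \<eta> unfolding w_def c_def by simp
        qed
      qed
      show "(\<integral>\<^sup>+\<tau>\<in>{0<..<t}. ennreal ((t - \<tau>) powr (-e) * w \<tau>) \<partial>lborel) \<le> ennreal (c * J)"
        unfolding w_def J_def by (rule weight[OF C1(2)[OF T less_imp_le[OF H] less_imp_le[OF \<eta>]] c]) measurable
    qed
    then show "marc_bound \<mu>2 (C * M powr (\<alpha> - 1) * t powr (1 - e - theta) * (\<eta> + H * (T / t) powr (1 - theta)))
         (\<lambda>x. ennreal (norm x powr \<sigma>2) * duhamel_nn n 0 t x)"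
    proof (rule marc_bound_mono)
      have "CD * (c * J) = CD * CS * C1 * (M powr (\<alpha> - 1) * (t powr (1 - e - theta) * (\<eta> + H * (T / t) powr (1 - theta))))"
        by (simp add: c_def J_def)
      also have "\<dots> \<le> C * (M powr (\<alpha> - 1) * (t powr (1 - e - theta) * (\<eta> + H * (T / t) powr (1 - theta))))"
        using Cle(1) H \<eta> by (intro mult_right_mono) auto
      finally show "CD * (c * J) \<le> C * M powr (\<alpha> - 1) * t powr (1 - e - theta) * (\<eta> + H * (T / t) powr (1 - theta))"
        by (simp only: mult.assoc)
    qed simp
  next
    fix a \<phi> \<psi> and u v :: "real \<Rightarrow> real ^ 'n \<Rightarrow> 'c" and M \<zeta> n and \<epsilon> t H :: real
    assume sp: "solution_pair a \<phi> \<psi> u v M \<zeta> n" and \<epsilon>: "0 < \<epsilon>" "\<epsilon> \<le> 1 / 2" and t: "0 < t" and H: "0 < H"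
      and hH: "\<forall>\<tau>>0. diff_bound u v H \<tau>"
    note S = solution_pairD[OF sp]
    have nm: "(\<lambda>(\<tau>, x). n \<tau> x) \<in> borel_measurable (borel \<Otimes>\<^sub>M borel)"
      using S(7) unfolding difference_representation_def by (elim conjE)
    define c where "c = CS * M powr (\<alpha> - 1) * H"
    have c: "c \<ge> 0" using CS(1) H by (simp add: c_def)
    define w where "w = (\<lambda>\<tau>. c * \<tau> powr (- theta))"
    define J where "J = C2 * \<epsilon> powr (1 - e) * t powr (1 - e - theta)"
    have J: "J \<ge> 0" using C2(1) by (simp add: J_def)
    have wm: "w \<in> borel_measurable borel" unfolding w_def by measurable
    have "marc_bound \<mu>2 (CD * (c * J)) (\<lambda>x. ennreal (norm x powr \<sigma>2) * duhamel_nn n ((1 - \<epsilon>) * t) t x)"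
    proof (rule CD(2)[OF nm wm])
      show "0 \<le> c * J" using c J by simp
      show "AE \<tau> in lborel. \<tau> \<in> {(1 - \<epsilon>) * t<..<t} \<longrightarrow> 0 \<le> w \<tau> \<and> marc_bound (\<alpha> * mu) (w \<tau>) (\<lambda>y. ennreal (norm y powr sg) * ennreal (norm (n \<tau> y)))"
        using CS(2)[OF sp]
      proof eventually_elim
        case (elim \<tau>)
        show ?case
        proof (intro impI conjI)
          assume \<tau>: "\<tau> \<in> {(1 - \<epsilon>) * t<..<t}"
          have "0 \<le> (1 - \<epsilon>) * t" using \<epsilon> t by simp
          then have \<tau>0: "0 < \<tau>" using \<tau> by simp
          show "0 \<le> w \<tau>" using c by (simp add: w_def)
          have "marc_bound (\<alpha> * mu) (CS * M powr (\<alpha> - 1) * (\<tau> powr (- theta) * H)) (\<lambda>y. ennreal (norm y powr sg) * ennreal (norm (n \<tau> y)))"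
            using elim \<tau>0 H hH by simp
          moreover have "w \<tau> = CS * M powr (\<alpha> - 1) * (\<tau> powr (- theta) * H)" by (simp add: w_def c_def mult_ac)
          ultimately show "marc_bound (\<alpha> * mu) (w \<tau>) (\<lambda>y. ennreal (norm y powr sg) * ennreal (norm (n \<tau> y)))" by simp
        qed
      qed
      show "(\<integral>\<^sup>+\<tau>\<in>{(1 - \<epsilon>) * t<..<t}. ennreal ((t - \<tau>) powr (-e) * w \<tau>) \<partial>lborel) \<le> ennreal (c * J)"
        unfolding w_def J_def by (rule weight[OF C2(2)[OF \<epsilon> t] c]) measurable
    qed
    then show "marc_bound \<mu>2 (C * M powr (\<alpha> - 1) * H * \<epsilon> powr (1 - e) * t powr (1 - e - theta))
         (\<lambda>x. ennreal (norm x powr \<sigma>2) * duhamel_nn n ((1 - \<epsilon>) * t) t x)"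
    proof (rule marc_bound_mono)
      have "CD * (c * J) = CD * CS * C2 * (M powr (\<alpha> - 1) * (H * (\<epsilon> powr (1 - e) * t powr (1 - e - theta))))"
        by (simp add: c_def J_def)
      also have "\<dots> \<le> C * (M powr (\<alpha> - 1) * (H * (\<epsilon> powr (1 - e) * t powr (1 - e - theta))))"
        using Cle(2) H by (intro mult_right_mono) auto
      finally show "CD * (c * J) \<le> C * M powr (\<alpha> - 1) * H * \<epsilon> powr (1 - e) * t powr (1 - e - theta)"
        by (simp only: mult.assoc)
    qed simp
  qed
qed

text \<open>The smoothing L^{q,r}_l to K with the critical rate. It starts from the weak space of
  exponent q, into which L^{q,r} embeds for every r.\<close>

lemma linear_bound:
  assumes dn: "d = real CARD('n::finite)"
  obtains C where "C > 0"
    "\<And>(f :: real ^ 'n \<Rightarrow> 'c::euclidean_space) W B t. f \<in> borel_measurable lebesgue \<Longrightarrow> W \<in> borel_measurable borel \<Longrightarrow> AE x in lebesgue. f x = W x \<Longrightarrow>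
      wlorentz_norm q r l f \<le> ennreal B \<Longrightarrow> 0 \<le> B \<Longrightarrow> 0 < t \<Longrightarrow>
      marc_bound mu (C * t powr (- beta) * B) (\<lambda>x. ennreal (norm x powr k) * nnheat t (\<lambda>y. ennreal (norm (W y))) x)"
proof -
  have rq: "0 \<le> recip q" "recip q \<le> 1" using recip_le_1[OF q] by auto
  have "\<exists>C>0. \<forall>(f :: real ^ 'n \<Rightarrow> 'c) B. f \<in> borel_measurable lebesgue \<longrightarrow> wlorentz_norm q r l f \<le> ennreal B \<longrightarrow> 0 \<le> B \<longrightarrow>
     marc_bound (recip q) (C * B) (\<lambda>y. ennreal (norm y powr l) * ennreal (norm (f y)))"
  \<comment> \<open>At q = 1 the weak space gives no bound of integrals over sets; the full L^1
    norm, available because r = 1, is used instead.\<close>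
  proof (cases "q = 1")
    case True
    then have r1: "r = 1" using q1 by simp
    show ?thesis
    proof (intro exI[of _ 1] conjI allI impI)
      fix f :: "real ^ 'n \<Rightarrow> 'c" and B :: real
      assume f: "f \<in> borel_measurable lebesgue" and B: "wlorentz_norm q r l f \<le> ennreal B"
      have "(\<integral>\<^sup>+x. ennreal (norm ((norm x powr l) *\<^sub>R f x)) \<partial>lebesgue) \<le> ennreal B"
        using B unfolding wlorentz_norm_def True r1 lorentz_norm_1_1[OF weighted_measurable[OF f]] .
      then have "marc_bound 1 B (\<lambda>x. ennreal (norm ((norm x powr l) *\<^sub>R f x)))" by (rule marc_bound_1_of_integral)
      then show "marc_bound (recip q) (1 * B) (\<lambda>y. ennreal (norm y powr l) * ennreal (norm (f y)))"
        using True by (simp add: ennreal_mult'[symmetric])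
    qed simp
  next
    case False
    have lt1: "recip q < 1"
    proof (rule ennreal_ge_1_cases[OF q])
      fix x assume "q = ennreal x" "x > 1"
      then show ?thesis by (simp add: recip_ennreal)
    qed (use False in auto)
    obtain C where C: "C > 0" "\<And>A (g :: real ^ 'n \<Rightarrow> real). g \<in> borel_measurable lebesgue \<Longrightarrow> weak_bound (recip q) A g \<Longrightarrow>
        marc_bound (recip q) (C * A) (\<lambda>x. ennreal (g x))"
      by (rule marc_bound_of_weak_bound[OF rq(1) lt1, where ?'a="real ^ 'n"]) (rule that)
    show ?thesis
    proof (intro exI[of _ "C * 2 powr (recip q + 1)"] conjI allI impI)
      fix f :: "real ^ 'n \<Rightarrow> 'c" and B :: real
      assume f: "f \<in> borel_measurable lebesgue" and B: "wlorentz_norm q r l f \<le> ennreal B" "0 \<le> B"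
      have "weak_bound (recip q) (2 powr (recip q + 1) * B) (\<lambda>x. norm ((norm x powr l) *\<^sub>R f x))"
        by (rule weak_bound_of_lorentz[OF weighted_measurable[OF f] r _ B(2)]) (use B(1) in \<open>simp only: wlorentz_norm_def\<close>)
      then have "weak_bound (recip q) (2 powr (recip q + 1) * B) (\<lambda>x. norm x powr l * norm (f x))" by simp
      from C(2)[OF weighted_norm_measurable_lebesgue[OF f] this]
      show "marc_bound (recip q) (C * 2 powr (recip q + 1) * B) (\<lambda>y. ennreal (norm y powr l) * ennreal (norm (f y)))"
        by (simp add: ennreal_mult'[symmetric] mult.assoc)
    qed (use C(1) in simp)
  qed
  then obtain C1 where C1: "C1 > 0" "\<And>(f :: real ^ 'n \<Rightarrow> 'c) B. f \<in> borel_measurable lebesgue \<Longrightarrow> wlorentz_norm q r l f \<le> ennreal B \<Longrightarrow> 0 \<le> B \<Longrightarrow>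
     marc_bound (recip q) (C1 * B) (\<lambda>y. ennreal (norm y powr l) * ennreal (norm (f y)))" by blast
  obtain C2 where C2: "C2 > 0" "\<And>(f :: real ^ 'n \<Rightarrow> ennreal) B t. f \<in> borel_measurable borel \<Longrightarrow> 0 \<le> B \<Longrightarrow> 0 < t \<Longrightarrow>
    marc_bound (recip q) B (\<lambda>y. ennreal (norm y powr l) * f y) \<Longrightarrow>
    marc_bound mu (C2 * t powr (- (CARD('n) / 2 * ((l / CARD('n) + recip q) - (k / CARD('n) + mu)))) * B)
      (\<lambda>x. ennreal (norm x powr k) * nnheat t f x)"
  proof (rule heat_marc_bound[where ?'n='n, OF rq mu(1,3) weights(3)])
    show "- real CARD('n) < k" using weights(4) unfolding dn[symmetric] .
    show "l / real CARD('n) + recip q < 1" unfolding dn[symmetric] lA by (rule A_less_1)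
    show "0 \<le> k / real CARD('n) + mu" using s_bounds(1) unfolding dn[symmetric] s_def .
    show "k / real CARD('n) + mu < l / real CARD('n) + recip q" using s_bounds(2) unfolding dn[symmetric] lA s_def .
  qed (rule that)
  show ?thesis
  proof (rule that[of "C2 * C1"])
    fix f :: "real ^ 'n \<Rightarrow> 'c" and W and B t :: real
    assume f: "f \<in> borel_measurable lebesgue" and W: "W \<in> borel_measurable borel" "AE x in lebesgue. f x = W x"
      and B: "wlorentz_norm q r l f \<le> ennreal B" "0 \<le> B" and t: "0 < t"
    have mb: "marc_bound (recip q) (C1 * B) (\<lambda>y. ennreal (norm y powr l) * ennreal (norm (W y)))"
      by (rule marc_bound_mono[OF C1(2)[OF f B] order_refl]) (use W(2) in eventually_elim, simp)
    have Wm: "(\<lambda>y. ennreal (norm (W y))) \<in> borel_measurable borel" using W(1) by measurable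
    have c0: "0 \<le> C1 * B" using C1(1) B(2) by simp
    from C2(2)[OF Wm c0 t mb]
    have "marc_bound mu (C2 * t powr (- beta) * (C1 * B)) (\<lambda>x. ennreal (norm x powr k) * nnheat t (\<lambda>y. ennreal (norm (W y))) x)"
      unfolding dn[symmetric] lA s_def[symmetric] beta_def[symmetric] .
    then show "marc_bound mu (C2 * C1 * t powr (- beta) * B) (\<lambda>x. ennreal (norm x powr k) * nnheat t (\<lambda>y. ennreal (norm (W y))) x)"
      by (simp only: mult_ac)
  qed (use C1(1) C2(1) in simp)
qed

lemma duhamel_bounds_K:
  assumes dn: "d = real CARD('n::finite)"
  obtains C e where "C > 0" "e < 1"
    "\<And>a \<phi> \<psi> (u :: real \<Rightarrow> real ^ 'n \<Rightarrow> 'c::euclidean_space) v M \<zeta> n T t H \<eta>. solution_pair a \<phi> \<psi> u v M \<zeta> n \<Longrightarrow>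
       0 < T \<Longrightarrow> T \<le> t / 2 \<Longrightarrow> 0 < H \<Longrightarrow> 0 < \<eta> \<Longrightarrow> \<forall>\<tau>>0. diff_bound u v H \<tau> \<Longrightarrow> \<forall>\<tau>\<ge>T. diff_bound u v \<eta> \<tau> \<Longrightarrow>
       marc_bound mu (C * M powr (\<alpha> - 1) * t powr (- beta) * (\<eta> + H * (T / t) powr (1 - theta)))
         (\<lambda>x. ennreal (norm x powr k) * duhamel_nn n 0 t x)"
    "\<And>a \<phi> \<psi> (u :: real \<Rightarrow> real ^ 'n \<Rightarrow> 'c::euclidean_space) v M \<zeta> n \<epsilon> t H. solution_pair a \<phi> \<psi> u v M \<zeta> n \<Longrightarrow>
       0 < \<epsilon> \<Longrightarrow> \<epsilon> \<le> 1 / 2 \<Longrightarrow> 0 < t \<Longrightarrow> 0 < H \<Longrightarrow> \<forall>\<tau>>0. diff_bound u v H \<tau> \<Longrightarrow>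
       marc_bound mu (C * M powr (\<alpha> - 1) * H * \<epsilon> powr (1 - e) * t powr (- beta))
         (\<lambda>x. ennreal (norm x powr k) * duhamel_nn n ((1 - \<epsilon>) * t) t x)"
proof (rule duhamel_bounds[OF dn mu(1,3) weights(1,4), of "d / 2 * (s1 - (k / d + mu))", unfolded s_def[symmetric] exponent_K, where ?'c='c])
  show "0 \<le> s" "s < s1" "d / 2 * (s1 - s) < 1" using s_bounds(1) s1_bounds(3) exponent_K_bounds(2) by auto
qed (rule refl, rule that[OF _ exponent_K_bounds(2)], assumption, assumption, assumption)

text \<open>The a priori bound is used for early and late times alike. Finiteness almost everywhere
  is what the restart identity requires.\<close>

lemma duhamel_finite:
  fixes u v :: "real \<Rightarrow> real ^ 'n \<Rightarrow> 'c::euclidean_space"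
  assumes dn: "d = real CARD('n)" and sp: "solution_pair a \<phi> \<psi> u v M \<zeta> n" and t: "t > 0"
  shows "AE x in lebesgue. duhamel_nn n 0 t x < \<infinity>"
proof -
  obtain C where C: "C > 0"
    "\<And>a \<phi> \<psi> (u :: real \<Rightarrow> real ^ 'n \<Rightarrow> 'c) v M \<zeta> n T t H \<eta>. solution_pair a \<phi> \<psi> u v M \<zeta> n \<Longrightarrow>
       0 < T \<Longrightarrow> T \<le> t / 2 \<Longrightarrow> 0 < H \<Longrightarrow> 0 < \<eta> \<Longrightarrow> \<forall>\<tau>>0. diff_bound u v H \<tau> \<Longrightarrow> \<forall>\<tau>\<ge>T. diff_bound u v \<eta> \<tau> \<Longrightarrow>
       marc_bound mu (C * M powr (\<alpha> - 1) * t powr (- beta) * (\<eta> + H * (T / t) powr (1 - theta)))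
         (\<lambda>x. ennreal (norm x powr k) * duhamel_nn n 0 t x)"
    by (rule duhamel_bounds_K[OF dn, where ?'c='c]) (rule that)
  note S = solution_pairD[OF sp]
  have nm: "(\<lambda>(\<tau>, x). n \<tau> x) \<in> borel_measurable (borel \<Otimes>\<^sub>M borel)"
    using S(7) unfolding difference_representation_def by (elim conjE)
  have H: "0 < 2 * 3 powr mu * M" using S(2) by simp
  have h: "\<forall>\<tau>>0. diff_bound u v (2 * 3 powr mu * M) \<tau>" using diff_bound_initial[OF dn sp] by blast
  have h2: "\<forall>\<tau>\<ge>t/2. diff_bound u v (2 * 3 powr mu * M) \<tau>" using h t by auto
  have T: "0 < t / 2" "t / 2 \<le> t / 2" using t by auto
  show ?thesis by (rule AE_finite_of_marc_bound[OF duhamel_nn_measurable[OF nm] C(2)[OF sp T H H h h2]])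
qed

text \<open>The two majorants are added as integrals over test sets, where the triangle inequality
  has constant 1, and the sum is turned into a weak bound only at the end. So the shares b1 and b2
  of \<eta> add without loss.\<close>

lemma diff_bound_of_bounds:
  fixes u v :: "real \<Rightarrow> real ^ 'n \<Rightarrow> 'c::euclidean_space"
  assumes G: "G1 \<in> borel_measurable borel" "G2 \<in> borel_measurable borel"
    and le: "AE x in lebesgue. ennreal (norm (u t x - v t x)) \<le> G1 x + G2 x"
    and m: "marc_bound mu (t powr (- beta) * b1) (\<lambda>x. ennreal (norm x powr k) * G1 x)"
      "marc_bound mu (t powr (- beta) * b2) (\<lambda>x. ennreal (norm x powr k) * G2 x)"
    and b: "0 \<le> b1" "0 \<le> b2" "b1 + b2 \<le> \<eta>"
  shows "diff_bound u v \<eta> t"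
proof -
  have Gm: "(\<lambda>x. ennreal (norm x powr k) * G x) \<in> borel_measurable lebesgue" if "G \<in> borel_measurable borel" for G :: "real ^ 'n \<Rightarrow> ennreal"
  proof -
    have "(\<lambda>x. ennreal (norm x powr k) * G x) \<in> borel_measurable lborel" using that by measurable
    then show ?thesis by (rule measurable_completion)
  qed
  have "marc_bound mu (t powr (- beta) * b1 + t powr (- beta) * b2) (\<lambda>x. ennreal (norm x powr k) * G1 x + ennreal (norm x powr k) * G2 x)"
    by (rule marc_bound_add[OF m _ _ Gm[OF G(1)] Gm[OF G(2)]]) (use b in auto)
  then have "weak_bound mu (t powr (- beta) * b1 + t powr (- beta) * b2) (\<lambda>x. norm x powr k * norm (u t x - v t x))"
  proof (rule weak_bound_of_marc_bound)
    show "AE x in lebesgue. ennreal (norm x powr k * norm (u t x - v t x)) \<le> ennreal (norm x powr k) * G1 x + ennreal (norm x powr k) * G2 x"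
      using le by eventually_elim (simp add: ennreal_mult' distrib_left[symmetric] mult_left_mono)
  qed (use mu b in auto)
  then show ?thesis unfolding diff_bound_def
  proof (rule weak_bound_mono)
    show "t powr (- beta) * b1 + t powr (- beta) * b2 \<le> t powr (- beta) * \<eta>"
      unfolding distrib_left[symmetric] using b by (intro mult_left_mono) auto
  qed
qed

lemma K_limit:
  fixes u v :: "real \<Rightarrow> real ^ 'n \<Rightarrow> 'c::euclidean_space"
  assumes sp: "solution_pair a \<phi> \<psi> u v M \<zeta> n" and lim: "\<And>\<eta>. \<eta> > 0 \<Longrightarrow> \<exists>T>0. \<forall>\<tau>\<ge>T. diff_bound u v \<eta> \<tau>"
  shows "((\<lambda>t. ennreal (t powr beta) * wlorentz_norm p \<infinity> k (\<lambda>x. u t x - v t x)) \<longlongrightarrow> 0) at_top"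
  unfolding tendsto_0_ennreal_iff
proof (intro allI impI)
  fix e :: real assume e: "e > 0"
  obtain T where T: "T > 0" "\<forall>\<tau>\<ge>T. diff_bound u v e \<tau>" using lim[OF e] by blast
  note S = solution_pairD[OF sp]
  show "\<forall>\<^sub>F t in at_top. ennreal (t powr beta) * wlorentz_norm p \<infinity> k (\<lambda>x. u t x - v t x) \<le> ennreal e"
    using eventually_ge_at_top[of T]
  proof eventually_elim
    case (elim t)
    then have t: "t > 0" using T by simp
    have "wlorentz_norm p \<infinity> k (\<lambda>x. u t x - v t x) \<le> ennreal (t powr (- beta) * e)"
      by (rule wlorentz_of_weak_bound[OF borel_measurable_diff[OF S(5)[OF t] S(6)[OF t]]]) (use T elim in \<open>simp add: diff_bound_def\<close>)
    then have "ennreal (t powr beta) * wlorentz_norm p \<infinity> k (\<lambda>x. u t x - v t x) \<le> ennreal (t powr beta) * ennreal (t powr (- beta) * e)"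
      by (intro mult_left_mono) auto
    also have "\<dots> = ennreal e" using t e by (simp add: ennreal_mult'[symmetric] mult.assoc[symmetric] powr_add[symmetric])
    finally show ?case .
  qed
qed

lemma ratio_tends_to_0:
  assumes T: "T > 0" and c: "c > 0"
  shows "\<forall>\<^sub>F t in at_top. T \<le> t / 2 \<and> H * (T / t) powr (1 - theta) \<le> c"
proof -
  have "((\<lambda>t. H * (T / t) powr (1 - theta)) \<longlongrightarrow> H * 0) at_top"
  proof (intro tendsto_mult tendsto_const)
    have "((\<lambda>t. T / t) \<longlongrightarrow> 0) at_top" by (intro tendsto_divide_0[OF tendsto_const] filterlim_at_top_imp_at_infinity filterlim_ident)
    moreover have "\<forall>\<^sub>F t in at_top. 0 \<le> T / t" using eventually_ge_at_top[of 1] by eventually_elim (use T in auto)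
    ultimately have "((\<lambda>t. (T / t) powr (1 - theta)) \<longlongrightarrow> 0 powr (1 - theta)) at_top"
      by (intro tendsto_powr') (use theta in auto)
    then show "((\<lambda>t. (T / t) powr (1 - theta)) \<longlongrightarrow> 0) at_top" by simp
  qed
  then have "\<forall>\<^sub>F t in at_top. H * (T / t) powr (1 - theta) < c" using c by (intro order_tendstoD(2)) auto
  then show ?thesis using eventually_ge_at_top[of "2 * T"] by eventually_elim auto
qed

lemma heat_data_measurable:
  assumes sp: "solution_pair a \<phi> \<psi> u v M \<zeta> n" and t: "t > 0"
  shows "heat t (\<lambda>x. \<phi> x - \<psi> x) \<in> borel_measurable lebesgue"
proof -
  note S = solution_pairD[OF sp]
  have \<zeta>m: "\<zeta> \<in> borel_measurable borel" and he: "\<And>x. heat t (\<lambda>x. \<phi> x - \<psi> x) x = heatB t \<zeta> x"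
    using S(7) t unfolding difference_representation_def by simp_all
  have "heatB t \<zeta> \<in> borel_measurable lborel" using heatB_measurable[OF \<zeta>m, of t] by simp
  then have "heatB t \<zeta> \<in> borel_measurable lebesgue" by (rule measurable_completion)
  moreover have "heat t (\<lambda>x. \<phi> x - \<psi> x) = heatB t \<zeta>" using he by (rule ext)
  ultimately show ?thesis by simp
qed

text \<open>The Duhamel majorant is estimated at the exponents 1/q and 1/q plus or minus \<epsilon>,
  wherever these lie in [0,1], and interpolated. The result contains no power of t, only the late
  bound \<eta> plus the fading contribution of times before T, and both can be made small.\<close>

lemma L_limit:
  fixes u v :: "real \<Rightarrow> real ^ 'n \<Rightarrow> 'c::euclidean_space"
  assumes dn: "d = real CARD('n)" and sp: "solution_pair a \<phi> \<psi> u v M \<zeta> n"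
    and lim: "\<And>\<eta>. \<eta> > 0 \<Longrightarrow> \<exists>T>0. \<forall>\<tau>\<ge>T. diff_bound u v \<eta> \<tau>"
  shows "((\<lambda>t. wlorentz_norm q r l (\<lambda>x. u t x - v t x - heat t (\<lambda>x. \<phi> x - \<psi> x) x)) \<longlongrightarrow> 0) at_top"
proof -
  note S = solution_pairD[OF sp]
  have nm: "(\<lambda>(\<tau>, x). n \<tau> x) \<in> borel_measurable (borel \<Otimes>\<^sub>M borel)"
    using S(7) unfolding difference_representation_def by simp
  define H where "H = 2 * 3 powr mu * M"
  have H: "0 < H" using S(2) by (simp add: H_def)
  have hH: "\<forall>\<tau>>0. diff_bound u v H \<tau>" using diff_bound_initial[OF dn sp] unfolding H_def by blast
  obtain \<epsilon> where \<epsilon>: "\<epsilon> > 0" "\<epsilon> < s1 - A" "\<epsilon> < A" "d / 2 * \<epsilon> < theta" "1 < q \<Longrightarrow> q < \<infinity> \<Longrightarrow> \<epsilon> \<le> recip q \<and> recip q + \<epsilon> \<le> 1"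
    by (rule margin) (rule that)
  let ?S = "{recip q - \<epsilon>, recip q, recip q + \<epsilon>}"
  define P where "P m C \<longleftrightarrow> (0 \<le> m \<longrightarrow> m \<le> 1 \<longrightarrow> (\<forall>T t \<eta>. 0 < T \<longrightarrow> T \<le> t / 2 \<longrightarrow> 0 < \<eta> \<longrightarrow> (\<forall>\<tau>\<ge>T. diff_bound u v \<eta> \<tau>) \<longrightarrow>
       marc_bound m (C * (\<eta> + H * (T / t) powr (1 - theta)) * t powr (d / 2 * (m - recip q)))
         (\<lambda>x. ennreal (norm x powr l) * duhamel_nn n 0 t x)))" for m C :: real
  have Pex: "\<exists>C>0. P m C" if mS: "m \<in> ?S" for m
  proof (cases "0 \<le> m \<and> m \<le> 1")
    case True
    have ms: "l / d + m = A + (m - recip q)" using lA by simp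
    have me: "\<bar>m - recip q\<bar> \<le> \<epsilon>" using mS \<epsilon>(1) by auto
    have s2: "0 \<le> l / d + m" "l / d + m < s1" unfolding ms using me \<epsilon>(2,3) by auto
    have "d / 2 * (recip q - m) \<le> d / 2 * \<epsilon>" using me d by (intro mult_left_mono) auto
    then have el: "d / 2 * (s1 - (l / d + m)) < 1" using exponent_L[of m] \<epsilon>(4) by (simp add: algebra_simps)
    obtain C where C: "C > 0"
      "\<And>a \<phi> \<psi> (u :: real \<Rightarrow> real ^ 'n \<Rightarrow> 'c) v M \<zeta> n T t H \<eta>. solution_pair a \<phi> \<psi> u v M \<zeta> n \<Longrightarrow>
       0 < T \<Longrightarrow> T \<le> t / 2 \<Longrightarrow> 0 < H \<Longrightarrow> 0 < \<eta> \<Longrightarrow> \<forall>\<tau>>0. diff_bound u v H \<tau> \<Longrightarrow> \<forall>\<tau>\<ge>T. diff_bound u v \<eta> \<tau> \<Longrightarrow>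
       marc_bound m (C * M powr (\<alpha> - 1) * t powr (1 - d / 2 * (s1 - (l / d + m)) - theta) * (\<eta> + H * (T / t) powr (1 - theta)))
         (\<lambda>x. ennreal (norm x powr l) * duhamel_nn n 0 t x)"
      by (rule duhamel_bounds[OF dn conjunct1[OF True] conjunct2[OF True] weights(2,5) s2 refl el, where ?'c='c]) (rule that)
    have "P m (C * M powr (\<alpha> - 1))"
      unfolding P_def
    proof (intro impI allI)
      fix T t \<eta> :: real assume *: "0 < T" "T \<le> t / 2" "0 < \<eta>" "\<forall>\<tau>\<ge>T. diff_bound u v \<eta> \<tau>"
      show "marc_bound m (C * M powr (\<alpha> - 1) * (\<eta> + H * (T / t) powr (1 - theta)) * t powr (d / 2 * (m - recip q)))
         (\<lambda>x. ennreal (norm x powr l) * duhamel_nn n 0 t x)"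
        using C(2)[OF sp *(1,2) H *(3) hH *(4)] unfolding exponent_L by (simp only: mult_ac)
    qed
    moreover have "C * M powr (\<alpha> - 1) > 0" using C(1) S(2) by simp
    ultimately show ?thesis by blast
  qed (auto intro!: exI[of _ 1] simp: P_def)
  have Pmono: "P m C'" if "P m C" "C \<le> C'" for m C C'
    unfolding P_def
  proof (intro impI allI)
    fix T t \<eta> :: real assume *: "0 \<le> m" "m \<le> 1" "0 < T" "T \<le> t / 2" "0 < \<eta>" "\<forall>\<tau>\<ge>T. diff_bound u v \<eta> \<tau>"
    then have "marc_bound m (C * (\<eta> + H * (T / t) powr (1 - theta)) * t powr (d / 2 * (m - recip q))) (\<lambda>x. ennreal (norm x powr l) * duhamel_nn n 0 t x)"
      using that(1) unfolding P_def by simp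
    then show "marc_bound m (C' * (\<eta> + H * (T / t) powr (1 - theta)) * t powr (d / 2 * (m - recip q))) (\<lambda>x. ennreal (norm x powr l) * duhamel_nn n 0 t x)"
      by (rule marc_bound_mono) (use that(2) * H in \<open>auto intro!: mult_right_mono\<close>)
  qed
  obtain CP where CP: "CP > 0" "\<And>m. m \<in> ?S \<Longrightarrow> P m CP"
    by (rule finite_uniform_constant[of ?S P]) (use Pex Pmono that in simp_all)
  obtain CL where CL: "CL > 0"
    "\<And>(g :: real ^ 'n \<Rightarrow> 'c) F K \<rho>. g \<in> borel_measurable lebesgue \<Longrightarrow> F \<in> borel_measurable borel \<Longrightarrow>
        AE x in lebesgue. ennreal (norm (g x)) \<le> F x \<Longrightarrow> 0 \<le> K \<Longrightarrow> 0 < \<rho> \<Longrightarrow>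
        (\<And>m. m \<in> {recip q - \<epsilon>, recip q, recip q + \<epsilon>} \<Longrightarrow> 0 \<le> m \<Longrightarrow> m \<le> 1 \<Longrightarrow>
           marc_bound m (K * \<rho> powr (m - recip q)) F) \<Longrightarrow>
        lorentz_norm q r g \<le> ennreal (CL * K)"
  proof (rule lorentz_norm_le_of_marc_bounds[OF q r q1 qinf \<epsilon>(1), where ?'n='n and ?'c='c], goal_cases)
    case 1
    then show ?case using \<epsilon>(5) by simp
  next
    case (2 C)
    show ?case by (rule 2(1)[OF 2(2,3)])
  qed
  have bound: "wlorentz_norm q r l (\<lambda>x. u t x - v t x - heat t (\<lambda>x. \<phi> x - \<psi> x) x) \<le> ennreal (CL * (CP * (\<eta> + H * (T / t) powr (1 - theta))))"
    if T: "0 < T" "T \<le> t / 2" and \<eta>: "0 < \<eta>" and h\<eta>: "\<forall>\<tau>\<ge>T. diff_bound u v \<eta> \<tau>" for T t \<eta>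
  proof -
    have t: "t > 0" using T by simp
    have fm: "(\<lambda>x. u t x - v t x - heat t (\<lambda>x. \<phi> x - \<psi> x) x) \<in> borel_measurable lebesgue"
      by (intro borel_measurable_diff S(5)[OF t] S(6)[OF t] heat_data_measurable[OF sp t])
    have Dm: "(\<lambda>x. ennreal (norm x powr l) * duhamel_nn n 0 t x) \<in> borel_measurable borel"
      using duhamel_nn_measurable[OF nm, of 0 t] by measurable
    show ?thesis
      unfolding wlorentz_norm_def
    \<comment> \<open>The interpolation scale is t^{d/2}, the volume scale of a ball of radius sqrt
      t; with it the powers of t at the neighbouring exponents match exactly.\<close>
    proof (rule CL(2)[of _ _ "CP * (\<eta> + H * (T / t) powr (1 - theta))" "t powr (d / 2)", OF weighted_measurable[OF fm] Dm])
      show "AE x in lebesgue. ennreal (norm (norm x powr l *\<^sub>R (u t x - v t x - heat t (\<lambda>x. \<phi> x - \<psi> x) x))) \<le> ennreal (norm x powr l) * duhamel_nn n 0 t x"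
        using difference_pointwise_bounds(1)[OF S(7,1) t duhamel_finite[OF dn sp t]]
        by eventually_elim (simp add: ennreal_mult' mult_left_mono)
      show "0 \<le> CP * (\<eta> + H * (T / t) powr (1 - theta))" using CP(1) \<eta> H by simp
      show "0 < t powr (d / 2)" using t by simp
      show "marc_bound m (CP * (\<eta> + H * (T / t) powr (1 - theta)) * (t powr (d / 2)) powr (m - recip q)) (\<lambda>x. ennreal (norm x powr l) * duhamel_nn n 0 t x)"
        if "m \<in> {recip q - \<epsilon>, recip q, recip q + \<epsilon>}" "0 \<le> m" "m \<le> 1" for m
        using CP(2)[OF that(1)] that(2,3) T \<eta> h\<eta> unfolding P_def powr_powr by simp
    qed
  qed
  show ?thesis
    unfolding tendsto_0_ennreal_iff
  proof (intro allI impI)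
    fix e :: real assume e: "e > 0"
    \<comment> \<open>Late and early times each receive the share \<eta>, so the total is
      \<open>CL * CP * 2 * \<eta> = e\<close>.\<close>
    define \<eta> where "\<eta> = e / (2 * (CL * CP))"
    have \<eta>: "\<eta> > 0" using e CL(1) CP(1) by (simp add: \<eta>_def)
    obtain T where T: "T > 0" "\<forall>\<tau>\<ge>T. diff_bound u v \<eta> \<tau>" using lim[OF \<eta>] by blast
    show "\<forall>\<^sub>F t in at_top. wlorentz_norm q r l (\<lambda>x. u t x - v t x - heat t (\<lambda>x. \<phi> x - \<psi> x) x) \<le> ennreal e"
      using ratio_tends_to_0[OF T(1) \<eta>, of H]
    proof eventually_elim
      case (elim t)
      have "CL * (CP * (\<eta> + H * (T / t) powr (1 - theta))) \<le> CL * (CP * (\<eta> + \<eta>))"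
        using elim CL(1) CP(1) by (intro mult_left_mono) auto
      also have "\<dots> = e" using CL(1) CP(1) by (simp add: \<eta>_def)
      finally show ?case using bound[OF T(1) conjunct1[OF elim] \<eta> T(2)] by (meson ennreal_leI order_trans)
    qed
  qed
qed

section \<open>Decay from the linear part, for small solutions\<close>

lemma diff_bound_halving:
  assumes dn: "d = real CARD('n::finite)"
  obtains M0 where "M0 > 0"
    "\<And>a \<phi> \<psi> (u :: real \<Rightarrow> real ^ 'n \<Rightarrow> 'c::euclidean_space) v M \<zeta> n \<eta>. solution_pair a \<phi> \<psi> u v M \<zeta> n \<Longrightarrow> M \<le> M0 \<Longrightarrow>
       ((\<lambda>t. wlorentz_norm q r l (heat t (\<lambda>x. \<phi> x - \<psi> x))) \<longlongrightarrow> 0) at_top \<Longrightarrow>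
       0 < \<eta> \<Longrightarrow> \<exists>T>0. \<forall>\<tau>\<ge>T. diff_bound u v \<eta> \<tau> \<Longrightarrow> \<exists>T>0. \<forall>\<tau>\<ge>T. diff_bound u v (\<eta> / 2) \<tau>"
proof -
  obtain CK e where CK: "CK > 0" "e < 1"
    "\<And>a \<phi> \<psi> (u :: real \<Rightarrow> real ^ 'n \<Rightarrow> 'c) v M \<zeta> n T t H \<eta>. solution_pair a \<phi> \<psi> u v M \<zeta> n \<Longrightarrow>
       0 < T \<Longrightarrow> T \<le> t / 2 \<Longrightarrow> 0 < H \<Longrightarrow> 0 < \<eta> \<Longrightarrow> \<forall>\<tau>>0. diff_bound u v H \<tau> \<Longrightarrow> \<forall>\<tau>\<ge>T. diff_bound u v \<eta> \<tau> \<Longrightarrow>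
       marc_bound mu (CK * M powr (\<alpha> - 1) * t powr (- beta) * (\<eta> + H * (T / t) powr (1 - theta)))
         (\<lambda>x. ennreal (norm x powr k) * duhamel_nn n 0 t x)"
    "\<And>a \<phi> \<psi> (u :: real \<Rightarrow> real ^ 'n \<Rightarrow> 'c) v M \<zeta> n \<epsilon> t H. solution_pair a \<phi> \<psi> u v M \<zeta> n \<Longrightarrow>
       0 < \<epsilon> \<Longrightarrow> \<epsilon> \<le> 1 / 2 \<Longrightarrow> 0 < t \<Longrightarrow> 0 < H \<Longrightarrow> \<forall>\<tau>>0. diff_bound u v H \<tau> \<Longrightarrow>
       marc_bound mu (CK * M powr (\<alpha> - 1) * H * \<epsilon> powr (1 - e) * t powr (- beta))
         (\<lambda>x. ennreal (norm x powr k) * duhamel_nn n ((1 - \<epsilon>) * t) t x)"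
    by (rule duhamel_bounds_K[OF dn, where ?'c='c]) (rule that)
  obtain CE where CE: "CE > 0"
    "\<And>(f :: real ^ 'n \<Rightarrow> 'c) W B t. f \<in> borel_measurable lebesgue \<Longrightarrow> W \<in> borel_measurable borel \<Longrightarrow> AE x in lebesgue. f x = W x \<Longrightarrow>
      wlorentz_norm q r l f \<le> ennreal B \<Longrightarrow> 0 \<le> B \<Longrightarrow> 0 < t \<Longrightarrow>
      marc_bound mu (CE * t powr (- beta) * B) (\<lambda>x. ennreal (norm x powr k) * nnheat t (\<lambda>y. ennreal (norm (W y))) x)"
    by (rule linear_bound[OF dn, where ?'c='c]) (rule that)
  \<comment> \<open>The largest \<open>M\<close> for which the Duhamel constant
    \<open>CK * M powr (\<alpha> - 1)\<close> is at most 1/4.\<close>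
  define M0 where "M0 = (1 / (4 * CK)) powr (1 / (\<alpha> - 1))"
  have M0: "CK * M powr (\<alpha> - 1) \<le> 1 / 4" if "0 < M" "M \<le> M0" for M
  proof -
    have "M powr (\<alpha> - 1) \<le> M0 powr (\<alpha> - 1)" using that alpha1 by (intro powr_mono2) auto
    also have "\<dots> = 1 / (4 * CK)" using CK(1) alpha1 by (simp add: M0_def powr_powr)
    finally show ?thesis using CK(1) by (simp add: field_simps)
  qed
  show ?thesis
  proof (rule that[of M0])
    show "M0 > 0" using CK(1) by (simp add: M0_def)
    fix a \<phi> \<psi> M \<zeta> n and \<eta> :: real and u v :: "real \<Rightarrow> real ^ 'n \<Rightarrow> 'c"
    assume sp: "solution_pair a \<phi> \<psi> u v M \<zeta> n" and M: "M \<le> M0"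
      and A: "((\<lambda>t. wlorentz_norm q r l (heat t (\<lambda>x. \<phi> x - \<psi> x))) \<longlongrightarrow> 0) at_top"
      and \<eta>: "0 < \<eta>" and ex: "\<exists>T>0. \<forall>\<tau>\<ge>T. diff_bound u v \<eta> \<tau>"
    note S = solution_pairD[OF sp]
    have \<zeta>m: "\<zeta> \<in> borel_measurable borel" and he: "\<And>t x. t > 0 \<Longrightarrow> heat t (\<lambda>x. \<phi> x - \<psi> x) x = heatB t \<zeta> x"
      and nm: "(\<lambda>(\<tau>, x). n \<tau> x) \<in> borel_measurable (borel \<Otimes>\<^sub>M borel)"
      using S(7) unfolding difference_representation_def by simp_all
    obtain T where T: "T > 0" "\<forall>\<tau>\<ge>T. diff_bound u v \<eta> \<tau>" using ex by blast
    define H where "H = 2 * 3 powr mu * M"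
    have H: "0 < H" using S(2) by (simp add: H_def)
    have hH: "\<forall>\<tau>>0. diff_bound u v H \<tau>" using diff_bound_initial[OF dn sp] unfolding H_def by blast
    \<comment> \<open>The linear flow is taken from time t/2 to t, which costs
      \<open>2 powr beta\<close> against the rate at t; this \<delta> makes the linear part
      contribute \<eta>/8.\<close>
    define \<delta> where "\<delta> = \<eta> / (8 * (CE * 2 powr beta))"
    have \<delta>: "\<delta> > 0" using \<eta> CE(1) by (simp add: \<delta>_def)
    have \<eta>2: "\<eta> / 2 > 0" using \<eta> by simp
    have "filterlim (\<lambda>t::real. t / 2) at_top at_top"
      by (rule filterlim_at_top_mult_tendsto_pos[of "\<lambda>_. 1 / 2" "1 / 2", OF tendsto_const _ filterlim_ident, simplified])
    then have half: "\<forall>\<^sub>F t in at_top. wlorentz_norm q r l (heat (t / 2) (\<lambda>x. \<phi> x - \<psi> x)) \<le> ennreal \<delta>"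
      using A[unfolded tendsto_0_ennreal_iff, rule_format, OF \<delta>] unfolding filterlim_iff by blast
    have "\<forall>\<^sub>F t in at_top. diff_bound u v (\<eta> / 2) t"
      using half ratio_tends_to_0[OF T(1) \<eta>2, of H]
    proof eventually_elim
      case (elim t)
      have t: "t > 0" using elim T(1) by simp
      then have t2: "0 < t / 2" "t / 2 < t" by auto
      define W where "W = heatB (t / 2) \<zeta>"
      have Wm: "W \<in> borel_measurable borel" unfolding W_def by (rule heatB_measurable[OF \<zeta>m])
      have heW: "heat (t / 2) (\<lambda>x. \<phi> x - \<psi> x) = W" unfolding W_def by (rule ext) (rule he[OF t2(1)])
      show ?case
      \<comment> \<open>For large t the early times add at most \<eta>/2 to the late bound \<eta>,
        so the Duhamel part is at most (1/4)(\<eta> + \<eta>/2) = 3\<eta>/8. With \<eta>/8 from the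
        linear part the sum is \<eta>/2.\<close>
      proof (rule diff_bound_of_bounds[where ?b1.0="\<eta> / 8" and ?b2.0="3 / 8 * \<eta>"])
        show "AE x in lebesgue. ennreal (norm (u t x - v t x)) \<le> nnheat (t / 2) (\<lambda>y. ennreal (norm (W y))) x + duhamel_nn n 0 t x"
          using difference_pointwise_bounds(2)[OF S(7,1) t duhamel_finite[OF dn sp t] t2] unfolding heW by simp
        show "nnheat (t / 2) (\<lambda>y. ennreal (norm (W y))) \<in> borel_measurable borel"
          by (rule nnheat_measurable) (use Wm in measurable)
        show "duhamel_nn n 0 t \<in> borel_measurable borel" by (rule duhamel_nn_measurable[OF nm])
        have "marc_bound mu (CE * (t / 2) powr (- beta) * \<delta>) (\<lambda>x. ennreal (norm x powr k) * nnheat (t / 2) (\<lambda>y. ennreal (norm (W y))) x)"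
          by (rule CE(2)[OF heat_data_measurable[OF sp t2(1)] Wm _ elim(1) less_imp_le[OF \<delta>] t2(1)]) (simp add: heW)
        moreover have "(t / 2) powr (- beta) = t powr (- beta) * 2 powr beta" using t by (simp add: powr_divide powr_minus_divide)
        then have "CE * (t / 2) powr (- beta) * \<delta> = t powr (- beta) * (\<eta> / 8)" using CE(1) by (simp add: \<delta>_def)
        ultimately show "marc_bound mu (t powr (- beta) * (\<eta> / 8)) (\<lambda>x. ennreal (norm x powr k) * nnheat (t / 2) (\<lambda>y. ennreal (norm (W y))) x)" by simp
        have "CK * M powr (\<alpha> - 1) * (\<eta> + H * (T / t) powr (1 - theta)) \<le> 1 / 4 * (\<eta> + \<eta> / 2)"
          using M0[OF S(2) M] elim(2) \<eta> H CK(1) by (intro mult_mono add_mono) auto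
        then have "t powr (- beta) * (CK * M powr (\<alpha> - 1) * (\<eta> + H * (T / t) powr (1 - theta))) \<le> t powr (- beta) * (3 / 8 * \<eta>)"
          by (intro mult_left_mono) auto
        then have le: "CK * M powr (\<alpha> - 1) * t powr (- beta) * (\<eta> + H * (T / t) powr (1 - theta)) \<le> t powr (- beta) * (3 / 8 * \<eta>)"
          by (simp only: mult_ac)
        show "marc_bound mu (t powr (- beta) * (3 / 8 * \<eta>)) (\<lambda>x. ennreal (norm x powr k) * duhamel_nn n 0 t x)"
          by (rule marc_bound_mono[OF CK(3)[OF sp T(1) conjunct1[OF elim(2)] H \<eta> hH T(2)] le]) simp
      qed (use \<eta> in auto)
    qed
    then obtain T' where T': "\<forall>\<tau>\<ge>T'. diff_bound u v (\<eta> / 2) \<tau>" unfolding eventually_at_top_linorder by blast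
    show "\<exists>T>0. \<forall>\<tau>\<ge>T. diff_bound u v (\<eta> / 2) \<tau>" by (rule exI[of _ "max 1 T'"]) (use T' in auto)
  qed
qed

text \<open>Halving, iterated finitely often from the a priori bound, takes the place of the
  argument that a finite limsup L with L \<le> L/2 vanishes.\<close>

lemma diff_bound_forward:
  assumes dn: "d = real CARD('n::finite)"
  obtains M0 where "M0 > 0"
    "\<And>a \<phi> \<psi> (u :: real \<Rightarrow> real ^ 'n \<Rightarrow> 'c::euclidean_space) v M \<zeta> n \<eta>. solution_pair a \<phi> \<psi> u v M \<zeta> n \<Longrightarrow> M \<le> M0 \<Longrightarrow>
       ((\<lambda>t. wlorentz_norm q r l (heat t (\<lambda>x. \<phi> x - \<psi> x))) \<longlongrightarrow> 0) at_top \<Longrightarrow>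
       0 < \<eta> \<Longrightarrow> \<exists>T>0. \<forall>\<tau>\<ge>T. diff_bound u v \<eta> \<tau>"
proof -
  obtain M0 where M0: "M0 > 0"
    "\<And>a \<phi> \<psi> (u :: real \<Rightarrow> real ^ 'n \<Rightarrow> 'c) v M \<zeta> n \<eta>. solution_pair a \<phi> \<psi> u v M \<zeta> n \<Longrightarrow> M \<le> M0 \<Longrightarrow>
       ((\<lambda>t. wlorentz_norm q r l (heat t (\<lambda>x. \<phi> x - \<psi> x))) \<longlongrightarrow> 0) at_top \<Longrightarrow>
       0 < \<eta> \<Longrightarrow> \<exists>T>0. \<forall>\<tau>\<ge>T. diff_bound u v \<eta> \<tau> \<Longrightarrow> \<exists>T>0. \<forall>\<tau>\<ge>T. diff_bound u v (\<eta> / 2) \<tau>"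
    by (rule diff_bound_halving[OF dn, where ?'c='c]) (rule that)
  show ?thesis
  proof (rule that[OF M0(1)])
    fix a \<phi> \<psi> M \<zeta> n and \<eta> :: real and u v :: "real \<Rightarrow> real ^ 'n \<Rightarrow> 'c"
    assume sp: "solution_pair a \<phi> \<psi> u v M \<zeta> n" and M: "M \<le> M0"
      and A: "((\<lambda>t. wlorentz_norm q r l (heat t (\<lambda>x. \<phi> x - \<psi> x))) \<longlongrightarrow> 0) at_top" and \<eta>: "0 < \<eta>"
    define H where "H = 2 * 3 powr mu * M"
    have H: "0 < H" using solution_pairD(2)[OF sp] by (simp add: H_def)
    have it: "\<exists>T>0. \<forall>\<tau>\<ge>T. diff_bound u v (H / 2 ^ m) \<tau>" for m
    proof (induction m)
      case 0
      show ?case by (rule exI[of _ 1]) (use diff_bound_initial[OF dn sp] in \<open>auto simp: H_def\<close>)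
    next
      case (Suc m)
      have "0 < H / 2 ^ m" using H by simp
      from M0(2)[OF sp M A this Suc] show ?case by (simp add: field_simps)
    qed
    obtain m where "H / \<eta> < 2 ^ m" using real_arch_pow[of 2 "H / \<eta>"] by auto
    then have m: "H / 2 ^ m \<le> \<eta>" using \<eta> by (simp add: field_simps)
    obtain T where T: "T > 0" "\<forall>\<tau>\<ge>T. diff_bound u v (H / 2 ^ m) \<tau>" using it[of m] by blast
    have "diff_bound u v \<eta> \<tau>" if "\<tau> \<ge> T" for \<tau>
      using T(2)[rule_format, OF that] unfolding diff_bound_def by (rule weak_bound_mono) (intro mult_left_mono m, simp)
    then show "\<exists>T>0. \<forall>\<tau>\<ge>T. diff_bound u v \<eta> \<tau>" using T(1) by blast
  qed
qed

section \<open>Decay from the difference of the solutions, for every size\<close>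

lemma diff_bound_backward:
  fixes u v :: "real \<Rightarrow> real ^ 'n \<Rightarrow> 'c::euclidean_space"
  assumes dn: "d = real CARD('n)" and sp: "solution_pair a \<phi> \<psi> u v M \<zeta> n"
    and B: "((\<lambda>t. wlorentz_norm q r l (\<lambda>x. u t x - v t x)) \<longlongrightarrow> 0) at_top" and \<eta>: "0 < \<eta>"
  shows "\<exists>T>0. \<forall>\<tau>\<ge>T. diff_bound u v \<eta> \<tau>"
proof -
  obtain CK e where CK: "CK > 0" "e < 1"
    "\<And>a \<phi> \<psi> (u :: real \<Rightarrow> real ^ 'n \<Rightarrow> 'c) v M \<zeta> n T t H \<eta>. solution_pair a \<phi> \<psi> u v M \<zeta> n \<Longrightarrow>
       0 < T \<Longrightarrow> T \<le> t / 2 \<Longrightarrow> 0 < H \<Longrightarrow> 0 < \<eta> \<Longrightarrow> \<forall>\<tau>>0. diff_bound u v H \<tau> \<Longrightarrow> \<forall>\<tau>\<ge>T. diff_bound u v \<eta> \<tau> \<Longrightarrow>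
       marc_bound mu (CK * M powr (\<alpha> - 1) * t powr (- beta) * (\<eta> + H * (T / t) powr (1 - theta)))
         (\<lambda>x. ennreal (norm x powr k) * duhamel_nn n 0 t x)"
    "\<And>a \<phi> \<psi> (u :: real \<Rightarrow> real ^ 'n \<Rightarrow> 'c) v M \<zeta> n \<epsilon> t H. solution_pair a \<phi> \<psi> u v M \<zeta> n \<Longrightarrow>
       0 < \<epsilon> \<Longrightarrow> \<epsilon> \<le> 1 / 2 \<Longrightarrow> 0 < t \<Longrightarrow> 0 < H \<Longrightarrow> \<forall>\<tau>>0. diff_bound u v H \<tau> \<Longrightarrow>
       marc_bound mu (CK * M powr (\<alpha> - 1) * H * \<epsilon> powr (1 - e) * t powr (- beta))
         (\<lambda>x. ennreal (norm x powr k) * duhamel_nn n ((1 - \<epsilon>) * t) t x)"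
    by (rule duhamel_bounds_K[OF dn, where ?'c='c]) (rule that)
  obtain CE where CE: "CE > 0"
    "\<And>(f :: real ^ 'n \<Rightarrow> 'c) W B t. f \<in> borel_measurable lebesgue \<Longrightarrow> W \<in> borel_measurable borel \<Longrightarrow> AE x in lebesgue. f x = W x \<Longrightarrow>
      wlorentz_norm q r l f \<le> ennreal B \<Longrightarrow> 0 \<le> B \<Longrightarrow> 0 < t \<Longrightarrow>
      marc_bound mu (CE * t powr (- beta) * B) (\<lambda>x. ennreal (norm x powr k) * nnheat t (\<lambda>y. ennreal (norm (W y))) x)"
    by (rule linear_bound[OF dn, where ?'c='c]) (rule that)
  note S = solution_pairD[OF sp]
  have nm: "(\<lambda>(\<tau>, x). n \<tau> x) \<in> borel_measurable (borel \<Otimes>\<^sub>M borel)"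
    using S(7) unfolding difference_representation_def by simp_all
  define H where "H = 2 * 3 powr mu * M"
  have H: "0 < H" using S(2) by (simp add: H_def)
  have hH: "\<forall>\<tau>>0. diff_bound u v H \<tau>" using diff_bound_initial[OF dn sp] unfolding H_def by blast
  define K where "K = CK * M powr (\<alpha> - 1) * H"
  have K: "K > 0" using CK(1) H S(2) by (simp add: K_def)
  \<comment> \<open>Fixed before t: it makes the contribution
    \<open>K * \<epsilon> powr (1 - e)\<close> of the final interval at most \<eta>/2, and 1/2 is
    the largest fraction that the tail estimate admits. This smallness substitutes for that of
    \<open>M\<close>.\<close>
  define \<epsilon> where "\<epsilon> = min (1 / 2) ((\<eta> / (2 * K)) powr (1 / (1 - e)))"
  have \<epsilon>: "0 < \<epsilon>" "\<epsilon> \<le> 1 / 2" using \<eta> K by (auto simp: \<epsilon>_def)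
  have "\<epsilon> powr (1 - e) \<le> ((\<eta> / (2 * K)) powr (1 / (1 - e))) powr (1 - e)"
    using \<epsilon>(1) CK(2) by (intro powr_mono2) (auto simp: \<epsilon>_def)
  also have "\<dots> = \<eta> / (2 * K)" using CK(2) \<eta> K by (simp add: powr_powr)
  finally have Ke: "K * \<epsilon> powr (1 - e) \<le> \<eta> / 2" using K by (simp add: field_simps)
  \<comment> \<open>After the restart at (1 - \<epsilon>)t the linear flow acts only for the time
    \<epsilon>t and costs the large factor \<open>\<epsilon> powr (- beta)\<close>. Since \<epsilon>
    is already fixed, the decay of u - v in L^{q,r}_l absorbs it.\<close>
  define \<delta> where "\<delta> = \<eta> / (2 * (CE * \<epsilon> powr (- beta)))"
  have \<delta>: "\<delta> > 0" using \<eta> CE(1) \<epsilon> by (simp add: \<delta>_def)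
  have "filterlim (\<lambda>t::real. (1 - \<epsilon>) * t) at_top at_top"
    by (rule filterlim_tendsto_pos_mult_at_top[OF tendsto_const _ filterlim_ident]) (use \<epsilon> in simp)
  then have small: "\<forall>\<^sub>F t in at_top. wlorentz_norm q r l (\<lambda>x. u ((1 - \<epsilon>) * t) x - v ((1 - \<epsilon>) * t) x) \<le> ennreal \<delta>"
    using B[unfolded tendsto_0_ennreal_iff, rule_format, OF \<delta>] unfolding filterlim_iff by blast
  have "\<forall>\<^sub>F t in at_top. diff_bound u v \<eta> t"
    using small eventually_gt_at_top[of 0]
  proof eventually_elim
    case (elim t)
    note t = elim(2)
    define \<sigma> where "\<sigma> = (1 - \<epsilon>) * t"
    have \<sigma>: "0 < \<sigma>" "\<sigma> < t" using \<epsilon> t by (auto simp: \<sigma>_def)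
    have t\<sigma>: "t - \<sigma> = \<epsilon> * t" by (simp add: \<sigma>_def algebra_simps)
    have et: "0 < \<epsilon> * t" using \<epsilon> t by simp
    obtain W where Wm: "W \<in> borel_measurable borel" and uW: "AE x in lebesgue. u \<sigma> x - v \<sigma> x = W x"
      and W: "AE x in lebesgue. ennreal (norm (u t x - v t x)) \<le> nnheat (t - \<sigma>) (\<lambda>y. ennreal (norm (W y))) x + duhamel_nn n \<sigma> t x"
      using difference_pointwise_bounds(3)[OF S(7,1) t duhamel_finite[OF dn sp t] \<sigma>] by (elim exE conjE) (rule that)
    show ?case
    proof (rule diff_bound_of_bounds[where ?b1.0="\<eta> / 2" and ?b2.0="K * \<epsilon> powr (1 - e)"])
      show "AE x in lebesgue. ennreal (norm (u t x - v t x)) \<le> nnheat (\<epsilon> * t) (\<lambda>y. ennreal (norm (W y))) x + duhamel_nn n \<sigma> t x"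
        using W unfolding t\<sigma> .
      show "nnheat (\<epsilon> * t) (\<lambda>y. ennreal (norm (W y))) \<in> borel_measurable borel"
        by (rule nnheat_measurable) (use Wm in measurable)
      show "duhamel_nn n \<sigma> t \<in> borel_measurable borel" by (rule duhamel_nn_measurable[OF nm])
      have "marc_bound mu (CE * (\<epsilon> * t) powr (- beta) * \<delta>) (\<lambda>x. ennreal (norm x powr k) * nnheat (\<epsilon> * t) (\<lambda>y. ennreal (norm (W y))) x)"
        by (rule CE(2)[OF borel_measurable_diff[OF S(5)[OF \<sigma>(1)] S(6)[OF \<sigma>(1)]] Wm uW elim(1)[folded \<sigma>_def] less_imp_le[OF \<delta>] et])
      moreover have "CE * (\<epsilon> * t) powr (- beta) * \<delta> = t powr (- beta) * (\<eta> / 2)"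
        using CE(1) \<epsilon> t by (simp add: \<delta>_def powr_mult)
      ultimately show "marc_bound mu (t powr (- beta) * (\<eta> / 2)) (\<lambda>x. ennreal (norm x powr k) * nnheat (\<epsilon> * t) (\<lambda>y. ennreal (norm (W y))) x)" by simp
      show "marc_bound mu (t powr (- beta) * (K * \<epsilon> powr (1 - e))) (\<lambda>x. ennreal (norm x powr k) * duhamel_nn n \<sigma> t x)"
        using CK(4)[OF sp \<epsilon> t H hH] unfolding K_def \<sigma>_def by (simp only: mult_ac)
    qed (use \<eta> K Ke in auto)
  qed
  then obtain T' where T': "\<forall>\<tau>\<ge>T'. diff_bound u v \<eta> \<tau>" unfolding eventually_at_top_linorder by blast
  show ?thesis by (rule exI[of _ "max 1 T'"]) (use T' in auto)
qed

text \<open>With the Duhamel term known to vanish in L^{q,r}_l, each limit follows from the other by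
  the quasi-triangle inequality, applied to the Duhamel term or to its negative.\<close>

lemma limit_transfer:
  fixes u v :: "real \<Rightarrow> real ^ 'n \<Rightarrow> 'c::euclidean_space"
  assumes dn: "d = real CARD('n)" and sp: "solution_pair a \<phi> \<psi> u v M \<zeta> n"
    and lim: "\<And>\<eta>. \<eta> > 0 \<Longrightarrow> \<exists>T>0. \<forall>\<tau>\<ge>T. diff_bound u v \<eta> \<tau>"
  shows "((\<lambda>t. wlorentz_norm q r l (heat t (\<lambda>x. \<phi> x - \<psi> x))) \<longlongrightarrow> 0) at_top
    \<longleftrightarrow> ((\<lambda>t. wlorentz_norm q r l (\<lambda>x. u t x - v t x)) \<longlongrightarrow> 0) at_top"
proof -
  let ?h = "\<lambda>t. heat t (\<lambda>x. \<phi> x - \<psi> x)"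
  note S = solution_pairD[OF sp]
  have wm: "(\<lambda>x. u t x - v t x) \<in> borel_measurable lebesgue" if "t > 0" for t
    using S(5)[OF that] S(6)[OF that] by (rule borel_measurable_diff)
  note hm = heat_data_measurable[OF sp]
  note L = L_limit[OF dn sp lim]
  have L': "((\<lambda>t. wlorentz_norm q r l (\<lambda>x. ?h t x - (u t x - v t x))) \<longlongrightarrow> 0) at_top"
    using L by (subst wlorentz_norm_minus_commute)
  show ?thesis
  proof
    assume "((\<lambda>t. wlorentz_norm q r l (?h t)) \<longlongrightarrow> 0) at_top"
    from wlorentz_norm_tendsto_0_add[OF r hm _ this L] wm hm
    show "((\<lambda>t. wlorentz_norm q r l (\<lambda>x. u t x - v t x)) \<longlongrightarrow> 0) at_top"
      by (simp add: borel_measurable_diff)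
  next
    assume "((\<lambda>t. wlorentz_norm q r l (\<lambda>x. u t x - v t x)) \<longlongrightarrow> 0) at_top"
    from wlorentz_norm_tendsto_0_add[OF r wm _ this L'] wm hm
    show "((\<lambda>t. wlorentz_norm q r l (?h t)) \<longlongrightarrow> 0) at_top"
      by (simp add: borel_measurable_diff)
  qed
qed

lemma solution_pair_exists:
  fixes u v :: "real \<Rightarrow> real ^ 'n \<Rightarrow> 'c::euclidean_space"
  assumes "a \<in> {-1, 1}" "0 < M"
    "global_mild_solution a \<gamma> \<alpha> q r l \<phi> u" "u \<in> K_space \<gamma> \<alpha> p k"
    "global_mild_solution a \<gamma> \<alpha> q r l \<psi> v" "v \<in> K_space \<gamma> \<alpha> p k"
    "max (K_norm \<gamma> \<alpha> p k u) (K_norm \<gamma> \<alpha> p k v) \<le> ennreal M"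
  obtains \<zeta> n where "solution_pair a \<phi> \<psi> u v M \<zeta> n"
proof -
  obtain \<zeta> n where "difference_representation a \<gamma> \<alpha> \<phi> \<psi> u v \<zeta> n"
    by (rule difference_representation_exists[OF assms(3,4,5,6)])
  then show ?thesis using assms by (intro that) (simp add: solution_pair_def)
qed

lemma asymptotics_forward:
  assumes dn: "d = real CARD('n::finite)"
  obtains M0 where "M0 > 0"
    "\<And>a \<phi> \<psi> (u :: real \<Rightarrow> real ^ 'n \<Rightarrow> 'c::euclidean_space) v M \<zeta> n. solution_pair a \<phi> \<psi> u v M \<zeta> n \<Longrightarrow> M \<le> M0 \<Longrightarrow>
       ((\<lambda>t. wlorentz_norm q r l (heat t (\<lambda>x. \<phi> x - \<psi> x))) \<longlongrightarrow> 0) at_top \<Longrightarrow>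
       ((\<lambda>t. wlorentz_norm q r l (\<lambda>x. u t x - v t x)) \<longlongrightarrow> 0) at_top
       \<and> ((\<lambda>t. ennreal (t powr beta) * wlorentz_norm p \<infinity> k (\<lambda>x. u t x - v t x)) \<longlongrightarrow> 0) at_top"
proof -
  obtain M0 where M0: "M0 > 0"
    "\<And>a \<phi> \<psi> (u :: real \<Rightarrow> real ^ 'n \<Rightarrow> 'c) v M \<zeta> n \<eta>. solution_pair a \<phi> \<psi> u v M \<zeta> n \<Longrightarrow> M \<le> M0 \<Longrightarrow>
       ((\<lambda>t. wlorentz_norm q r l (heat t (\<lambda>x. \<phi> x - \<psi> x))) \<longlongrightarrow> 0) at_top \<Longrightarrow>
       0 < \<eta> \<Longrightarrow> \<exists>T>0. \<forall>\<tau>\<ge>T. diff_bound u v \<eta> \<tau>"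
    by (rule diff_bound_forward[OF dn, where ?'c='c]) (rule that)
  show ?thesis
  proof (rule that[OF M0(1)])
    fix a \<phi> \<psi> M \<zeta> n and u v :: "real \<Rightarrow> real ^ 'n \<Rightarrow> 'c"
    assume sp: "solution_pair a \<phi> \<psi> u v M \<zeta> n" and M: "M \<le> M0"
      and A: "((\<lambda>t. wlorentz_norm q r l (heat t (\<lambda>x. \<phi> x - \<psi> x))) \<longlongrightarrow> 0) at_top"
    note lim = M0(2)[OF sp M A]
    show "((\<lambda>t. wlorentz_norm q r l (\<lambda>x. u t x - v t x)) \<longlongrightarrow> 0) at_top
       \<and> ((\<lambda>t. ennreal (t powr beta) * wlorentz_norm p \<infinity> k (\<lambda>x. u t x - v t x)) \<longlongrightarrow> 0) at_top"
      by (rule conjI[OF iffD1[OF limit_transfer[OF dn sp lim] A] K_limit[OF sp lim]])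
  qed
qed

end

theorem theorem1p8:
  fixes d :: nat and a \<gamma> \<alpha> l k :: real and q r p :: ennreal
  assumes "d = CARD('n::finite)"
    and "a \<in> {-1, 1}"
    and "\<gamma> > - min 2 (real d)"
    and "\<alpha> > 1 + (2 + \<gamma>) / real d"
    and "1 \<le> q" and "1 \<le> r"
    and "l / real d + recip q = inv_qc d \<gamma> \<alpha>"
    and "\<gamma> / (\<alpha> - 1) \<le> l"
    and "q = 1 \<longrightarrow> r = 1"
    and "q = \<infinity> \<longrightarrow> r = \<infinity>"
    and "1 \<le> p"
    and "ennreal \<alpha> < p"
    and "(l + \<gamma>) / \<alpha> \<le> k" and "k \<le> l"
    and "0 \<le> k / real d + recip p"
    and "(2 + \<gamma> * \<alpha>) / (real d * \<alpha> * (\<alpha> - 1)) < k / real d + recip p"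
    and "k / real d + recip p < min (inv_qc d \<gamma> \<alpha>) ((real d + \<gamma>) / (real d * \<alpha>))"
  shows
    "(\<exists>M0>0. \<forall>(\<phi> :: real ^ 'n \<Rightarrow> 'c::{real_normed_field, euclidean_space}) \<psi> u v M.
        0 < M \<and> M \<le> M0
        \<and> global_mild_solution a \<gamma> \<alpha> q r l \<phi> u \<and> u \<in> K_space \<gamma> \<alpha> p k
        \<and> global_mild_solution a \<gamma> \<alpha> q r l \<psi> v \<and> v \<in> K_space \<gamma> \<alpha> p k
        \<and> max (K_norm \<gamma> \<alpha> p k u) (K_norm \<gamma> \<alpha> p k v) \<le> ennreal M
        \<and> ((\<lambda>t. wlorentz_norm q r l (heat t (\<lambda>x. \<phi> x - \<psi> x))) \<longlongrightarrow> 0) at_top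
        \<longrightarrow> ((\<lambda>t. wlorentz_norm q r l (\<lambda>x. u t x - v t x)) \<longlongrightarrow> 0) at_top
          \<and> ((\<lambda>t. ennreal (t powr (real d / 2 * (inv_qc d \<gamma> \<alpha> - k / real d - recip p)))
                    * wlorentz_norm p \<infinity> k (\<lambda>x. u t x - v t x)) \<longlongrightarrow> 0) at_top)
   \<and> (\<forall>(\<phi> :: real ^ 'n \<Rightarrow> 'c) \<psi> u v M.
        0 < M \<and> 1 < q
        \<and> global_mild_solution a \<gamma> \<alpha> q r l \<phi> u \<and> u \<in> K_space \<gamma> \<alpha> p k
        \<and> global_mild_solution a \<gamma> \<alpha> q r l \<psi> v \<and> v \<in> K_space \<gamma> \<alpha> p k
        \<and> max (K_norm \<gamma> \<alpha> p k u) (K_norm \<gamma> \<alpha> p k v) \<le> ennreal M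
        \<and> ((\<lambda>t. wlorentz_norm q r l (\<lambda>x. u t x - v t x)) \<longlongrightarrow> 0) at_top
        \<longrightarrow> ((\<lambda>t. wlorentz_norm q r l (heat t (\<lambda>x. \<phi> x - \<psi> x))) \<longlongrightarrow> 0) at_top)
   \<and> (\<exists>\<delta>>0. \<exists>\<rho>0>0. \<exists>M0>0. \<forall>(\<phi> :: real ^ 'n \<Rightarrow> 'c) \<psi> u v \<rho> M.
        0 < M \<and> M \<le> M0 \<and> 0 < \<rho> \<and> \<rho> \<le> \<rho>0 \<and> 1 < q
        \<and> K_norm \<gamma> \<alpha> p k (\<lambda>t. heat t \<phi>) \<le> ennreal \<delta>
        \<and> K_norm \<gamma> \<alpha> p k (\<lambda>t. heat t \<psi>) \<le> ennreal \<delta>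
        \<and> global_mild_solution a \<gamma> \<alpha> q r l \<phi> u \<and> unique_solution_in_ball a \<gamma> \<alpha> p k \<rho> \<phi> u
        \<and> global_mild_solution a \<gamma> \<alpha> q r l \<psi> v \<and> unique_solution_in_ball a \<gamma> \<alpha> p k \<rho> \<psi> v
        \<and> max (K_norm \<gamma> \<alpha> p k u) (K_norm \<gamma> \<alpha> p k v) \<le> ennreal M
        \<longrightarrow> (((\<lambda>t. wlorentz_norm q r l (heat t (\<lambda>x. \<phi> x - \<psi> x))) \<longlongrightarrow> 0) at_top
             \<longleftrightarrow> ((\<lambda>t. wlorentz_norm q r l (\<lambda>x. u t x - v t x)) \<longlongrightarrow> 0) at_top))"
proof -
  have dn: "real d = real CARD('n)" using assms(1) by simp
  have d: "0 < real d" unfolding dn by simp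
  interpret hardy_henon "real d" \<gamma> \<alpha> l k q r p
  proof
    show "k / real d + recip p < (2 + \<gamma>) / (real d * (\<alpha> - 1))" "k / real d + recip p < (real d + \<gamma>) / (real d * \<alpha>)"
      using assms(17) by (simp_all add: inv_qc_def)
    show "l / real d + recip q = (2 + \<gamma>) / (real d * (\<alpha> - 1))" using assms(7) by (simp add: inv_qc_def)
  qed (rule d assms)+
  have beta: "real d / 2 * (inv_qc d \<gamma> \<alpha> - k / real d - recip p) = beta"
    unfolding beta_def A_def s_def mu_def inv_qc_def by (simp only: diff_diff_eq)
  obtain M0 where M0: "M0 > 0"
    "\<And>a \<phi> \<psi> (u :: real \<Rightarrow> real ^ 'n \<Rightarrow> 'c) v M \<zeta> n. solution_pair a \<phi> \<psi> u v M \<zeta> n \<Longrightarrow> M \<le> M0 \<Longrightarrow>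
       ((\<lambda>t. wlorentz_norm q r l (heat t (\<lambda>x. \<phi> x - \<psi> x))) \<longlongrightarrow> 0) at_top \<Longrightarrow>
       ((\<lambda>t. wlorentz_norm q r l (\<lambda>x. u t x - v t x)) \<longlongrightarrow> 0) at_top
       \<and> ((\<lambda>t. ennreal (t powr beta) * wlorentz_norm p \<infinity> k (\<lambda>x. u t x - v t x)) \<longlongrightarrow> 0) at_top"
    by (rule asymptotics_forward[OF dn, where ?'c='c]) (rule that)
  have backward: "((\<lambda>t. wlorentz_norm q r l (heat t (\<lambda>x. \<phi> x - \<psi> x))) \<longlongrightarrow> 0) at_top"
    if "solution_pair a \<phi> \<psi> u v M \<zeta> n" "((\<lambda>t. wlorentz_norm q r l (\<lambda>x. u t x - v t x)) \<longlongrightarrow> 0) at_top"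
    for \<phi> \<psi> M \<zeta> n and u v :: "real \<Rightarrow> real ^ 'n \<Rightarrow> 'c"
    by (rule iffD2[OF limit_transfer[OF dn that(1) diff_bound_backward[OF dn that]] that(2)])
  note pair = solution_pair_exists[OF assms(2), where ?'n='n and ?'c='c]
  show ?thesis
    unfolding beta
  proof (intro conjI, goal_cases)
    case 1
    show ?case
    proof (rule exI[of _ M0], rule conjI[OF M0(1)], intro allI impI, elim conjE, goal_cases)
      case (1 \<phi> \<psi> u v M)
      obtain \<zeta> n where "solution_pair a \<phi> \<psi> u v M \<zeta> n" by (rule pair[OF 1(1,3-7)])
      then show ?case using 1(2,8) by (rule M0(2))
    qed
  next
    case 2
    show ?case
    proof (intro allI impI, elim conjE, goal_cases)
      case (1 \<phi> \<psi> u v M)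
      obtain \<zeta> n where "solution_pair a \<phi> \<psi> u v M \<zeta> n" by (rule pair[OF 1(1,3-7)])
      then show ?case using 1(8) by (rule backward)
    qed
  next
    case 3
    show ?case
    \<comment> \<open>The equivalence combines the two previous claims, with \<open>M0\<close> from
      the first; being the unique solution in a ball provides membership in K.\<close>
    proof (rule exI[of _ 1], intro conjI zero_less_one, rule exI[of _ 1], intro conjI zero_less_one, rule exI[of _ M0],
        intro conjI allI impI M0(1), elim conjE, goal_cases)
      case (1 \<phi> \<psi> u v \<rho> M)
      then have K: "u \<in> K_space \<gamma> \<alpha> p k" "v \<in> K_space \<gamma> \<alpha> p k" by (simp_all add: unique_solution_in_ball_def)
      obtain \<zeta> n where sp: "solution_pair a \<phi> \<psi> u v M \<zeta> n" by (rule pair[OF 1(1,8) K(1) 1(10) K(2) 1(12)])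
      show ?case using M0(2)[OF sp 1(2)] backward[OF sp] by blast
    qed
  qed
qed

end
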